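(* Let $\alpha\colon\mathbb{N}\to\mathbb{N}$ be any monotone function with $\alpha=\omega(1)$. Then there is a family of partial Boolean functions $F$ on $\{-1,1\}^N\times\{-1,1\}^N$ (for infinitely many $N$) with $Q^{\mathrm{cc}}_{1/3}(F)\leq\alpha(N)\log N$ and $R^{\mathrm{cc}}_{1/3}(F)\geq N^{1-o(1)}$.
   Context: A partial Boolean function on $\{-1,1\}^N\times\{-1,1\}^N$ is a map $F\colon\{-1,1\}^N\times\{-1,1\}^N\to\{0,1,*\}$. A two-party communication protocol computes $F$ with error $\epsilon$ if on every $(x,y)$ with $F(x,y)\in\{0,1\}$ it outputs $F(x,y)$ with probability at least $1-\epsilon$. $R^{\mathrm{cc}}_\epsilon(F)$ and $Q^{\mathrm{cc}}_\epsilon(F)$ denote the minimum communication cost of a classical randomized protocol and of a quantum protocol, respectively, computing $F$ with error $\epsilon$. *)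

theory Defs
  imports
    "HOL-Probability.Probability_Mass_Function"
    "HOL-Library.Landau_Symbols"
    "HOL-Library.Extended_Nat"
    "Jordan_Normal_Form.Schur_Decomposition"
begin

type_synonym sign_vec = "nat \<Rightarrow> int"

definition cube :: "nat \<Rightarrow> sign_vec set" where
  "cube N = {..<N} \<rightarrow>\<^sub>E {-1, 1}"

text \<open>Partial Boolean functions: \<open>None\<close> is the undefined value \<open>*\<close>, \<open>Some False\<close> is 0 and
  \<open>Some True\<close> is 1. Only the values on \<open>cube N \<times> cube N\<close> are ever used.\<close>

type_synonym partial_fun = "sign_vec \<Rightarrow> sign_vec \<Rightarrow> bool option"

text \<open>Classical protocols are the usual protocol trees. At an inner node the named player sends
  one bit, and the bit selects the subtree (the first subtree for \<open>False\<close>).\<close>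

datatype protocol =
    Leaf bool
  | Alice "sign_vec \<Rightarrow> bool" protocol protocol
  | Bob "sign_vec \<Rightarrow> bool" protocol protocol

primrec run :: "protocol \<Rightarrow> sign_vec \<Rightarrow> sign_vec \<Rightarrow> bool" where
  "run (Leaf v) x y = v"
| "run (Alice f P0 P1) x y = (if f x then run P1 x y else run P0 x y)"
| "run (Bob g P0 P1) x y = (if g y then run P1 x y else run P0 x y)"

primrec cost :: "protocol \<Rightarrow> nat" where
  "cost (Leaf v) = 0"
| "cost (Alice f P0 P1) = Suc (max (cost P0) (cost P1))"
| "cost (Bob g P0 P1) = Suc (max (cost P0) (cost P1))"

text \<open>A randomized protocol is a public-coin protocol, that is, a probability distribution over
  deterministic ones; its cost is the worst case over the coins.\<close>

definition rand_computes :: "nat \<Rightarrow> real \<Rightarrow> partial_fun \<Rightarrow> protocol pmf \<Rightarrow> bool" where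
  "rand_computes N \<epsilon> F P \<longleftrightarrow>
     (\<forall>x \<in> cube N. \<forall>y \<in> cube N. \<forall>v. F x y = Some v \<longrightarrow>
        measure_pmf.prob P {t. run t x y = v} \<ge> 1 - \<epsilon>)"

definition Rcc :: "nat \<Rightarrow> real \<Rightarrow> partial_fun \<Rightarrow> enat" where
  "Rcc N \<epsilon> F = Inf {enat c | c. \<exists>P. rand_computes N \<epsilon> F P \<and> (\<forall>t \<in> set_pmf P. cost t \<le> c)}"

text \<open>Quantum protocols follow Yao's model: no prior entanglement, all qubits start in state 0,
  arbitrarily large private workspaces. The sequence of senders does not depend on the input.
  A protocol is a nonempty list of steps. In each step the named player applies a unitary,
  depending on the own input, to all qubits she currently holds, and then sends one of
  these qubits to the other player. The output is obtained by measuring the last qubit sent in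
  the computational basis.

  If Alice holds \<open>a\<close> and Bob holds \<open>b\<close> qubits, then a pure state is written as its
  \<open>2^a \<times> 2^b\<close> matrix \<open>M\<close> of amplitudes, row indices being Alice's basis states and column indices
  Bob's. Under this identification \<open>U \<otimes> I\<close> acts by \<open>M \<mapsto> U M\<close> and \<open>I \<otimes> V\<close> by
  \<open>M \<mapsto> M V\<^sup>T\<close>. The qubit sent is always the least significant bit of the sender's index, and it
  becomes the least significant bit of the recipient's index.\<close>

datatype qprotocol =
    ALast "sign_vec \<Rightarrow> complex mat"
  | BLast "sign_vec \<Rightarrow> complex mat"
  | ASend "sign_vec \<Rightarrow> complex mat" qprotocol
  | BSend "sign_vec \<Rightarrow> complex mat" qprotocol

definition unitary_mats :: "nat \<Rightarrow> complex mat set" where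
  "unitary_mats d = {U \<in> carrier_mat d d. mat_adjoint U * U = 1\<^sub>m d \<and> U * mat_adjoint U = 1\<^sub>m d}"

text \<open>\<open>qvalid N a b P\<close>: the protocol is well formed on inputs from \<open>cube N\<close> when Alice currently
  holds \<open>a\<close> qubits and Bob holds \<open>b\<close>.\<close>

primrec qvalid :: "nat \<Rightarrow> nat \<Rightarrow> nat \<Rightarrow> qprotocol \<Rightarrow> bool" where
  "qvalid N a b (ALast U) \<longleftrightarrow> a \<ge> 1 \<and> (\<forall>x \<in> cube N. U x \<in> unitary_mats (2 ^ a))"
| "qvalid N a b (BLast V) \<longleftrightarrow> b \<ge> 1 \<and> (\<forall>y \<in> cube N. V y \<in> unitary_mats (2 ^ b))"
| "qvalid N a b (ASend U P) \<longleftrightarrow>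
     a \<ge> 1 \<and> (\<forall>x \<in> cube N. U x \<in> unitary_mats (2 ^ a)) \<and> qvalid N (a - 1) (b + 1) P"
| "qvalid N a b (BSend V P) \<longleftrightarrow>
     b \<ge> 1 \<and> (\<forall>y \<in> cube N. V y \<in> unitary_mats (2 ^ b)) \<and> qvalid N (a + 1) (b - 1) P"

primrec qcost :: "qprotocol \<Rightarrow> nat" where
  "qcost (ALast U) = 1"
| "qcost (BLast V) = 1"
| "qcost (ASend U P) = Suc (qcost P)"
| "qcost (BSend V P) = Suc (qcost P)"

definition qubit_to_bob :: "complex mat \<Rightarrow> complex mat" where
  "qubit_to_bob M = mat (dim_row M div 2) (2 * dim_col M)
     (\<lambda>(i, j). M $$ (2 * i + j mod 2, j div 2))"

definition qubit_to_alice :: "complex mat \<Rightarrow> complex mat" where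
  "qubit_to_alice M = mat (2 * dim_row M) (dim_col M div 2)
     (\<lambda>(i, j). M $$ (i div 2, 2 * j + i mod 2))"

definition init_state :: "nat \<Rightarrow> nat \<Rightarrow> complex mat" where
  "init_state a b = mat (2 ^ a) (2 ^ b) (\<lambda>(i, j). if i = 0 \<and> j = 0 then 1 else 0)"

text \<open>Born rule for the least significant qubit of Alice, respectively Bob.\<close>

definition alice_qubit_prob :: "complex mat \<Rightarrow> bool \<Rightarrow> real" where
  "alice_qubit_prob M v =
     (\<Sum>i | i < dim_row M \<and> odd i = v. \<Sum>j < dim_col M. (cmod (M $$ (i, j)))\<^sup>2)"

definition bob_qubit_prob :: "complex mat \<Rightarrow> bool \<Rightarrow> real" where
  "bob_qubit_prob M v =
     (\<Sum>i < dim_row M. \<Sum>j | j < dim_col M \<and> odd j = v. (cmod (M $$ (i, j)))\<^sup>2)"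

text \<open>\<open>qprob P x y M v\<close>: probability that \<open>P\<close>, run on input \<open>(x, y)\<close> from the state \<open>M\<close>,
  outputs \<open>v\<close>.\<close>

primrec qprob :: "qprotocol \<Rightarrow> sign_vec \<Rightarrow> sign_vec \<Rightarrow> complex mat \<Rightarrow> bool \<Rightarrow> real" where
  "qprob (ALast U) x y M v = bob_qubit_prob (qubit_to_bob (U x * M)) v"
| "qprob (BLast V) x y M v = alice_qubit_prob (qubit_to_alice (M * transpose_mat (V y))) v"
| "qprob (ASend U P) x y M v = qprob P x y (qubit_to_bob (U x * M)) v"
| "qprob (BSend V P) x y M v = qprob P x y (qubit_to_alice (M * transpose_mat (V y))) v"

definition quantum_computes ::
    "nat \<Rightarrow> real \<Rightarrow> partial_fun \<Rightarrow> nat \<Rightarrow> nat \<Rightarrow> qprotocol \<Rightarrow> bool" where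
  "quantum_computes N \<epsilon> F a b P \<longleftrightarrow> qvalid N a b P \<and>
     (\<forall>x \<in> cube N. \<forall>y \<in> cube N. \<forall>v. F x y = Some v \<longrightarrow>
        qprob P x y (init_state a b) v \<ge> 1 - \<epsilon>)"

definition Qcc :: "nat \<Rightarrow> real \<Rightarrow> partial_fun \<Rightarrow> enat" where
  "Qcc N \<epsilon> F = Inf {enat (qcost P) | P a b. quantum_computes N \<epsilon> F a b P}"

end

theory Submission
  imports Defs "HOL-Probability.Probability"
begin

text \<open>
  For a real \<open>n \<times> n\<close> contraction \<open>M\<close> and sign vectors \<open>z\<^sub>0, \<dots>, z\<^sub>k\<close>, consider the amplitude
  \<open>\<phi>(z) = \<langle>u, diag(z\<^sub>0) M diag(z\<^sub>1) M \<dots> diag(z\<^sub>k) u\<rangle>\<close> with \<open>u\<close> the uniform unit vector. Constantly many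
  quantum queries estimate it, so if every sign of \<open>z\<close> is an inner-product gadget of \<open>O(log n)\<close> bits of
  \<open>x\<close> and \<open>y\<close>, a quantum protocol of cost \<open>O(log n)\<close> decides whether one of a constant number of independent
  copies of \<open>\<phi>\<close> is bounded away from 0.

  If the entries of \<open>M\<close> have size about \<open>1 / sqrt n\<close>, then \<open>\<phi>\<close> is tiny for uniform \<open>z\<close>. On the other hand there is a
  density on the inputs under which \<open>\<phi>\<close> has constant mean although every subcube of codimension at most \<open>d\<close>
  has almost at least its uniform measure: consecutive layers are coupled through a kernel whose Fourier
  coefficients are moments of sines of correlated Gaussians. If all \<open>d \<times> d\<close> submatrices of \<open>M\<close> have small
  norm, as they do for random sign matrices, this kernel is hypercontractive on functions of \<open>d\<close> coordinates, and
  iterating along the chain pushes the exponent so high that fixing \<open>d\<close> coordinates is not felt in the middle.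
  The one-sided subcube bound lifts through the gadget to all rectangles up to an error exponentially small in \<open>d * log n\<close>, so a
  randomized protocol of cost below \<open>d\<close> cannot tell the two distributions apart. With \<open>n = U ^ A\<close>,
  \<open>d = U ^ (A - 4)\<close> and \<open>k = 2 A\<close>, the exponent of the separation tends to 1 as \<open>A\<close> grows; \<open>A\<close> is increased so slowly that
  \<open>\<alpha>\<close> absorbs the constants.
\<close>

section \<open>Lifting lower bounds on densities through a gadget\<close>

text \<open>A one-sided comparison is enough: the inputs that a cheap protocol answers by 0 split
  into few rectangles and hold most of the uniform inputs, so they also keep much of the mass of a
  density that sits mostly on 1-inputs. The parameters come from a race. Norms of
  \<open>d \<times> d\<close> submatrices are about \<open>sqrt (d * log n / n)\<close>, which for
  \<open>d = n / U ^ 4\<close> is below \<open>1 / (2 * U)\<close>; this is the noise at which one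
  layer multiplies an exponent by \<open>U\<close>. Fixing \<open>d\<close> coordinates costs
  \<open>2 ^ d\<close> once, at an end of the chain, and \<open>A\<close> layers later this is
  reduced to its root of order \<open>U ^ A\<close>, with \<open>U ^ A = n\<close> far above
  \<open>d\<close>. Two ends need \<open>2 * A\<close> layers. The price is a mean of \<phi> as
  small as a constant to the power \<open>2 * A\<close>. For fixed \<open>A\<close> it is still a
  constant, and independent copies raise it to a gap of 1/3, at the expense of a factor in the
  quantum cost that depends on \<open>A\<close> alone. The gadget is what connects the two notions
  of cost: the subcube bounds speak of fixed coordinates only, whereas a rectangle splits into
  pieces in which some blocks are fixed and the others have enough entropy to look random.\<close>

definition sgns :: "'i set \<Rightarrow> ('i \<Rightarrow> real) set" where
  "sgns I = I \<rightarrow>\<^sub>E {-1, 1}"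

lemma finite_sgns [simp]: "finite I \<Longrightarrow> finite (sgns I)"
  by (auto simp: sgns_def intro: finite_PiE)

lemma sgns_val: "z \<in> sgns I \<Longrightarrow> i \<in> I \<Longrightarrow> z i = -1 \<or> z i = 1"
  by (auto simp: sgns_def PiE_iff)

lemma prod_one_plus:
  fixes f :: "'i \<Rightarrow> 'c::comm_semiring_1"
  assumes "finite A"
  shows "(\<Prod>i\<in>A. 1 + f i) = (\<Sum>S\<in>Pow A. \<Prod>i\<in>S. f i)"
  using prod_add[OF assms, of f "\<lambda>_. 1"] by (simp add: add.commute)

lemma sum_Pow_card:
  fixes c :: "'c::comm_semiring_1"
  assumes "finite A"
  shows "(\<Sum>S\<in>Pow A. c ^ card S) = (1 + c) ^ card A"
  using prod_one_plus[OF assms, of "\<lambda>_. c"] by simp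

lemma sum_fiber_card:
  fixes F :: "'b \<Rightarrow> real"
  assumes "finite A" "finite B" "\<And>x. x \<in> A \<Longrightarrow> h x \<in> B"
  shows "(\<Sum>x\<in>A. F (h x)) = (\<Sum>b\<in>B. real (card {x\<in>A. h x = b}) * F b)"
proof -
  have "(\<Sum>b\<in>B. real (card {x\<in>A. h x = b}) * F b) = (\<Sum>b\<in>B. \<Sum>x\<in>{x\<in>A. h x = b}. F (h x))"
    by (intro sum.cong) auto
  also have "\<dots> = (\<Sum>x\<in>A. F (h x))"
    using assms by (intro sum.group) auto
  finally show ?thesis by simp
qed

text \<open>The last assumption is near-orthogonality of the rows; it makes the operator norm of the sign matrix
  at most \<open>sqrt (2 * card \<Sigma>)\<close>.\<close>

locale gadget =
  fixes \<Sigma> :: "'s set" and g :: "'s \<Rightarrow> 's \<Rightarrow> real"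
  assumes fin: "finite \<Sigma>" and ne: "\<Sigma> \<noteq> {}"
    and sign: "x \<in> \<Sigma> \<Longrightarrow> y \<in> \<Sigma> \<Longrightarrow> g x y \<in> {-1, 1}"
    and balanced: "y \<in> \<Sigma> \<Longrightarrow> (\<Sum>x\<in>\<Sigma>. g x y) = 0"
    and gram: "x \<in> \<Sigma> \<Longrightarrow> (\<Sum>x'\<in>\<Sigma>. \<bar>\<Sum>y\<in>\<Sigma>. g x y * g x' y\<bar>) \<le> 2 * real (card \<Sigma>)"
begin

definition s :: real where "s = real (card \<Sigma>)"

lemma s_ge1: "s \<ge> 1"
  using fin ne by (simp add: s_def Suc_leI card_gt_0_iff)

definition G :: "'j set \<Rightarrow> ('j \<Rightarrow> 's) \<Rightarrow> ('j \<Rightarrow> 's) \<Rightarrow> 'j \<Rightarrow> real" where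
  "G J x y = (\<lambda>i\<in>J. g (x i) (y i))"

lemma G_sgns: "x \<in> J \<rightarrow>\<^sub>E \<Sigma> \<Longrightarrow> y \<in> J \<rightarrow>\<^sub>E \<Sigma> \<Longrightarrow> G J x y \<in> sgns J"
  using sign by (fastforce simp: G_def sgns_def PiE_iff)

text \<open>Schur test. The Gram matrix of the tensor power is the tensor power of the Gram matrix
  \<Gamma>, so its absolute row sums are products of those bounded by \<open>gram\<close>; a
  symmetric form is bounded by its largest absolute row sum.\<close>

lemma tensor_norm:
  assumes S: "finite S"
  shows "(\<Sum>\<beta>\<in>S \<rightarrow>\<^sub>E \<Sigma>. (\<Sum>\<alpha>\<in>S \<rightarrow>\<^sub>E \<Sigma>. p \<alpha> * (\<Prod>i\<in>S. g (\<alpha> i) (\<beta> i)))\<^sup>2)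
           \<le> (2 * s) ^ card S * (\<Sum>\<alpha>\<in>S \<rightarrow>\<^sub>E \<Sigma>. (p \<alpha>)\<^sup>2)"
proof -
  let ?P = "S \<rightarrow>\<^sub>E \<Sigma>"
  define \<Gamma> where "\<Gamma> x x' = (\<Sum>y\<in>\<Sigma>. g x y * g x' y)" for x x'
  have \<Gamma>sym: "\<Gamma> x x' = \<Gamma> x' x" for x x' by (simp add: \<Gamma>_def mult.commute)
  have row: "(\<Sum>\<alpha>'\<in>?P. \<Prod>i\<in>S. \<bar>\<Gamma> (\<alpha> i) (\<alpha>' i)\<bar>) \<le> (2 * s) ^ card S" if "\<alpha> \<in> ?P" for \<alpha>
  proof -
    have "(\<Sum>\<alpha>'\<in>?P. \<Prod>i\<in>S. \<bar>\<Gamma> (\<alpha> i) (\<alpha>' i)\<bar>) = (\<Prod>i\<in>S. \<Sum>x'\<in>\<Sigma>. \<bar>\<Gamma> (\<alpha> i) x'\<bar>)"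
      using S fin by (subst prod_sum_PiE) auto
    also have "\<dots> \<le> (\<Prod>i\<in>S. 2 * s)"
      using that gram by (intro prod_mono) (auto simp: \<Gamma>_def s_def PiE_iff sum_nonneg)
    finally show ?thesis by simp
  qed
  have "(\<Sum>\<beta>\<in>?P. (\<Sum>\<alpha>\<in>?P. p \<alpha> * (\<Prod>i\<in>S. g (\<alpha> i) (\<beta> i)))\<^sup>2)
      = (\<Sum>\<beta>\<in>?P. \<Sum>\<alpha>\<in>?P. \<Sum>\<alpha>'\<in>?P. p \<alpha> * p \<alpha>' * (\<Prod>i\<in>S. g (\<alpha> i) (\<beta> i) * g (\<alpha>' i) (\<beta> i)))"
    by (simp add: power2_eq_square sum_product prod.distrib mult_ac)
  also have "\<dots> = (\<Sum>\<alpha>\<in>?P. \<Sum>\<beta>\<in>?P. \<Sum>\<alpha>'\<in>?P. p \<alpha> * p \<alpha>' * (\<Prod>i\<in>S. g (\<alpha> i) (\<beta> i) * g (\<alpha>' i) (\<beta> i)))"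
    by (rule sum.swap)
  also have "\<dots> = (\<Sum>\<alpha>\<in>?P. \<Sum>\<alpha>'\<in>?P. \<Sum>\<beta>\<in>?P. p \<alpha> * p \<alpha>' * (\<Prod>i\<in>S. g (\<alpha> i) (\<beta> i) * g (\<alpha>' i) (\<beta> i)))"
    by (intro sum.cong refl sum.swap)
  also have "\<dots> = (\<Sum>\<alpha>\<in>?P. \<Sum>\<alpha>'\<in>?P. p \<alpha> * p \<alpha>' * (\<Prod>i\<in>S. \<Gamma> (\<alpha> i) (\<alpha>' i)))"
    unfolding \<Gamma>_def using S fin
    by (subst prod_sum_PiE) (auto simp: sum_distrib_left)
  also have "\<dots> \<le> (\<Sum>\<alpha>\<in>?P. \<Sum>\<alpha>'\<in>?P. ((p \<alpha>)\<^sup>2 + (p \<alpha>')\<^sup>2) / 2 * (\<Prod>i\<in>S. \<bar>\<Gamma> (\<alpha> i) (\<alpha>' i)\<bar>))"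
  proof (intro sum_mono)
    fix \<alpha> \<alpha>'
    have "p \<alpha> * p \<alpha>' * (\<Prod>i\<in>S. \<Gamma> (\<alpha> i) (\<alpha>' i)) \<le> \<bar>p \<alpha> * p \<alpha>'\<bar> * (\<Prod>i\<in>S. \<bar>\<Gamma> (\<alpha> i) (\<alpha>' i)\<bar>)"
      by (metis abs_ge_self abs_mult abs_prod)
    also have "\<dots> \<le> ((p \<alpha>)\<^sup>2 + (p \<alpha>')\<^sup>2) / 2 * (\<Prod>i\<in>S. \<bar>\<Gamma> (\<alpha> i) (\<alpha>' i)\<bar>)"
    proof (intro mult_right_mono prod_nonneg)
      have "0 \<le> (\<bar>p \<alpha>\<bar> - \<bar>p \<alpha>'\<bar>)\<^sup>2" by simp
      then show "\<bar>p \<alpha> * p \<alpha>'\<bar> \<le> ((p \<alpha>)\<^sup>2 + (p \<alpha>')\<^sup>2) / 2"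
        by (simp add: power2_diff abs_mult)
    qed auto
    finally show "p \<alpha> * p \<alpha>' * (\<Prod>i\<in>S. \<Gamma> (\<alpha> i) (\<alpha>' i)) \<le> ((p \<alpha>)\<^sup>2 + (p \<alpha>')\<^sup>2) / 2 * (\<Prod>i\<in>S. \<bar>\<Gamma> (\<alpha> i) (\<alpha>' i)\<bar>)" .
  qed
  also have "\<dots> = (\<Sum>\<alpha>\<in>?P. \<Sum>\<alpha>'\<in>?P. (p \<alpha>)\<^sup>2 / 2 * (\<Prod>i\<in>S. \<bar>\<Gamma> (\<alpha> i) (\<alpha>' i)\<bar>))
       + (\<Sum>\<alpha>\<in>?P. \<Sum>\<alpha>'\<in>?P. (p \<alpha>')\<^sup>2 / 2 * (\<Prod>i\<in>S. \<bar>\<Gamma> (\<alpha> i) (\<alpha>' i)\<bar>))"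
    by (simp only: add_divide_distrib distrib_right sum.distrib)
  also have "(\<Sum>\<alpha>\<in>?P. \<Sum>\<alpha>'\<in>?P. (p \<alpha>')\<^sup>2 / 2 * (\<Prod>i\<in>S. \<bar>\<Gamma> (\<alpha> i) (\<alpha>' i)\<bar>))
       = (\<Sum>\<alpha>\<in>?P. \<Sum>\<alpha>'\<in>?P. (p \<alpha>)\<^sup>2 / 2 * (\<Prod>i\<in>S. \<bar>\<Gamma> (\<alpha> i) (\<alpha>' i)\<bar>))"
    by (subst sum.swap) (simp add: \<Gamma>sym)
  also have "(\<Sum>\<alpha>\<in>?P. \<Sum>\<alpha>'\<in>?P. (p \<alpha>)\<^sup>2 / 2 * (\<Prod>i\<in>S. \<bar>\<Gamma> (\<alpha> i) (\<alpha>' i)\<bar>)) + \<dots>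
       = (\<Sum>\<alpha>\<in>?P. (p \<alpha>)\<^sup>2 * (\<Sum>\<alpha>'\<in>?P. \<Prod>i\<in>S. \<bar>\<Gamma> (\<alpha> i) (\<alpha>' i)\<bar>))"
    by (simp add: sum.distrib[symmetric] sum_distrib_left)
  also have "\<dots> \<le> (\<Sum>\<alpha>\<in>?P. (p \<alpha>)\<^sup>2 * (2 * s) ^ card S)"
    using row by (intro sum_mono mult_left_mono) auto
  also have "\<dots> = (2 * s) ^ card S * (\<Sum>\<alpha>\<in>?P. (p \<alpha>)\<^sup>2)"
    by (simp add: sum_distrib_right[symmetric] mult.commute)
  finally show ?thesis .
qed

text \<open>\<open>A\<close> is dense if every marginal has large min-entropy: fixing the blocks in \<open>T\<close> costs a factor
  \<open>\<tau>\<close> per block.\<close>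

definition dense :: "real \<Rightarrow> 'j set \<Rightarrow> ('j \<Rightarrow> 's) set \<Rightarrow> bool" where
  "dense \<tau> I A \<longleftrightarrow> (\<forall>T\<subseteq>I. T \<noteq> {} \<longrightarrow>
     (\<forall>\<alpha>\<in>A. real (card {x\<in>A. \<forall>i\<in>T. x i = \<alpha> i}) * \<tau> ^ card T \<le> real (card A)))"

text \<open>The squared 2-norm of the marginal counts is at most their maximum, which density
  controls, times their sum \<open>card A\<close>.\<close>

lemma dense_norm:
  assumes "finite J" "A \<subseteq> J \<rightarrow>\<^sub>E \<Sigma>" "S \<subseteq> I" "S \<noteq> {}" "I \<subseteq> J" "dense \<tau> I A" "\<tau> > 0"
  shows "(\<Sum>\<alpha>\<in>S \<rightarrow>\<^sub>E \<Sigma>. (real (card {x\<in>A. restrict x S = \<alpha>}))\<^sup>2) \<le> (real (card A))\<^sup>2 / \<tau> ^ card S"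
proof -
  have finJ: "finite (J \<rightarrow>\<^sub>E \<Sigma>)" using assms fin by (intro finite_PiE) auto
  have finA: "finite A" by (rule finite_subset[OF assms(2) finJ])
  have finS: "finite S" by (rule finite_subset[OF subset_trans[OF assms(3,5)] assms(1)])
  let ?p = "\<lambda>\<alpha>. real (card {x\<in>A. restrict x S = \<alpha>})"
  have p: "?p \<alpha> \<le> real (card A) / \<tau> ^ card S" if "\<alpha> \<in> S \<rightarrow>\<^sub>E \<Sigma>" for \<alpha>
  proof (cases "{x\<in>A. restrict x S = \<alpha>} = {}")
    case True
    show ?thesis unfolding True using assms(7) by simp
  next
    case False
    then obtain x0 where x0: "x0 \<in> A" "restrict x0 S = \<alpha>" by auto
    have "{x\<in>A. restrict x S = \<alpha>} = {x\<in>A. \<forall>i\<in>S. x i = x0 i}"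
      unfolding x0(2)[symmetric] by (auto simp: restrict_def fun_eq_iff)
    moreover have "real (card {x\<in>A. \<forall>i\<in>S. x i = x0 i}) * \<tau> ^ card S \<le> real (card A)"
      using assms x0 by (auto simp: dense_def)
    ultimately show ?thesis using assms(7) by (simp add: pos_le_divide_eq)
  qed
  have "(\<Sum>\<alpha>\<in>S \<rightarrow>\<^sub>E \<Sigma>. (?p \<alpha>)\<^sup>2) \<le> (\<Sum>\<alpha>\<in>S \<rightarrow>\<^sub>E \<Sigma>. ?p \<alpha> * (real (card A) / \<tau> ^ card S))"
    unfolding power2_eq_square using p by (intro sum_mono mult_left_mono) auto
  also have "\<dots> = (\<Sum>\<alpha>\<in>S \<rightarrow>\<^sub>E \<Sigma>. ?p \<alpha>) * (real (card A) / \<tau> ^ card S)"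
    by (rule sum_distrib_right[symmetric])
  also have "(\<Sum>\<alpha>\<in>S \<rightarrow>\<^sub>E \<Sigma>. ?p \<alpha>) = real (card A)"
  proof -
    have "(\<Sum>x\<in>A. (1::real)) = (\<Sum>\<alpha>\<in>S \<rightarrow>\<^sub>E \<Sigma>. ?p \<alpha> * 1)"
      using assms(2,3,5) finA finS fin
      by (intro sum_fiber_card[where F="\<lambda>_. 1"]) (fastforce intro!: finite_PiE)+
    then show ?thesis by simp
  qed
  finally show ?thesis by (simp only: power2_eq_square times_divide_eq_right)
qed

text \<open>The character sum depends only on the marginal counts \<open>p\<close>, \<open>q\<close>
  of the two sides on \<open>S\<close>. It is a bilinear form in them, and Cauchy-Schwarz with
  \<open>tensor_norm\<close> yields a gain of \<open>sqrt (2 * s) / \<tau>\<close> per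
  block.\<close>

lemma dense_char_bound:
  assumes J: "finite J" "A \<subseteq> J \<rightarrow>\<^sub>E \<Sigma>" "B \<subseteq> J \<rightarrow>\<^sub>E \<Sigma>" "S \<subseteq> I" "S \<noteq> {}" "I \<subseteq> J"
    and d: "dense \<tau> I A" "dense \<tau> I B" and \<tau>: "\<tau> > 0"
  shows "\<bar>\<Sum>x\<in>A. \<Sum>y\<in>B. \<Prod>i\<in>S. g (x i) (y i)\<bar> \<le> real (card A) * real (card B) * (sqrt (2 * s) / \<tau>) ^ card S"
proof -
  have finJ: "finite (J \<rightarrow>\<^sub>E \<Sigma>)" using J fin by (intro finite_PiE) auto
  have finAB: "finite A" "finite B" using finite_subset[OF J(2) finJ] finite_subset[OF J(3) finJ] by auto
  have finS: "finite S" by (rule finite_subset[OF subset_trans[OF J(4,6)] J(1)])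
  let ?P = "S \<rightarrow>\<^sub>E \<Sigma>"
  have finP: "finite ?P" using finS fin by (intro finite_PiE) auto
  define p where "p \<alpha> = real (card {x\<in>A. restrict x S = \<alpha>})" for \<alpha>
  define q where "q \<alpha> = real (card {x\<in>B. restrict x S = \<alpha>})" for \<alpha>
  define k where "k \<alpha> \<beta> = (\<Prod>i\<in>S. g (\<alpha> i) (\<beta> i))" for \<alpha> \<beta>
  have kr: "(\<Prod>i\<in>S. g (x i) (y i)) = k (restrict x S) (restrict y S)" for x y
    by (simp add: k_def)
  have inP: "restrict x S \<in> ?P" if "x \<in> A \<or> x \<in> B" for x
    using that J by fastforce
  have "(\<Sum>x\<in>A. \<Sum>y\<in>B. \<Prod>i\<in>S. g (x i) (y i)) = (\<Sum>x\<in>A. \<Sum>\<beta>\<in>?P. q \<beta> * k (restrict x S) \<beta>)"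
    unfolding kr q_def
  proof (rule sum.cong[OF refl])
    fix x assume "x \<in> A"
    show "(\<Sum>y\<in>B. k (restrict x S) (restrict y S)) = (\<Sum>\<beta>\<in>?P. real (card {y \<in> B. restrict y S = \<beta>}) * k (restrict x S) \<beta>)"
      by (rule sum_fiber_card[OF finAB(2) finP]) (use inP in blast)
  qed
  also have "\<dots> = (\<Sum>\<alpha>\<in>?P. p \<alpha> * (\<Sum>\<beta>\<in>?P. q \<beta> * k \<alpha> \<beta>))"
    unfolding p_def by (rule sum_fiber_card[OF finAB(1) finP]) (use inP in blast)
  also have "\<dots> = (\<Sum>\<beta>\<in>?P. q \<beta> * (\<Sum>\<alpha>\<in>?P. p \<alpha> * k \<alpha> \<beta>))"
    unfolding sum_distrib_left by (subst sum.swap) (simp only: mult_ac)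
  finally have eq: "(\<Sum>x\<in>A. \<Sum>y\<in>B. \<Prod>i\<in>S. g (x i) (y i)) = (\<Sum>\<beta>\<in>?P. q \<beta> * (\<Sum>\<alpha>\<in>?P. p \<alpha> * k \<alpha> \<beta>))" .
  have "(\<Sum>\<beta>\<in>?P. q \<beta> * (\<Sum>\<alpha>\<in>?P. p \<alpha> * k \<alpha> \<beta>))\<^sup>2 \<le> (\<Sum>\<beta>\<in>?P. (q \<beta>)\<^sup>2) * (\<Sum>\<beta>\<in>?P. (\<Sum>\<alpha>\<in>?P. p \<alpha> * k \<alpha> \<beta>)\<^sup>2)"
    by (rule Cauchy_Schwarz_ineq_sum)
  also have "\<dots> \<le> (\<Sum>\<beta>\<in>?P. (q \<beta>)\<^sup>2) * ((2 * s) ^ card S * (\<Sum>\<alpha>\<in>?P. (p \<alpha>)\<^sup>2))"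
    unfolding k_def by (intro mult_left_mono tensor_norm finS sum_nonneg) auto
  also have "\<dots> \<le> ((real (card B))\<^sup>2 / \<tau> ^ card S) * ((2 * s) ^ card S * ((real (card A))\<^sup>2 / \<tau> ^ card S))"
    using dense_norm[OF J(1,2,4,5,6) d(1) \<tau>] dense_norm[OF J(1,3,4,5,6) d(2) \<tau>] s_ge1 \<tau>
    unfolding p_def q_def
    by (intro mult_mono mult_left_mono mult_nonneg_nonneg sum_nonneg divide_nonneg_nonneg) auto
  also have "\<dots> = (real (card A) * real (card B) * (sqrt (2 * s) / \<tau>) ^ card S)\<^sup>2"
    using s_ge1 by (simp add: power_mult_distrib power_divide real_sqrt_power[symmetric] power2_eq_square)
  finally have "\<bar>\<Sum>\<beta>\<in>?P. q \<beta> * (\<Sum>\<alpha>\<in>?P. p \<alpha> * k \<alpha> \<beta>)\<bar> \<le> \<bar>real (card A) * real (card B) * (sqrt (2 * s) / \<tau>) ^ card S\<bar>"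
    by (simp add: abs_le_square_iff)
  then show ?thesis using eq \<tau> s_ge1 by simp
qed

definition agree :: "'j set \<Rightarrow> ('j \<Rightarrow> 's) set \<Rightarrow> bool" where
  "agree Z A \<longleftrightarrow> (\<forall>x\<in>A. \<forall>x'\<in>A. \<forall>i\<in>Z. x i = x' i)"

lemma agreeD: "agree Z A \<Longrightarrow> x \<in> A \<Longrightarrow> x' \<in> A \<Longrightarrow> i \<in> Z \<Longrightarrow> x i = x' i"
  by (auto simp: agree_def)

text \<open>On the free blocks the gadget values are nearly uniform: the indicator of
  \<open>G J x y = z\<close> expands into characters, the empty one gives the main term, and the
  others sum to at most \<open>(1 + \<omega>) ^ card J - 1\<close>. The fixed blocks confine
  \<open>z\<close> to one subcube, where the mass of \<open>f\<close> is bounded below.\<close>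

lemma dense_rectangle:
  assumes J: "finite J" "A \<subseteq> J \<rightarrow>\<^sub>E \<Sigma>" "B \<subseteq> J \<rightarrow>\<^sub>E \<Sigma>" "Z \<subseteq> J"
    and agree: "agree Z A" "agree Z B"
    and d: "dense \<tau> (J - Z) A" "dense \<tau> (J - Z) B" and \<tau>: "\<tau> > 0"
    and f: "\<And>z. z \<in> sgns J \<Longrightarrow> f z \<ge> 0"
    and sub: "\<And>a. a \<in> sgns J \<Longrightarrow> (\<Sum>z\<in>{z\<in>sgns J. \<forall>i\<in>Z. z i = a i}. f z) \<ge> lam * 2 ^ (card J - card Z)"
    and \<omega>: "\<omega> = sqrt (2 * s) / \<tau>" "(1 + \<omega>) ^ card J \<le> 1 + \<epsilon>" "\<epsilon> \<le> 1" and lam: "lam \<ge> 0"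
  shows "(\<Sum>x\<in>A. \<Sum>y\<in>B. f (G J x y)) \<ge> lam * (1 - \<epsilon>) * real (card A) * real (card B)"
proof (cases "A = {} \<or> B = {}")
  case True
  then show ?thesis by auto
next
  case False
  then obtain x0 y0 where xy0: "x0 \<in> A" "y0 \<in> B" by auto
  have finJ: "finite (J \<rightarrow>\<^sub>E \<Sigma>)" using J fin by (intro finite_PiE) auto
  define I where "I = J - Z"
  have finI: "finite I" using J by (auto simp: I_def)
  have \<omega>0: "\<omega> \<ge> 0" using \<omega> \<tau> s_ge1 by simp
  define a where "a = G J x0 y0"
  have a: "a \<in> sgns J" using G_sgns[of x0 J y0] xy0 J(2,3) by (auto simp: a_def)
  define C where "C = {z\<in>sgns J. \<forall>i\<in>Z. z i = a i}"
  have finC: "finite C" using J by (simp add: C_def)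
  have GC: "G J x y \<in> C" if "x \<in> A" "y \<in> B" for x y
  proof -
    have "G J x y i = a i" if "i \<in> Z" for i
      using agreeD[OF agree(1) \<open>x \<in> A\<close> xy0(1) that] agreeD[OF agree(2) \<open>y \<in> B\<close> xy0(2) that] J(4) that
      by (auto simp: a_def G_def)
    moreover have "G J x y \<in> sgns J" using G_sgns[of x J y] that J(2,3) by auto
    ultimately show ?thesis by (simp add: C_def)
  qed
  have cI: "card I = card J - card Z"
    using J finite_subset[OF J(4,1)] by (simp add: I_def card_Diff_subset)
  have ind: "(\<Prod>i\<in>I. 1 + z i * g (x i) (y i)) = (if G J x y = z then 2 ^ card I else 0)"
    if "x \<in> A" "y \<in> B" "z \<in> C" for x y z
  proof (cases "G J x y = z")
    case True
    have "z i * g (x i) (y i) = 1" if "i \<in> I" for i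
    proof -
      have "i \<in> J" using that by (simp add: I_def)
      then have "z i = g (x i) (y i)" using True by (auto simp: G_def)
      moreover have "g (x i) (y i) \<in> {-1,1}" using sign \<open>x \<in> A\<close> \<open>y \<in> B\<close> J \<open>i \<in> J\<close> by (meson PiE_mem subsetD)
      ultimately show ?thesis by auto
    qed
    then show ?thesis using True by simp
  next
    case False
    have "G J x y \<in> C" using GC that by blast
    then obtain i where i: "i \<in> J" "G J x y i \<noteq> z i"
      using False \<open>z \<in> C\<close> by (metis (no_types, lifting) C_def PiE_ext mem_Collect_eq sgns_def)
    then have "i \<in> I" using \<open>G J x y \<in> C\<close> \<open>z \<in> C\<close> by (auto simp: I_def C_def)
    moreover have "1 + z i * g (x i) (y i) = 0"
    proof -
      have "g (x i) (y i) \<in> {-1,1}" using sign \<open>x \<in> A\<close> \<open>y \<in> B\<close> J \<open>i \<in> J\<close> by (meson PiE_mem subsetD)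
      moreover have "z i \<in> {-1,1}" using \<open>z \<in> C\<close> i(1) by (auto simp: C_def dest: sgns_val)
      ultimately show ?thesis using i by (auto simp: G_def)
    qed
    ultimately show ?thesis using False finI by (auto simp: prod_zero_iff)
  qed
  have low: "(\<Sum>x\<in>A. \<Sum>y\<in>B. \<Prod>i\<in>I. 1 + z i * g (x i) (y i)) \<ge> real (card A) * real (card B) * (1 - \<epsilon>)"
    if z: "z \<in> C" for z
  proof -
    have "(\<Sum>x\<in>A. \<Sum>y\<in>B. \<Prod>i\<in>I. 1 + z i * g (x i) (y i))
       = (\<Sum>x\<in>A. \<Sum>y\<in>B. \<Sum>S\<in>Pow I. (\<Prod>i\<in>S. z i) * (\<Prod>i\<in>S. g (x i) (y i)))"
      by (simp add: prod_one_plus[OF finI] prod.distrib)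
    also have "\<dots> = (\<Sum>x\<in>A. \<Sum>S\<in>Pow I. \<Sum>y\<in>B. (\<Prod>i\<in>S. z i) * (\<Prod>i\<in>S. g (x i) (y i)))"
      by (intro sum.cong refl sum.swap)
    also have "\<dots> = (\<Sum>S\<in>Pow I. \<Sum>x\<in>A. \<Sum>y\<in>B. (\<Prod>i\<in>S. z i) * (\<Prod>i\<in>S. g (x i) (y i)))"
      by (rule sum.swap)
    also have "\<dots> = (\<Sum>S\<in>Pow I. (\<Prod>i\<in>S. z i) * (\<Sum>x\<in>A. \<Sum>y\<in>B. (\<Prod>i\<in>S. g (x i) (y i))))"
      by (simp add: sum_distrib_left)
    also have "\<dots> = real (card A) * real (card B) + (\<Sum>S\<in>Pow I - {{}}. (\<Prod>i\<in>S. z i) * (\<Sum>x\<in>A. \<Sum>y\<in>B. (\<Prod>i\<in>S. g (x i) (y i))))"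
      using finI by (subst sum.remove[of _ "{}"]) auto
    also have "\<dots> \<ge> real (card A) * real (card B) + (\<Sum>S\<in>Pow I - {{}}. - (real (card A) * real (card B) * \<omega> ^ card S))"
    proof (intro add_left_mono sum_mono)
      fix S assume S: "S \<in> Pow I - {{}}"
      have "\<bar>\<Prod>i\<in>S. z i\<bar> = 1"
        unfolding abs_prod using S z by (intro prod.neutral) (auto simp: C_def I_def dest!: sgns_val)
      then have "\<bar>(\<Prod>i\<in>S. z i) * (\<Sum>x\<in>A. \<Sum>y\<in>B. (\<Prod>i\<in>S. g (x i) (y i)))\<bar> \<le> real (card A) * real (card B) * \<omega> ^ card S"
        using dense_char_bound[OF J(1,2,3), of S I \<tau>] S d \<tau> \<omega>(1)
        by (auto simp: abs_mult I_def)
      then show "- (real (card A) * real (card B) * \<omega> ^ card S) \<le> (\<Prod>i\<in>S. z i) * (\<Sum>x\<in>A. \<Sum>y\<in>B. (\<Prod>i\<in>S. g (x i) (y i)))"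
        by linarith
    qed
    also have "real (card A) * real (card B) + (\<Sum>S\<in>Pow I - {{}}. - (real (card A) * real (card B) * \<omega> ^ card S))
       = real (card A) * real (card B) * (2 - (1 + \<omega>) ^ card I)"
      using finI by (simp add: sum_negf sum_diff1 sum_distrib_left[symmetric] sum_Pow_card algebra_simps)
    also have "\<dots> \<ge> real (card A) * real (card B) * (1 - \<epsilon>)"
    proof -
      have "(1 + \<omega>) ^ card I \<le> (1 + \<omega>) ^ card J"
        using \<omega>0 J(1) by (intro power_increasing card_mono) (auto simp: I_def)
      then show ?thesis using \<omega> by (intro mult_left_mono) auto
    qed
    finally show ?thesis .
  qed
  have "(\<Sum>x\<in>A. \<Sum>y\<in>B. f (G J x y)) * 2 ^ card I
     = (\<Sum>x\<in>A. \<Sum>y\<in>B. \<Sum>z\<in>C. f z * (if G J x y = z then 2 ^ card I else 0))"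
    unfolding sum_distrib_right using GC finC by (intro sum.cong refl) (simp add: if_distrib[of "\<lambda>t. f _ * t"] sum.delta' cong: if_cong)
  also have "\<dots> = (\<Sum>x\<in>A. \<Sum>y\<in>B. \<Sum>z\<in>C. f z * (\<Prod>i\<in>I. 1 + z i * g (x i) (y i)))"
    using ind by (intro sum.cong refl) auto
  also have "\<dots> = (\<Sum>x\<in>A. \<Sum>z\<in>C. \<Sum>y\<in>B. f z * (\<Prod>i\<in>I. 1 + z i * g (x i) (y i)))"
    by (intro sum.cong refl sum.swap)
  also have "\<dots> = (\<Sum>z\<in>C. \<Sum>x\<in>A. \<Sum>y\<in>B. f z * (\<Prod>i\<in>I. 1 + z i * g (x i) (y i)))"
    by (rule sum.swap)
  also have "\<dots> = (\<Sum>z\<in>C. f z * (\<Sum>x\<in>A. \<Sum>y\<in>B. \<Prod>i\<in>I. 1 + z i * g (x i) (y i)))"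
    by (simp add: sum_distrib_left)
  also have "\<dots> \<ge> (\<Sum>z\<in>C. f z * (real (card A) * real (card B) * (1 - \<epsilon>)))"
    using f low by (intro sum_mono mult_left_mono) (auto simp: C_def)
  also have "(\<Sum>z\<in>C. f z * (real (card A) * real (card B) * (1 - \<epsilon>))) = (\<Sum>z\<in>C. f z) * (real (card A) * real (card B) * (1 - \<epsilon>))"
    by (simp add: sum_distrib_right)
  also have "\<dots> \<ge> (lam * 2 ^ card I) * (real (card A) * real (card B) * (1 - \<epsilon>))"
    using sub[OF a] \<omega> unfolding C_def cI by (intro mult_right_mono) auto
  finally have "(lam * (1 - \<epsilon>) * real (card A) * real (card B)) * 2 ^ card I \<le> (\<Sum>x\<in>A. \<Sum>y\<in>B. f (G J x y)) * 2 ^ card I"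
    by (simp add: algebra_simps)
  then show ?thesis by simp
qed

end

section \<open>Decomposition of a rectangle into dense pieces\<close>

context gadget
begin

lemma card_agree:
  assumes J: "finite J" "A \<subseteq> J \<rightarrow>\<^sub>E \<Sigma>" "Z \<subseteq> J"
    and agree: "agree Z A"
  shows "real (card A) \<le> s ^ (card J - card Z)"
proof -
  have "inj_on (\<lambda>x. restrict x (J - Z)) A"
  proof (rule inj_onI)
    fix x x' assume x: "x \<in> A" "x' \<in> A" "restrict x (J - Z) = restrict x' (J - Z)"
    have "x i = x' i" if "i \<in> J" for i
      using agreeD[OF agree x(1,2)] x(3) that by (cases "i \<in> Z") (auto simp: restrict_def fun_eq_iff split: if_splits)
    then show "x = x'" using x(1,2) J(2) by (intro PiE_ext[where k=J and s="\<lambda>_. \<Sigma>"]) auto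
  qed
  moreover have "(\<lambda>x. restrict x (J - Z)) ` A \<subseteq> (J - Z) \<rightarrow>\<^sub>E \<Sigma>"
    using J(2) by fastforce
  ultimately have "card A \<le> card ((J - Z) \<rightarrow>\<^sub>E \<Sigma>)"
    using J(1) fin by (intro card_inj_on_le[of "\<lambda>x. restrict x (J - Z)"]) (auto intro: finite_PiE)
  also have "\<dots> = card \<Sigma> ^ (card J - card Z)"
    using J finite_subset[OF J(3,1)] by (simp add: card_PiE card_Diff_subset)
  finally show ?thesis unfolding s_def by (metis of_nat_le_iff of_nat_power)
qed

text \<open>The piece \<open>A'\<close> of \<open>A\<close> violates density at \<open>T\<close>. Fixing the blocks in \<open>T\<close> on Bob's side too multiplies the
  error of \<open>IH\<close> by \<open>\<theta>\<close> less often; \<open>big\<close> pays for this and leaves a share proportional to the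
  relative size of \<open>A'\<close>.\<close>

lemma piece_bound:
  fixes F :: "('j \<Rightarrow> 's) \<Rightarrow> ('j \<Rightarrow> 's) \<Rightarrow> real"
  assumes J: "finite J" "A \<subseteq> J \<rightarrow>\<^sub>E \<Sigma>" "B \<subseteq> J \<rightarrow>\<^sub>E \<Sigma>" "Z \<subseteq> J"
    and agree: "agree Z A" "agree Z B"
    and F: "\<And>x y. x \<in> J \<rightarrow>\<^sub>E \<Sigma> \<Longrightarrow> y \<in> J \<rightarrow>\<^sub>E \<Sigma> \<Longrightarrow> F x y \<ge> 0"
    and IH: "\<And>Z' A' B'. Z \<subset> Z' \<Longrightarrow> Z' \<subseteq> J \<Longrightarrow> card Z' \<le> d \<Longrightarrow> A' \<subseteq> J \<rightarrow>\<^sub>E \<Sigma> \<Longrightarrow> B' \<subseteq> J \<rightarrow>\<^sub>E \<Sigma> \<Longrightarrow>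
         agree Z' A' \<Longrightarrow> agree Z' B' \<Longrightarrow>
         (\<Sum>x\<in>A'. \<Sum>y\<in>B'. F x y) \<ge> c * real (card A') * real (card B') - \<theta> ^ (d - card Z') * s ^ (2 * (card J - card Z'))"
    and c: "0 \<le> c" "c \<le> 1" and \<tau>: "\<tau> > 0" and M: "M \<ge> 1" and \<theta>: "\<theta> = M * \<tau> / s" "\<theta> \<le> 1"
    and T: "T \<subseteq> J - Z" "T \<noteq> {}" and \<alpha>: "\<alpha> \<in> A" and A': "A' = {x\<in>A. \<forall>i\<in>T. x i = \<alpha> i}"
    and big: "real (card A) < real (card A') * \<tau> ^ card T"
  shows "(\<Sum>x\<in>A'. \<Sum>y\<in>B. F x y) \<ge> c * real (card A') * real (card B)
      - \<theta> ^ (d - card Z) * s ^ (2 * (card J - card Z)) * (real (card A') / real (card A)) / M"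
proof -
  have finJ: "finite (J \<rightarrow>\<^sub>E \<Sigma>)" using J fin by (intro finite_PiE) auto
  have finAB: "finite A" "finite B" using finite_subset[OF J(2) finJ] finite_subset[OF J(3) finJ] by auto
  have finT: "finite T" "finite Z" using T J finite_subset[of T J] finite_subset[of Z J] by auto
  define t where "t = card T"
  define m where "m = card J - card Z"
  define e where "e = d - card Z"
  define Z' where "Z' = Z \<union> T"
  have t1: "t \<ge> 1" using T finT by (simp add: t_def Suc_leI card_gt_0_iff)
  have cZ': "card Z' = card Z + t" using T finT by (auto simp: Z'_def t_def intro!: card_Un_disjoint)
  have Z'J: "Z' \<subseteq> J" using T J by (auto simp: Z'_def)
  have cle: "card Z' \<le> card J" using Z'J J(1) by (intro card_mono)
  have tm: "t \<le> m" using cle cZ' by (simp add: m_def)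
  have cJ: "card J - card Z' = m - t" using cZ' by (simp add: m_def)
  have s0: "s > 0" using s_ge1 by simp
  have \<theta>0: "\<theta> > 0" using \<theta> M \<tau> s0 by simp
  have A'A: "A' \<subseteq> A" using A' by auto
  have agA': "agree Z' A'"
    using agree(1) A' unfolding agree_def Z'_def by auto
  have cA: "real (card A) > 0" using \<alpha> finAB by (auto simp: card_gt_0_iff)
  have ratio: "real (card A') / real (card A) \<ge> 1 / \<tau> ^ t"
    using big \<tau> cA by (simp add: field_simps t_def)
  have Mt: "M \<le> M ^ t" using M t1 by (metis power_increasing power_one_right)
  have \<theta>t: "M * \<tau> ^ t \<le> \<theta> ^ t * s ^ t"
    using Mt \<tau> s0 unfolding \<theta>(1) by (simp add: power_mult_distrib power_divide)
  \<comment> \<open>\<open>E\<close> is the total error over Bob's \<open>s ^ t\<close> fibres, each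
    of which contributes \<open>\<theta> ^ (e - t) * s ^ (2 * (m - t))\<close>.\<close>
  define E where "E = s ^ (2 * m) / s ^ t * \<theta> ^ (e - t)"
  have E: "E \<le> \<theta> ^ e * s ^ (2 * m) * (real (card A') / real (card A)) / M"
  proof -
    have "M * \<tau> ^ t * \<theta> ^ (e - t) \<le> \<theta> ^ t * s ^ t * \<theta> ^ (e - t)"
      using \<theta>t \<theta>0 by (intro mult_right_mono) auto
    also have "\<dots> = s ^ t * \<theta> ^ (t + (e - t))" by (simp add: power_add)
    also have "\<dots> \<le> s ^ t * \<theta> ^ e"
      using \<theta> \<theta>0 s0 by (intro mult_left_mono power_decreasing) auto
    finally have "\<theta> ^ (e - t) / s ^ t \<le> \<theta> ^ e * (1 / \<tau> ^ t) / M"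
      using M \<tau> s0 by (simp add: field_simps)
    also have "\<dots> \<le> \<theta> ^ e * (real (card A') / real (card A)) / M"
      using ratio \<theta>0 M by (intro divide_right_mono mult_left_mono) auto
    finally have "s ^ (2 * m) * (\<theta> ^ (e - t) / s ^ t) \<le> s ^ (2 * m) * (\<theta> ^ e * (real (card A') / real (card A)) / M)"
      using s0 by (intro mult_left_mono) auto
    then show ?thesis by (simp add: E_def mult_ac)
  qed
  have "(\<Sum>x\<in>A'. \<Sum>y\<in>B. F x y) \<ge> c * real (card A') * real (card B) - E"
  proof (cases "card Z' \<le> d")
    case True
    define Bf where "Bf \<beta> = {y\<in>B. restrict y T = \<beta>}" for \<beta>
    have finP: "finite (T \<rightarrow>\<^sub>E \<Sigma>)" using finT fin by (intro finite_PiE) auto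
    have im: "(\<lambda>y. restrict y T) ` B \<subseteq> T \<rightarrow>\<^sub>E \<Sigma>" using J(3) T by fastforce
    have grp: "(\<Sum>\<beta>\<in>T \<rightarrow>\<^sub>E \<Sigma>. \<Sum>y\<in>Bf \<beta>. h y) = (\<Sum>y\<in>B. h y)" for h :: "('j \<Rightarrow> 's) \<Rightarrow> real"
      unfolding Bf_def using sum.group[OF finAB(2) finP im] by simp
    have "(\<Sum>x\<in>A'. \<Sum>y\<in>B. F x y) = (\<Sum>x\<in>A'. \<Sum>\<beta>\<in>T \<rightarrow>\<^sub>E \<Sigma>. \<Sum>y\<in>Bf \<beta>. F x y)"
      by (simp add: grp)
    also have "\<dots> = (\<Sum>\<beta>\<in>T \<rightarrow>\<^sub>E \<Sigma>. \<Sum>x\<in>A'. \<Sum>y\<in>Bf \<beta>. F x y)"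
      by (rule sum.swap)
    also have "\<dots> \<ge> (\<Sum>\<beta>\<in>T \<rightarrow>\<^sub>E \<Sigma>. c * real (card A') * real (card (Bf \<beta>)) - \<theta> ^ (d - card Z') * s ^ (2 * (card J - card Z')))"
    proof (intro sum_mono)
      fix \<beta> assume "\<beta> \<in> T \<rightarrow>\<^sub>E \<Sigma>"
      show "c * real (card A') * real (card (Bf \<beta>)) - \<theta> ^ (d - card Z') * s ^ (2 * (card J - card Z')) \<le> (\<Sum>x\<in>A'. \<Sum>y\<in>Bf \<beta>. F x y)"
      proof (rule IH[OF _ Z'J True])
        show "Z \<subset> Z'" using T by (auto simp: Z'_def)
        show "A' \<subseteq> J \<rightarrow>\<^sub>E \<Sigma>" using A'A J(2) by (rule subset_trans)
        show "Bf \<beta> \<subseteq> J \<rightarrow>\<^sub>E \<Sigma>" using J(3) by (auto simp: Bf_def)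
        show "agree Z' A'" by (rule agA')
        show "agree Z' (Bf \<beta>)" unfolding agree_def
        proof (intro ballI)
          fix x x' i assume x: "x \<in> Bf \<beta>" "x' \<in> Bf \<beta>" "i \<in> Z'"
          show "x i = x' i"
          proof (cases "i \<in> Z")
            case True
            then show ?thesis using agreeD[OF agree(2)] x by (auto simp: Bf_def)
          next
            case False
            then have "i \<in> T" using x by (auto simp: Z'_def)
            moreover have "restrict x T = restrict x' T" using x by (simp add: Bf_def)
            ultimately show ?thesis by (metis restrict_apply')
          qed
        qed
      qed
    qed
    also have "(\<Sum>\<beta>\<in>T \<rightarrow>\<^sub>E \<Sigma>. c * real (card A') * real (card (Bf \<beta>)) - \<theta> ^ (d - card Z') * s ^ (2 * (card J - card Z')))
      = c * real (card A') * (\<Sum>\<beta>\<in>T \<rightarrow>\<^sub>E \<Sigma>. real (card (Bf \<beta>))) - real (card (T \<rightarrow>\<^sub>E \<Sigma>)) * (\<theta> ^ (d - card Z') * s ^ (2 * (m - t)))"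
      by (simp add: sum_subtractf sum_distrib_left cJ)
    also have "(\<Sum>\<beta>\<in>T \<rightarrow>\<^sub>E \<Sigma>. real (card (Bf \<beta>))) = real (card B)"
      using grp[of "\<lambda>_. 1"] by simp
    also have "real (card (T \<rightarrow>\<^sub>E \<Sigma>)) * (\<theta> ^ (d - card Z') * s ^ (2 * (m - t))) = E"
    proof -
      have "2 * m = 2 * (m - t) + t + t" using tm by simp
      then have "s ^ (2 * m) = s ^ (2 * (m - t)) * s ^ t * s ^ t"
        by (metis power_add)
      then show ?thesis
        using s0 cZ' finT by (simp add: E_def card_PiE s_def[symmetric] t_def e_def)
    qed
    finally show ?thesis .
  next
    case False
    \<comment> \<open>More than \<open>d\<close> fixed blocks are out of reach of \<open>IH\<close>,
      but then \<open>E\<close> is at least the trivial bound on \<open>card A' * card B\<close>,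
      and nonnegativity of \<open>F\<close> suffices.\<close>
    then have "e - t = 0" using cZ' by (simp add: e_def)
    have "c * real (card A') * real (card B) \<le> 1 * s ^ (m - t) * s ^ m"
    proof (intro mult_mono)
      show "real (card A') \<le> s ^ (m - t)"
        using card_agree[OF J(1) subset_trans[OF A'A J(2)] Z'J agA'] by (simp add: cJ)
      show "real (card B) \<le> s ^ m"
        using card_agree[OF J(1,3,4) agree(2)] by (simp add: m_def)
    qed (use c s0 in auto)
    also have "\<dots> = E"
    proof -
      have "2 * m = (m - t) + t + m" using tm by simp
      then have "s ^ (2 * m) = s ^ (m - t) * s ^ t * s ^ m"
        by (metis power_add)
      then show ?thesis using s0 \<open>e - t = 0\<close> by (simp add: E_def)
    qed
    finally have "c * real (card A') * real (card B) - E \<le> 0" by simp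
    also have "0 \<le> (\<Sum>x\<in>A'. \<Sum>y\<in>B. F x y)"
      using F A'A J by (intro sum_nonneg) blast
    finally show ?thesis .
  qed
  with E show ?thesis by (simp add: e_def m_def)
qed

lemma harm_diff_ge:
  assumes "k \<le> n" "n > 0"
  shows "real k / real n \<le> harm n - harm (n - k)"
  using assms(1)
proof (induction k)
  case 0
  then show ?case by simp
next
  case (Suc k)
  then have IH: "real k / real n \<le> harm n - harm (n - k)" by simp
  have "n - k = Suc (n - Suc k)" using Suc by simp
  then have "harm (n - k) = (harm (n - Suc k) :: real) + inverse (real (n - k))"
    by (metis harm_Suc)
  moreover have "inverse (real (n - k)) \<ge> 1 / real n"
    using Suc assms by (simp add: inverse_eq_divide frac_le)
  ultimately show ?case using IH by (simp add: add_divide_distrib)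
qed

text \<open>Violating pieces are split off one after the other; the harmonic numbers bound the sum of the
  relative sizes \<open>card A' / card A\<close> over all pieces split off.\<close>

lemma rectangle_bound_aux:
  assumes J: "finite J"
    and f: "\<And>z. z \<in> sgns J \<Longrightarrow> f z \<ge> 0"
    and sub: "\<And>T a. T \<subseteq> J \<Longrightarrow> card T \<le> d \<Longrightarrow> a \<in> sgns J \<Longrightarrow>
        (\<Sum>z\<in>{z\<in>sgns J. \<forall>i\<in>T. z i = a i}. f z) \<ge> lam * 2 ^ (card J - card T)"
    and lam: "0 \<le> lam" "lam \<le> 1"
    and \<tau>: "\<tau> > 0" and \<omega>: "\<omega> = sqrt (2 * s) / \<tau>" "(1 + \<omega>) ^ card J \<le> 1 + \<epsilon>" "\<epsilon> \<le> 1" "0 \<le> \<epsilon>"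
    and M: "M \<ge> 1" "M \<ge> 2 * harm (card \<Sigma> ^ card J)" and \<theta>: "\<theta> = M * \<tau> / s" "\<theta> \<le> 1"
  shows "A \<subseteq> J \<rightarrow>\<^sub>E \<Sigma> \<Longrightarrow> B \<subseteq> J \<rightarrow>\<^sub>E \<Sigma> \<Longrightarrow> Z \<subseteq> J \<Longrightarrow> card Z \<le> d \<Longrightarrow>
    agree Z A \<Longrightarrow> agree Z B \<Longrightarrow>
    (\<Sum>x\<in>A. \<Sum>y\<in>B. f (G J x y)) \<ge> lam * (1 - \<epsilon>) * real (card A) * real (card B)
      - \<theta> ^ (d - card Z) * s ^ (2 * (card J - card Z)) * ((harm (card A) + harm (card B)) / M)"
\<comment> \<open>Two nested inductions: fixing further blocks lowers the number of free blocks,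
  splitting off a piece lowers \<open>card A + card B\<close>.\<close>
proof (induction "card (J - Z)" arbitrary: Z A B rule: less_induct)
  case outer: less
  \<comment> \<open>For larger \<open>Z'\<close> the harmonic factor can be replaced by 1, because
    \<open>M\<close> exceeds twice the largest harmonic number that occurs. This is the form that
    \<open>piece_bound\<close> expects.\<close>
  have IHo: "(\<Sum>x\<in>A'. \<Sum>y\<in>B'. f (G J x y)) \<ge> lam * (1 - \<epsilon>) * real (card A') * real (card B')
        - \<theta> ^ (d - card Z') * s ^ (2 * (card J - card Z'))"
    if "Z \<subset> Z'" "Z' \<subseteq> J" "card Z' \<le> d" "A' \<subseteq> J \<rightarrow>\<^sub>E \<Sigma>" "B' \<subseteq> J \<rightarrow>\<^sub>E \<Sigma>"
      "agree Z' A'" "agree Z' B'" for Z' A' B'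
  proof -
    have finJ: "finite (J \<rightarrow>\<^sub>E \<Sigma>)" using J fin by (intro finite_PiE) auto
    have "card (J - Z') < card (J - Z)"
      using that J by (intro psubset_card_mono) auto
    note * = outer.hyps[OF this that(4,5,2,3,6,7)]
    have "card A' \<le> card \<Sigma> ^ card J" "card B' \<le> card \<Sigma> ^ card J"
      using card_mono[OF finJ that(4)] card_mono[OF finJ that(5)] J by (simp_all add: card_PiE)
    then have "harm (card A') \<le> (harm (card \<Sigma> ^ card J) :: real)" "harm (card B') \<le> (harm (card \<Sigma> ^ card J) :: real)"
      by (simp_all add: harm_mono)
    then have "(harm (card A') + harm (card B')) / M \<le> 1"
      using M by (simp add: field_simps)
    moreover have "0 \<le> \<theta> ^ (d - card Z') * s ^ (2 * (card J - card Z'))"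
      using s_ge1 \<theta> M \<tau> by simp
    ultimately have "\<theta> ^ (d - card Z') * s ^ (2 * (card J - card Z')) * ((harm (card A') + harm (card B')) / M)
      \<le> \<theta> ^ (d - card Z') * s ^ (2 * (card J - card Z'))"
      by (rule mult_left_le)
    with * show ?thesis by linarith
  qed
  define W where "W = \<theta> ^ (d - card Z) * s ^ (2 * (card J - card Z))"
  have W0: "W \<ge> 0" using s_ge1 \<theta> M \<tau> by (simp add: W_def)
  define c where "c = lam * (1 - \<epsilon>)"
  have c01: "0 \<le> c" "c \<le> 1" using lam \<omega> by (auto simp: c_def mult_le_one)
  show ?case
    using outer.prems(1,2,5,6)
  proof (induction "card A + card B" arbitrary: A B rule: less_induct)
    case (less A B)
    have finJ: "finite (J \<rightarrow>\<^sub>E \<Sigma>)" using J fin by (intro finite_PiE) auto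
    have finAB: "finite A" "finite B"
      using finite_subset[OF less.prems(1) finJ] finite_subset[OF less.prems(2) finJ] by auto
    have F0: "f (G J x y) \<ge> 0" if "x \<in> J \<rightarrow>\<^sub>E \<Sigma>" "y \<in> J \<rightarrow>\<^sub>E \<Sigma>" for x y
      using f G_sgns that by blast
    consider (dense) "dense \<tau> (J - Z) A" "dense \<tau> (J - Z) B" | (A) "\<not> dense \<tau> (J - Z) A" | (B) "\<not> dense \<tau> (J - Z) B"
      by blast
    then show ?case
    proof cases
      case dense
      have "(\<Sum>x\<in>A. \<Sum>y\<in>B. f (G J x y)) \<ge> c * real (card A) * real (card B)"
        unfolding c_def
        by (rule dense_rectangle[OF J less.prems(1,2) outer.prems(3) less.prems(3,4) dense \<tau> f _ \<omega>(1-3) lam(1)])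
           (use sub outer.prems(3,4) in auto)
      moreover have "W * ((harm (card A) + harm (card B)) / M) \<ge> 0"
        using W0 M by (intro mult_nonneg_nonneg divide_nonneg_nonneg add_nonneg_nonneg) (auto intro: harm_nonneg)
      ultimately show ?thesis by (simp add: W_def c_def)
    next
      case A
      then obtain T \<alpha> where T: "T \<subseteq> J - Z" "T \<noteq> {}" "\<alpha> \<in> A"
        and big: "real (card A) < real (card {x\<in>A. \<forall>i\<in>T. x i = \<alpha> i}) * \<tau> ^ card T"
        by (auto simp: dense_def not_le)
      define A' where "A' = {x\<in>A. \<forall>i\<in>T. x i = \<alpha> i}"
      have A'A: "A' \<subseteq> A" "\<alpha> \<in> A'" using T by (auto simp: A'_def)
      have cd: "card (A - A') = card A - card A'" "card A' \<le> card A" "card A' > 0" "card A > 0"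
        using A'A finAB finite_subset[OF A'A(1) finAB(1)] T(3)
        by (auto simp: card_Diff_subset card_gt_0_iff intro: card_mono)
      have 1: "(\<Sum>x\<in>A'. \<Sum>y\<in>B. f (G J x y)) \<ge> c * real (card A') * real (card B) - W * (real (card A') / real (card A)) / M"
        unfolding W_def
        by (rule piece_bound[OF J less.prems(1,2) outer.prems(3) less.prems(3,4) F0 IHo[folded c_def] c01 \<tau> M(1) \<theta> T A'_def big[folded A'_def]])
      have 2: "(\<Sum>x\<in>A - A'. \<Sum>y\<in>B. f (G J x y)) \<ge> c * real (card (A - A')) * real (card B)
        - W * ((harm (card (A - A')) + harm (card B)) / M)"
        unfolding W_def c_def
        by (rule less.hyps) (use cd less.prems in \<open>auto simp: agree_def\<close>)
      have "real (card A') / real (card A) \<le> harm (card A) - harm (card (A - A'))"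
        unfolding cd(1) using cd by (intro harm_diff_ge) auto
      then have "W / M * (real (card A') / real (card A)) \<le> W / M * (harm (card A) - harm (card (A - A')))"
        using W0 M by (intro mult_left_mono) auto
      moreover have "(\<Sum>x\<in>A. \<Sum>y\<in>B. f (G J x y)) = (\<Sum>x\<in>A - A'. \<Sum>y\<in>B. f (G J x y)) + (\<Sum>x\<in>A'. \<Sum>y\<in>B. f (G J x y))"
        using A'A finAB by (intro sum.subset_diff) auto
      moreover have "real (card A) = real (card A') + real (card (A - A'))" using cd by simp
      then have "c * real (card A) * real (card B) = c * real (card A') * real (card B) + c * real (card (A - A')) * real (card B)"
        by (simp only: distrib_left distrib_right)
      ultimately show ?thesis using 1 2
        unfolding W_def[symmetric] c_def[symmetric] by (simp add: algebra_simps add_divide_distrib diff_divide_distrib)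
    next
      case B
      then obtain T \<alpha> where T: "T \<subseteq> J - Z" "T \<noteq> {}" "\<alpha> \<in> B"
        and big: "real (card B) < real (card {x\<in>B. \<forall>i\<in>T. x i = \<alpha> i}) * \<tau> ^ card T"
        by (auto simp: dense_def not_le)
      define B' where "B' = {x\<in>B. \<forall>i\<in>T. x i = \<alpha> i}"
      have B'B: "B' \<subseteq> B" "\<alpha> \<in> B'" using T by (auto simp: B'_def)
      have cd: "card (B - B') = card B - card B'" "card B' \<le> card B" "card B' > 0" "card B > 0"
        using B'B finAB finite_subset[OF B'B(1) finAB(2)] T(3)
        by (auto simp: card_Diff_subset card_gt_0_iff intro: card_mono)
      have IHs: "(\<Sum>y\<in>B'. \<Sum>x\<in>A'. f (G J x y)) \<ge> c * real (card B') * real (card A')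
        - \<theta> ^ (d - card Z') * s ^ (2 * (card J - card Z'))"
        if "Z \<subset> Z'" "Z' \<subseteq> J" "card Z' \<le> d" "B' \<subseteq> J \<rightarrow>\<^sub>E \<Sigma>" "A' \<subseteq> J \<rightarrow>\<^sub>E \<Sigma>"
          "agree Z' B'" "agree Z' A'" for Z' A' B'
        using IHo[OF that(1,2,3,5,4,7,6)] sum.swap[of "\<lambda>x y. f (G J x y)" B' A']
        by (simp add: c_def mult_ac)
      have 1: "(\<Sum>y\<in>B'. \<Sum>x\<in>A. f (G J x y)) \<ge> c * real (card B') * real (card A) - W * (real (card B') / real (card B)) / M"
        unfolding W_def
        by (rule piece_bound[OF J less.prems(2,1) outer.prems(3) less.prems(4,3) F0 IHs c01 \<tau> M(1) \<theta> T B'_def big[folded B'_def]])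
      have 2: "(\<Sum>x\<in>A. \<Sum>y\<in>B - B'. f (G J x y)) \<ge> c * real (card A) * real (card (B - B'))
        - W * ((harm (card A) + harm (card (B - B'))) / M)"
        unfolding W_def c_def
        by (rule less.hyps) (use cd less.prems in \<open>auto simp: agree_def\<close>)
      have "real (card B') / real (card B) \<le> harm (card B) - harm (card (B - B'))"
        unfolding cd(1) using cd by (intro harm_diff_ge) auto
      then have "W / M * (real (card B') / real (card B)) \<le> W / M * (harm (card B) - harm (card (B - B')))"
        using W0 M by (intro mult_left_mono) auto
      moreover have "(\<Sum>x\<in>A. \<Sum>y\<in>B. f (G J x y)) = (\<Sum>x\<in>A. \<Sum>y\<in>B - B'. f (G J x y)) + (\<Sum>y\<in>B'. \<Sum>x\<in>A. f (G J x y))"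
        unfolding sum.swap[of "\<lambda>y x. f (G J x y)" A B'] sum.distrib[symmetric]
        using B'B finAB by (intro sum.cong refl sum.subset_diff) auto
      moreover have "real (card B) = real (card B') + real (card (B - B'))" using cd by simp
      then have "c * real (card A) * real (card B) = c * real (card B') * real (card A) + c * real (card A) * real (card (B - B'))"
        by (simp add: distrib_left)
      ultimately show ?thesis using 1 2
        unfolding W_def[symmetric] c_def[symmetric] by (simp add: algebra_simps add_divide_distrib diff_divide_distrib)
    qed
  qed
qed

text \<open>The two requirements on \<tau> compete: well above \<open>sqrt (2 * s)\<close> it makes
  dense pieces pseudorandom, well below \<open>s / M\<close> it makes \<theta>, hence the error
  \<open>\<theta> ^ d\<close> relative to all input pairs, small. A gadget of large size
  \<open>s\<close> leaves room for both.\<close>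

theorem rectangle_bound:
  fixes J :: "'j set"
  assumes J: "finite J"
    and f: "\<And>z. z \<in> sgns J \<Longrightarrow> f z \<ge> 0"
    and sub: "\<And>T a. T \<subseteq> J \<Longrightarrow> card T \<le> d \<Longrightarrow> a \<in> sgns J \<Longrightarrow>
        (\<Sum>z\<in>{z\<in>sgns J. \<forall>i\<in>T. z i = a i}. f z) \<ge> lam * 2 ^ (card J - card T)"
    and lam: "0 \<le> lam" "lam \<le> 1"
    and \<tau>: "\<tau> > 0" and \<omega>: "\<omega> = sqrt (2 * s) / \<tau>" "(1 + \<omega>) ^ card J \<le> 1 + \<epsilon>" "\<epsilon> \<le> 1" "0 \<le> \<epsilon>"
    and M: "M \<ge> 1" "M \<ge> 2 * harm (card \<Sigma> ^ card J)" and \<theta>: "\<theta> = M * \<tau> / s" "\<theta> \<le> 1"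
    and AB: "A \<subseteq> J \<rightarrow>\<^sub>E \<Sigma>" "B \<subseteq> J \<rightarrow>\<^sub>E \<Sigma>"
  shows "(\<Sum>x\<in>A. \<Sum>y\<in>B. f (G J x y)) \<ge> lam * (1 - \<epsilon>) * real (card A) * real (card B) - \<theta> ^ d * s ^ (2 * card J)"
proof -
  have finJ: "finite (J \<rightarrow>\<^sub>E \<Sigma>)" using J fin by (intro finite_PiE) auto
  have *: "(\<Sum>x\<in>A. \<Sum>y\<in>B. f (G J x y)) \<ge> lam * (1 - \<epsilon>) * real (card A) * real (card B)
      - \<theta> ^ (d - card ({} :: 'j set)) * s ^ (2 * (card J - card ({} :: 'j set))) * ((harm (card A) + harm (card B)) / M)"
    by (rule rectangle_bound_aux[OF J f sub lam \<tau> \<omega> M \<theta> AB]) (auto simp: agree_def)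
  have "card A \<le> card \<Sigma> ^ card J" "card B \<le> card \<Sigma> ^ card J"
    using card_mono[OF finJ AB(1)] card_mono[OF finJ AB(2)] J by (simp_all add: card_PiE)
  then have "harm (card A) \<le> (harm (card \<Sigma> ^ card J) :: real)" "harm (card B) \<le> (harm (card \<Sigma> ^ card J) :: real)"
    by (simp_all add: harm_mono)
  then have "(harm (card A) + harm (card B)) / M \<le> 1"
    using M by (simp add: field_simps)
  moreover have "0 \<le> \<theta> ^ d * s ^ (2 * card J)"
    using s_ge1 \<theta> M \<tau> by simp
  ultimately have "\<theta> ^ d * s ^ (2 * card J) * ((harm (card A) + harm (card B)) / M) \<le> \<theta> ^ d * s ^ (2 * card J)"
    by (rule mult_left_le)
  with * show ?thesis by simp
qed

end

section \<open>Correlated sines of Gaussians\<close>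

definition psd_on :: "'i set \<Rightarrow> ('i \<Rightarrow> 'i \<Rightarrow> real) \<Rightarrow> bool" where
  "psd_on I P \<longleftrightarrow> (\<forall>i\<in>I. \<forall>j\<in>I. P i j = P j i) \<and> (\<forall>x. 0 \<le> (\<Sum>i\<in>I. \<Sum>j\<in>I. x i * x j * P i j))"

lemma quad_insert:
  fixes P :: "'i \<Rightarrow> 'i \<Rightarrow> real"
  assumes "finite I" "a \<notin> I" "\<And>i. i \<in> I \<Longrightarrow> P i a = P a i"
  shows "(\<Sum>i\<in>insert a I. \<Sum>j\<in>insert a I. x i * x j * P i j)
    = (x a)\<^sup>2 * P a a + 2 * x a * (\<Sum>i\<in>I. x i * P a i) + (\<Sum>i\<in>I. \<Sum>j\<in>I. x i * x j * P i j)"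
proof -
  have "(\<Sum>i\<in>I. x i * x a * P i a) = x a * (\<Sum>i\<in>I. x i * P a i)"
    unfolding sum_distrib_left using assms(3) by (intro sum.cong) auto
  moreover have "(\<Sum>i\<in>I. x a * x i * P a i) = x a * (\<Sum>i\<in>I. x i * P a i)"
    unfolding sum_distrib_left by (intro sum.cong) auto
  ultimately show ?thesis
    using assms(1,2) by (simp add: sum.distrib power2_eq_square algebra_simps)
qed

text \<open>Cholesky factorization by induction: subtracting the rank-one matrix
  \<open>w i * w j\<close> leaves the Schur complement of the new diagonal entry, which is again
  positive semidefinite.\<close>

lemma psd_factor:
  assumes "finite I" "psd_on I P"
  shows "\<exists>v. \<forall>i\<in>I. \<forall>j\<in>I. P i j = (\<Sum>k\<in>I. v i k * v j k)"
  using assms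
proof (induction I arbitrary: P rule: finite_induct)
  case empty
  then show ?case by simp
next
  case (insert a I)
  have sym: "P i j = P j i" if "i \<in> insert a I" "j \<in> insert a I" for i j
    using insert.prems that unfolding psd_on_def by blast
  have syma: "P i a = P a i" if "i \<in> I" for i using sym that by auto
  have quad: "0 \<le> (x a)\<^sup>2 * P a a + 2 * x a * (\<Sum>i\<in>I. x i * P a i) + (\<Sum>i\<in>I. \<Sum>j\<in>I. x i * x j * P i j)" for x
  proof -
    have "0 \<le> (\<Sum>i\<in>insert a I. \<Sum>j\<in>insert a I. x i * x j * P i j)"
      using insert.prems unfolding psd_on_def by blast
    then show ?thesis using quad_insert[OF insert.hyps(1,2), of P x] syma by simp
  qed
  have Paa: "P a a \<ge> 0"
    using quad[of "\<lambda>i. if i = a then 1 else 0"] insert.hyps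
    by (simp add: if_distrib[of "\<lambda>t. t * _"] cong: if_cong sum.cong) (smt (verit, best) sum.neutral)
  \<comment> \<open>If \<open>P a a = 0\<close>, division by zero makes \<open>w\<close> vanish,
    which is the right column then: the row of \<open>a\<close> is zero by
    \<open>zero\<close>.\<close>
  define w where "w i = P a i / sqrt (P a a)" for i
  define P' where "P' i j = P i j - w i * w j" for i j
  have zero: "P a j = 0" if "P a a = 0" "j \<in> I" for j
  proof (rule ccontr)
    assume nz: "P a j \<noteq> 0"
    \<comment> \<open>Without its quadratic term the form is affine in the coordinate
      \<open>a\<close>; this value makes it equal to -1.\<close>
    define t where "t = - (P j j + 1) / (2 * P a j)"
    have "j \<noteq> a" using that insert.hyps by auto
    have 1: "(\<Sum>i\<in>I. (if i = a then t else if i = j then 1 else 0) * P a i) = P a j"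
    proof -
      have "(\<Sum>i\<in>I. (if i = a then t else if i = j then 1 else 0) * P a i) = (\<Sum>i\<in>I. if i = j then P a i else 0)"
        using insert.hyps by (intro sum.cong) auto
      then show ?thesis using that insert.hyps by simp
    qed
    have 2: "(\<Sum>i\<in>I. \<Sum>k\<in>I. (if i = a then t else if i = j then 1 else 0) * (if k = a then t else if k = j then 1 else 0) * P i k) = P j j"
    proof -
      have "(\<Sum>k\<in>I. (if k = a then t else if k = j then 1 else 0) * P i k) = (\<Sum>k\<in>I. if k = j then P i k else 0)" for i
        using insert.hyps by (intro sum.cong) auto
      then have "(\<Sum>k\<in>I. (if k = a then t else if k = j then 1 else 0) * P i k) = P i j" for i
        using that insert.hyps by simp
      then have "(\<Sum>i\<in>I. \<Sum>k\<in>I. (if i = a then t else if i = j then 1 else 0) * (if k = a then t else if k = j then 1 else 0) * P i k)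
         = (\<Sum>i\<in>I. (if i = a then t else if i = j then 1 else 0) * P i j)"
        unfolding mult.assoc sum_distrib_left[symmetric] by presburger
      also have "\<dots> = (\<Sum>i\<in>I. if i = j then P i j else 0)"
        using insert.hyps by (intro sum.cong) auto
      finally show ?thesis using that insert.hyps by simp
    qed
    have "0 \<le> 2 * t * P a j + P j j"
      using quad[of "\<lambda>i. if i = a then t else if i = j then 1 else 0"] that(1) 1 2 by simp
    also have "\<dots> = -1" using nz by (simp add: t_def field_simps)
    finally show False by simp
  qed
  have "psd_on I P'"
    unfolding psd_on_def
  proof (intro conjI ballI allI)
    show "P' i j = P' j i" if "i \<in> I" "j \<in> I" for i j
      using sym that by (simp add: P'_def)
    show "0 \<le> (\<Sum>i\<in>I. \<Sum>j\<in>I. x i * x j * P' i j)" for x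
    proof -
      define c where "c = (\<Sum>i\<in>I. x i * P a i)"
      have ww: "(\<Sum>i\<in>I. \<Sum>j\<in>I. x i * x j * P' i j) = (\<Sum>i\<in>I. \<Sum>j\<in>I. x i * x j * P i j) - (\<Sum>i\<in>I. x i * w i)\<^sup>2"
        by (simp add: P'_def algebra_simps sum_subtractf power2_eq_square sum_product)
      have cw: "(\<Sum>i\<in>I. x i * w i) = c / sqrt (P a a)"
        by (simp add: w_def c_def sum_divide_distrib)
      show ?thesis
      proof (cases "P a a = 0")
        case True
        then have "(\<Sum>i\<in>I. \<Sum>j\<in>I. x i * x j * P' i j) = (\<Sum>i\<in>I. \<Sum>j\<in>I. x i * x j * P i j)"
          by (simp add: P'_def w_def)
        also have "\<dots> \<ge> 0" 
        proof -
          have e: "(\<Sum>i\<in>I. \<Sum>j\<in>I. (x(a:=0)) i * (x(a:=0)) j * P i j) = (\<Sum>i\<in>I. \<Sum>j\<in>I. x i * x j * P i j)"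
            using insert.hyps by (intro sum.cong refl) auto
          show ?thesis using quad[of "x(a := 0)"] unfolding e by simp
        qed
        finally show ?thesis .
      next
        case False
        \<comment> \<open>This choice of the coordinate \<open>a\<close> minimizes the form, so its
          positivity there is exactly positivity of the Schur complement at
          \<open>x\<close>.\<close>
        define y where "y = x(a := - c / P a a)"
        have e1: "(\<Sum>i\<in>I. y i * P a i) = c"
          unfolding c_def y_def using insert.hyps by (intro sum.cong refl) auto
        have e2: "(\<Sum>i\<in>I. \<Sum>j\<in>I. y i * y j * P i j) = (\<Sum>i\<in>I. \<Sum>j\<in>I. x i * x j * P i j)"
          using insert.hyps by (intro sum.cong refl) (auto simp: y_def)
        have "0 \<le> (c / P a a)\<^sup>2 * P a a - 2 * (c / P a a) * c + (\<Sum>i\<in>I. \<Sum>j\<in>I. x i * x j * P i j)"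
          using quad[of y] unfolding e1 e2 by (simp add: y_def)
        also have "(c / P a a)\<^sup>2 * P a a - 2 * (c / P a a) * c = - (c / sqrt (P a a))\<^sup>2"
          using False Paa by (simp add: power_divide field_simps power2_eq_square)
        finally show ?thesis unfolding ww cw by simp
      qed
    qed
  qed
  then obtain v where v: "\<And>i j. i \<in> I \<Longrightarrow> j \<in> I \<Longrightarrow> P' i j = (\<Sum>k\<in>I. v i k * v j k)"
    using insert.IH by blast
  define u where "u i k = (if k = a then w i else if i = a then 0 else v i k)" for i k
  have wa: "w a * w j = P a j" if "j \<in> insert a I" for j
    using that zero Paa by (cases "P a a = 0") (auto simp: w_def)
  have "P i j = (\<Sum>k\<in>insert a I. u i k * u j k)" if ij: "i \<in> insert a I" "j \<in> insert a I" for i j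
  proof -
    have "(\<Sum>k\<in>insert a I. u i k * u j k) = w i * w j + (\<Sum>k\<in>I. u i k * u j k)"
      using insert.hyps by (simp add: u_def)
    also have "(\<Sum>k\<in>I. u i k * u j k) = (if i = a \<or> j = a then 0 else P' i j)"
    proof (cases "i = a \<or> j = a")
      case True
      then show ?thesis using insert.hyps by (auto simp: u_def intro!: sum.neutral)
    next
      case False
      then have "(\<Sum>k\<in>I. u i k * u j k) = (\<Sum>k\<in>I. v i k * v j k)"
        using insert.hyps by (intro sum.cong refl) (auto simp: u_def)
      then show ?thesis using False v ij by auto
    qed
    finally show ?thesis using wa[OF ij(1)] wa[OF ij(2)] sym[OF ij]
      by (auto simp: P'_def mult.commute)
  qed
  then show ?case by blast
qed

text \<open>The defect matrix (the identity minus the Gram matrix of the columns of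
  \<open>C\<close>) is positive semidefinite because \<open>C\<close> is a contraction. Its factor
  \<open>v\<close> supplies the additional rows that make all columns orthonormal.\<close>

lemma dilation:
  fixes C :: "'i \<Rightarrow> 'j \<Rightarrow> real"
  assumes fin: "finite I" "finite J"
    and contr: "\<And>x. (\<Sum>i\<in>I. (\<Sum>j\<in>J. C i j * x j)\<^sup>2) \<le> (\<Sum>j\<in>J. (x j)\<^sup>2)"
  shows "\<exists>v. \<forall>j\<in>J. \<forall>j'\<in>J. (\<Sum>i\<in>I. C i j * C i j') + (\<Sum>k\<in>J. v j k * v j' k) = (if j = j' then 1 else 0 :: real)"
proof -
  define P where "P j j' = (if j = j' then 1 else 0) - (\<Sum>i\<in>I. C i j * C i j')" for j j'
  have "psd_on J P"
    unfolding psd_on_def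
  proof (intro conjI ballI allI)
    show "P i j = P j i" for i j by (simp add: P_def mult.commute)
    fix x
    have "(\<Sum>i\<in>J. \<Sum>j\<in>J. x i * x j * P i j)
       = (\<Sum>i\<in>J. \<Sum>j\<in>J. if i = j then x i * x j else 0) - (\<Sum>i\<in>J. \<Sum>j\<in>J. \<Sum>l\<in>I. (C l i * x i) * (C l j * x j))"
      unfolding sum_subtractf[symmetric]
      by (intro sum.cong refl) (simp add: P_def algebra_simps sum_distrib_left)
    also have "(\<Sum>i\<in>J. \<Sum>j\<in>J. if i = j then x i * x j else 0) = (\<Sum>i\<in>J. (x i)\<^sup>2)"
      using fin by (simp add: power2_eq_square)
    also have "(\<Sum>i\<in>J. \<Sum>j\<in>J. \<Sum>l\<in>I. (C l i * x i) * (C l j * x j)) = (\<Sum>i\<in>J. \<Sum>l\<in>I. \<Sum>j\<in>J. (C l i * x i) * (C l j * x j))"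
      by (intro sum.cong refl sum.swap)
    also have "\<dots> = (\<Sum>l\<in>I. \<Sum>i\<in>J. \<Sum>j\<in>J. (C l i * x i) * (C l j * x j))"
      by (rule sum.swap)
    also have "\<dots> = (\<Sum>l\<in>I. (\<Sum>j\<in>J. C l j * x j)\<^sup>2)"
      by (simp add: power2_eq_square sum_product)
    finally show "0 \<le> (\<Sum>i\<in>J. \<Sum>j\<in>J. x i * x j * P i j)" using contr[of x] by simp
  qed
  from psd_factor[OF fin(2) this] obtain v where v: "\<forall>i\<in>J. \<forall>j\<in>J. P i j = (\<Sum>k\<in>J. v i k * v j k)"
    by blast
  have "(\<Sum>i\<in>I. C i j * C i j') + (\<Sum>k\<in>J. v j k * v j' k) = (if j = j' then 1 else 0)" if "j \<in> J" "j' \<in> J" for j j'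
  proof -
    have "P j j' = (\<Sum>k\<in>J. v j k * v j' k)" using v that by blast
    then show ?thesis unfolding P_def by linarith
  qed
  then show ?thesis by blast
qed

section \<open>Gaussian means of products of sines\<close>

definition gauss :: "'d set \<Rightarrow> ('d \<Rightarrow> real) measure" where
  "gauss D = Pi\<^sub>M D (\<lambda>_. std_normal_distribution)"

lemma prob_space_gauss: "prob_space (gauss D)"
  unfolding gauss_def using prob_space_normal_density[of 1 0]
  by (intro prob_space_PiM) (simp add: real_distribution.axioms[OF real_dist_normal_dist])

interpretation gauss: prob_space "gauss D" for D by (rule prob_space_gauss)

interpretation std_normal: real_distribution std_normal_distribution by (rule real_dist_normal_dist)

interpretation gaussP: product_sigma_finite "\<lambda>_::'d. std_normal_distribution"
  by unfold_locales

lemma integral_gauss_prod: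
  fixes f :: "'d \<Rightarrow> real \<Rightarrow> _::{real_normed_field,banach,second_countable_topology}"
  assumes "finite D" "\<And>i. i \<in> D \<Longrightarrow> integrable std_normal_distribution (f i)"
  shows "(\<integral>g. (\<Prod>i\<in>D. f i (g i)) \<partial>gauss D) = (\<Prod>i\<in>D. \<integral>x. f i x \<partial>std_normal_distribution)"
  unfolding gauss_def by (rule gaussP.product_integral_prod) (use assms in auto)

lemma measurable_gauss_coord [measurable]: "i \<in> D \<Longrightarrow> (\<lambda>g. g i) \<in> borel_measurable (gauss D)"
proof -
  assume "i \<in> D"
  then have *: "(\<lambda>g. g i) \<in> measurable (gauss D) std_normal_distribution"
    unfolding gauss_def by (rule measurable_component_singleton)
  have "measurable (gauss D) std_normal_distribution = borel_measurable (gauss D)"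
    by (rule measurable_cong_sets[OF refl]) (simp only: sets_density sets_lborel)
  with * show "(\<lambda>g. g i) \<in> borel_measurable (gauss D)" by (simp only:)
qed

lemma integral_gauss_exp:
  assumes "finite D"
  shows "(\<integral>g. exp (\<i> * complex_of_real (\<Sum>k\<in>D. t k * g k)) \<partial>gauss D) = complex_of_real (exp (- (\<Sum>k\<in>D. (t k)\<^sup>2) / 2))"
proof -
  have "(\<integral>g. exp (\<i> * complex_of_real (\<Sum>k\<in>D. t k * g k)) \<partial>gauss D) = (\<integral>g. (\<Prod>k\<in>D. exp (\<i> * complex_of_real (t k * g k))) \<partial>gauss D)"
    using assms by (simp add: exp_sum[symmetric] sum_distrib_left)
  also have "\<dots> = (\<Prod>k\<in>D. \<integral>x. exp (\<i> * complex_of_real (t k * x)) \<partial>std_normal_distribution)"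
    using assms by (intro integral_gauss_prod std_normal.integrable_iexp) auto
  also have "\<dots> = (\<Prod>k\<in>D. complex_of_real (exp (- ((t k)\<^sup>2) / 2)))"
    using char_std_normal_distribution by (simp add: char_def fun_eq_iff)
  also have "\<dots> = complex_of_real (exp (- (\<Sum>k\<in>D. (t k)\<^sup>2) / 2))"
    using assms by (simp add: exp_sum[symmetric] sum_negf sum_divide_distrib flip: of_real_prod)
  finally show ?thesis .
qed

text \<open>The expectation of a product of sines of jointly Gaussian variables with covariance \<open>C\<close>,
  see \<open>integral_prod_sin\<close>. It depends on \<open>C\<close> only, so the Gaussian vector can be chosen afresh
  for every bilinear inequality.\<close>

definition sin_moment :: "'w set \<Rightarrow> ('w \<Rightarrow> 'w \<Rightarrow> real) \<Rightarrow> real" where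
  "sin_moment W C = Re ((- \<i> / 2) ^ card W * complex_of_real
     (\<Sum>\<xi>\<in>sgns W. (\<Prod>w\<in>W. \<xi> w) * exp (- (\<Sum>w\<in>W. \<Sum>w'\<in>W. \<xi> w * \<xi> w' * C w w') / 2)))"

lemma sin_sgn: "complex_of_real (sin \<theta>) = (- \<i> / 2) * (\<Sum>s\<in>{-1,1::real}. complex_of_real s * exp (\<i> * complex_of_real (s * \<theta>)))"
  by (simp add: sin_of_real[symmetric] sin_exp_eq field_simps)

text \<open>Writing each sine as a signed sum of two exponentials turns the product into a sum over
  sign patterns \<xi> of characters with frequency vector \<open>T \<xi>\<close>. The Gaussian mean
  of such a character depends only on the squared length of \<open>T \<xi>\<close>, hence only on
  the inner products of the rows of \<open>r\<close>.\<close>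

lemma integral_prod_sin:
  fixes r :: "'w \<Rightarrow> 'd \<Rightarrow> real"
  assumes W: "finite W" and D: "finite D"
  shows "(\<integral>g. (\<Prod>w\<in>W. sin (\<Sum>k\<in>D. r w k * g k)) \<partial>gauss D) = sin_moment W (\<lambda>w w'. \<Sum>k\<in>D. r w k * r w' k)"
proof -
  define T where "T \<xi> k = (\<Sum>w\<in>W. \<xi> w * r w k)" for \<xi> k
  have e: "complex_of_real (\<Prod>w\<in>W. sin (\<Sum>k\<in>D. r w k * g k)) =
     (\<Sum>\<xi>\<in>sgns W. (- \<i> / 2) ^ card W * complex_of_real (\<Prod>w\<in>W. \<xi> w) * exp (\<i> * complex_of_real (\<Sum>k\<in>D. T \<xi> k * g k)))" for g
  proof -
    have "complex_of_real (\<Prod>w\<in>W. sin (\<Sum>k\<in>D. r w k * g k)) =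
       (\<Prod>w\<in>W. (- \<i> / 2) * (\<Sum>s\<in>{-1,1::real}. complex_of_real s * exp (\<i> * complex_of_real (s * (\<Sum>k\<in>D. r w k * g k)))))"
      unfolding of_real_prod by (intro prod.cong refl sin_sgn)
    also have "\<dots> = (- \<i> / 2) ^ card W * (\<Prod>w\<in>W. \<Sum>s\<in>{-1,1::real}. complex_of_real s * exp (\<i> * complex_of_real (s * (\<Sum>k\<in>D. r w k * g k))))"
      by (simp only: prod.distrib prod_constant)
    also have "(\<Prod>w\<in>W. \<Sum>s\<in>{-1,1::real}. complex_of_real s * exp (\<i> * complex_of_real (s * (\<Sum>k\<in>D. r w k * g k))))
       = (\<Sum>\<xi>\<in>sgns W. \<Prod>w\<in>W. complex_of_real (\<xi> w) * exp (\<i> * complex_of_real (\<xi> w * (\<Sum>k\<in>D. r w k * g k))))"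
      unfolding sgns_def using W by (subst prod_sum_PiE) auto
    also have "\<dots> = (\<Sum>\<xi>\<in>sgns W. complex_of_real (\<Prod>w\<in>W. \<xi> w) * exp (\<i> * complex_of_real (\<Sum>k\<in>D. T \<xi> k * g k)))"
    proof (intro sum.cong refl)
      fix \<xi>
      have "(\<Sum>w\<in>W. \<xi> w * (\<Sum>k\<in>D. r w k * g k)) = (\<Sum>k\<in>D. T \<xi> k * g k)"
        unfolding T_def sum_distrib_left sum_distrib_right by (subst sum.swap) (simp add: mult_ac)
      then have "(\<Prod>w\<in>W. exp (\<i> * complex_of_real (\<xi> w * (\<Sum>k\<in>D. r w k * g k)))) = exp (\<i> * complex_of_real (\<Sum>k\<in>D. T \<xi> k * g k))"
        using W by (simp only: exp_sum[symmetric] sum_distrib_left[symmetric] of_real_sum[symmetric])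
      then show "(\<Prod>w\<in>W. complex_of_real (\<xi> w) * exp (\<i> * complex_of_real (\<xi> w * (\<Sum>k\<in>D. r w k * g k)))) =
           complex_of_real (\<Prod>w\<in>W. \<xi> w) * exp (\<i> * complex_of_real (\<Sum>k\<in>D. T \<xi> k * g k))"
        by (simp only: prod.distrib of_real_prod)
    qed
    finally show ?thesis by (simp only: sum_distrib_left mult.assoc)
  qed
  have "complex_of_real (\<integral>g. (\<Prod>w\<in>W. sin (\<Sum>k\<in>D. r w k * g k)) \<partial>gauss D)
     = (\<integral>g. (\<Sum>\<xi>\<in>sgns W. (- \<i> / 2) ^ card W * complex_of_real (\<Prod>w\<in>W. \<xi> w) * exp (\<i> * complex_of_real (\<Sum>k\<in>D. T \<xi> k * g k))) \<partial>gauss D)"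
    unfolding e[symmetric] by (simp only: integral_complex_of_real)
  also have "\<dots> = (\<Sum>\<xi>\<in>sgns W. (- \<i> / 2) ^ card W * complex_of_real (\<Prod>w\<in>W. \<xi> w) * complex_of_real (exp (- (\<Sum>k\<in>D. (T \<xi> k)\<^sup>2) / 2)))"
  proof (subst Bochner_Integration.integral_sum)
    fix \<xi>
    have "integrable (gauss D) (\<lambda>g. exp (\<i> * complex_of_real (\<Sum>k\<in>D. T \<xi> k * g k)))"
      by (rule gauss.integrable_iexp) measurable
    then show "integrable (gauss D) (\<lambda>g. (- \<i> / 2) ^ card W * complex_of_real (\<Prod>w\<in>W. \<xi> w) * exp (\<i> * complex_of_real (\<Sum>k\<in>D. T \<xi> k * g k)))"
      by simp
  next
    show "(\<Sum>\<xi>\<in>sgns W. \<integral>g. (- \<i> / 2) ^ card W * complex_of_real (\<Prod>w\<in>W. \<xi> w) * exp (\<i> * complex_of_real (\<Sum>k\<in>D. T \<xi> k * g k)) \<partial>gauss D)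
      = (\<Sum>\<xi>\<in>sgns W. (- \<i> / 2) ^ card W * complex_of_real (\<Prod>w\<in>W. \<xi> w) * complex_of_real (exp (- (\<Sum>k\<in>D. (T \<xi> k)\<^sup>2) / 2)))"
      by (simp only: integral_mult_right_zero integral_gauss_exp[OF D])
  qed
  also have "\<dots> = (- \<i> / 2) ^ card W * complex_of_real (\<Sum>\<xi>\<in>sgns W. (\<Prod>w\<in>W. \<xi> w) * exp (- (\<Sum>k\<in>D. (T \<xi> k)\<^sup>2) / 2))"
    by (simp add: sum_distrib_left mult.assoc)
  also have "(\<lambda>\<xi>. \<Sum>k\<in>D. (T \<xi> k)\<^sup>2) = (\<lambda>\<xi>. \<Sum>w\<in>W. \<Sum>w'\<in>W. \<xi> w * \<xi> w' * (\<Sum>k\<in>D. r w k * r w' k))"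
  proof
    fix \<xi>
    have "(\<Sum>k\<in>D. (T \<xi> k)\<^sup>2) = (\<Sum>k\<in>D. \<Sum>w\<in>W. \<Sum>w'\<in>W. \<xi> w * r w k * (\<xi> w' * r w' k))"
      by (simp add: T_def power2_eq_square sum_product)
    also have "\<dots> = (\<Sum>w\<in>W. \<Sum>k\<in>D. \<Sum>w'\<in>W. \<xi> w * r w k * (\<xi> w' * r w' k))"
      by (rule sum.swap)
    also have "\<dots> = (\<Sum>w\<in>W. \<Sum>w'\<in>W. \<Sum>k\<in>D. \<xi> w * r w k * (\<xi> w' * r w' k))"
      by (intro sum.cong refl sum.swap)
    finally show "(\<Sum>k\<in>D. (T \<xi> k)\<^sup>2) = (\<Sum>w\<in>W. \<Sum>w'\<in>W. \<xi> w * \<xi> w' * (\<Sum>k\<in>D. r w k * r w' k))"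
      by (simp add: sum_distrib_left mult_ac)
  qed
  finally have "Re (complex_of_real (\<integral>g. (\<Prod>w\<in>W. sin (\<Sum>k\<in>D. r w k * g k)) \<partial>gauss D)) = sin_moment W (\<lambda>w w'. \<Sum>k\<in>D. r w k * r w' k)"
    unfolding sin_moment_def by metis
  then show ?thesis by simp
qed

text \<open>Since \<open>\<xi> w * \<xi> w = 1\<close>, a constant added to the diagonal contributes
  the same factor for all sign patterns. This allows smaller variances at unchanged covariances.
  Here \<open>block_gram\<close> is still a variable for an arbitrary matrix.\<close>

lemma sin_moment_shift:
  assumes "finite W" "\<And>w. w \<in> W \<Longrightarrow> block_gram w w = Gm' w w + c"
    "\<And>w w'. w \<in> W \<Longrightarrow> w' \<in> W \<Longrightarrow> w \<noteq> w' \<Longrightarrow> block_gram w w' = Gm' w w'"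
  shows "sin_moment W block_gram = exp (- c * real (card W) / 2) * sin_moment W Gm'"
proof -
  have "(\<Sum>w\<in>W. \<Sum>w'\<in>W. \<xi> w * \<xi> w' * block_gram w w') = c * card W + (\<Sum>w\<in>W. \<Sum>w'\<in>W. \<xi> w * \<xi> w' * Gm' w w')"
    if "\<xi> \<in> sgns W" for \<xi>
  proof -
    have "(\<Sum>w\<in>W. \<Sum>w'\<in>W. \<xi> w * \<xi> w' * block_gram w w') = (\<Sum>w\<in>W. \<Sum>w'\<in>W. \<xi> w * \<xi> w' * Gm' w w' + (if w = w' then c else 0))"
    proof (intro sum.cong refl)
      fix w w' assume w: "w \<in> W" "w' \<in> W"
      have "\<xi> w * \<xi> w = 1" using sgns_val[OF that w(1)] by auto
      then show "\<xi> w * \<xi> w' * block_gram w w' = \<xi> w * \<xi> w' * Gm' w w' + (if w = w' then c else 0)"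
        using assms w by (cases "w = w'") (auto simp: distrib_left)
    qed
    then show ?thesis using assms(1) by (simp add: sum.distrib)
  qed
  then have "(\<Sum>\<xi>\<in>sgns W. (\<Prod>w\<in>W. \<xi> w) * exp (- (\<Sum>w\<in>W. \<Sum>w'\<in>W. \<xi> w * \<xi> w' * block_gram w w') / 2))
     = (\<Sum>\<xi>\<in>sgns W. exp (- c * real (card W) / 2) * ((\<Prod>w\<in>W. \<xi> w) * exp (- (\<Sum>w\<in>W. \<Sum>w'\<in>W. \<xi> w * \<xi> w' * Gm' w w') / 2)))"
    by (intro sum.cong refl) (simp add: exp_add[symmetric] add_divide_distrib diff_divide_distrib)
  also have "\<dots> = exp (- c * real (card W) / 2) * (\<Sum>\<xi>\<in>sgns W. (\<Prod>w\<in>W. \<xi> w) * exp (- (\<Sum>w\<in>W. \<Sum>w'\<in>W. \<xi> w * \<xi> w' * Gm' w w') / 2))"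
    by (rule sum_distrib_left[symmetric])
  finally show ?thesis unfolding sin_moment_def by (simp del: of_real_exp of_real_sum)
qed

lemma sin_moment_cong:
  assumes "\<And>w w'. w \<in> W \<Longrightarrow> w' \<in> W \<Longrightarrow> block_gram w w' = Gm' w w'"
  shows "sin_moment W block_gram = sin_moment W Gm'"
  unfolding sin_moment_def using assms by (simp cong: sum.cong)

lemma integral_sin_std_normal: "(\<integral>x. sin (t * x) \<partial>std_normal_distribution) = 0"
proof -
  have "(\<integral>x. sin (t * x) \<partial>std_normal_distribution) = (\<integral>x. Im (exp (\<i> * complex_of_real (t * x))) \<partial>std_normal_distribution)"
    by (intro Bochner_Integration.integral_cong refl) (simp add: Im_exp)
  also have "\<dots> = Im (char std_normal_distribution t)"
    unfolding char_def using std_normal.integrable_iexp by simp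
  finally show ?thesis by (simp add: char_std_normal_distribution)
qed

lemma integrable_sin_std_normal: "integrable std_normal_distribution (\<lambda>x. sin (t * x))"
  by (rule std_normal.integrable_const_bound[of _ 1]) auto

lemma integral_sin_sq_std_normal:
  "(\<integral>x. (sin (t * x))\<^sup>2 \<partial>std_normal_distribution) \<le> t\<^sup>2"
  "0 \<le> (\<integral>x. (sin (t * x))\<^sup>2 \<partial>std_normal_distribution)"
  "integrable std_normal_distribution (\<lambda>x. (sin (t * x))\<^sup>2)"
proof -
  show int: "integrable std_normal_distribution (\<lambda>x. (sin (t * x))\<^sup>2)"
    by (rule std_normal.integrable_const_bound[of _ 1]) (auto simp: abs_square_le_1)
  have "(\<integral>x. (sin (t * x))\<^sup>2 \<partial>std_normal_distribution) \<le> (\<integral>x. t\<^sup>2 * x\<^sup>2 \<partial>std_normal_distribution)"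
  proof (rule integral_mono[OF int])
    show "integrable std_normal_distribution (\<lambda>x. t\<^sup>2 * x\<^sup>2)"
      using std_normal_distribution_even_moments(2)[of 1] by simp
    show "(sin (t * x))\<^sup>2 \<le> t\<^sup>2 * x\<^sup>2" for x
      using abs_sin_x_le_abs_x[of "t * x"] by (metis abs_le_square_iff power_mult_distrib)
  qed
  also have "\<dots> = t\<^sup>2"
    using std_normal_distribution_even_moments(1)[of 1] by simp
  finally show "(\<integral>x. (sin (t * x))\<^sup>2 \<partial>std_normal_distribution) \<le> t\<^sup>2" .
  show "0 \<le> (\<integral>x. (sin (t * x))\<^sup>2 \<partial>std_normal_distribution)"
    by (rule Bochner_Integration.integral_nonneg) simp
qed

text \<open>The moments depend on the covariance only, so the orthonormal rows may be exchanged for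
  unit vectors. Then the factors are independent, and a sine that occurs only once has mean
  0.\<close>

lemma orthonormal_sin_products:
  fixes r :: "'w \<Rightarrow> 'd \<Rightarrow> real"
  assumes X: "finite X" "S \<subseteq> X" "S' \<subseteq> X" and D: "finite D"
    and orth: "\<And>w w'. w \<in> X \<Longrightarrow> w' \<in> X \<Longrightarrow> (\<Sum>k\<in>D. r w k * r w' k) = (if w = w' then 1 else 0)"
  shows "(\<integral>g. (\<Prod>w\<in>S. sin (\<Sum>k\<in>D. t * r w k * g k)) * (\<Prod>w\<in>S'. sin (\<Sum>k\<in>D. t * r w k * g k)) \<partial>gauss D)
     = (if S = S' then (\<integral>x. (sin (t * x))\<^sup>2 \<partial>std_normal_distribution) ^ card S else 0)"
proof -
  have fS: "finite S" "finite S'" using X finite_subset by auto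
  \<comment> \<open>Indexing by the disjoint sum turns the two products into a single one, in which
    elements of both sets occur twice.\<close>
  define un :: "'w + 'w \<Rightarrow> 'w" where "un = case_sum id id"
  have prodP: "(\<Prod>w\<in>S <+> S'. h (un w)) = (\<Prod>w\<in>S. h w) * (\<Prod>w\<in>S'. h w)" for h :: "'w \<Rightarrow> real"
    using fS by (simp add: prod.Plus un_def o_def)
  have unX: "w \<in> S <+> S' \<Longrightarrow> un w \<in> X" for w using X by (auto simp: un_def)
  have "(\<integral>g. (\<Prod>w\<in>S. sin (\<Sum>k\<in>D. t * r w k * g k)) * (\<Prod>w\<in>S'. sin (\<Sum>k\<in>D. t * r w k * g k)) \<partial>gauss D)
     = sin_moment (S <+> S') (\<lambda>w w'. \<Sum>k\<in>D. (t * r (un w) k) * (t * r (un w') k))"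
    using integral_prod_sin[of "S <+> S'" D "\<lambda>w k. t * r (un w) k"] fS D
    by (simp add: prodP[of "\<lambda>w. sin (\<Sum>k\<in>D. t * r w k * _ k)"])
  also have "\<dots> = sin_moment (S <+> S') (\<lambda>w w'. \<Sum>k\<in>X. (t * (if un w = k then 1 else 0)) * (t * (if un w' = k then 1 else 0)))"
  proof (rule sin_moment_cong)
    fix w w' assume w: "w \<in> S <+> S'" "w' \<in> S <+> S'"
    have "(\<Sum>k\<in>D. (t * r (un w) k) * (t * r (un w') k)) = t * t * (\<Sum>k\<in>D. r (un w) k * r (un w') k)"
      by (simp add: sum_distrib_left mult_ac)
    also have "\<dots> = t * t * (if un w = un w' then 1 else 0)" using orth unX w by simp
    also have "\<dots> = (\<Sum>k\<in>X. if k = un w then t * t * (if un w' = k then 1 else 0) else 0)"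
      using unX[OF w(1)] X(1) by auto
    also have "\<dots> = (\<Sum>k\<in>X. (t * (if un w = k then 1 else 0)) * (t * (if un w' = k then 1 else 0)))"
      by (intro sum.cong) auto
    finally show "(\<Sum>k\<in>D. (t * r (un w) k) * (t * r (un w') k)) = (\<Sum>k\<in>X. (t * (if un w = k then 1 else 0)) * (t * (if un w' = k then 1 else 0)))" .
  qed
  also have "\<dots> = (\<integral>g. (\<Prod>w\<in>S. sin (\<Sum>k\<in>X. t * (if w = k then 1 else 0) * g k)) * (\<Prod>w\<in>S'. sin (\<Sum>k\<in>X. t * (if w = k then 1 else 0) * g k)) \<partial>gauss X)"
    using integral_prod_sin[of "S <+> S'" X "\<lambda>w k. t * (if un w = k then 1 else 0)"] fS X
    by (simp add: prodP[of "\<lambda>w. sin (\<Sum>k\<in>X. t * (if w = k then 1 else 0) * _ k)"])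
  also have "\<dots> = (\<integral>g. (\<Prod>w\<in>X. (if w \<in> S then sin (t * g w) else 1) * (if w \<in> S' then sin (t * g w) else 1)) \<partial>gauss X)"
  proof (intro Bochner_Integration.integral_cong refl)
    fix g :: "'w \<Rightarrow> real"
    have 1: "(\<Sum>k\<in>X. t * (if w = k then 1 else 0) * g k) = t * g w" if "w \<in> X" for w
    proof -
      have "(\<Sum>k\<in>X. t * (if w = k then 1 else 0) * g k) = (\<Sum>k\<in>X. if k = w then t * g k else 0)"
        by (intro sum.cong) auto
      then show ?thesis using that X by simp
    qed
    have 2: "(\<Prod>w\<in>U. sin (\<Sum>k\<in>X. t * (if w = k then 1 else 0) * g k)) = (\<Prod>w\<in>X. if w \<in> U then sin (t * g w) else 1)" if "U \<subseteq> X" for U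
    proof -
      have "(\<Prod>w\<in>U. sin (\<Sum>k\<in>X. t * (if w = k then 1 else 0) * g k)) = (\<Prod>w\<in>U. sin (t * g w))"
        using 1 that by (intro prod.cong refl) auto
      also have "\<dots> = (\<Prod>w\<in>X. if w \<in> U then sin (t * g w) else 1)"
        using that X by (intro prod.mono_neutral_cong_left) auto
      finally show ?thesis .
    qed
    show "(\<Prod>w\<in>S. sin (\<Sum>k\<in>X. t * (if w = k then 1 else 0) * g k)) * (\<Prod>w\<in>S'. sin (\<Sum>k\<in>X. t * (if w = k then 1 else 0) * g k))
       = (\<Prod>w\<in>X. (if w \<in> S then sin (t * g w) else 1) * (if w \<in> S' then sin (t * g w) else 1))"
      unfolding 2[OF X(2)] 2[OF X(3)] by (rule prod.distrib[symmetric])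
  qed
  also have "\<dots> = (\<Prod>w\<in>X. \<integral>x. (if w \<in> S then sin (t * x) else 1) * (if w \<in> S' then sin (t * x) else 1) \<partial>std_normal_distribution)"
  proof (rule integral_gauss_prod[OF X(1)])
    fix w
    show "integrable std_normal_distribution (\<lambda>x. (if w \<in> S then sin (t * x) else 1) * (if w \<in> S' then sin (t * x) else 1))"
      using integrable_sin_std_normal[of t] integral_sin_sq_std_normal(3)[of t]
      by (cases "w \<in> S"; cases "w \<in> S'") (simp_all add: power2_eq_square)
  qed
  also have "\<dots> = (\<Prod>w\<in>X. if w \<in> S \<and> w \<in> S' then (\<integral>x. (sin (t * x))\<^sup>2 \<partial>std_normal_distribution)
      else if w \<in> S \<or> w \<in> S' then 0 else 1)"
  proof (intro prod.cong refl)
    fix w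
    show "(\<integral>x. (if w \<in> S then sin (t * x) else 1) * (if w \<in> S' then sin (t * x) else 1) \<partial>std_normal_distribution)
      = (if w \<in> S \<and> w \<in> S' then (\<integral>x. (sin (t * x))\<^sup>2 \<partial>std_normal_distribution) else if w \<in> S \<or> w \<in> S' then 0 else 1)"
      using integral_sin_std_normal[of t] std_normal.prob_space
      by (cases "w \<in> S"; cases "w \<in> S'") (simp_all add: power2_eq_square)
  qed
  also have "\<dots> = (if S = S' then (\<integral>x. (sin (t * x))\<^sup>2 \<partial>std_normal_distribution) ^ card S else 0)"
  proof (cases "S = S'")
    case True
    have "(\<Prod>w\<in>X. if w \<in> S \<and> w \<in> S' then (\<integral>x. (sin (t * x))\<^sup>2 \<partial>std_normal_distribution)
      else if w \<in> S \<or> w \<in> S' then 0 else 1) = (\<Prod>w\<in>S. (\<integral>x. (sin (t * x))\<^sup>2 \<partial>std_normal_distribution))"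
      using True X by (intro prod.mono_neutral_cong_right) auto
    then show ?thesis using True by simp
  next
    case False
    then obtain w where "w \<in> X" "\<not> (w \<in> S \<and> w \<in> S')" "w \<in> S \<or> w \<in> S'" using X by blast
    then show ?thesis using False X(1) by (auto intro!: prod_zero bexI[of _ w])
  qed
  finally show ?thesis .
qed

section \<open>The sine kernel of a contraction\<close>

definition block_gram :: "('i \<Rightarrow> 'j \<Rightarrow> real) \<Rightarrow> 'i + 'j \<Rightarrow> 'i + 'j \<Rightarrow> real" where
  "block_gram M w w' = (case w of
      Inl i \<Rightarrow> (case w' of Inl i' \<Rightarrow> (if i = i' then 1 else 0) | Inr j \<Rightarrow> M i j)
    | Inr j \<Rightarrow> (case w' of Inl i \<Rightarrow> M i j | Inr j' \<Rightarrow> (if j = j' then 1 else 0)))"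

text \<open>\<open>sin_kernel M S S'\<close> is a Fourier coefficient of the mean of \<open>(\<Prod>i. 1 + a i * sin (g i)) * (\<Prod>j. 1 + b j * sin (g' j))\<close>
  for standard Gaussian vectors \<open>g\<close>, \<open>g'\<close> with cross covariance \<open>M\<close>. Sine being bounded by 1 makes this a
  nonnegative function of \<open>(a, b)\<close>, and its being odd makes the marginals uniform.\<close>

definition sin_kernel :: "('i \<Rightarrow> 'j \<Rightarrow> real) \<Rightarrow> 'i set \<Rightarrow> 'j set \<Rightarrow> real" where
  "sin_kernel M S S' = sin_moment (S <+> S') (block_gram M)"

definition nrm_le :: "'i set \<Rightarrow> 'j set \<Rightarrow> ('i \<Rightarrow> 'j \<Rightarrow> real) \<Rightarrow> real \<Rightarrow> bool" where
  "nrm_le I J M c \<longleftrightarrow> (\<forall>x. (\<Sum>i\<in>I. (\<Sum>j\<in>J. M i j * x j)\<^sup>2) \<le> c\<^sup>2 * (\<Sum>j\<in>J. (x j)\<^sup>2))"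

text \<open>The first coordinates of the vector of \<open>j\<close> are the scaled column of
  \<open>M\<close>, so its inner product with the unit vector at \<open>Inl i\<close> is
  \<open>M i j / \<eta>\<close>: two orthonormal families with prescribed mutual inner
  products.\<close>

lemma exists_dilation:
  fixes M :: "'i \<Rightarrow> 'j \<Rightarrow> real"
  assumes fin: "finite T" "finite T'" and M: "nrm_le T T' M \<eta>" and \<eta>: "\<eta> > 0"
  shows "\<exists>r :: 'j \<Rightarrow> 'i + 'j \<Rightarrow> real.
     (\<forall>j\<in>T'. \<forall>j'\<in>T'. (\<Sum>k\<in>T <+> T'. r j k * r j' k) = (if j = j' then 1 else 0)) \<and>
     (\<forall>j\<in>T'. \<forall>i\<in>T. r j (Inl i) = M i j / \<eta>)"
proof -
  have "(\<Sum>i\<in>T. (\<Sum>j\<in>T'. (M i j / \<eta>) * x j)\<^sup>2) \<le> (\<Sum>j\<in>T'. (x j)\<^sup>2)" for x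
  proof -
    have "(\<Sum>i\<in>T. (\<Sum>j\<in>T'. (M i j / \<eta>) * x j)\<^sup>2) = (\<Sum>i\<in>T. (\<Sum>j\<in>T'. M i j * x j)\<^sup>2) / \<eta>\<^sup>2"
      by (simp add: sum_divide_distrib[symmetric] power_divide)
    also have "\<dots> \<le> (\<Sum>j\<in>T'. (x j)\<^sup>2)"
      using M \<eta> by (simp add: nrm_le_def divide_le_eq mult.commute)
    finally show ?thesis .
  qed
  from dilation[OF fin this] obtain v where
    v: "\<forall>j\<in>T'. \<forall>j'\<in>T'. (\<Sum>i\<in>T. (M i j / \<eta>) * (M i j' / \<eta>)) + (\<Sum>k\<in>T'. v j k * v j' k) = (if j = j' then 1 else 0 :: real)"
    by blast
  define r where "r j k = (case k of Inl i \<Rightarrow> M i j / \<eta> | Inr k \<Rightarrow> v j k)" for j and k :: "'i + 'j"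
  have "(\<Sum>k\<in>T <+> T'. r j k * r j' k) = (\<Sum>i\<in>T. (M i j / \<eta>) * (M i j' / \<eta>)) + (\<Sum>k\<in>T'. v j k * v j' k)" for j j'
    using fin by (simp add: sum.Plus r_def o_def)
  then show ?thesis using v by (intro exI[of _ r]) (auto simp: r_def)
qed

lemma bounded_prod_sin: "\<bar>\<Prod>w\<in>W. sin (h w)\<bar> \<le> (1::real)"
  unfolding abs_prod by (intro prod_le_1) auto

lemma integral_square_orth:
  fixes h :: "'k set \<Rightarrow> 'a \<Rightarrow> real"
  assumes P: "finite P"
    and o: "\<And>S S'. S \<in> P \<Longrightarrow> S' \<in> P \<Longrightarrow> (\<integral>g. h S g * h S' g \<partial>M) = (if S = S' then \<rho> ^ card S else 0)"
    and i: "\<And>S S'. integrable M (\<lambda>g. h S g * h S' g)"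
  shows "(\<integral>g. (\<Sum>S\<in>P. c S * h S g)\<^sup>2 \<partial>M) = (\<Sum>S\<in>P. (c S)\<^sup>2 * \<rho> ^ card S)"
    "integrable M (\<lambda>g. (\<Sum>S\<in>P. c S * h S g)\<^sup>2)"
proof -
  have eq: "(\<Sum>S\<in>P. c S * h S g)\<^sup>2 = (\<Sum>S\<in>P. \<Sum>S'\<in>P. (c S * c S') * (h S g * h S' g))" for g
    by (simp add: power2_eq_square sum_product mult_ac)
  show "integrable M (\<lambda>g. (\<Sum>S\<in>P. c S * h S g)\<^sup>2)"
    unfolding eq by (intro Bochner_Integration.integrable_sum integrable_mult_right i)
  have "(\<integral>g. (\<Sum>S\<in>P. c S * h S g)\<^sup>2 \<partial>M) = (\<Sum>S\<in>P. \<Sum>S'\<in>P. (c S * c S') * (\<integral>g. h S g * h S' g \<partial>M))"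
    unfolding eq by (simp add: Bochner_Integration.integral_sum Bochner_Integration.integrable_sum i)
  also have "\<dots> = (\<Sum>S\<in>P. \<Sum>S'\<in>P. if S = S' then (c S)\<^sup>2 * \<rho> ^ card S else 0)"
    using o by (intro sum.cong refl) (auto simp: power2_eq_square)
  also have "\<dots> = (\<Sum>S\<in>P. (c S)\<^sup>2 * \<rho> ^ card S)" using P by simp
  finally show "(\<integral>g. (\<Sum>S\<in>P. c S * h S g)\<^sup>2 \<partial>M) = (\<Sum>S\<in>P. (c S)\<^sup>2 * \<rho> ^ card S)" .
qed

lemma weighted_sum_le:
  fixes w :: "'k set \<Rightarrow> real"
  assumes a01: "\<And>s. 0 \<le> a s" "\<And>s. a s \<le> 1" and \<rho>: "0 \<le> \<rho>" "\<rho> \<le> \<eta>"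
  shows "(\<Sum>S\<in>P. (w S * a (card S))\<^sup>2 * \<rho> ^ card S) \<le> (\<Sum>S\<in>P. \<eta> ^ card S * (w S)\<^sup>2)"
proof (intro sum_mono)
  fix S :: "'k set"
  have "(a (card S))\<^sup>2 * \<rho> ^ card S \<le> 1 * \<eta> ^ card S"
    using a01 \<rho> by (intro mult_mono power_mono) (auto simp: power_le_one)
  then have "(w S)\<^sup>2 * ((a (card S))\<^sup>2 * \<rho> ^ card S) \<le> (w S)\<^sup>2 * (\<eta> ^ card S)"
    by (intro mult_left_mono) auto
  then show "(w S * a (card S))\<^sup>2 * \<rho> ^ card S \<le> \<eta> ^ card S * (w S)\<^sup>2"
    by (simp add: power_mult_distrib mult_ac)
qed

lemma integrable_gauss_mult:
  assumes "f \<in> borel_measurable (gauss D)" "h \<in> borel_measurable (gauss D)"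
    "\<And>g. \<bar>f g\<bar> \<le> (1::real)" "\<And>g. \<bar>h g\<bar> \<le> (1::real)"
  shows "integrable (gauss D) (\<lambda>g. f g * h g)"
proof (rule gauss.integrable_const_bound[of _ 1])
  show "AE g in gauss D. norm (f g * h g) \<le> 1"
    using assms(3,4) by (auto simp: abs_mult intro!: mult_le_one)
  show "(\<lambda>g. f g * h g) \<in> borel_measurable (gauss D)"
    using assms(1,2) by (rule borel_measurable_times)
qed

text \<open>Dilating \<open>M / \<eta>\<close> realizes both families of products as orthogonal functions of correlated
  Gaussian vectors; every index then contributes one factor of \<open>\<eta>\<close>.\<close>

lemma sin_kernel_bilinear:
  fixes M :: "'i \<Rightarrow> 'j \<Rightarrow> real"
  assumes fin: "finite T" "finite T'" and M: "nrm_le T T' M \<eta>" and \<eta>: "0 < \<eta>" "\<eta> \<le> 1"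
  shows "(\<Sum>S\<in>Pow T. \<Sum>S'\<in>Pow T'. u S * v S' * sin_kernel M S S')
     \<le> ((\<Sum>S\<in>Pow T. \<eta> ^ card S * (u S)\<^sup>2) + (\<Sum>S'\<in>Pow T'. \<eta> ^ card S' * (v S')\<^sup>2)) / 2"
proof -
  obtain r :: "'j \<Rightarrow> 'i + 'j \<Rightarrow> real" where
    r: "\<And>j j'. j \<in> T' \<Longrightarrow> j' \<in> T' \<Longrightarrow> (\<Sum>k\<in>T <+> T'. r j k * r j' k) = (if j = j' then 1 else 0)"
    and rM: "\<And>j i. j \<in> T' \<Longrightarrow> i \<in> T \<Longrightarrow> r j (Inl i) = M i j / \<eta>"
    using exists_dilation[OF fin M \<eta>(1)] by blast
  define D where "D = T <+> T'"
  have finD: "finite D" using fin by (simp add: D_def)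
  define e :: "'i \<Rightarrow> 'i + 'j \<Rightarrow> real" where "e i k = (if k = Inl i then 1 else 0)" for i k
  have sum_e: "(\<Sum>k\<in>D. e i k * h k) = h (Inl i)" if "i \<in> T" for i and h :: "'i + 'j \<Rightarrow> real"
  proof -
    have "(\<Sum>k\<in>D. e i k * h k) = (\<Sum>k\<in>D. if k = Inl i then h k else 0)"
      by (intro sum.cong) (auto simp: e_def)
    moreover have "Inl i \<in> D" using that by (auto simp: D_def)
    ultimately show ?thesis using finD by simp
  qed
  have orthe: "(\<Sum>k\<in>D. e i k * e i' k) = (if i = i' then 1 else 0)" if "i \<in> T" "i' \<in> T" for i i'
    using sum_e[OF that(1), of "e i'"] by (auto simp: e_def)
  \<comment> \<open>Scaling both families by \<open>t\<close> makes the cross covariances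
    \<open>\<eta> * (M i j / \<eta>) = M i j\<close>, as wanted, but lowers the variances from 1 to
    \<eta>. By \<open>sin_moment_shift\<close> the difference costs only the factors
    \<open>a\<close>, which are at most 1.\<close>
  define t where "t = sqrt \<eta>"
  have t2: "t * t = \<eta>" using \<eta> by (simp add: t_def)
  define \<rho> where "\<rho> = (\<integral>x. (sin (t * x))\<^sup>2 \<partial>std_normal_distribution)"
  have \<rho>: "0 \<le> \<rho>" "\<rho> \<le> \<eta>"
    using integral_sin_sq_std_normal[of t] \<eta> by (auto simp: \<rho>_def t_def)
  define f where "f S g = (\<Prod>i\<in>S. sin (\<Sum>k\<in>D. t * e i k * g k))" for S and g :: "'i + 'j \<Rightarrow> real"
  define f' where "f' S g = (\<Prod>j\<in>S. sin (\<Sum>k\<in>D. t * r j k * g k))" for S and g :: "'i + 'j \<Rightarrow> real"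
  define a where "a s = exp (- (1 - \<eta>) * real s / 2)" for s :: nat
  have a01: "0 \<le> a s" "a s \<le> 1" for s using \<eta> by (auto simp: a_def mult_nonpos_nonneg)
  have meas [measurable]: "f S \<in> borel_measurable (gauss D)" "f' S' \<in> borel_measurable (gauss D)" for S S'
    unfolding f_def[abs_def] f'_def[abs_def] by measurable
  have bnd: "\<bar>f S g\<bar> \<le> 1" "\<bar>f' S' g\<bar> \<le> 1" for S S' g
    unfolding f_def f'_def by (rule bounded_prod_sin)+
  have int: "integrable (gauss D) (\<lambda>g. f S g * f S' g)" "integrable (gauss D) (\<lambda>g. f' U g * f' U' g)"
     "integrable (gauss D) (\<lambda>g. f S g * f' U g)" for S S' U U'
    by (intro integrable_gauss_mult meas bnd)+
  have ff: "(\<integral>g. f S g * f S' g \<partial>gauss D) = (if S = S' then \<rho> ^ card S else 0)" if "S \<in> Pow T" "S' \<in> Pow T" for S S'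
    unfolding f_def \<rho>_def using that fin finD orthe by (intro orthonormal_sin_products[where X=T]) auto
  have ff': "(\<integral>g. f' S g * f' S' g \<partial>gauss D) = (if S = S' then \<rho> ^ card S else 0)" if "S \<in> Pow T'" "S' \<in> Pow T'" for S S'
    unfolding f'_def \<rho>_def using that fin finD r[folded D_def] by (intro orthonormal_sin_products[where X=T']) auto
  have KE: "sin_kernel M S S' = a (card S) * a (card S') * (\<integral>g. f S g * f' S' g \<partial>gauss D)"
    if S: "S \<in> Pow T" "S' \<in> Pow T'" for S S'
  proof -
    have fS: "finite S" "finite S'" using S fin finite_subset by auto
    define q where "q w = (case w of Inl i \<Rightarrow> e i | Inr j \<Rightarrow> r j)" for w
    have "(\<integral>g. f S g * f' S' g \<partial>gauss D) = (\<integral>g. (\<Prod>w\<in>S <+> S'. sin (\<Sum>k\<in>D. t * q w k * g k)) \<partial>gauss D)"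
      using fS by (simp add: prod.Plus f_def f'_def q_def o_def)
    also have "\<dots> = sin_moment (S <+> S') (\<lambda>w w'. \<Sum>k\<in>D. (t * q w k) * (t * q w' k))"
      using fS finD by (intro integral_prod_sin) auto
    finally have 1: "(\<integral>g. f S g * f' S' g \<partial>gauss D) = sin_moment (S <+> S') (\<lambda>w w'. \<Sum>k\<in>D. (t * q w k) * (t * q w' k))" .
    have gr: "(\<Sum>k\<in>D. (t * q w k) * (t * q w' k)) = \<eta> * (\<Sum>k\<in>D. q w k * q w' k)" for w w'
      unfolding t2[symmetric] sum_distrib_left by (simp add: mult_ac)
    have er: "(\<Sum>k\<in>D. e i k * r j k) = M i j / \<eta>" "(\<Sum>k\<in>D. r j k * e i k) = M i j / \<eta>" if "i \<in> T" "j \<in> T'" for i j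
      using sum_e[OF that(1), of "r j"] rM that by (simp_all add: mult.commute)
    have ST: "\<And>i. i \<in> S \<Longrightarrow> i \<in> T" "\<And>j. j \<in> S' \<Longrightarrow> j \<in> T'" using S by auto
    have "sin_moment (S <+> S') (block_gram M) = exp (- (1 - \<eta>) * real (card (S <+> S')) / 2) * sin_moment (S <+> S') (\<lambda>w w'. \<Sum>k\<in>D. (t * q w k) * (t * q w' k))"
    proof (rule sin_moment_shift)
      show "finite (S <+> S')" using fS by simp
      show "block_gram M w w = (\<Sum>k\<in>D. t * q w k * (t * q w k)) + (1 - \<eta>)" if "w \<in> S <+> S'" for w
        unfolding gr using that S orthe r[folded D_def] by (auto simp: q_def block_gram_def)
      show "block_gram M w w' = (\<Sum>k\<in>D. t * q w k * (t * q w' k))" if "w \<in> S <+> S'" "w' \<in> S <+> S'" "w \<noteq> w'" for w w'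
        unfolding gr using that orthe[OF ST(1) ST(1)] r[folded D_def, OF ST(2) ST(2)] er[OF ST(1) ST(2)] \<eta>
        by (cases w; cases w') (auto simp: q_def block_gram_def)
    qed
    then show ?thesis unfolding sin_kernel_def 1 using fS
      by (simp add: a_def card_Plus exp_add[symmetric] add_divide_distrib distrib_left)
  qed
  define \<Phi> where "\<Phi> g = (\<Sum>S\<in>Pow T. u S * a (card S) * f S g)" for g
  define \<Psi> where "\<Psi> g = (\<Sum>S\<in>Pow T'. v S * a (card S) * f' S g)" for g
  note sq = integral_square_orth[where M = "gauss D" and \<rho> = \<rho>]
  have le: "(\<Sum>S\<in>P. (w S * a (card S))\<^sup>2 * \<rho> ^ card S) \<le> (\<Sum>S\<in>P. \<eta> ^ card S * (w S)\<^sup>2)"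
    for P :: "'i set set" and w using weighted_sum_le[where a=a and \<rho>=\<rho> and \<eta>=\<eta>] a01 \<rho> by blast
  have le': "(\<Sum>S\<in>P. (w S * a (card S))\<^sup>2 * \<rho> ^ card S) \<le> (\<Sum>S\<in>P. \<eta> ^ card S * (w S)\<^sup>2)"
    for P :: "'j set set" and w using weighted_sum_le[where a=a and \<rho>=\<rho> and \<eta>=\<eta>] a01 \<rho> by blast
  have "(\<Sum>S\<in>Pow T. \<Sum>S'\<in>Pow T'. u S * v S' * sin_kernel M S S')
    = (\<Sum>S\<in>Pow T. \<Sum>S'\<in>Pow T'. (u S * a (card S) * (v S' * a (card S'))) * (\<integral>g. f S g * f' S' g \<partial>gauss D))"
    using KE by (intro sum.cong refl) (simp add: mult_ac)
  also have "\<dots> = (\<integral>g. (\<Sum>S\<in>Pow T. \<Sum>S'\<in>Pow T'. (u S * a (card S) * (v S' * a (card S'))) * (f S g * f' S' g)) \<partial>gauss D)"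
    by (simp add: Bochner_Integration.integral_sum Bochner_Integration.integrable_sum int)
  also have "\<dots> \<le> (\<integral>g. ((\<Phi> g)\<^sup>2 + (\<Psi> g)\<^sup>2) / 2 \<partial>gauss D)"
  proof (rule integral_mono)
    show "integrable (gauss D) (\<lambda>g. \<Sum>S\<in>Pow T. \<Sum>S'\<in>Pow T'. (u S * a (card S) * (v S' * a (card S'))) * (f S g * f' S' g))"
      by (intro Bochner_Integration.integrable_sum integrable_mult_right int)
    show "integrable (gauss D) (\<lambda>g. ((\<Phi> g)\<^sup>2 + (\<Psi> g)\<^sup>2) / 2)"
      unfolding \<Phi>_def \<Psi>_def using fin ff ff' int
      by (intro integrable_divide Bochner_Integration.integrable_add sq(2)) auto
    fix g
    have "(\<Sum>S\<in>Pow T. \<Sum>S'\<in>Pow T'. (u S * a (card S) * (v S' * a (card S'))) * (f S g * f' S' g)) = \<Phi> g * \<Psi> g"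
      unfolding \<Phi>_def \<Psi>_def sum_product by (simp add: mult_ac)
    also have "\<dots> \<le> ((\<Phi> g)\<^sup>2 + (\<Psi> g)\<^sup>2) / 2"
      using zero_le_power2[of "\<Phi> g - \<Psi> g"] by (simp add: power2_diff)
    finally show "(\<Sum>S\<in>Pow T. \<Sum>S'\<in>Pow T'. (u S * a (card S) * (v S' * a (card S'))) * (f S g * f' S' g)) \<le> ((\<Phi> g)\<^sup>2 + (\<Psi> g)\<^sup>2) / 2" .
  qed
  also have "\<dots> = ((\<Sum>S\<in>Pow T. (u S * a (card S))\<^sup>2 * \<rho> ^ card S) + (\<Sum>S\<in>Pow T'. (v S * a (card S))\<^sup>2 * \<rho> ^ card S)) / 2"
  proof -
    have 1: "integrable (gauss D) (\<lambda>g. (\<Phi> g)\<^sup>2)" "integrable (gauss D) (\<lambda>g. (\<Psi> g)\<^sup>2)"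
      unfolding \<Phi>_def \<Psi>_def using fin ff ff' int by (intro sq(2); auto)+
    have 2: "(\<integral>g. (\<Phi> g)\<^sup>2 \<partial>gauss D) = (\<Sum>S\<in>Pow T. (u S * a (card S))\<^sup>2 * \<rho> ^ card S)"
         "(\<integral>g. (\<Psi> g)\<^sup>2 \<partial>gauss D) = (\<Sum>S\<in>Pow T'. (v S * a (card S))\<^sup>2 * \<rho> ^ card S)"
      unfolding \<Phi>_def \<Psi>_def using fin ff ff' int by (intro sq(1); auto)+
    show ?thesis using 1 2 by simp
  qed
  also have "\<dots> \<le> ((\<Sum>S\<in>Pow T. \<eta> ^ card S * (u S)\<^sup>2) + (\<Sum>S'\<in>Pow T'. \<eta> ^ card S' * (v S')\<^sup>2)) / 2"
    using le[of "u" "Pow T"] le'[of v "Pow T'"] by simp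
  finally show ?thesis .
qed

section \<open>Fourier analysis on the cube\<close>

definition E :: "'i set \<Rightarrow> (('i \<Rightarrow> real) \<Rightarrow> real) \<Rightarrow> real" where
  "E I u = (\<Sum>x\<in>sgns I. u x) / 2 ^ card I"

definition chi :: "'i set \<Rightarrow> ('i \<Rightarrow> real) \<Rightarrow> real" where
  "chi S x = (\<Prod>i\<in>S. x i)"

definition fc :: "'i set \<Rightarrow> (('i \<Rightarrow> real) \<Rightarrow> real) \<Rightarrow> 'i set \<Rightarrow> real" where
  "fc I u S = E I (\<lambda>x. u x * chi S x)"

definition mul :: "'i set \<Rightarrow> ('i \<Rightarrow> real) \<Rightarrow> ('i \<Rightarrow> real) \<Rightarrow> 'i \<Rightarrow> real" where
  "mul I x y = (\<lambda>i\<in>I. x i * y i)"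

lemma card_sgns: "finite I \<Longrightarrow> card (sgns I) = 2 ^ card I"
  by (simp add: sgns_def card_PiE numeral_2_eq_2)

lemma E_add: "E I (\<lambda>x. u x + v x) = E I u + E I v"
  by (simp add: E_def sum.distrib add_divide_distrib)

lemma E_diff: "E I (\<lambda>x. u x - v x) = E I u - E I v"
  by (simp add: E_def sum_subtractf diff_divide_distrib)

lemma E_cmult: "E I (\<lambda>x. c * u x) = c * E I u"
  by (simp add: E_def sum_distrib_left)

lemma E_multc: "E I (\<lambda>x. u x * c) = E I u * c"
  by (simp add: E_def sum_distrib_right)

lemma E_sum: "E I (\<lambda>x. \<Sum>a\<in>A. u a x) = (\<Sum>a\<in>A. E I (u a))"
  unfolding E_def by (subst sum.swap) (simp add: sum_divide_distrib)

lemma E_swap: "E I (\<lambda>x. E J (\<lambda>y. u x y)) = E J (\<lambda>y. E I (\<lambda>x. u x y))"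
  unfolding E_def by (simp add: sum_divide_distrib[symmetric] mult.commute) (subst sum.swap, simp)

lemma E_const: "finite I \<Longrightarrow> E I (\<lambda>x. c) = c"
  by (simp add: E_def card_sgns)

lemma E_mono: "(\<And>x. x \<in> sgns I \<Longrightarrow> u x \<le> v x) \<Longrightarrow> E I u \<le> E I v"
  unfolding E_def by (intro divide_right_mono sum_mono) auto

lemma E_nonneg: "(\<And>x. x \<in> sgns I \<Longrightarrow> 0 \<le> u x) \<Longrightarrow> 0 \<le> E I u"
  unfolding E_def by (intro divide_nonneg_nonneg sum_nonneg) auto

lemma E_cong: "(\<And>x. x \<in> sgns I \<Longrightarrow> u x = v x) \<Longrightarrow> E I u = E I v"
  unfolding E_def by (simp cong: sum.cong)

lemma chi_empty [simp]: "chi {} x = 1"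
  by (simp add: chi_def)

lemma chi_sq: "x \<in> sgns I \<Longrightarrow> S \<subseteq> I \<Longrightarrow> chi S x * chi S x = 1"
  unfolding chi_def prod.distrib[symmetric] by (intro prod.neutral) (auto dest!: sgns_val)

lemma chi_mul: "S \<subseteq> I \<Longrightarrow> chi S (mul I x y) = chi S x * chi S y"
  unfolding chi_def mul_def prod.distrib[symmetric] by (intro prod.cong) auto

lemma mul_sgns: "x \<in> sgns I \<Longrightarrow> y \<in> sgns I \<Longrightarrow> mul I x y \<in> sgns I"
  by (fastforce simp: mul_def sgns_def PiE_iff)

lemma mul_mul: assumes "x \<in> sgns I" "y \<in> sgns I" shows "mul I (mul I x y) y = x"
proof
  fix i
  show "mul I (mul I x y) y i = x i"
    using assms sgns_val[OF assms(2), of i] by (cases "i \<in> I") (auto simp: mul_def sgns_def)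
qed

lemma mul_comm: "mul I x y = mul I y x"
  by (simp add: mul_def mult.commute)

lemma E_shift:
  assumes "y \<in> sgns I"
  shows "E I (\<lambda>x. u (mul I x y)) = E I u"
proof -
  have "(\<Sum>x\<in>sgns I. u (mul I x y)) = (\<Sum>x\<in>sgns I. u x)"
    by (rule sum.reindex_bij_witness[of _ "\<lambda>x. mul I x y" "\<lambda>x. mul I x y"])
       (use assms mul_mul mul_sgns in auto)
  then show ?thesis by (simp add: E_def)
qed

lemma sum_sgns_prod:
  assumes "finite I"
  shows "E I (\<lambda>x. \<Prod>i\<in>I. h i (x i)) = (\<Prod>i\<in>I. (h i 1 + h i (-1)) / 2)"
proof -
  have "(\<Prod>i\<in>I. h i 1 + h i (-1)) = (\<Prod>i\<in>I. \<Sum>s\<in>{-1,1::real}. h i s)"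
    by (intro prod.cong) (auto simp: add.commute)
  also have "\<dots> = (\<Sum>x\<in>sgns I. \<Prod>i\<in>I. h i (x i))"
    unfolding sgns_def using assms by (subst prod_sum_PiE) auto
  finally show ?thesis by (simp add: E_def prod_dividef)
qed

lemma E_chi_chi:
  assumes "finite I" "S \<subseteq> I" "S' \<subseteq> I"
  shows "E I (\<lambda>x. chi S x * chi S' x) = (if S = S' then 1 else 0)"
proof -
  have c: "chi U x = (\<Prod>i\<in>I. if i \<in> U then x i else 1)" if "U \<subseteq> I" for U x
    unfolding chi_def using that assms(1) by (intro prod.mono_neutral_cong_left) auto
  have "E I (\<lambda>x. chi S x * chi S' x) = E I (\<lambda>x. \<Prod>i\<in>I. (if i \<in> S then x i else 1) * (if i \<in> S' then x i else 1))"
    unfolding c[OF assms(2)] c[OF assms(3)] by (simp add: prod.distrib)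
  also have "\<dots> = (\<Prod>i\<in>I. if i \<in> S \<longleftrightarrow> i \<in> S' then 1 else 0)"
    by (subst sum_sgns_prod[OF assms(1), of "\<lambda>i t. (if i \<in> S then t else 1) * (if i \<in> S' then t else 1)"])
       (intro prod.cong, auto)
  also have "\<dots> = (if S = S' then 1 else 0)"
  proof (cases "S = S'")
    case False
    then obtain i where "i \<in> I" "\<not> (i \<in> S \<longleftrightarrow> i \<in> S')" using assms by blast
    then show ?thesis using False assms(1) by (auto intro!: prod_zero bexI[of _ i])
  qed simp
  finally show ?thesis .
qed

lemma fc_expand:
  assumes "finite I" "\<And>x. x \<in> sgns I \<Longrightarrow> u x = (\<Sum>S\<in>Pow I. c S * chi S x)" "S \<in> Pow I"
  shows "fc I u S = c S"
proof -
  have "fc I u S = E I (\<lambda>x. \<Sum>S'\<in>Pow I. c S' * (chi S' x * chi S x))"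
    unfolding fc_def using assms(2) by (intro E_cong) (simp add: sum_distrib_right mult.assoc)
  also have "\<dots> = (\<Sum>S'\<in>Pow I. c S' * (if S' = S then 1 else 0))"
    unfolding E_sum E_cmult using assms by (intro sum.cong refl) (simp add: E_chi_chi)
  also have "\<dots> = (\<Sum>S'\<in>Pow I. if S' = S then c S' else 0)"
    by (intro sum.cong) auto
  finally show ?thesis using assms by simp
qed

lemma fourier:
  assumes I: "finite I" and x: "x \<in> sgns I"
  shows "u x = (\<Sum>S\<in>Pow I. fc I u S * chi S x)"
proof -
  have ker: "(\<Sum>S\<in>Pow I. chi S y * chi S x) = (if y = x then 2 ^ card I else 0)" if y: "y \<in> sgns I" for y
  proof -
    have "(\<Sum>S\<in>Pow I. chi S y * chi S x) = (\<Prod>i\<in>I. 1 + y i * x i)"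
      unfolding prod_one_plus[OF I] chi_def by (simp add: prod.distrib)
    also have "\<dots> = (if y = x then 2 ^ card I else 0)"
    proof (cases "y = x")
      case True
      have "1 + x i * x i = 2" if "i \<in> I" for i using sgns_val[OF x that] by auto
      then show ?thesis using True by simp
    next
      case False
      then obtain i where i: "i \<in> I" "y i \<noteq> x i"
        using x y unfolding sgns_def by (meson PiE_ext)
      then have "1 + y i * x i = 0" using sgns_val[OF x i(1)] sgns_val[OF y i(1)] by auto
      then show ?thesis using False I i(1) by (auto intro!: prod_zero bexI[of _ i])
    qed
    finally show ?thesis .
  qed
  have "(\<Sum>S\<in>Pow I. fc I u S * chi S x) = E I (\<lambda>y. u y * (\<Sum>S\<in>Pow I. chi S y * chi S x))"
    unfolding fc_def sum_distrib_left E_sum by (simp add: E_multc mult.assoc[symmetric])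
  also have "\<dots> = E I (\<lambda>y. if y = x then u y * 2 ^ card I else 0)"
    using ker by (intro E_cong) auto
  also have "\<dots> = u x" using I x by (simp add: E_def)
  finally show ?thesis by simp
qed

lemma parseval:
  assumes I: "finite I"
  shows "E I (\<lambda>x. u x * v x) = (\<Sum>S\<in>Pow I. fc I u S * fc I v S)"
proof -
  have "E I (\<lambda>x. u x * v x) = E I (\<lambda>x. \<Sum>S\<in>Pow I. fc I u S * (v x * chi S x))"
    using fourier[OF I, of _ u] by (intro E_cong) (simp add: sum_distrib_left mult_ac)
  also have "\<dots> = (\<Sum>S\<in>Pow I. fc I u S * fc I v S)"
    by (simp add: E_sum E_cmult fc_def)
  finally show ?thesis .
qed

lemma fc_empty: "fc I u {} = E I u"
  by (simp add: fc_def)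

section \<open>Hypercontractivity for even exponents\<close>

lemma binomial_step: "Suc k * (n choose Suc k) = (n - k) * (n choose k)"
  using binomial_absorption[of k n] binomial_absorb_comp[of n k] by simp

text \<open>Comparison of consecutive quotients: from \<open>j\<close> to \<open>j + 1\<close> the
  left side grows by \<open>(m - j) / (j + 1)\<close> times
  \<open>(2 * m - 2 * j - 1) / (2 * j + 1)\<close>, the right side by
  \<open>(m - j) / (j + 1)\<close> times \<open>2 * m\<close>.\<close>

lemma choose_double_le:
  assumes "j \<le> m"
  shows "real ((2 * m) choose (2 * j)) \<le> real (m choose j) * (2 * real m) ^ j"
  using assms
proof (induction j)
  case 0
  then show ?case by simp
next
  case (Suc j)
  let ?n = "2 * m"
  have a: "real (Suc (Suc (2*j))) * real (Suc (2*j)) * real (?n choose (2 * Suc j)) = real (?n - Suc (2*j)) * real (?n - 2*j) * real (?n choose (2*j))"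
  proof -
    have "2 * Suc j = Suc (Suc (2*j))" by simp
    then have "Suc (Suc (2*j)) * Suc (2*j) * (?n choose (2 * Suc j)) = Suc (2*j) * (Suc (Suc (2*j)) * (?n choose Suc (Suc (2*j))))"
      by (simp only: mult.assoc mult.left_commute)
    also have "\<dots> = Suc (2*j) * ((?n - Suc (2*j)) * (?n choose Suc (2*j)))"
      by (simp only: binomial_step)
    also have "\<dots> = (?n - Suc (2*j)) * (Suc (2*j) * (?n choose Suc (2*j)))" by (simp only: mult_ac)
    also have "\<dots> = (?n - Suc (2*j)) * ((?n - 2*j) * (?n choose (2*j)))"
      by (simp only: binomial_step)
    finally show ?thesis unfolding of_nat_mult[symmetric] of_nat_eq_iff by (simp only: mult.assoc)
  qed
  have b: "real (Suc j) * real (m choose Suc j) = real (m - j) * real (m choose j)"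
    using binomial_step[of j m] by (metis of_nat_mult)
  have mj: "real (?n - 2*j) = 2 * real (m - j)" using Suc by auto
  have IH: "real (?n choose (2 * j)) \<le> real (m choose j) * (2 * real m) ^ j" using Suc by simp
  have "real (Suc (Suc (2*j))) * real (Suc (2*j)) * real (?n choose (2 * Suc j))
      \<le> (2 * real m) * (2 * real (m - j)) * (real (m choose j) * (2 * real m) ^ j)"
    unfolding a mj using IH Suc by (intro mult_mono) auto
  also have "\<dots> = 2 * (2 * real m) ^ Suc j * (real (Suc j) * real (m choose Suc j))"
    unfolding b by simp
  also have "\<dots> = real (Suc (Suc (2*j))) * (real (m choose Suc j) * (2 * real m) ^ Suc j)"
    by (simp add: algebra_simps)
  also have "\<dots> \<le> real (Suc (Suc (2*j))) * (real (Suc (2*j)) * (real (m choose Suc j) * (2 * real m) ^ Suc j))"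
  proof -
    have "0 \<le> real (m choose Suc j) * (2 * real m) ^ Suc j" by simp
    then have "1 * (real (m choose Suc j) * (2 * real m) ^ Suc j) \<le> real (Suc (2*j)) * (real (m choose Suc j) * (2 * real m) ^ Suc j)"
      by (intro mult_right_mono) auto
    then show ?thesis by (intro mult_left_mono) auto
  qed
  finally have "(real (Suc (Suc (2*j))) * real (Suc (2*j))) * real (?n choose (2 * Suc j))
      \<le> (real (Suc (Suc (2*j))) * real (Suc (2*j))) * (real (m choose Suc j) * (2 * real m) ^ Suc j)"
    by (simp only: mult.assoc)
  then show ?case by (subst (asm) mult_le_cancel_left_pos) simp_all
qed

lemma sum_even_odd: "(\<Sum>k\<le>2*(m::nat). f k) = (\<Sum>j\<le>m. f (2*j)) + (\<Sum>j<m. f (2*j+1) :: real)"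
  by (induct m) (simp_all add: algebra_simps)

text \<open>Odd powers of \<open>B\<close> cancel; in the even ones
  \<open>(\<rho>\<^sup>2) ^ j\<close> pays for the excess of the binomial coefficients. The right
  side is the m-th power of \<open>A\<^sup>2 + B\<^sup>2\<close>, left expanded because
  \<open>A\<close> and \<open>B\<close> will be functions to which Hoelder is applied term by
  term.\<close>

lemma two_point:
  fixes A B \<rho> :: real
  assumes "2 * real m * \<rho>\<^sup>2 \<le> 1"
  shows "((A + \<rho> * B) ^ (2*m) + (A - \<rho> * B) ^ (2*m)) / 2 \<le> (\<Sum>j\<le>m. real (m choose j) * ((A\<^sup>2) ^ (m - j) * (B\<^sup>2) ^ j))"
proof -
  have "(A + \<rho> * B) ^ (2*m) = (\<Sum>k\<le>2*m. real (2*m choose k) * (\<rho> * B) ^ k * A ^ (2*m - k))"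
    using binomial_ring[of "\<rho> * B" A "2*m"] by (simp add: add.commute)
  moreover have "(A - \<rho> * B) ^ (2*m) = (\<Sum>k\<le>2*m. real (2*m choose k) * (- (\<rho> * B)) ^ k * A ^ (2*m - k))"
    using binomial_ring[of "- (\<rho> * B)" A "2*m"] by simp
  ultimately have "((A + \<rho> * B) ^ (2*m) + (A - \<rho> * B) ^ (2*m)) / 2
      = (\<Sum>j\<le>m. real (2*m choose (2*j)) * (\<rho> * B) ^ (2*j) * A ^ (2*m - 2*j))"
    by (simp add: sum_even_odd sum.distrib[symmetric] sum_negf)
  also have "\<dots> \<le> (\<Sum>j\<le>m. real (m choose j) * ((A\<^sup>2) ^ (m - j) * (B\<^sup>2) ^ j))"
  proof (rule sum_mono)
    fix j assume j: "j \<in> {..m}"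
    have "real (2*m choose (2*j)) * (\<rho>\<^sup>2) ^ j \<le> real (m choose j) * (2 * real m) ^ j * (\<rho>\<^sup>2) ^ j"
      using choose_double_le[of j m] j by (intro mult_right_mono) auto
    also have "\<dots> = real (m choose j) * (2 * real m * \<rho>\<^sup>2) ^ j" by (simp only: power_mult_distrib mult.assoc)
    also have "\<dots> \<le> real (m choose j) * 1" using assms by (intro mult_left_mono power_le_one) auto
    finally have "real (2*m choose (2*j)) * (\<rho>\<^sup>2) ^ j * ((A\<^sup>2) ^ (m - j) * (B\<^sup>2) ^ j) \<le> real (m choose j) * ((A\<^sup>2) ^ (m - j) * (B\<^sup>2) ^ j)"
      by (intro mult_right_mono) auto
    moreover have "(\<rho> * B) ^ (2*j) * A ^ (2*m - 2*j) = (\<rho>\<^sup>2) ^ j * ((A\<^sup>2) ^ (m - j) * (B\<^sup>2) ^ j)"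
    proof -
      have "2 * m - 2 * j = 2 * (m - j)" by simp
      show ?thesis unfolding \<open>2 * m - 2 * j = 2 * (m - j)\<close> power_mult power_mult_distrib by (simp only: mult_ac)
    qed
    ultimately show "real (2*m choose (2*j)) * (\<rho> * B) ^ (2*j) * A ^ (2*m - 2*j) \<le> real (m choose j) * ((A\<^sup>2) ^ (m - j) * (B\<^sup>2) ^ j)"
      by (simp only: mult.assoc)
  qed
  finally show ?thesis .
qed

lemma young_power:
  fixes s t :: real
  assumes "0 \<le> s" "0 \<le> t" "j \<le> m" "m > 0"
  shows "s ^ (m - j) * t ^ j \<le> (real (m - j) * s ^ m + real j * t ^ m) / real m"
proof (cases "s = 0 \<or> t = 0 \<or> j = 0 \<or> j = m")
  case True
  then show ?thesis using assms by (auto simp: power_0_left divide_simps)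
next
  case False
  then have p: "s > 0" "t > 0" "0 < j" "j < m" using assms by auto
  define a where "a = real (m - j) / real m"
  define b where "b = real j / real m"
  have ab: "a + b = 1" "a \<ge> 0" "b \<ge> 0" using p by (auto simp: a_def b_def of_nat_diff field_simps)
  have "(s ^ m) powr a * (t ^ m) powr b \<le> a * s ^ m + b * t ^ m"
    using ab p by (intro Youngs_inequality_0) auto
  moreover have "(s ^ m) powr a = s ^ (m - j)" "(t ^ m) powr b = t ^ j"
    using p by (simp_all add: powr_realpow[symmetric] powr_powr a_def b_def)
  ultimately show ?thesis by (simp add: a_def b_def add_divide_distrib)
qed

text \<open>Hoelder's inequality with exponents \<open>m / (m - j)\<close> and \<open>m / j\<close>.
  Scaling by \<alpha> and \<beta> reduces it to Young's inequality at every point; vanishing bounds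
  are treated apart because they do not permit scaling.\<close>

lemma holder_power:
  assumes I: "finite I" and X: "\<And>x. x \<in> sgns I \<Longrightarrow> 0 \<le> X x" "\<And>x. x \<in> sgns I \<Longrightarrow> 0 \<le> Y x"
    and m: "m > 0" "j \<le> m" and ab: "E I (\<lambda>x. X x ^ m) \<le> \<alpha> ^ m" "E I (\<lambda>x. Y x ^ m) \<le> \<beta> ^ m" "0 \<le> \<alpha>" "0 \<le> \<beta>"
  shows "E I (\<lambda>x. X x ^ (m - j) * Y x ^ j) \<le> \<alpha> ^ (m - j) * \<beta> ^ j"
proof -
  have zero: "W x = 0" if "E I (\<lambda>x. W x ^ m) \<le> 0" "\<And>x. x \<in> sgns I \<Longrightarrow> 0 \<le> W x" "x \<in> sgns I" for W x
  proof -
    have "(\<Sum>x\<in>sgns I. W x ^ m) \<le> 0" using that(1) by (simp add: E_def divide_le_0_iff) (smt (verit) zero_less_power)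
    moreover have "W x ^ m \<le> (\<Sum>x\<in>sgns I. W x ^ m)" using that I by (intro member_le_sum) auto
    moreover have "0 \<le> W x ^ m" using that by simp
    ultimately show ?thesis using m by (metis order_antisym order_trans power_eq_0_iff)
  qed
  consider "j = 0" | "j = m" | "0 < j" "j < m" "\<alpha> = 0" | "0 < j" "j < m" "\<beta> = 0" | "\<alpha> > 0" "\<beta> > 0"
    using m ab by linarith
  then show ?thesis
  proof cases
    case 1
    then show ?thesis using ab by simp
  next
    case 2
    then show ?thesis using ab by simp
  next
    case 3
    then have "X x = 0" if "x \<in> sgns I" for x using zero[of X x] ab m X that by (simp add: power_0_left)
    then have "E I (\<lambda>x. X x ^ (m - j) * Y x ^ j) = E I (\<lambda>x. 0)" using 3 by (intro E_cong) auto
    then show ?thesis using I 3 ab by (simp add: E_const)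
  next
    case 4
    then have "Y x = 0" if "x \<in> sgns I" for x using zero[of Y x] ab m X that by (simp add: power_0_left)
    then have "E I (\<lambda>x. X x ^ (m - j) * Y x ^ j) = E I (\<lambda>x. 0)" using 4 by (intro E_cong) auto
    then show ?thesis using I 4 ab by (simp add: E_const)
  next
    case 5
    let ?s = "\<lambda>x. X x / \<alpha>" and ?t = "\<lambda>x. Y x / \<beta>"
    have "E I (\<lambda>x. ?s x ^ (m - j) * ?t x ^ j) \<le> E I (\<lambda>x. real (m - j) / real m * ?s x ^ m + real j / real m * ?t x ^ m)"
    proof (rule E_mono)
      fix x assume "x \<in> sgns I"
      then show "?s x ^ (m - j) * ?t x ^ j \<le> real (m - j) / real m * ?s x ^ m + real j / real m * ?t x ^ m"
        using young_power[of "?s x" "?t x" j m] X 5 m by (simp add: add_divide_distrib)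
    qed
    also have "\<dots> = real (m - j) / real m * (E I (\<lambda>x. X x ^ m) / \<alpha> ^ m) + real j / real m * (E I (\<lambda>x. Y x ^ m) / \<beta> ^ m)"
      unfolding E_add E_cmult by (simp add: power_divide E_multc[of I _ "1 / _", simplified])
    also have "\<dots> \<le> real (m - j) / real m * 1 + real j / real m * 1"
      using ab 5 by (intro add_mono mult_left_mono) auto
    also have "\<dots> = 1" using m by (simp add: of_nat_diff field_simps)
    finally have "E I (\<lambda>x. ?s x ^ (m - j) * ?t x ^ j) \<le> 1" .
    moreover have "E I (\<lambda>x. ?s x ^ (m - j) * ?t x ^ j) = E I (\<lambda>x. X x ^ (m - j) * Y x ^ j) * (1 / (\<alpha> ^ (m - j) * \<beta> ^ j))"
      by (simp only: E_multc[symmetric]) (simp add: power_divide)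
    ultimately show ?thesis using 5 by (simp add: divide_le_eq)
  qed
qed

lemma sgns_insert_E:
  assumes "finite I" "a \<notin> I"
  shows "E (insert a I) u = E I (\<lambda>z. (u (z(a := 1)) + u (z(a := -1))) / 2)"
proof -
  have "sgns (insert a I) = (\<lambda>(y, g). g(a := y)) ` ({-1, 1} \<times> sgns I)"
    unfolding sgns_def by (rule PiE_insert_eq)
  moreover have "inj_on (\<lambda>(y, g). g(a := y)) ({-1, 1} \<times> sgns I)"
    using assms unfolding sgns_def by (intro inj_combinator)
  ultimately have "(\<Sum>x\<in>sgns (insert a I). u x) = (\<Sum>(y, g)\<in>{-1, 1} \<times> sgns I. u (g(a := y)))"
    by (simp add: sum.reindex case_prod_unfold)
  also have "\<dots> = (\<Sum>y\<in>{-1, 1}. \<Sum>g\<in>sgns I. u (g(a := y)))"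
    by (simp add: sum.cartesian_product)
  finally show ?thesis
    using assms by (simp add: E_def sum.distrib sum_divide_distrib[symmetric])
qed

text \<open>Induction on the coordinates: the function splits into \<open>A\<close> and \<rho> times
  the new coordinate times \<open>B\<close>. The two-point inequality removes the new coordinate,
  Hoelder and the induction hypothesis bound the mixed moments, and the binomial theorem adds up to
  \<open>(\<beta> + \<alpha>) ^ m\<close>.\<close>

theorem bonami:
  assumes "finite I" "m > 0" "2 * real m * \<rho>\<^sup>2 \<le> 1"
  shows "E I (\<lambda>x. (\<Sum>S\<in>Pow I. \<rho> ^ card S * w S * chi S x) ^ (2*m)) \<le> (\<Sum>S\<in>Pow I. (w S)\<^sup>2) ^ m"
  using assms(1)
proof (induction I arbitrary: w rule: finite_induct)
  case empty
  then show ?case by (simp add: E_def sgns_def power_mult)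
next
  case (insert a I)
  define A where "A z = (\<Sum>S\<in>Pow I. \<rho> ^ card S * w S * chi S z)" for z
  define B where "B z = (\<Sum>S\<in>Pow I. \<rho> ^ card S * w (insert a S) * chi S z)" for z
  define \<alpha> where "\<alpha> = (\<Sum>S\<in>Pow I. (w S)\<^sup>2)"
  define \<beta> where "\<beta> = (\<Sum>S\<in>Pow I. (w (insert a S))\<^sup>2)"
  have split: "(\<Sum>S\<in>Pow (insert a I). h S) = (\<Sum>S\<in>Pow I. h S) + (\<Sum>S\<in>Pow I. h (insert a S))" for h :: "_ \<Rightarrow> real"
  proof -
    have "inj_on (insert a) (Pow I)" using insert.hyps by (intro inj_onI) (metis PowD insert_ident subsetD)
    moreover have "Pow I \<inter> insert a ` Pow I = {}" using insert.hyps by auto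
    ultimately show ?thesis unfolding Pow_insert using insert.hyps
      by (subst sum.union_disjoint) (auto simp: sum.reindex)
  qed
  have eq: "(\<Sum>S\<in>Pow (insert a I). \<rho> ^ card S * w S * chi S (z(a := s))) = A z + s * \<rho> * B z" for z s
  proof -
    have "chi S (z(a := s)) = chi S z" "chi (insert a S) (z(a := s)) = s * chi S z" "card (insert a S) = Suc (card S)"
      if "S \<in> Pow I" for S
    proof -
      have *: "finite S" "a \<notin> S" using that insert.hyps finite_subset by auto
      then show "chi S (z(a := s)) = chi S z" by (auto simp: chi_def intro!: prod.cong)
      then show "chi (insert a S) (z(a := s)) = s * chi S z" using * by (simp add: chi_def)
      show "card (insert a S) = Suc (card S)" using * by simp
    qed
    then show ?thesis unfolding split A_def B_def sum_distrib_left
      by (intro arg_cong2[where f=plus] sum.cong refl) (simp_all add: mult_ac)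
  qed
  have "E (insert a I) (\<lambda>x. (\<Sum>S\<in>Pow (insert a I). \<rho> ^ card S * w S * chi S x) ^ (2*m))
     = E I (\<lambda>z. ((A z + \<rho> * B z) ^ (2*m) + (A z - \<rho> * B z) ^ (2*m)) / 2)"
    unfolding sgns_insert_E[OF insert.hyps] eq by simp
  also have "\<dots> \<le> E I (\<lambda>z. \<Sum>j\<le>m. real (m choose j) * (((A z)\<^sup>2) ^ (m - j) * ((B z)\<^sup>2) ^ j))"
    using assms(3) by (intro E_mono two_point)
  also have "\<dots> = (\<Sum>j\<le>m. real (m choose j) * E I (\<lambda>z. ((A z)\<^sup>2) ^ (m - j) * ((B z)\<^sup>2) ^ j))"
    unfolding E_sum E_cmult ..
  also have "\<dots> \<le> (\<Sum>j\<le>m. real (m choose j) * (\<alpha> ^ (m - j) * \<beta> ^ j))"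
  proof (intro sum_mono mult_left_mono holder_power insert.hyps assms(2))
    show "E I (\<lambda>x. ((A x)\<^sup>2) ^ m) \<le> \<alpha> ^ m"
      using insert.IH[of w] by (simp add: A_def \<alpha>_def power_mult)
    show "E I (\<lambda>x. ((B x)\<^sup>2) ^ m) \<le> \<beta> ^ m"
      using insert.IH[of "\<lambda>S. w (insert a S)"] by (simp add: B_def \<beta>_def power_mult)
  qed (auto simp: \<alpha>_def \<beta>_def intro!: sum_nonneg)
  also have "\<dots> = (\<beta> + \<alpha>) ^ m"
    unfolding binomial_ring by (intro sum.cong) (auto simp: mult_ac)
  also have "\<beta> + \<alpha> = (\<Sum>S\<in>Pow (insert a I). (w S)\<^sup>2)"
    unfolding split \<alpha>_def \<beta>_def by simp
  finally show ?case .
qed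

section \<open>Messages along a chain of kernels\<close>

text \<open>Convolution with the normalized indicator of the subcube on which \<open>z\<close>
  agrees with \<open>a\<close> on \<open>T\<close>. On the Fourier side it keeps the sets inside
  \<open>T\<close> and twists them by \<open>chi S a\<close>.\<close>

definition Z :: "'i set \<Rightarrow> 'i set \<Rightarrow> ('i \<Rightarrow> real) \<Rightarrow> (('i \<Rightarrow> real) \<Rightarrow> real) \<Rightarrow> ('i \<Rightarrow> real) \<Rightarrow> real" where
  "Z I T a v b = E I (\<lambda>z. (\<Prod>i\<in>T. 1 + a i * z i) * v (mul I b z))"

definition Qop :: "'i set \<Rightarrow> (('i \<Rightarrow> real) \<Rightarrow> ('i \<Rightarrow> real) \<Rightarrow> real) \<Rightarrow> (('i \<Rightarrow> real) \<Rightarrow> real) \<Rightarrow> ('i \<Rightarrow> real) \<Rightarrow> real" where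
  "Qop I q v a = E I (\<lambda>b. q a b * v b)"

text \<open>\<open>Kc\<close> holds the Fourier coefficients of the kernel \<open>q\<close>. The last clause says that \<open>q\<close> behaves like
  the noise operator with parameter \<open>\<eta>\<close> on functions of at most \<open>d\<close> coordinates on each side.\<close>

definition good where
  "good I q Kc d \<eta> \<longleftrightarrow> finite I \<and> 0 < \<eta> \<and>
     (\<forall>a\<in>sgns I. \<forall>b\<in>sgns I. 0 \<le> q a b \<and> q a b = (\<Sum>S\<in>Pow I. \<Sum>S'\<in>Pow I. Kc S S' * chi S a * chi S' b)) \<and>
     (\<forall>S\<in>Pow I. Kc S {} = (if S = {} then 1 else 0) \<and> Kc {} S = (if S = {} then 1 else 0)) \<and>
     (\<forall>T T' u v. T \<subseteq> I \<longrightarrow> T' \<subseteq> I \<longrightarrow> card T \<le> d \<longrightarrow> card T' \<le> d \<longrightarrow>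
        (\<Sum>S\<in>Pow T. \<Sum>S'\<in>Pow T'. u S * v S' * Kc S S')
          \<le> ((\<Sum>S\<in>Pow T. \<eta> ^ card S * (u S)\<^sup>2) + (\<Sum>S'\<in>Pow T'. \<eta> ^ card S' * (v S')\<^sup>2)) / (2::real))"

lemma good_fin: "good I q Kc d \<eta> \<Longrightarrow> finite I"
  unfolding good_def by (elim conjE)

lemma good_pos: "good I q Kc d \<eta> \<Longrightarrow> 0 < \<eta>"
  unfolding good_def by (elim conjE)

lemma good_nonneg:
  assumes "good I q Kc d \<eta>" "a \<in> sgns I" "b \<in> sgns I"
  shows "0 \<le> q a b"
proof -
  from assms(1) have "\<forall>a\<in>sgns I. \<forall>b\<in>sgns I. 0 \<le> q a b \<and> q a b = (\<Sum>S\<in>Pow I. \<Sum>S'\<in>Pow I. Kc S S' * chi S a * chi S' b)"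
    unfolding good_def by (elim conjE)
  then show ?thesis using assms(2,3) by blast
qed

lemma good_eq:
  assumes "good I q Kc d \<eta>" "a \<in> sgns I" "b \<in> sgns I"
  shows "q a b = (\<Sum>S\<in>Pow I. \<Sum>S'\<in>Pow I. Kc S S' * chi S a * chi S' b)"
proof -
  from assms(1) have "\<forall>a\<in>sgns I. \<forall>b\<in>sgns I. 0 \<le> q a b \<and> q a b = (\<Sum>S\<in>Pow I. \<Sum>S'\<in>Pow I. Kc S S' * chi S a * chi S' b)"
    unfolding good_def by (elim conjE)
  then show ?thesis using assms(2,3) by blast
qed

lemma good_K:
  assumes "good I q Kc d \<eta>" "S \<in> Pow I"
  shows "Kc S {} = (if S = {} then 1 else 0)" "Kc {} S = (if S = {} then 1 else 0)"
proof -
  from assms(1) have "\<forall>S\<in>Pow I. Kc S {} = (if S = {} then 1 else 0) \<and> Kc {} S = (if S = {} then 1 else 0)"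
    unfolding good_def by (elim conjE)
  then show "Kc S {} = (if S = {} then 1 else 0)" "Kc {} S = (if S = {} then 1 else 0)"
    using assms(2) by blast+
qed

lemma good_bil:
  assumes "good I q Kc d \<eta>" "T \<subseteq> I" "T' \<subseteq> I" "card T \<le> d" "card T' \<le> d"
  shows "(\<Sum>S\<in>Pow T. \<Sum>S'\<in>Pow T'. u S * v S' * Kc S S')
          \<le> ((\<Sum>S\<in>Pow T. \<eta> ^ card S * (u S)\<^sup>2) + (\<Sum>S'\<in>Pow T'. \<eta> ^ card S' * (v S')\<^sup>2)) / (2::real)"
  using assms unfolding good_def by blast

lemma good_transpose:
  assumes "good I q Kc d \<eta>"
  shows "good I (\<lambda>a b. q b a) (\<lambda>S S'. Kc S' S) d \<eta>"
proof -
  have f: "finite I" by (rule good_fin[OF assms])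
  have 1: "0 \<le> q b a \<and> q b a = (\<Sum>S\<in>Pow I. \<Sum>S'\<in>Pow I. Kc S' S * chi S a * chi S' b)"
    if "a \<in> sgns I" "b \<in> sgns I" for a b
  proof -
    have 1: "q b a = (\<Sum>S\<in>Pow I. \<Sum>S'\<in>Pow I. Kc S S' * chi S b * chi S' a)" and 2: "0 \<le> q b a"
      using good_eq[OF assms that(2,1)] good_nonneg[OF assms that(2,1)] by simp_all
    have "(\<Sum>S\<in>Pow I. \<Sum>S'\<in>Pow I. Kc S S' * chi S b * chi S' a) = (\<Sum>S\<in>Pow I. \<Sum>S'\<in>Pow I. Kc S' S * chi S a * chi S' b)"
      by (subst sum.swap) (simp only: mult.assoc mult.commute[of "chi _ a"])
    with 1 2 show ?thesis by simp
  qed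
  have 2: "(\<Sum>S\<in>Pow T. \<Sum>S'\<in>Pow T'. u S * v S' * Kc S' S)
          \<le> ((\<Sum>S\<in>Pow T. \<eta> ^ card S * (u S)\<^sup>2) + (\<Sum>S'\<in>Pow T'. \<eta> ^ card S' * (v S')\<^sup>2)) / 2"
    if "T \<subseteq> I" "T' \<subseteq> I" "card T \<le> d" "card T' \<le> d" for T T' u v
  proof -
    have "(\<Sum>S\<in>Pow T'. \<Sum>S'\<in>Pow T. v S * u S' * Kc S S')
          \<le> ((\<Sum>S\<in>Pow T'. \<eta> ^ card S * (v S)\<^sup>2) + (\<Sum>S'\<in>Pow T. \<eta> ^ card S' * (u S')\<^sup>2)) / 2"
      using good_bil[OF assms that(2,1,4,3)] by simp
    then show ?thesis by (subst sum.swap) (simp add: mult_ac add.commute)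
  qed
  have 3: "Kc {} S = (if S = {} then 1 else 0) \<and> Kc S {} = (if S = {} then 1 else 0)" if "S \<in> Pow I" for S
    using good_K[OF assms that] by simp
  show ?thesis unfolding good_def
    using f good_pos[OF assms] 1 2 3 by (intro conjI ballI allI impI) blast+
qed

text \<open>Operators given by a stochastic matrix. Positivity and Jensen's inequality for the
  propagation of messages come from this representation.\<close>

definition markov :: "'i set \<Rightarrow> ((('i \<Rightarrow> real) \<Rightarrow> real) \<Rightarrow> ('i \<Rightarrow> real) \<Rightarrow> real) \<Rightarrow> bool" where
  "markov I P \<longleftrightarrow> (\<exists>p. (\<forall>x\<in>sgns I. \<forall>y\<in>sgns I. 0 \<le> p x y) \<and> (\<forall>x\<in>sgns I. (\<Sum>y\<in>sgns I. p x y) = 1) \<and>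
      (\<forall>v. \<forall>x\<in>sgns I. P v x = (\<Sum>y\<in>sgns I. p x y * v y)))"

lemma markov_nonneg:
  assumes "markov I P" "x \<in> sgns I" "\<And>y. y \<in> sgns I \<Longrightarrow> 0 \<le> v y"
  shows "0 \<le> P v x"
proof -
  from assms(1) obtain p where "\<And>x y. x \<in> sgns I \<Longrightarrow> y \<in> sgns I \<Longrightarrow> 0 \<le> p x y"
     "\<And>v x. x \<in> sgns I \<Longrightarrow> P v x = (\<Sum>y\<in>sgns I. p x y * v y)" unfolding markov_def by blast
  then show ?thesis using assms(2,3) by (auto intro!: sum_nonneg mult_nonneg_nonneg)
qed

lemma markov_jensen:
  assumes "finite I" "markov I P" "x \<in> sgns I" "\<And>y. y \<in> sgns I \<Longrightarrow> 0 \<le> v y"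
  shows "(P v x) ^ k \<le> P (\<lambda>y. v y ^ k) x"
proof -
  from assms(2) obtain p where p: "\<And>x y. x \<in> sgns I \<Longrightarrow> y \<in> sgns I \<Longrightarrow> 0 \<le> p x y"
     "\<And>x. x \<in> sgns I \<Longrightarrow> (\<Sum>y\<in>sgns I. p x y) = 1"
     "\<And>v x. x \<in> sgns I \<Longrightarrow> P v x = (\<Sum>y\<in>sgns I. p x y * v y)" unfolding markov_def by blast
  have cv: "convex_on {0..} (\<lambda>t::real. t ^ k)"
    using convex_power_odd[of k] convex_on_subset[OF convex_power_even[of k], of "{0..}"] by (cases "even k") auto
  have "(\<Sum>y\<in>sgns I. p x y *\<^sub>R v y) ^ k \<le> (\<Sum>y\<in>sgns I. p x y * v y ^ k)"
    by (rule convex_on_sum[OF _ _ cv]) (use assms p in auto)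
  then show ?thesis using p(3)[OF assms(3)] by simp
qed

lemma markov_comp:
  assumes "markov I P" "markov I R"
  shows "markov I (\<lambda>v. P (R v))"
proof -
  from assms(1) obtain p where p: "\<And>x y. x \<in> sgns I \<Longrightarrow> y \<in> sgns I \<Longrightarrow> 0 \<le> p x y"
     "\<And>x. x \<in> sgns I \<Longrightarrow> (\<Sum>y\<in>sgns I. p x y) = 1"
     "\<And>v x. x \<in> sgns I \<Longrightarrow> P v x = (\<Sum>y\<in>sgns I. p x y * v y)" unfolding markov_def by blast
  from assms(2) obtain r where r: "\<And>x y. x \<in> sgns I \<Longrightarrow> y \<in> sgns I \<Longrightarrow> 0 \<le> r x y"
     "\<And>x. x \<in> sgns I \<Longrightarrow> (\<Sum>y\<in>sgns I. r x y) = 1"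
     "\<And>v x. x \<in> sgns I \<Longrightarrow> R v x = (\<Sum>y\<in>sgns I. r x y * v y)" unfolding markov_def by blast
  show ?thesis unfolding markov_def
  proof (intro exI[of _ "\<lambda>x y. \<Sum>w\<in>sgns I. p x w * r w y"] conjI ballI allI)
    show "0 \<le> (\<Sum>w\<in>sgns I. p x w * r w y)" if "x \<in> sgns I" "y \<in> sgns I" for x y
      using p r that by (intro sum_nonneg mult_nonneg_nonneg) auto
    show "(\<Sum>y\<in>sgns I. \<Sum>w\<in>sgns I. p x w * r w y) = 1" if "x \<in> sgns I" for x
      using p(2)[OF that] r(2) by (subst sum.swap) (simp add: sum_distrib_left[symmetric])
    show "P (R v) x = (\<Sum>y\<in>sgns I. (\<Sum>w\<in>sgns I. p x w * r w y) * v y)" if "x \<in> sgns I" for v x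
      unfolding p(3)[OF that] sum_distrib_right by (subst sum.swap) (simp add: r(3) sum_distrib_left mult_ac)
  qed
qed

lemma weight_eq: "finite T \<Longrightarrow> (\<Prod>i\<in>T. 1 + a i * z i) = (\<Sum>S\<in>Pow T. chi S a * chi S z)"
  by (simp add: prod_one_plus chi_def prod.distrib)

lemma weight_nonneg:
  assumes "T \<subseteq> I" "a \<in> sgns I" "z \<in> sgns I"
  shows "0 \<le> (\<Prod>i\<in>T. 1 + a i * z i)"
proof (rule prod_nonneg)
  fix i assume "i \<in> T"
  then have "i \<in> I" using assms by auto
  then show "0 \<le> 1 + a i * z i" using sgns_val[OF assms(2)] sgns_val[OF assms(3)] by fastforce
qed

lemma E_weight:
  assumes "finite I" "T \<subseteq> I"
  shows "E I (\<lambda>z. \<Prod>i\<in>T. 1 + a i * z i) = 1"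
proof -
  have T: "finite T" using assms finite_subset by auto
  have "E I (\<lambda>z. \<Prod>i\<in>T. 1 + a i * z i) = (\<Sum>S\<in>Pow T. chi S a * E I (\<lambda>z. chi S z * chi {} z))"
    unfolding weight_eq[OF T] E_sum E_cmult by simp
  also have "\<dots> = (\<Sum>S\<in>Pow T. if S = {} then chi S a else 0)"
    using assms by (intro sum.cong refl) (auto simp: E_chi_chi simp del: chi_empty)
  finally show ?thesis using T by simp
qed

lemma Z_fourier:
  assumes I: "finite I" and T: "T \<subseteq> I" and b: "b \<in> sgns I"
  shows "Z I T a v b = (\<Sum>S\<in>Pow T. chi S a * fc I v S * chi S b)"
proof -
  have fT: "finite T" using I T finite_subset by auto
  have "Z I T a v b = E I (\<lambda>z. \<Sum>S\<in>Pow T. \<Sum>S'\<in>Pow I. (chi S a * fc I v S' * chi S' b) * (chi S z * chi S' z))"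
    unfolding Z_def
  proof (intro E_cong)
    fix z assume z: "z \<in> sgns I"
    have "v (mul I b z) = (\<Sum>S'\<in>Pow I. fc I v S' * chi S' (mul I b z))"
      by (rule fourier[OF I mul_sgns[OF b z]])
    also have "\<dots> = (\<Sum>S'\<in>Pow I. fc I v S' * (chi S' b * chi S' z))"
      by (intro sum.cong) (auto simp: chi_mul)
    finally show "(\<Prod>i\<in>T. 1 + a i * z i) * v (mul I b z) = (\<Sum>S\<in>Pow T. \<Sum>S'\<in>Pow I. (chi S a * fc I v S' * chi S' b) * (chi S z * chi S' z))"
      unfolding weight_eq[OF fT] by (simp add: sum_product mult_ac)
  qed
  also have "\<dots> = (\<Sum>S\<in>Pow T. \<Sum>S'\<in>Pow I. (chi S a * fc I v S' * chi S' b) * (if S = S' then 1 else 0))"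
    unfolding E_sum E_cmult using I T by (intro sum.cong refl) (auto simp: E_chi_chi)
  also have "\<dots> = (\<Sum>S\<in>Pow T. \<Sum>S'\<in>Pow I. if S = S' then chi S a * fc I v S' * chi S' b else 0)"
    by (intro sum.cong refl) auto
  also have "\<dots> = (\<Sum>S\<in>Pow T. chi S a * fc I v S * chi S b)"
    using I T by (intro sum.cong refl) auto
  finally show ?thesis .
qed

lemma sum_Pow_subset:
  assumes "finite I" "T \<subseteq> I"
  shows "(\<Sum>S\<in>Pow I. if S \<subseteq> T then h S else 0) = (\<Sum>S\<in>Pow T. h S :: real)"
  using assms by (intro sum.mono_neutral_cong_right) auto

lemma fc_Z:
  assumes I: "finite I" and T: "T \<subseteq> I" and S: "S \<in> Pow I"
  shows "fc I (Z I T a v) S = (if S \<subseteq> T then chi S a * fc I v S else 0)"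
proof (rule fc_expand[OF I _ S])
  fix x assume "x \<in> sgns I"
  then show "Z I T a v x = (\<Sum>S\<in>Pow I. (if S \<subseteq> T then chi S a * fc I v S else 0) * chi S x)"
    using Z_fourier[OF I T, of x a v] sum_Pow_subset[OF I T, of "\<lambda>S. chi S a * fc I v S * chi S x"]
    by (simp add: if_distrib[of "\<lambda>t. t * _"] cong: if_cong)
qed

lemma fc_weight:
  assumes I: "finite I" and T: "T \<subseteq> I" and S: "S \<in> Pow I"
  shows "fc I (\<lambda>z. \<Prod>i\<in>T. 1 + a i * z i) S = (if S \<subseteq> T then chi S a else 0)"
proof (rule fc_expand[OF I _ S])
  fix x assume "x \<in> sgns I"
  have fT: "finite T" using I T finite_subset by auto
  show "(\<Prod>i\<in>T. 1 + a i * x i) = (\<Sum>S\<in>Pow I. (if S \<subseteq> T then chi S a else 0) * chi S x)"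
    unfolding weight_eq[OF fT] using sum_Pow_subset[OF I T, of "\<lambda>S. chi S a * chi S x"]
    by (simp add: if_distrib[of "\<lambda>t. t * _"] cong: if_cong)
qed

lemma fc_cong: "(\<And>x. x \<in> sgns I \<Longrightarrow> u x = v x) \<Longrightarrow> fc I u S = fc I v S"
  unfolding fc_def by (rule E_cong) simp

text \<open>\<open>Z\<close> is diagonal in the Fourier basis, with real multipliers.\<close>

lemma Z_self_adjoint:
  assumes I: "finite I" and T: "T \<subseteq> I"
  shows "E I (\<lambda>x. Z I T a u x * v x) = E I (\<lambda>x. u x * Z I T a v x)"
  unfolding parseval[OF I] by (intro sum.cong refl) (simp add: fc_Z[OF I T])

lemma Z_markov:
  assumes I: "finite I" and T: "T \<subseteq> I" and a: "a \<in> sgns I"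
  shows "markov I (Z I T a)"
proof -
  have eq: "Z I T a v b = E I (\<lambda>z. (\<Prod>i\<in>T. 1 + a i * mul I z b i) * v z)" if b: "b \<in> sgns I" for v b
  proof -
    have "Z I T a v b = E I (\<lambda>z. (\<Prod>i\<in>T. 1 + a i * mul I z b i) * v (mul I b (mul I z b)))"
      unfolding Z_def using E_shift[OF b, of "\<lambda>z. (\<Prod>i\<in>T. 1 + a i * z i) * v (mul I b z)"] by simp
    also have "\<dots> = E I (\<lambda>z. (\<Prod>i\<in>T. 1 + a i * mul I z b i) * v z)"
      using b by (intro E_cong) (metis mul_comm mul_mul)
    finally show ?thesis .
  qed
  show ?thesis unfolding markov_def
  proof (intro exI[of _ "\<lambda>b z. (\<Prod>i\<in>T. 1 + a i * mul I z b i) / 2 ^ card I"] conjI ballI allI)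
    show "0 \<le> (\<Prod>i\<in>T. 1 + a i * mul I y x i) / 2 ^ card I" if "x \<in> sgns I" "y \<in> sgns I" for x y
      using weight_nonneg[OF T a mul_sgns[OF that(2,1)]] by simp
    show "(\<Sum>y\<in>sgns I. (\<Prod>i\<in>T. 1 + a i * mul I y x i) / 2 ^ card I) = 1" if "x \<in> sgns I" for x
      using E_shift[OF that, of "\<lambda>z. \<Prod>i\<in>T. 1 + a i * z i"] E_weight[OF I T, of a]
      by (simp add: E_def sum_divide_distrib)
    show "Z I T a v x = (\<Sum>y\<in>sgns I. (\<Prod>i\<in>T. 1 + a i * mul I y x i) / 2 ^ card I * v y)" if "x \<in> sgns I" for v x
      unfolding eq[OF that] by (simp add: E_def sum_divide_distrib)
  qed
qed

lemma Q_fourier: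
  assumes g: "good I q Kc d \<eta>" and a: "a \<in> sgns I"
  shows "Qop I q v a = (\<Sum>S\<in>Pow I. (\<Sum>S'\<in>Pow I. Kc S S' * fc I v S') * chi S a)"
proof -
  have "Qop I q v a = E I (\<lambda>b. \<Sum>S\<in>Pow I. \<Sum>S'\<in>Pow I. (Kc S S' * chi S a) * (v b * chi S' b))"
    unfolding Qop_def using good_eq[OF g a]
    by (intro E_cong) (simp add: sum_distrib_right sum_distrib_left mult_ac)
  also have "\<dots> = (\<Sum>S\<in>Pow I. \<Sum>S'\<in>Pow I. (Kc S S' * chi S a) * fc I v S')"
    unfolding E_sum E_cmult fc_def ..
  finally show ?thesis by (simp add: sum_distrib_left mult_ac)
qed

lemma fc_Q:
  assumes g: "good I q Kc d \<eta>" and S: "S \<in> Pow I"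
  shows "fc I (Qop I q v) S = (\<Sum>S'\<in>Pow I. Kc S S' * fc I v S')"
  by (rule fc_expand[OF good_fin[OF g] Q_fourier[OF g] S])

lemma Q_markov:
  assumes g: "good I q Kc d \<eta>"
  shows "markov I (Qop I q)"
  unfolding markov_def
proof (intro exI[of _ "\<lambda>x y. q x y / 2 ^ card I"] conjI ballI allI)
  have I: "finite I" by (rule good_fin[OF g])
  show "0 \<le> q x y / 2 ^ card I" if "x \<in> sgns I" "y \<in> sgns I" for x y
    using good_nonneg[OF g that] by simp
  show "(\<Sum>y\<in>sgns I. q x y / 2 ^ card I) = 1" if x: "x \<in> sgns I" for x
  proof -
    have f1: "fc I (\<lambda>_. 1) S = (if S = {} then 1 else 0)" if "S \<in> Pow I" for S
      using E_chi_chi[OF I, of "{}" S] that by (auto simp: fc_def)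
    have "(\<Sum>y\<in>sgns I. q x y / 2 ^ card I) = Qop I q (\<lambda>_. 1) x"
      by (simp add: Qop_def E_def sum_divide_distrib)
    also have "\<dots> = (\<Sum>S\<in>Pow I. (\<Sum>S'\<in>Pow I. if S' = {} then Kc S {} else 0) * chi S x)"
      unfolding Q_fourier[OF g x] using f1 by (intro sum.cong arg_cong2[where f=times] refl) auto
    also have "\<dots> = (\<Sum>S\<in>Pow I. if S = {} then 1 else 0)"
      using good_K(1)[OF g] I by (intro sum.cong refl) auto
    finally show ?thesis using I by simp
  qed
  show "Qop I q v x = (\<Sum>y\<in>sgns I. q x y / 2 ^ card I * v y)" if "x \<in> sgns I" for v x
    by (simp add: Qop_def E_def sum_divide_distrib)
qed

lemma Q_adjoint: "E I (\<lambda>x. Qop I q u x * v x) = E I (\<lambda>x. u x * Qop I (\<lambda>a b. q b a) v x)"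
proof -
  have "E I (\<lambda>x. Qop I q u x * v x) = E I (\<lambda>x. E I (\<lambda>y. q x y * u y * v x))"
    by (simp add: Qop_def E_multc)
  also have "\<dots> = E I (\<lambda>y. E I (\<lambda>x. q x y * u y * v x))" by (rule E_swap)
  also have "\<dots> = E I (\<lambda>x. u x * Qop I (\<lambda>a b. q b a) v x)"
    unfolding Qop_def E_cmult[symmetric] by (simp add: mult_ac)
  finally show ?thesis .
qed

text \<open>The two restrictions cut the kernel down to coefficients on subsets of \<open>T\<close>
  and \<open>T'\<close>, where the last clause of \<open>good\<close> applies. It bounds the output
  coefficients with weights \<open>1 / \<eta> ^ card S\<close>, which is what Bonami's inequality
  with \<open>\<rho> = sqrt \<eta>\<close> takes as input.\<close>

lemma hyper:
  assumes g: "good I q Kc d \<eta>" and T: "T \<subseteq> I" "card T \<le> d" "T' \<subseteq> I" "card T' \<le> d"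
    and a: "a \<in> sgns I" "a' \<in> sgns I" and m: "m > 0" "2 * real m * \<eta> \<le> 1"
  shows "E I (\<lambda>x. Z I T a (Qop I q (Z I T' a' v)) x ^ (2*m)) \<le> (E I (\<lambda>x. (v x)\<^sup>2)) ^ m"
proof -
  have I: "finite I" and \<eta>: "\<eta> > 0" by (rule good_fin[OF g], rule good_pos[OF g])
  define f where "f S' = chi S' a' * fc I v S'" for S'
  define c where "c S = (\<Sum>S'\<in>Pow T'. Kc S S' * f S')" for S
  define \<rho> where "\<rho> = sqrt \<eta>"
  have \<rho>: "\<rho> > 0" "\<rho>\<^sup>2 = \<eta>" using \<eta> by (auto simp: \<rho>_def)
  define w where "w S = (if S \<subseteq> T then chi S a * c S / \<rho> ^ card S else 0)" for S
  have fcQ: "fc I (Qop I q (Z I T' a' v)) S = c S" if "S \<in> Pow I" for S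
  proof -
    have "fc I (Qop I q (Z I T' a' v)) S = (\<Sum>S'\<in>Pow I. if S' \<subseteq> T' then Kc S S' * f S' else 0)"
      unfolding fc_Q[OF g that] using fc_Z[OF I T(3)] by (intro sum.cong refl) (auto simp: f_def)
    then show ?thesis unfolding c_def sum_Pow_subset[OF I T(3)] .
  qed
  have "E I (\<lambda>x. Z I T a (Qop I q (Z I T' a' v)) x ^ (2*m)) = E I (\<lambda>x. (\<Sum>S\<in>Pow I. \<rho> ^ card S * w S * chi S x) ^ (2*m))"
  proof (intro E_cong arg_cong[where f="\<lambda>t. t ^ _"])
    fix x assume x: "x \<in> sgns I"
    have "Z I T a (Qop I q (Z I T' a' v)) x = (\<Sum>S\<in>Pow T. chi S a * c S * chi S x)"
      unfolding Z_fourier[OF I T(1) x] using T fcQ by (intro sum.cong refl) auto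
    also have "\<dots> = (\<Sum>S\<in>Pow I. if S \<subseteq> T then chi S a * c S * chi S x else 0)"
      by (rule sum_Pow_subset[OF I T(1), symmetric])
    also have "\<dots> = (\<Sum>S\<in>Pow I. \<rho> ^ card S * w S * chi S x)"
      using \<rho> by (intro sum.cong refl) (auto simp: w_def)
    finally show "Z I T a (Qop I q (Z I T' a' v)) x = (\<Sum>S\<in>Pow I. \<rho> ^ card S * w S * chi S x)" .
  qed
  also have "\<dots> \<le> (\<Sum>S\<in>Pow I. (w S)\<^sup>2) ^ m"
    using m \<rho> by (intro bonami I) auto
  also have "(\<Sum>S\<in>Pow I. (w S)\<^sup>2) = (\<Sum>S\<in>Pow I. if S \<subseteq> T then (c S)\<^sup>2 / \<eta> ^ card S else 0)"
  proof (intro sum.cong refl)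
    fix S assume "S \<in> Pow I"
    then have "(chi S a)\<^sup>2 = 1" using chi_sq[OF a(1)] by (auto simp: power2_eq_square)
    then show "(w S)\<^sup>2 = (if S \<subseteq> T then (c S)\<^sup>2 / \<eta> ^ card S else 0)"
      by (simp add: w_def power_divide power_mult_distrib \<rho>(2)[symmetric] power_mult[symmetric] mult.commute)
  qed
  also have "\<dots> = (\<Sum>S\<in>Pow T. (c S)\<^sup>2 / \<eta> ^ card S)" by (rule sum_Pow_subset[OF I T(1)])
  also have "\<dots> ^ m \<le> (E I (\<lambda>x. (v x)\<^sup>2)) ^ m"
  proof (intro power_mono)
    \<comment> \<open>Testing the bilinear bound with \<open>c S / \<eta> ^ card S\<close> puts
      \<open>?A\<close> on the left and half of it on the right, so \<open>?A\<close> is bounded by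
      the other half.\<close>
    let ?A = "\<Sum>S\<in>Pow T. (c S)\<^sup>2 / \<eta> ^ card S"
    have "?A = (\<Sum>S\<in>Pow T. \<Sum>S'\<in>Pow T'. (c S / \<eta> ^ card S) * f S' * Kc S S')"
      by (simp add: c_def power2_eq_square sum_distrib_left sum_divide_distrib mult_ac)
    also have "\<dots> \<le> ((\<Sum>S\<in>Pow T. \<eta> ^ card S * (c S / \<eta> ^ card S)\<^sup>2) + (\<Sum>S'\<in>Pow T'. \<eta> ^ card S' * (f S')\<^sup>2)) / 2"
      by (rule good_bil[OF g T(1,3,2,4)])
    also have "(\<Sum>S\<in>Pow T. \<eta> ^ card S * (c S / \<eta> ^ card S)\<^sup>2) = ?A"
      using \<eta> by (intro sum.cong refl) (simp add: power_divide power2_eq_square)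
    finally have "?A \<le> (\<Sum>S'\<in>Pow T'. \<eta> ^ card S' * (f S')\<^sup>2)" by simp
    also have "\<dots> \<le> (\<Sum>S'\<in>Pow T'. (fc I v S')\<^sup>2)"
    proof (intro sum_mono)
      fix S' assume "S' \<in> Pow T'"
      then have "chi S' a' * chi S' a' = 1" using chi_sq[OF a(2)] T by auto
      then have "(f S')\<^sup>2 = (fc I v S')\<^sup>2" by (simp add: f_def power2_eq_square power_mult_distrib mult_ac) 
      moreover have "\<eta> \<le> 1"
      proof -
        have "1 * \<eta> \<le> 2 * real m * \<eta>" using m(1) \<eta> by (intro mult_right_mono) auto
        with m(2) show ?thesis by simp
      qed
      ultimately show "\<eta> ^ card S' * (f S')\<^sup>2 \<le> (fc I v S')\<^sup>2"
        using \<eta> by (simp add: mult_left_le_one_le power_le_one)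
    qed
    also have "\<dots> \<le> (\<Sum>S'\<in>Pow I. (fc I v S')\<^sup>2)"
      using I T by (intro sum_mono2) auto
    also have "\<dots> = E I (\<lambda>x. (v x)\<^sup>2)"
      using parseval[OF I, of v v] by (simp add: power2_eq_square)
    finally show "?A \<le> E I (\<lambda>x. (v x)\<^sup>2)" .
    show "0 \<le> ?A" using \<eta> by (intro sum_nonneg) auto
  qed
  finally show ?thesis .
qed

lemma markov_ZQ:
  assumes g: "good I q Kc d \<eta>" and T: "T \<subseteq> I" and a: "a \<in> sgns I"
  shows "markov I (\<lambda>v. Z I T a (Qop I q v))"
proof -
  have I: "finite I" by (rule good_fin[OF g])
  show ?thesis by (rule markov_comp[OF Z_markov[OF I T a] Q_markov[OF g]])
qed

lemma markov_ZQZ: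
  assumes g: "good I q Kc d \<eta>" and T: "T \<subseteq> I" "T' \<subseteq> I" and a: "a \<in> sgns I" "a' \<in> sgns I"
  shows "markov I (\<lambda>v. Z I T a (Qop I q (Z I T' a' v)))"
proof -
  have I: "finite I" by (rule good_fin[OF g])
  show ?thesis by (rule markov_comp[OF markov_ZQ[OF g T(1) a(1)] Z_markov[OF I T(2) a(2)]])
qed

text \<open>Jensen moves the power \<open>k\<close> inside the Markov operator, and
  \<open>hyper\<close> is applied to the k-th power of \<open>v\<close>. So the exponent that is
  controlled grows from \<open>2 * k\<close> to \<open>2 * m * k\<close> at every use.\<close>

lemma hyper_step:
  assumes g: "good I q Kc d \<eta>" and T: "T \<subseteq> I" "card T \<le> d" "T' \<subseteq> I" "card T' \<le> d"
    and a: "a \<in> sgns I" "a' \<in> sgns I" and m: "m > 0" "2 * real m * \<eta> \<le> 1"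
    and v: "\<And>x. x \<in> sgns I \<Longrightarrow> 0 \<le> v x"
  shows "E I (\<lambda>x. Z I T a (Qop I q (Z I T' a' v)) x ^ (2 * (m * k))) \<le> (E I (\<lambda>x. v x ^ (2 * k))) ^ m"
proof -
  have I: "finite I" by (rule good_fin[OF g])
  have mk: "markov I (\<lambda>v. Z I T a (Qop I q (Z I T' a' v)))"
    by (rule markov_ZQZ[OF g T(1,3) a])
  have "E I (\<lambda>x. Z I T a (Qop I q (Z I T' a' v)) x ^ (2 * (m * k)))
     \<le> E I (\<lambda>x. Z I T a (Qop I q (Z I T' a' (\<lambda>y. v y ^ k))) x ^ (2 * m))"
  proof (rule E_mono)
    fix x assume x: "x \<in> sgns I"
    have "Z I T a (Qop I q (Z I T' a' v)) x ^ (2 * (m * k)) = (Z I T a (Qop I q (Z I T' a' v)) x ^ k) ^ (2 * m)"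
      by (simp add: power_mult[symmetric] mult_ac)
    also have "\<dots> \<le> Z I T a (Qop I q (Z I T' a' (\<lambda>y. v y ^ k))) x ^ (2 * m)"
      using markov_jensen[OF I mk x v] markov_nonneg[OF mk x v] by (intro power_mono) auto
    finally show "Z I T a (Qop I q (Z I T' a' v)) x ^ (2 * (m * k)) \<le> Z I T a (Qop I q (Z I T' a' (\<lambda>y. v y ^ k))) x ^ (2 * m)" .
  qed
  also have "\<dots> \<le> (E I (\<lambda>x. (v x ^ k)\<^sup>2)) ^ m" by (rule hyper[OF g T a m])
  finally show ?thesis by (simp add: power_mult[symmetric] mult.commute)
qed

section \<open>Propagated messages and their second moments\<close>

text \<open>\<open>msg I p T a l\<close> is the forward message of belief propagation after the coordinates in \<open>T j\<close>,
  \<open>j \<le> l\<close>, have been fixed to \<open>a j\<close>, normalized so that without any fixing it is constantly 1.\<close>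

primrec msg where
  "msg I p T a 0 = (\<lambda>z. \<Prod>i\<in>T 0. 1 + a 0 i * z i)"
| "msg I p T a (Suc l) = Z I (T (Suc l)) (a (Suc l)) (Qop I p (msg I p T a l))"

lemma msg_nonneg:
  assumes g: "good I p Kc d \<eta>" and T: "\<And>j. j \<le> l \<Longrightarrow> T j \<subseteq> I" and a: "\<And>j. j \<le> l \<Longrightarrow> a j \<in> sgns I"
    and x: "x \<in> sgns I"
  shows "0 \<le> msg I p T a l x"
  using T a x
proof (induction l arbitrary: x)
  case 0
  then show ?case using weight_nonneg[of "T 0" I "a 0" x] by simp
next
  case (Suc l)
  have I: "finite I" by (rule good_fin[OF g])
  have mk: "markov I (\<lambda>v. Z I (T (Suc l)) (a (Suc l)) (Qop I p v))"
    by (rule markov_ZQ[OF g]) (use Suc.prems in auto)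
  show ?case unfolding msg.simps
    by (rule markov_nonneg[OF mk Suc.prems(3)]) (use Suc in auto)
qed

text \<open>The message of layer \<open>l\<close> has only Fourier sets inside \<open>T l\<close>,
  and with the all-ones vector \<open>Z\<close> has no twist, so it acts as the identity on it. This
  projection can thus be inserted anywhere to provide the second restriction that
  \<open>hyper\<close> requires.\<close>

lemma msg_proj:
  assumes I: "finite I" and T: "T l \<subseteq> I" and x: "x \<in> sgns I"
  shows "Z I (T l) (\<lambda>i\<in>I. 1) (msg I p T a l) x = msg I p T a l x"
proof -
  have one: "chi S (\<lambda>i\<in>I. 1::real) = 1" if "S \<subseteq> I" for S
    unfolding chi_def by (intro prod.neutral) (use that in auto)
  have fcm: "fc I (msg I p T a l) S = (if S \<subseteq> T l then fc I (msg I p T a l) S else 0)" if "S \<in> Pow I" for S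
    using fc_weight[OF I, of "T l" S "a 0"] fc_Z[OF I, of "T l" S "a l"] that T by (cases l) auto
  have "Z I (T l) (\<lambda>i\<in>I. 1) (msg I p T a l) x = (\<Sum>S\<in>Pow (T l). fc I (msg I p T a l) S * chi S x)"
    unfolding Z_fourier[OF I T x] using T one by (intro sum.cong refl) auto
  also have "\<dots> = (\<Sum>S\<in>Pow I. if S \<subseteq> T l then fc I (msg I p T a l) S * chi S x else 0)"
    by (rule sum_Pow_subset[OF I T, symmetric])
  also have "\<dots> = (\<Sum>S\<in>Pow I. fc I (msg I p T a l) S * chi S x)"
  proof (rule sum.cong[OF refl])
    fix S assume "S \<in> Pow I"
    then show "(if S \<subseteq> T l then fc I (msg I p T a l) S * chi S x else 0) = fc I (msg I p T a l) S * chi S x"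
      using fcm[of S] by (cases "S \<subseteq> T l") simp_all
  qed
  also have "\<dots> = msg I p T a l x" by (rule fourier[OF I x, symmetric])
  finally show ?thesis .
qed

lemma one_sgns: "(\<lambda>i\<in>I. 1) \<in> sgns I"
  by (auto simp: sgns_def)

lemma E_msg:
  assumes g: "good I p Kc d \<eta>" and T: "\<And>j. j \<le> l \<Longrightarrow> T j \<subseteq> I"
  shows "E I (msg I p T a l) = 1"
  using T
proof (induction l)
  case 0
  have I: "finite I" by (rule good_fin[OF g])
  show ?case using E_weight[OF I, of "T 0" "a 0"] 0 by simp
next
  case (Suc l)
  have I: "finite I" by (rule good_fin[OF g])
  have "E I (msg I p T a (Suc l)) = fc I (msg I p T a (Suc l)) {}" by (simp add: fc_empty)
  also have "\<dots> = (\<Sum>S'\<in>Pow I. Kc {} S' * fc I (msg I p T a l) S')"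
    using Suc.prems by (simp add: fc_Z[OF I] fc_Q[OF g])
  also have "\<dots> = (\<Sum>S'\<in>Pow I. if S' = {} then fc I (msg I p T a l) {} else 0)"
    using good_K(2)[OF g] by (intro sum.cong refl) auto
  also have "\<dots> = 1" using I Suc by (simp add: fc_empty)
  finally show ?case .
qed

text \<open>The squared norm \<open>X\<close> of the last message equals the pairing of the message of layer \<open>h - j\<close> with \<open>w j\<close>,
  the adjoint propagation through \<open>j\<close> layers, each of which multiplies the exponent of the controlled
  moment by \<open>m\<close>. At layer 0 only the trivial bound \<open>2 ^ d\<close> on the weight is lost, so
  \<open>X ^ (2 * m ^ h) \<le> 2 ^ d * X ^ m ^ h\<close>.\<close>

theorem msg_bound:
  assumes g: "good I p Kc d \<eta>" and T: "\<And>j. j \<le> h \<Longrightarrow> T j \<subseteq> I" "\<And>j. j \<le> h \<Longrightarrow> card (T j) \<le> d"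
    and a: "\<And>j. j \<le> h \<Longrightarrow> a j \<in> sgns I" and m: "m > 0" "2 * real m * \<eta> \<le> 1"
  shows "(E I (\<lambda>x. (msg I p T a h x)\<^sup>2)) ^ (m ^ h) \<le> 2 ^ d"
proof -
  have I: "finite I" by (rule good_fin[OF g])
  let ?u = "msg I p T a"
  let ?one = "\<lambda>i\<in>I. 1::real"
  define pt where "pt = (\<lambda>a b. p b a)"
  have gt: "good I pt (\<lambda>S S'. Kc S' S) d \<eta>" unfolding pt_def by (rule good_transpose[OF g])
  define X where "X = E I (\<lambda>x. (?u h x)\<^sup>2)"
  \<comment> \<open>Every layer is restricted on both sides: by the weight \<open>a (h - j)\<close>
    of the layer that is left and by the inserted projection of the layer that is entered.\<close>
  define w where "w = rec_nat (?u h) (\<lambda>j v. Z I (T (h - Suc j)) ?one (Qop I pt (Z I (T (h - j)) (a (h - j)) v)))"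
  have w0: "w 0 = ?u h" and wS: "w (Suc j) = Z I (T (h - Suc j)) ?one (Qop I pt (Z I (T (h - j)) (a (h - j)) (w j)))" for j
    by (simp_all add: w_def)
  have wnn: "0 \<le> w j x" if "j \<le> h" "x \<in> sgns I" for j x
    using that
  proof (induction j arbitrary: x)
    case 0
    show ?case unfolding w0 by (rule msg_nonneg[OF g]) (use T(1) a 0 in auto)
  next
    case (Suc j)
    have mk: "markov I (\<lambda>v. Z I (T (h - Suc j)) ?one (Qop I pt (Z I (T (h - j)) (a (h - j)) v)))"
      by (rule markov_ZQZ[OF gt]) (use T(1) a one_sgns in auto)
    show ?case unfolding wS by (rule markov_nonneg[OF mk Suc.prems(2)]) (use Suc in auto)
  qed
  have inner: "E I (\<lambda>x. ?u (h - j) x * w j x) = X" if "j \<le> h" for j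
    using that
  proof (induction j)
    case 0
    then show ?case by (simp add: w0 X_def power2_eq_square)
  next
    case (Suc j)
    then obtain l where l: "h - j = Suc l" by (metis Suc_diff_Suc Suc_le_lessD)
    then have l': "h - Suc j = l" by simp
    have "X = E I (\<lambda>x. ?u (Suc l) x * w j x)" using Suc l by simp
    also have "\<dots> = E I (\<lambda>x. Qop I p (?u l) x * Z I (T (Suc l)) (a (Suc l)) (w j) x)"
      using Suc.prems l T(1)[of "Suc l"] by (simp add: Z_self_adjoint[OF I])
    also have "\<dots> = E I (\<lambda>x. ?u l x * Qop I pt (Z I (T (Suc l)) (a (Suc l)) (w j)) x)"
      unfolding pt_def by (rule Q_adjoint)
    also have "\<dots> = E I (\<lambda>x. Z I (T l) ?one (?u l) x * Qop I pt (Z I (T (Suc l)) (a (Suc l)) (w j)) x)"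
      using l msg_proj[where T=T and p=p and a=a and l=l, OF I T(1)] by (intro E_cong) simp
    also have "\<dots> = E I (\<lambda>x. ?u l x * w (Suc j) x)"
      unfolding wS l l' using l by (intro Z_self_adjoint[OF I] T) simp
    finally show ?case by (simp add: l')
  qed
  have mom: "E I (\<lambda>x. w j x ^ (2 * m ^ j)) \<le> X ^ (m ^ j)" if "j \<le> h" for j
    using that
  proof (induction j)
    case 0
    then show ?case by (simp add: w0 X_def)
  next
    case (Suc j)
    have "E I (\<lambda>x. w (Suc j) x ^ (2 * m ^ Suc j)) \<le> (E I (\<lambda>x. w j x ^ (2 * m ^ j))) ^ m"
      unfolding wS power_Suc using Suc.prems
      by (intro hyper_step[OF gt] T a one_sgns m wnn) auto
    also have "\<dots> \<le> (X ^ (m ^ j)) ^ m"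
      using Suc wnn by (intro power_mono E_nonneg) auto
    finally show ?case by (simp add: power_mult[symmetric] mult.commute)
  qed
  let ?M = "m ^ h"
  have Z0: "markov I (Z I (T 0) (a 0))" using T a by (intro Z_markov I) auto
  \<comment> \<open>As the value of a Markov operator at the all-ones point, \<open>X\<close> is an
    average of \<open>w h\<close>, which opens the way to Jensen's inequality.\<close>
  have X_eq: "X = Z I (T 0) (a 0) (w h) ?one"
  proof -
    have "X = E I (\<lambda>x. ?u 0 x * w h x)" using inner[of h] by simp
    also have "\<dots> = Z I (T 0) (a 0) (w h) ?one"
      unfolding Z_def
    proof (intro E_cong)
      fix z assume "z \<in> sgns I"
      have "mul I ?one z = z" using \<open>z \<in> sgns I\<close> by (auto simp: mul_def sgns_def fun_eq_iff PiE_def extensional_def)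
      then show "?u 0 z * w h z = (\<Prod>i\<in>T 0. 1 + a 0 i * z i) * w h (mul I ?one z)" by simp
    qed
    finally show ?thesis .
  qed
  have "X ^ (2 * ?M) \<le> Z I (T 0) (a 0) (\<lambda>y. w h y ^ (2 * ?M)) ?one"
    unfolding X_eq by (rule markov_jensen[OF I Z0 one_sgns]) (use wnn in auto)
  also have "\<dots> \<le> E I (\<lambda>z. 2 ^ d * (w h z ^ (2 * ?M)))"
    unfolding Z_def
  proof (rule E_mono)
    fix z assume z: "z \<in> sgns I"
    have mz: "mul I ?one z = z" using z by (auto simp: mul_def sgns_def fun_eq_iff PiE_def extensional_def)
    have "(\<Prod>i\<in>T 0. 1 + a 0 i * z i) \<le> (\<Prod>i\<in>T 0. 2)"
    proof (rule prod_mono)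
      fix i assume "i \<in> T 0"
      then have "i \<in> I" using T by auto
      then show "0 \<le> 1 + a 0 i * z i \<and> 1 + a 0 i * z i \<le> 2"
        using sgns_val[OF z] sgns_val[OF a[of 0]] by fastforce
    qed
    also have "\<dots> \<le> 2 ^ d" using T by (simp add: power_increasing)
    finally have "(\<Prod>i\<in>T 0. 1 + a 0 i * z i) \<le> 2 ^ d" .
    then show "(\<Prod>i\<in>T 0. 1 + a 0 i * z i) * w h (mul I ?one z) ^ (2 * ?M) \<le> 2 ^ d * w h z ^ (2 * ?M)"
      unfolding mz using wnn[of h z] z by (intro mult_right_mono) auto
  qed
  also have "\<dots> \<le> 2 ^ d * X ^ ?M"
    unfolding E_cmult using mom[of h] by (intro mult_left_mono) auto
  finally have "X ^ ?M * X ^ ?M \<le> 2 ^ d * X ^ ?M" by (simp add: mult_2 power_add)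
  moreover have "X \<ge> 0" unfolding X_def by (intro E_nonneg) auto
  moreover have "m ^ h > 0" using m by simp
  ultimately show ?thesis unfolding X_def[symmetric]
    by (cases "X = 0") (auto simp: power_0_left)
qed

text \<open>By Bernoulli \<open>(1 + 1 / k) ^ (d * k)\<close> is at least \<open>2 ^ d\<close>;
  since \<open>m ^ h\<close> exceeds \<open>d * k\<close>, a second moment above
  \<open>1 + 1 / k\<close> would violate \<open>msg_bound\<close>. The mean being 1, the distance
  from 1 is the second moment minus 1.\<close>

lemma msg_near_one:
  assumes g: "good I p Kc d \<eta>" and T: "\<And>j. j \<le> h \<Longrightarrow> T j \<subseteq> I" "\<And>j. j \<le> h \<Longrightarrow> card (T j) \<le> d"
    and a: "\<And>j. j \<le> h \<Longrightarrow> a j \<in> sgns I" and m: "m > 0" "2 * real m * \<eta> \<le> 1"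
    and k: "k > 0" "d * k < m ^ h"
  shows "E I (\<lambda>x. (msg I p T a h x - 1)\<^sup>2) \<le> 1 / real k"
proof -
  have I: "finite I" by (rule good_fin[OF g])
  let ?X = "E I (\<lambda>x. (msg I p T a h x)\<^sup>2)"
  have "?X \<le> 1 + 1 / real k"
  proof (rule ccontr)
    assume "\<not> ?thesis"
    then have gt: "?X > 1 + 1 / real k" by simp
    have "(2::real) \<le> (1 + 1 / real k) ^ k"
      using Bernoulli_inequality[of "1 / real k" k] k by (simp add: field_simps)
    then have "(2::real) ^ d \<le> ((1 + 1 / real k) ^ k) ^ d" by (intro power_mono) auto
    also have "\<dots> = (1 + 1 / real k) ^ (d * k)" by (simp add: power_mult[symmetric] mult.commute)
    also have "\<dots> < (1 + 1 / real k) ^ (m ^ h)" using k by (intro power_strict_increasing) auto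
    also have "\<dots> \<le> ?X ^ (m ^ h)" using gt k by (intro power_mono) auto
    also have "\<dots> \<le> 2 ^ d" by (rule msg_bound[OF g T a m])
    finally show False by simp
  qed
  moreover have "E I (\<lambda>x. (msg I p T a h x - 1)\<^sup>2) = ?X - 1"
  proof -
    have "E I (\<lambda>x. (msg I p T a h x - 1)\<^sup>2) = E I (\<lambda>x. (msg I p T a h x)\<^sup>2 - 2 * msg I p T a h x + 1)"
      by (simp add: power2_diff algebra_simps)
    also have "\<dots> = ?X - 2 * 1 + 1"
      unfolding E_add E_diff E_cmult E_const[OF I] using E_msg[OF g, of h T a] T(1) by simp
    finally show ?thesis by simp
  qed
  ultimately show ?thesis by simp
qed

text \<open>The forward and the backward message meet in the middle, where both are close to 1 in the 2-norm.\<close>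

theorem subcube_meet:
  fixes h :: nat
  assumes g: "good I q Kc d \<eta>" and T: "\<And>j. j \<le> 2 * h \<Longrightarrow> T j \<subseteq> I" "\<And>j. j \<le> 2 * h \<Longrightarrow> card (T j) \<le> d"
    and a: "\<And>j. j \<le> 2 * h \<Longrightarrow> a j \<in> sgns I" and m: "m > 0" "2 * real m * \<eta> \<le> 1"
    and k: "k > 0" "d * k < m ^ h" and h: "h > 0"
  shows "E I (\<lambda>x. (\<Prod>i\<in>T (2*h). 1 + a (2*h) i * x i) * Qop I (\<lambda>a b. q b a) (msg I (\<lambda>a b. q b a) T a (2*h - 1)) x) \<ge> 1 - 1 / real k"
proof -
  have I: "finite I" by (rule good_fin[OF g])
  define qt where "qt = (\<lambda>a b. q b a)"
  have gt: "good I qt (\<lambda>S S'. Kc S' S) d \<eta>" unfolding qt_def by (rule good_transpose[OF g])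
  have qtt: "(\<lambda>a b. qt b a) = q" by (simp add: qt_def)
  let ?f = "msg I qt T a"
  let ?r = "msg I q (\<lambda>j. T (2*h - j)) (\<lambda>j. a (2*h - j))"
  define L where "L = E I (\<lambda>x. Qop I qt (?f (2*h - 1)) x * ?r 0 x)"
  \<comment> \<open>Moving one layer at a time from the forward to the backward side by adjointness
    leaves the pairing unchanged.\<close>
  have meet: "E I (\<lambda>x. Qop I qt (?f (2*h - 1 - j)) x * ?r j x) = L" if "j \<le> 2*h - 1" for j
    using that
  proof (induction j)
    case 0
    then show ?case by (simp add: L_def)
  next
    case (Suc j)
    obtain l where l: "2*h - 1 - j = Suc l" using Suc.prems by (metis Suc_diff_Suc Suc_le_lessD)
    then have l': "2*h - 1 - Suc j = l" "2*h - Suc j = Suc l" by auto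
    have "L = E I (\<lambda>x. Z I (T (Suc l)) (a (Suc l)) (Qop I qt (?f l)) x * Qop I q (?r j) x)"
      using Suc l by (simp add: Q_adjoint[of I qt] qtt)
    also have "\<dots> = E I (\<lambda>x. Qop I qt (?f l) x * Z I (T (Suc l)) (a (Suc l)) (Qop I q (?r j)) x)"
      using l Suc.prems by (intro Z_self_adjoint[OF I] T) simp
    also have "\<dots> = E I (\<lambda>x. Qop I qt (?f (2*h - 1 - Suc j)) x * ?r (Suc j) x)"
      using l' by simp
    finally show ?case by simp
  qed
  obtain h' where h': "h = Suc h'" using h by (cases h) auto
  \<comment> \<open>The weight of the middle layer is already part of the forward message, so the
    backward message enters that layer through the plain projection onto \<open>T h\<close>.\<close>
  define a' where "a' j = (if j = h then \<lambda>i\<in>I. 1 else a (2*h - j))" for j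
  let ?r' = "msg I q (\<lambda>j. T (2*h - j)) a'"
  have rr: "?r' j = ?r j" if "j < h" for j
    using that by (induction j) (auto simp: a'_def)
  have "L = E I (\<lambda>x. Qop I qt (?f h) x * ?r h' x)"
    using meet[of h'] h' by simp
  also have "\<dots> = E I (\<lambda>x. ?f h x * Qop I q (?r h') x)"
    unfolding Q_adjoint[of I qt] qtt ..
  also have "\<dots> = E I (\<lambda>x. Z I (T h) (\<lambda>i\<in>I. 1) (?f h) x * Qop I q (?r h') x)"
    using msg_proj[where T=T and p=qt and a=a and l=h, OF I T(1)] by (intro E_cong) simp
  also have "\<dots> = E I (\<lambda>x. ?f h x * Z I (T h) (\<lambda>i\<in>I. 1) (Qop I q (?r h')) x)"
    by (intro Z_self_adjoint[OF I] T) simp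
  also have "\<dots> = E I (\<lambda>x. ?f h x * ?r' h x)"
    using rr[of h'] h' by (simp add: a'_def)
  finally have L: "L = E I (\<lambda>x. ?f h x * ?r' h x)" .
  have Ef: "E I (?f h) = 1" "E I (?r' h) = 1"
    using E_msg[OF gt, of h T a] E_msg[OF g, of h "\<lambda>j. T (2*h - j)" a'] T by auto
  have nf: "E I (\<lambda>x. (?f h x - 1)\<^sup>2) \<le> 1 / real k"
    by (rule msg_near_one[OF gt _ _ _ m k]) (use T a in auto)
  have nr: "E I (\<lambda>x. (?r' h x - 1)\<^sup>2) \<le> 1 / real k"
    by (rule msg_near_one[OF g _ _ _ m k]) (use T a one_sgns in \<open>auto simp: a'_def\<close>)
  \<comment> \<open>Integrates \<open>f * r \<ge> f + r - 1 - ((f - 1)\<^sup>2 + (r - 1)\<^sup>2) /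
    2\<close>, which is the nonnegativity of a square.\<close>
  have "1 - ((1 / real k) + (1 / real k)) / 2 \<le> 1 - (E I (\<lambda>x. (?f h x - 1)\<^sup>2) + E I (\<lambda>x. (?r' h x - 1)\<^sup>2)) / 2"
    using nf nr by simp
  also have "\<dots> = E I (\<lambda>x. ?f h x + ?r' h x - 1 - ((?f h x - 1)\<^sup>2 + (?r' h x - 1)\<^sup>2) * (1/2))"
    unfolding E_add E_diff E_multc E_const[OF I] Ef by simp
  also have "\<dots> \<le> E I (\<lambda>x. ?f h x * ?r' h x)"
  proof (rule E_mono)
    fix x
    have "0 \<le> ((?f h x - 1) + (?r' h x - 1))\<^sup>2" by simp
    then show "?f h x + ?r' h x - 1 - ((?f h x - 1)\<^sup>2 + (?r' h x - 1)\<^sup>2) * (1/2) \<le> ?f h x * ?r' h x"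
      by (simp add: power2_eq_square algebra_simps)
  qed
  finally have "1 - 1 / real k \<le> L" using L by simp
  then show ?thesis unfolding L_def by (simp add: qt_def mult.commute)
qed

section \<open>The density of the chain\<close>

text \<open>Positivity of \<open>q\<close> needs one Gaussian vector for all of \<open>I\<close>,
  for which \<open>M\<close> is dilated as a mere contraction. The bilinear bound uses a different
  dilation for each pair of small sets. Both compute the same coefficients, since these depend on
  the covariance alone.\<close>

lemma exists_good_kernel:
  fixes M :: "'i \<Rightarrow> 'i \<Rightarrow> real"
  assumes I: "finite I" and M1: "nrm_le I I M 1" and \<eta>: "0 < \<eta>" "\<eta> \<le> 1"
    and sub: "\<And>T T'. T \<subseteq> I \<Longrightarrow> T' \<subseteq> I \<Longrightarrow> card T \<le> d \<Longrightarrow> card T' \<le> d \<Longrightarrow> nrm_le T T' M \<eta>"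
  shows "\<exists>q. good I q (sin_kernel M) d \<eta>"
proof -
  obtain r :: "'i \<Rightarrow> 'i + 'i \<Rightarrow> real" where
    r: "\<And>j j'. j \<in> I \<Longrightarrow> j' \<in> I \<Longrightarrow> (\<Sum>k\<in>I <+> I. r j k * r j' k) = (if j = j' then 1 else 0)"
    and rM: "\<And>j i. j \<in> I \<Longrightarrow> i \<in> I \<Longrightarrow> r j (Inl i) = M i j / 1"
  proof -
    have "(0::real) < 1" by simp
    from exists_dilation[OF I I M1 this] show ?thesis using that by blast
  qed
  define D where "D = I <+> I"
  have finD: "finite D" using I by (simp add: D_def)
  define e :: "'i \<Rightarrow> 'i + 'i \<Rightarrow> real" where "e i k = (if k = Inl i then 1 else 0)" for i k
  have sum_e: "(\<Sum>k\<in>D. e i k * h k) = h (Inl i)" if "i \<in> I" for i and h :: "'i + 'i \<Rightarrow> real"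
  proof -
    have "(\<Sum>k\<in>D. e i k * h k) = (\<Sum>k\<in>D. if k = Inl i then h k else 0)"
      by (intro sum.cong) (auto simp: e_def)
    moreover have "Inl i \<in> D" using that by (auto simp: D_def)
    ultimately show ?thesis using finD by simp
  qed
  have orthe: "(\<Sum>k\<in>D. e i k * e i' k) = (if i = i' then 1 else 0)" if "i \<in> I" "i' \<in> I" for i i'
    using sum_e[OF that(1), of "e i'"] by (auto simp: e_def)
  have er: "(\<Sum>k\<in>D. e i k * r j k) = M i j" "(\<Sum>k\<in>D. r j k * e i k) = M i j" if "i \<in> I" "j \<in> I" for i j
    using sum_e[OF that(1), of "r j"] rM that by (simp_all add: mult.commute)
  define f where "f S g = (\<Prod>i\<in>S. sin (\<Sum>k\<in>D. 1 * e i k * g k))" for S and g :: "'i + 'i \<Rightarrow> real"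
  define f' where "f' S g = (\<Prod>j\<in>S. sin (\<Sum>k\<in>D. 1 * r j k * g k))" for S and g :: "'i + 'i \<Rightarrow> real"
  have meas: "f S \<in> borel_measurable (gauss D)" "f' S' \<in> borel_measurable (gauss D)" for S S'
    unfolding f_def[abs_def] f'_def[abs_def] by measurable
  have bnd: "\<bar>f S g\<bar> \<le> 1" "\<bar>f' S' g\<bar> \<le> 1" for S S' g
    unfolding f_def f'_def by (rule bounded_prod_sin)+
  have int: "integrable (gauss D) (\<lambda>g. f S g * f' U g)" for S U
    by (intro integrable_gauss_mult meas bnd)
  have KE: "sin_kernel M S S' = (\<integral>g. f S g * f' S' g \<partial>gauss D)" if S: "S \<in> Pow I" "S' \<in> Pow I" for S S'
  proof -
    have fS: "finite S" "finite S'" using S I finite_subset by auto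
    have ST: "\<And>i. i \<in> S \<Longrightarrow> i \<in> I" "\<And>j. j \<in> S' \<Longrightarrow> j \<in> I" using S by auto
    define q where "q w = (case w of Inl i \<Rightarrow> e i | Inr j \<Rightarrow> r j)" for w
    have "(\<integral>g. f S g * f' S' g \<partial>gauss D) = (\<integral>g. (\<Prod>w\<in>S <+> S'. sin (\<Sum>k\<in>D. q w k * g k)) \<partial>gauss D)"
      using fS by (simp add: prod.Plus f_def f'_def q_def o_def)
    also have "\<dots> = sin_moment (S <+> S') (\<lambda>w w'. \<Sum>k\<in>D. q w k * q w' k)"
      using fS finD by (intro integral_prod_sin) auto
    also have "\<dots> = sin_moment (S <+> S') (block_gram M)"
    proof (rule sin_moment_cong)
      fix w w' assume "w \<in> S <+> S'" "w' \<in> S <+> S'"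
      then show "(\<Sum>k\<in>D. q w k * q w' k) = block_gram M w w'"
        using orthe[OF ST(1) ST(1)] r[folded D_def, OF ST(2) ST(2)] er[OF ST(1) ST(2)]
        by (cases w; cases w') (auto simp: q_def block_gram_def)
    qed
    finally show ?thesis by (simp add: sin_kernel_def)
  qed
  define q where "q a b = (\<integral>g. (\<Prod>i\<in>I. 1 + a i * sin (\<Sum>k\<in>D. 1 * e i k * g k)) * (\<Prod>j\<in>I. 1 + b j * sin (\<Sum>k\<in>D. 1 * r j k * g k)) \<partial>gauss D)" for a b
  have q0: "0 \<le> q a b" if ab: "a \<in> sgns I" "b \<in> sgns I" for a b
  proof -
    have nn: "0 \<le> 1 + a i * sin t" "0 \<le> 1 + b i * sin t" if "i \<in> I" for i t
    proof -
      have "0 \<le> 1 + sin t" "0 \<le> 1 - sin t"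
        using sin_le_one[of t] sin_ge_minus_one[of t] by linarith+
      then show "0 \<le> 1 + a i * sin t" "0 \<le> 1 + b i * sin t"
        using sgns_val[OF ab(1) that] sgns_val[OF ab(2) that] by auto
    qed
    show ?thesis unfolding q_def
      by (intro Bochner_Integration.integral_nonneg mult_nonneg_nonneg prod_nonneg nn) auto
  qed
  have qK: "q a b = (\<Sum>S\<in>Pow I. \<Sum>S'\<in>Pow I. sin_kernel M S S' * chi S a * chi S' b)" for a b
  proof -
    have "q a b = (\<integral>g. (\<Sum>S\<in>Pow I. \<Sum>S'\<in>Pow I. (chi S a * chi S' b) * (f S g * f' S' g)) \<partial>gauss D)"
      unfolding q_def prod_one_plus[OF I] f_def f'_def chi_def prod.distrib sum_product
      by (simp only: mult.assoc mult.left_commute)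
    also have "\<dots> = (\<Sum>S\<in>Pow I. \<Sum>S'\<in>Pow I. (chi S a * chi S' b) * (\<integral>g. f S g * f' S' g \<partial>gauss D))"
      by (simp add: Bochner_Integration.integral_sum Bochner_Integration.integrable_sum int)
    also have "\<dots> = (\<Sum>S\<in>Pow I. \<Sum>S'\<in>Pow I. sin_kernel M S S' * chi S a * chi S' b)"
      using KE by (intro sum.cong refl) (simp add: mult_ac)
    finally show ?thesis .
  qed
  have K1: "sin_kernel M S {} = (if S = {} then 1 else 0)" if "S \<in> Pow I" for S
  proof -
    have "sin_kernel M S {} = (\<integral>g. f S g * (\<Prod>w\<in>{}. sin (\<Sum>k\<in>D. 1 * e w k * g k)) \<partial>gauss D)"
      using KE[OF that, of "{}"] by (simp add: f'_def)
    also have "\<dots> = (if S = {} then (\<integral>x. (sin (1 * x))\<^sup>2 \<partial>std_normal_distribution) ^ card S else 0)"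
      unfolding f_def using that I finD orthe by (intro orthonormal_sin_products[where X=I]) auto
    finally show ?thesis by auto
  qed
  have K2: "sin_kernel M {} S = (if S = {} then 1 else 0)" if "S \<in> Pow I" for S
  proof -
    have "sin_kernel M {} S = (\<integral>g. (\<Prod>w\<in>{}. sin (\<Sum>k\<in>D. 1 * r w k * g k)) * f' S g \<partial>gauss D)"
      using KE[OF _ that, of "{}"] by (simp add: f_def)
    also have "\<dots> = (if {} = S then (\<integral>x. (sin (1 * x))\<^sup>2 \<partial>std_normal_distribution) ^ card ({} :: 'i set) else 0)"
      unfolding f'_def using that I finD r[folded D_def] by (intro orthonormal_sin_products[where X=I]) auto
    finally show ?thesis by auto
  qed
  have bil: "(\<Sum>S\<in>Pow T. \<Sum>S'\<in>Pow T'. u S * v S' * sin_kernel M S S')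
          \<le> ((\<Sum>S\<in>Pow T. \<eta> ^ card S * (u S)\<^sup>2) + (\<Sum>S'\<in>Pow T'. \<eta> ^ card S' * (v S')\<^sup>2)) / (2::real)"
    if "T \<subseteq> I" "T' \<subseteq> I" "card T \<le> d" "card T' \<le> d" for T T' u v
    by (rule sin_kernel_bilinear[OF finite_subset[OF that(1) I] finite_subset[OF that(2) I] sub[OF that] \<eta>])
  have "good I q (sin_kernel M) d \<eta>"
    unfolding good_def using I \<eta>(1) q0 qK K1 K2 bil by (intro conjI ballI allI impI) blast+
  then show ?thesis by blast
qed

lemma sin_kernel_singletons: "sin_kernel M {i} {j} = exp (-1) * ((exp (M i j) - inverse (exp (M i j))) / 2)"
proof -
  let ?w = "Inl i" and ?w' = "Inr j"
  let ?h = "\<lambda>\<xi>. (\<Prod>w\<in>{?w, ?w'}. \<xi> w) * exp (- (\<Sum>w\<in>{?w, ?w'}. \<Sum>w'\<in>{?w, ?w'}. \<xi> w * \<xi> w' * block_gram M w w') / 2) :: real"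
  have W: "{i} <+> {j} = {?w, ?w'}" by auto
  have s: "(\<Sum>\<xi>\<in>sgns {?w, ?w'}. ?h \<xi>) = 4 * E (insert ?w (insert ?w' {})) ?h"
    by (simp add: E_def)
  also have "E (insert ?w (insert ?w' {})) ?h = (exp (- 1 - M i j) - exp (-1 + M i j)) / 2"
    by (simp add: sgns_insert_E, simp add: E_def sgns_def block_gram_def diff_divide_distrib add_divide_distrib)
  finally have "(\<Sum>\<xi>\<in>sgns {?w, ?w'}. ?h \<xi>) = 2 * (exp (- 1 - M i j) - exp (-1 + M i j))" by simp
  then have "sin_kernel M {i} {j} = Re ((- \<i> / 2) ^ 2 * complex_of_real (2 * (exp (- 1 - M i j) - exp (-1 + M i j))))"
    unfolding sin_kernel_def sin_moment_def W by (simp add: numeral_2_eq_2[symmetric])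
  also have "\<dots> = (exp (-1 + M i j) - exp (- 1 - M i j)) / 2"
    by (simp add: power_divide diff_divide_distrib)
  also have "\<dots> = exp (-1) * ((exp (M i j) - inverse (exp (M i j))) / 2)"
    by (simp add: exp_add exp_diff exp_minus field_simps)
  finally show ?thesis .
qed

text \<open>The coefficient is \<open>exp (-1)\<close> times the hyperbolic sine of
  \<open>M i j\<close>: it has the sign of \<open>M i j\<close> and at least the size of its linear
  term.\<close>

lemma sin_kernel_singletons_ge: "M i j * sin_kernel M {i} {j} \<ge> exp (-1) * (M i j)\<^sup>2"
proof -
  let ?s = "\<lambda>x::real. (exp x - inverse (exp x)) / 2"
  have "x * ?s x \<ge> x\<^sup>2" for x
  proof (cases "x \<ge> 0")
    case True
    then show ?thesis using real_le_x_sinh[of x] by (simp only: power2_eq_square) (intro mult_left_mono, auto)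
  next
    case False
    then have "- x \<le> ?s (- x)" using real_le_x_sinh[of "-x"] by simp
    then have "(-x) * (-x) \<le> (-x) * ?s (-x)" using False by (intro mult_left_mono) auto
    also have "\<dots> = x * ?s x" by (simp add: exp_minus algebra_simps)
    finally show ?thesis by (simp add: power2_eq_square)
  qed
  from this[of "M i j"] have "exp (-1) * (M i j)\<^sup>2 \<le> exp (-1) * (M i j * ?s (M i j))"
    by (intro mult_left_mono) auto
  then show ?thesis unfolding sin_kernel_singletons by (simp only: mult.left_commute)
qed

section \<open>The density on chains of sign vectors\<close>

definition EF :: "'i set \<Rightarrow> nat \<Rightarrow> ((nat \<Rightarrow> 'i \<Rightarrow> real) \<Rightarrow> real) \<Rightarrow> real" where
  "EF I L u = (\<Sum>z\<in>{..<L} \<rightarrow>\<^sub>E sgns I. u z) / (2 ^ card I) ^ L"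

lemma EF_0: "EF I 0 u = u (\<lambda>_. undefined)"
  by (simp add: EF_def)

lemma EF_Suc:
  assumes "finite I"
  shows "EF I (Suc L) u = E I (\<lambda>x. EF I L (\<lambda>z. u (z(L := x))))"
proof -
  have "{..<Suc L} \<rightarrow>\<^sub>E sgns I = insert L {..<L} \<rightarrow>\<^sub>E sgns I" by (simp add: lessThan_Suc)
  also have "\<dots> = (\<lambda>(y, g). g(L := y)) ` (sgns I \<times> ({..<L} \<rightarrow>\<^sub>E sgns I))"
    by (rule PiE_insert_eq)
  finally have *: "{..<Suc L} \<rightarrow>\<^sub>E sgns I = (\<lambda>(y, g). g(L := y)) ` (sgns I \<times> ({..<L} \<rightarrow>\<^sub>E sgns I))" .
  have "inj_on (\<lambda>(y, g). g(L := y)) (sgns I \<times> ({..<L} \<rightarrow>\<^sub>E sgns I))"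
    by (intro inj_combinator) auto
  then have "(\<Sum>z\<in>{..<Suc L} \<rightarrow>\<^sub>E sgns I. u z) = (\<Sum>(x, z)\<in>sgns I \<times> ({..<L} \<rightarrow>\<^sub>E sgns I). u (z(L := x)))"
    unfolding * by (simp add: sum.reindex case_prod_unfold)
  also have "\<dots> = (\<Sum>x\<in>sgns I. \<Sum>z\<in>{..<L} \<rightarrow>\<^sub>E sgns I. u (z(L := x)))"
    by (simp add: sum.cartesian_product)
  finally show ?thesis by (simp add: EF_def E_def sum_divide_distrib[symmetric] mult.commute)
qed

lemma EF_cong: "(\<And>z. z \<in> {..<L} \<rightarrow>\<^sub>E sgns I \<Longrightarrow> u z = v z) \<Longrightarrow> EF I L u = EF I L v"
  unfolding EF_def by (simp cong: sum.cong)

lemma EF_cmult: "EF I L (\<lambda>z. c * u z) = c * EF I L u"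
  by (simp add: EF_def sum_distrib_left)

lemma EF_add: "EF I L (\<lambda>z. u z + v z) = EF I L u + EF I L v"
  by (simp add: EF_def sum.distrib add_divide_distrib)

lemma EF_diff: "EF I L (\<lambda>z. u z - v z) = EF I L u - EF I L v"
  by (simp add: EF_def sum_subtractf diff_divide_distrib)

lemma EF_sum: "EF I L (\<lambda>z. \<Sum>a\<in>A. u a z) = (\<Sum>a\<in>A. EF I L (u a))"
  unfolding EF_def by (subst sum.swap) (simp add: sum_divide_distrib)

lemma EF_E_swap: "EF I L (\<lambda>z. E I (\<lambda>b. u z b)) = E I (\<lambda>b. EF I L (\<lambda>z. u z b))"
  unfolding EF_def E_def sum_divide_distrib by (subst sum.swap) (simp add: mult.commute)

lemma EF_prod:
  assumes "finite I"
  shows "EF I L (\<lambda>z. \<Prod>l<L. h l (z l)) = (\<Prod>l<L. E I (h l))"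
proof -
  have "(\<Sum>z\<in>{..<L} \<rightarrow>\<^sub>E sgns I. \<Prod>l<L. h l (z l)) = (\<Prod>l<L. \<Sum>x\<in>sgns I. h l x)"
    using assms by (subst prod_sum_PiE) auto
  then show ?thesis by (simp add: EF_def E_def prod_dividef)
qed

text \<open>The density is the average over hidden sign vectors b1, b2, ... of
  \<open>q (z 0) b1 * q (b1 * z 1) b2 * q (b2 * z 2) b3 * ...\<close>, and \<open>z k\<close> closes
  the chain in \<open>dens\<close>. An inner layer is thus the coordinatewise product of the two
  kernel ends that meet there.\<close>

primrec fwd where
  "fwd q I z 0 = (\<lambda>b. q (z (0::nat)) b)"
| "fwd q I z (Suc l) = (\<lambda>b. E I (\<lambda>b'. fwd q I z l b' * q (mul I b' (z (Suc l))) b))"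

definition dens where "dens q I k z = fwd q I z (k - 1) (z k)"

lemma fwd_cong: "(\<And>j. j \<le> l \<Longrightarrow> z j = z' j) \<Longrightarrow> fwd q I z l = fwd q I z' l"
proof (induction l)
  case (Suc l)
  then have "fwd q I z l = fwd q I z' l" "z (Suc l) = z' (Suc l)" by auto
  then show ?case by simp
qed simp

lemma fwd_nonneg:
  assumes g: "good I q Kc d \<eta>"
  shows "(\<And>j. j \<le> l \<Longrightarrow> z j \<in> sgns I) \<Longrightarrow> b \<in> sgns I \<Longrightarrow> 0 \<le> fwd q I z l b"
proof (induction l arbitrary: b)
  case 0
  then show ?case using good_nonneg[OF g] by simp
next
  case (Suc l b)
  show ?case unfolding fwd.simps
  proof (intro E_nonneg mult_nonneg_nonneg)
    fix x assume x: "x \<in> sgns I"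
    show "0 \<le> fwd q I z l x" using Suc x by auto
    show "0 \<le> q (mul I x (z (Suc l))) b"
      by (rule good_nonneg[OF g mul_sgns[OF x]]) (use Suc.prems in auto)
  qed
qed

text \<open>Arbitrary layer weights in place of the subcube weights of \<open>msg\<close>, so that
  subcubes and monomials are integrated against the density by one computation.\<close>

primrec gmsg where
  "gmsg I p \<omega> 0 = \<omega> (0::nat)"
| "gmsg I p \<omega> (Suc l) = (\<lambda>b. E I (\<lambda>z. \<omega> (Suc l) z * Qop I p (gmsg I p \<omega> l) (mul I b z)))"

lemma gmsg_msg: "gmsg I p (\<lambda>l z. \<Prod>i\<in>T l. 1 + a l i * z i) l = msg I p T a l"
proof (induction l)
  case (Suc l)
  show ?case unfolding gmsg.simps msg.simps Suc by (rule ext) (simp add: Z_def)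
qed simp

lemma fwd_weighted:
  assumes I: "finite I"
  shows "\<forall>b\<in>sgns I. EF I (Suc l) (\<lambda>z. (\<Prod>i<Suc l. \<omega> i (z i)) * fwd q I z l b) = Qop I (\<lambda>a b. q b a) (gmsg I (\<lambda>a b. q b a) \<omega> l) b"
proof (induction l)
  case 0
  then show ?case by (simp add: EF_Suc[OF I] EF_0 Qop_def mult.commute)
next
  case (Suc l)
  show ?case
  proof
  fix b assume b: "b \<in> sgns I"
  let ?qt = "\<lambda>a b. q b a"
  let ?h = "Qop I ?qt (gmsg I ?qt \<omega> l)"
  have "EF I (Suc (Suc l)) (\<lambda>z. (\<Prod>i<Suc (Suc l). \<omega> i (z i)) * fwd q I z (Suc l) b)
     = E I (\<lambda>x. EF I (Suc l) (\<lambda>z. E I (\<lambda>b'. (\<omega> (Suc l) x * q (mul I b' x) b) * ((\<Prod>i<Suc l. \<omega> i (z i)) * fwd q I z l b'))))"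
    unfolding EF_Suc[OF I, of "Suc l"]
  proof (intro E_cong EF_cong)
    fix x z
    have "fwd q I (z(Suc l := x)) l = fwd q I z l" by (rule fwd_cong) simp
    moreover have "(\<Prod>i<Suc (Suc l). \<omega> i ((z(Suc l := x)) i)) = \<omega> (Suc l) x * (\<Prod>i<Suc l. \<omega> i (z i))"
      by (simp add: lessThan_Suc mult.commute)
    ultimately show "(\<Prod>i<Suc (Suc l). \<omega> i ((z(Suc l := x)) i)) * fwd q I (z(Suc l := x)) (Suc l) b
       = E I (\<lambda>b'. (\<omega> (Suc l) x * q (mul I b' x) b) * ((\<Prod>i<Suc l. \<omega> i (z i)) * fwd q I z l b'))"
      unfolding fwd.simps E_cmult[symmetric] by (simp only: fun_upd_same mult_ac)
  qed
  also have "\<dots> = E I (\<lambda>x. E I (\<lambda>b'. (\<omega> (Suc l) x * q (mul I b' x) b) * ?h b'))"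
    unfolding EF_E_swap EF_cmult using Suc.IH by (intro E_cong) simp
  \<comment> \<open>The substitution \<open>c = b' * x\<close> turns the coordinatewise product
    inside the kernel into the convolution that defines \<open>gmsg\<close>.\<close>
  also have "\<dots> = E I (\<lambda>x. E I (\<lambda>c. (\<omega> (Suc l) x * q c b) * ?h (mul I c x)))"
  proof (rule E_cong)
    fix x assume x: "x \<in> sgns I"
    have "E I (\<lambda>b'. (\<omega> (Suc l) x * q (mul I b' x) b) * ?h b') = E I (\<lambda>c. (\<omega> (Suc l) x * q (mul I (mul I c x) x) b) * ?h (mul I c x))"
      by (rule E_shift[OF x, symmetric])
    also have "\<dots> = E I (\<lambda>c. (\<omega> (Suc l) x * q c b) * ?h (mul I c x))"
      using mul_mul[OF _ x] by (intro E_cong) simp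
    finally show "E I (\<lambda>b'. (\<omega> (Suc l) x * q (mul I b' x) b) * ?h b') = E I (\<lambda>c. (\<omega> (Suc l) x * q c b) * ?h (mul I c x))" .
  qed
  also have "\<dots> = E I (\<lambda>c. q c b * E I (\<lambda>x. \<omega> (Suc l) x * ?h (mul I c x)))"
    unfolding E_cmult[symmetric] by (subst E_swap) (simp only: mult_ac)
  also have "\<dots> = Qop I ?qt (gmsg I ?qt \<omega> (Suc l)) b"
    by (simp add: Qop_def)
  finally show "EF I (Suc (Suc l)) (\<lambda>z. (\<Prod>i<Suc (Suc l). \<omega> i (z i)) * fwd q I z (Suc l) b) = Qop I (\<lambda>a b. q b a) (gmsg I (\<lambda>a b. q b a) \<omega> (Suc l)) b" .
  qed
qed

theorem dens_weighted:
  assumes I: "finite I" and k: "k > 0"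
  shows "EF I (Suc k) (\<lambda>z. (\<Prod>i<Suc k. \<omega> i (z i)) * dens q I k z) = E I (\<lambda>x. \<omega> k x * Qop I (\<lambda>a b. q b a) (gmsg I (\<lambda>a b. q b a) \<omega> (k - 1)) x)"
proof -
  obtain l where l: "k = Suc l" using k by (cases k) auto
  have "EF I (Suc k) (\<lambda>z. (\<Prod>i<Suc k. \<omega> i (z i)) * dens q I k z)
     = E I (\<lambda>x. EF I k (\<lambda>z. \<omega> k x * ((\<Prod>i<k. \<omega> i (z i)) * fwd q I z l x)))"
    unfolding EF_Suc[OF I]
  proof (intro E_cong EF_cong)
    fix x z
    have "fwd q I (z(k := x)) l = fwd q I z l" by (rule fwd_cong) (simp add: l)
    moreover have "(\<Prod>i<Suc k. \<omega> i ((z(k := x)) i)) = \<omega> k x * (\<Prod>i<k. \<omega> i (z i))"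
      by (simp add: lessThan_Suc mult.commute)
    ultimately show "(\<Prod>i<Suc k. \<omega> i ((z(k := x)) i)) * dens q I k (z(k := x)) = \<omega> k x * ((\<Prod>i<k. \<omega> i (z i)) * fwd q I z l x)"
      by (simp add: dens_def l)
  qed
  also have "\<dots> = E I (\<lambda>x. \<omega> k x * Qop I (\<lambda>a b. q b a) (gmsg I (\<lambda>a b. q b a) \<omega> (k - 1)) x)"
    unfolding EF_cmult using fwd_weighted[OF I, where l=l and \<omega>=\<omega> and q=q] by (intro E_cong) (simp add: l)
  finally show ?thesis .
qed

lemma dens_nonneg:
  assumes "good I q Kc d \<eta>" "\<And>j. j \<le> k \<Longrightarrow> z j \<in> sgns I"
  shows "0 \<le> dens q I k z"
  unfolding dens_def using assms(2) by (intro fwd_nonneg[OF assms(1)]) auto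

theorem dens_subcube:
  assumes g: "good I q Kc d \<eta>" and T: "\<And>j. j \<le> 2 * h \<Longrightarrow> T j \<subseteq> I" "\<And>j. j \<le> 2 * h \<Longrightarrow> card (T j) \<le> d"
    and a: "\<And>j. j \<le> 2 * h \<Longrightarrow> a j \<in> sgns I" and m: "m > 0" "2 * real m * \<eta> \<le> 1"
    and k: "k > 0" "d * k < m ^ h" and h: "h > 0"
  shows "EF I (Suc (2*h)) (\<lambda>z. (\<Prod>l<Suc (2*h). \<Prod>i\<in>T l. 1 + a l i * z l i) * dens q I (2*h) z) \<ge> 1 - 1 / real k"
proof -
  have I: "finite I" by (rule good_fin[OF g])
  have "0 < 2 * h" using h by simp
  from dens_weighted[OF I this, of "\<lambda>l z. \<Prod>i\<in>T l. 1 + a l i * z i" q]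
  show ?thesis unfolding gmsg_msg
    using subcube_meet[OF g, of h T a m k] T a m k h by simp
qed

lemma fc_single: "finite I \<Longrightarrow> i \<in> I \<Longrightarrow> S \<in> Pow I \<Longrightarrow> fc I (\<lambda>x. c * x i) S = (if S = {i} then c else 0)"
proof -
  assume I: "finite I" "i \<in> I" "S \<in> Pow I"
  have "fc I (\<lambda>x. c * x i) S = c * E I (\<lambda>x. chi {i} x * chi S x)"
    by (simp add: fc_def chi_def E_cmult[symmetric] mult.assoc)
  then show ?thesis using E_chi_chi[of I "{i}" S] I by auto
qed

text \<open>With one coordinate as weight of every layer the message stays a multiple of a single
  character; each kernel only contributes its coefficient at the two singletons.\<close>

lemma gmsg_monomial:
  assumes g: "good I q Kc d \<eta>"
  shows "(\<And>j. j \<le> l \<Longrightarrow> i j \<in> I) \<Longrightarrow> b \<in> sgns I \<Longrightarrow>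
    gmsg I (\<lambda>a b. q b a) (\<lambda>l z. z (i l)) l b = (\<Prod>j<l. Kc {i j} {i (Suc j)}) * b (i l)"
proof (induction l arbitrary: b)
  case 0
  then show ?case by simp
next
  case (Suc l b)
  have I: "finite I" by (rule good_fin[OF g])
  let ?qt = "\<lambda>a b. q b a"
  have gt: "good I ?qt (\<lambda>S S'. Kc S' S) d \<eta>" by (rule good_transpose[OF g])
  define c where "c = (\<Prod>j<l. Kc {i j} {i (Suc j)})"
  have i: "i l \<in> I" "i (Suc l) \<in> I" using Suc.prems by auto
  have fcQ: "fc I (Qop I ?qt (gmsg I ?qt (\<lambda>l z. z (i l)) l)) S = c * Kc {i l} S" if "S \<in> Pow I" for S
  proof -
    have "fc I (Qop I ?qt (gmsg I ?qt (\<lambda>l z. z (i l)) l)) S = (\<Sum>S'\<in>Pow I. if S' = {i l} then Kc S' S * c else 0)"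
      unfolding fc_Q[OF gt that]
    proof (intro sum.cong refl)
      fix S' assume S': "S' \<in> Pow I"
      have "fc I (gmsg I ?qt (\<lambda>l z. z (i l)) l) S' = fc I (\<lambda>x. c * x (i l)) S'"
        by (rule fc_cong) (use Suc in \<open>simp add: c_def\<close>)
      then show "Kc S' S * fc I (gmsg I ?qt (\<lambda>l z. z (i l)) l) S' = (if S' = {i l} then Kc S' S * c else 0)"
        using fc_single[OF I i(1) S'] by simp
    qed
    then show ?thesis using I i by (simp add: mult.commute)
  qed
  have "gmsg I ?qt (\<lambda>l z. z (i l)) (Suc l) b = E I (\<lambda>z. z (i (Suc l)) * Qop I ?qt (gmsg I ?qt (\<lambda>l z. z (i l)) l) (mul I b z))"
    by simp
  also have "\<dots> = E I (\<lambda>z. \<Sum>S\<in>Pow I. (c * Kc {i l} S * chi S b) * (chi {i (Suc l)} z * chi S z))"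
  proof (intro E_cong)
    fix z assume z: "z \<in> sgns I"
    have "Qop I ?qt (gmsg I ?qt (\<lambda>l z. z (i l)) l) (mul I b z)
      = (\<Sum>S\<in>Pow I. fc I (Qop I ?qt (gmsg I ?qt (\<lambda>l z. z (i l)) l)) S * chi S (mul I b z))"
      by (rule fourier[OF I mul_sgns[OF Suc.prems(2) z]])
    also have "\<dots> = (\<Sum>S\<in>Pow I. c * Kc {i l} S * (chi S b * chi S z))"
      using fcQ by (intro sum.cong) (auto simp: chi_mul)
    finally show "z (i (Suc l)) * Qop I ?qt (gmsg I ?qt (\<lambda>l z. z (i l)) l) (mul I b z)
       = (\<Sum>S\<in>Pow I. (c * Kc {i l} S * chi S b) * (chi {i (Suc l)} z * chi S z))"
      by (simp add: chi_def sum_distrib_left mult_ac)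
  qed
  also have "\<dots> = (\<Sum>S\<in>Pow I. if S = {i (Suc l)} then c * Kc {i l} S * chi S b else 0)"
    unfolding E_sum E_cmult using I i by (intro sum.cong refl) (auto simp: E_chi_chi)
  also have "\<dots> = c * Kc {i l} {i (Suc l)} * b (i (Suc l))"
    using I i by (simp add: chi_def)
  finally show ?case by (simp add: c_def)
qed

theorem dens_monomial:
  assumes g: "good I q Kc d \<eta>" and k: "k > 0" and i: "\<And>j. j \<le> k \<Longrightarrow> i j \<in> I"
  shows "EF I (Suc k) (\<lambda>z. (\<Prod>l<Suc k. z l (i l)) * dens q I k z) = (\<Prod>j<k. Kc {i j} {i (Suc j)})"
proof -
  have I: "finite I" by (rule good_fin[OF g])
  let ?qt = "\<lambda>a b. q b a"
  obtain l where l: "k = Suc l" using k by (cases k) auto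
  have "EF I (Suc k) (\<lambda>z. (\<Prod>l<Suc k. z l (i l)) * dens q I k z) = E I (\<lambda>x. x (i k) * Qop I ?qt (gmsg I ?qt (\<lambda>l z. z (i l)) l) x)"
    using dens_weighted[OF I k, of "\<lambda>l z. z (i l)" q] by (simp add: l)
  also have "\<dots> = gmsg I ?qt (\<lambda>l z. z (i l)) k (\<lambda>i\<in>I. 1)"
    unfolding l gmsg.simps
  proof (intro E_cong)
    fix z assume z: "z \<in> sgns I"
    have "mul I (\<lambda>i\<in>I. 1) z = z" using z by (auto simp: mul_def sgns_def fun_eq_iff PiE_def extensional_def)
    then show "z (i (Suc l)) * Qop I ?qt (gmsg I ?qt (\<lambda>l z. z (i l)) l) z =
       z (i (Suc l)) * Qop I ?qt (gmsg I ?qt (\<lambda>l z. z (i l)) l) (mul I (\<lambda>i\<in>I. 1) z)" by simp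
  qed
  also have "\<dots> = (\<Prod>j<k. Kc {i j} {i (Suc j)})"
  proof -
    have "gmsg I ?qt (\<lambda>l z. z (i l)) k (\<lambda>i\<in>I. 1) = (\<Prod>j<k. Kc {i j} {i (Suc j)}) * (\<lambda>i\<in>I. 1) (i k)"
      by (rule gmsg_monomial[OF g _ one_sgns]) (use i in auto)
    then show ?thesis using i[of k] by simp
  qed
  finally show ?thesis .
qed

section \<open>The amplitude under the uniform distribution and under the density\<close>

text \<open>The amplitude of the uniform superposition after the alternating product of the phase matrices
  \<open>diag (z l)\<close> and \<open>M\<close>, expanded as a sum over paths.\<close>

definition phi :: "'i set \<Rightarrow> ('i \<Rightarrow> 'i \<Rightarrow> real) \<Rightarrow> nat \<Rightarrow> (nat \<Rightarrow> 'i \<Rightarrow> real) \<Rightarrow> real" where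
  "phi I M k z = (\<Sum>i\<in>{..k} \<rightarrow>\<^sub>E I. (\<Prod>j<k. M (i j) (i (Suc j))) * (\<Prod>l<Suc k. z l (i l))) / real (card I)"

lemma dens_total:
  assumes g: "good I q Kc d \<eta>" and k: "k > 0"
  shows "EF I (Suc k) (dens q I k) = 1"
proof -
  have I: "finite I" by (rule good_fin[OF g])
  have gt: "good I (\<lambda>a b. q b a) (\<lambda>S S'. Kc S' S) d \<eta>" by (rule good_transpose[OF g])
  have "EF I (Suc k) (dens q I k) = E I (\<lambda>x. Qop I (\<lambda>a b. q b a) (msg I (\<lambda>a b. q b a) (\<lambda>_. {}) (\<lambda>_. \<lambda>_. 1) (k - 1)) x)"
    using dens_weighted[OF I k, of "\<lambda>l z. \<Prod>i\<in>{}. 1 + (1::real) * z i" q]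
      gmsg_msg[where I=I and p="\<lambda>a b. q b a" and T="\<lambda>_. {}" and a="\<lambda>_ _. 1" and l="k - 1"] by simp
  also have "\<dots> = fc I (Qop I (\<lambda>a b. q b a) (msg I (\<lambda>a b. q b a) (\<lambda>_. {}) (\<lambda>_. \<lambda>_. 1) (k - 1))) {}"
    by (simp add: fc_empty)
  also have "\<dots> = (\<Sum>S'\<in>Pow I. if S' = {} then fc I (msg I (\<lambda>a b. q b a) (\<lambda>_. {}) (\<lambda>_. \<lambda>_. 1) (k - 1)) {} else 0)"
    unfolding fc_Q[OF gt Pow_bottom] using good_K(1)[OF g] by (intro sum.cong refl) auto
  also have "\<dots> = 1" using I E_msg[OF gt, where l="k - 1" and T="\<lambda>_. {}" and a="\<lambda>_ _. 1"] by (simp add: fc_empty)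
  finally show ?thesis .
qed

text \<open>Different paths give orthogonal monomials, so only the diagonal remains: with
  \<open>n = card I\<close> there are \<open>n ^ (k + 1)\<close> paths, each with squared
  coefficient at most \<open>(1 / n) ^ k / n\<^sup>2\<close>.\<close>

lemma phi_unif_sq:
  fixes I :: "'i set"
  assumes I: "finite I" "I \<noteq> {}" and flat: "\<And>i j. i \<in> I \<Longrightarrow> j \<in> I \<Longrightarrow> (M i j)\<^sup>2 \<le> 1 / real (card I)"
  shows "EF I (Suc k) (\<lambda>z. (phi I M k z)\<^sup>2) \<le> 1 / real (card I)"
proof -
  let ?P = "{..k} \<rightarrow>\<^sub>E I"
  let ?n = "real (card I)"
  have n: "?n > 0" using I by (simp add: card_gt_0_iff)
  have finP: "finite ?P" using I by (intro finite_PiE) auto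
  define c where "c i = (\<Prod>j<k. M (i j) (i (Suc j)))" for i
  have orth: "EF I (Suc k) (\<lambda>z. (\<Prod>l<Suc k. z l (i l)) * (\<Prod>l<Suc k. z l (i' l))) = (if i = i' then 1 else 0)"
    if "i \<in> ?P" "i' \<in> ?P" for i i'
  proof -
    have mem: "i l \<in> I" "i' l \<in> I" if "l < Suc k" for l using that \<open>i \<in> ?P\<close> \<open>i' \<in> ?P\<close> by auto
    have "EF I (Suc k) (\<lambda>z. (\<Prod>l<Suc k. z l (i l)) * (\<Prod>l<Suc k. z l (i' l))) = (\<Prod>l<Suc k. E I (\<lambda>x. chi {i l} x * chi {i' l} x))"
      unfolding prod.distrib[symmetric] using EF_prod[OF I(1), where L="Suc k" and h="\<lambda>l x. x (i l) * x (i' l)"]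
      by (simp add: chi_def del: prod.lessThan_Suc)
    also have "\<dots> = (\<Prod>l<Suc k. if i l = i' l then 1 else 0)"
      using mem I by (intro prod.cong refl) (auto simp: E_chi_chi)
    also have "\<dots> = (if i = i' then 1 else 0)"
    proof (cases "i = i'")
      case False
      then obtain l where "l \<in> {..k}" "i l \<noteq> i' l" using PiE_ext[OF \<open>i \<in> ?P\<close> \<open>i' \<in> ?P\<close>] by blast
      then show ?thesis using False by (auto intro!: prod_zero bexI[of _ l] simp del: prod.lessThan_Suc)
    qed simp
    finally show ?thesis .
  qed
  have "EF I (Suc k) (\<lambda>z. (phi I M k z)\<^sup>2)
     = EF I (Suc k) (\<lambda>z. \<Sum>i\<in>?P. \<Sum>i'\<in>?P. (c i * c i' / ?n\<^sup>2) * ((\<Prod>l<Suc k. z l (i l)) * (\<Prod>l<Suc k. z l (i' l))))"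
  proof (rule EF_cong)
    fix z :: "nat \<Rightarrow> 'i \<Rightarrow> real"
    define X where "X i = (\<Prod>l<Suc k. z l (i l))" for i
    have "phi I M k z = (\<Sum>i\<in>?P. c i * X i) / ?n" by (simp only: phi_def c_def X_def)
    then have "(phi I M k z)\<^sup>2 = (\<Sum>i\<in>?P. \<Sum>i'\<in>?P. (c i * X i) * (c i' * X i')) / ?n\<^sup>2"
      by (simp only: power_divide power2_eq_square sum_product times_divide_times_eq)
    also have "\<dots> = (\<Sum>i\<in>?P. \<Sum>i'\<in>?P. (c i * c i' / ?n\<^sup>2) * (X i * X i'))"
      unfolding sum_divide_distrib by (intro sum.cong refl) simp
    finally show "(phi I M k z)\<^sup>2 = (\<Sum>i\<in>?P. \<Sum>i'\<in>?P. (c i * c i' / ?n\<^sup>2) * ((\<Prod>l<Suc k. z l (i l)) * (\<Prod>l<Suc k. z l (i' l))))"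
      by (simp only: X_def)
  qed
  also have "\<dots> = (\<Sum>i\<in>?P. \<Sum>i'\<in>?P. if i = i' then (c i)\<^sup>2 / ?n\<^sup>2 else 0)"
    unfolding EF_sum EF_cmult using orth by (intro sum.cong refl) (auto simp: power2_eq_square simp del: prod.lessThan_Suc)
  also have "\<dots> = (\<Sum>i\<in>?P. (c i)\<^sup>2 / ?n\<^sup>2)" using finP by simp
  also have "\<dots> \<le> (\<Sum>i\<in>?P. (1 / ?n) ^ k / ?n\<^sup>2)"
  proof (intro sum_mono divide_right_mono)
    fix i assume i: "i \<in> ?P"
    have "(c i)\<^sup>2 = (\<Prod>j<k. (M (i j) (i (Suc j)))\<^sup>2)" by (simp add: c_def prod_power_distrib)
    also have "\<dots> \<le> (\<Prod>j<k. 1 / ?n)" using flat[OF PiE_mem[OF i] PiE_mem[OF i]] by (intro prod_mono) auto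
    finally show "(c i)\<^sup>2 \<le> (1 / ?n) ^ k" by simp
  qed auto
  also have "\<dots> = ?n ^ Suc k * ((1 / ?n) ^ k / ?n\<^sup>2)" by (simp add: card_PiE)
  also have "\<dots> = 1 / ?n" using n by (simp add: power_one_over power2_eq_square field_simps)
  finally show ?thesis .
qed

text \<open>Under the density the mean of a path monomial is a product of kernel coefficients with
  the same signs as the entries of \<open>M\<close> along the path. All \<open>n ^ (k + 1)\<close>
  paths thus contribute positively and nothing cancels.\<close>

lemma phi_dens:
  assumes g: "good I q (sin_kernel M) d \<eta>" and I: "I \<noteq> {}" and k: "k > 0"
    and flat: "\<And>i j. i \<in> I \<Longrightarrow> j \<in> I \<Longrightarrow> (M i j)\<^sup>2 \<ge> \<kappa> / real (card I)" and \<kappa>: "\<kappa> \<ge> 0"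
  shows "EF I (Suc k) (\<lambda>z. phi I M k z * dens q I k z) \<ge> (exp (-1) * \<kappa>) ^ k"
proof -
  have finI: "finite I" by (rule good_fin[OF g])
  let ?P = "{..k} \<rightarrow>\<^sub>E I"
  let ?n = "real (card I)"
  have n: "?n > 0" using I finI by (simp add: card_gt_0_iff)
  have "EF I (Suc k) (\<lambda>z. phi I M k z * dens q I k z)
     = EF I (Suc k) (\<lambda>z. \<Sum>i\<in>?P. ((\<Prod>j<k. M (i j) (i (Suc j))) / ?n) * ((\<Prod>l<Suc k. z l (i l)) * dens q I k z))"
    unfolding phi_def by (simp only: sum_divide_distrib sum_distrib_right) (simp add: mult_ac)
  also have "\<dots> = (\<Sum>i\<in>?P. ((\<Prod>j<k. M (i j) (i (Suc j))) / ?n) * (\<Prod>j<k. sin_kernel M {i j} {i (Suc j)}))"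
    unfolding EF_sum EF_cmult using k by (intro sum.cong refl arg_cong2[where f=times] dens_monomial[OF g]) auto
  also have "\<dots> = (\<Sum>i\<in>?P. (\<Prod>j<k. M (i j) (i (Suc j)) * sin_kernel M {i j} {i (Suc j)}) / ?n)"
    by (simp add: prod.distrib)
  also have "\<dots> \<ge> (\<Sum>i\<in>?P. (exp (-1) * \<kappa> / ?n) ^ k / ?n)"
  proof (intro sum_mono divide_right_mono)
    fix i assume i: "i \<in> ?P"
    have "(\<Prod>j<k. exp (-1) * \<kappa> / ?n) \<le> (\<Prod>j<k. M (i j) (i (Suc j)) * sin_kernel M {i j} {i (Suc j)})"
    proof (intro prod_mono conjI)
      fix j assume "j \<in> {..<k}"
      then have ij: "i j \<in> I" "i (Suc j) \<in> I" using i by auto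
      have "exp (-1) * (\<kappa> / ?n) \<le> exp (-1) * (M (i j) (i (Suc j)))\<^sup>2"
        using flat[OF ij] by (intro mult_left_mono) auto
      also have "\<dots> \<le> M (i j) (i (Suc j)) * sin_kernel M {i j} {i (Suc j)}" by (rule sin_kernel_singletons_ge)
      finally show "exp (-1) * \<kappa> / ?n \<le> M (i j) (i (Suc j)) * sin_kernel M {i j} {i (Suc j)}" by simp
    qed (use \<kappa> n in auto)
    then show "(exp (-1) * \<kappa> / ?n) ^ k \<le> (\<Prod>j<k. M (i j) (i (Suc j)) * sin_kernel M {i j} {i (Suc j)})" by simp
  qed (use n in auto)
  also have "(\<Sum>i\<in>?P. (exp (-1) * \<kappa> / ?n) ^ k / ?n) = ?n ^ Suc k * ((exp (-1) * \<kappa> / ?n) ^ k / ?n)"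
    by (simp add: card_PiE)
  also have "\<dots> = (exp (-1) * \<kappa>) ^ k" using n by (simp add: power_divide)
  finally show ?thesis .
qed

section \<open>A flat contraction with small submatrices\<close>

text \<open>Termwise comparison of the power series, by
  \<open>fact (2 * k) \<ge> 2 ^ k * fact k\<close>.\<close>

lemma cosh_le_exp: "(exp x + exp (- x)) / 2 \<le> exp (x\<^sup>2 / 2)" for x :: real
proof -
  have fact_ge: "real (fact (2 * k)) \<ge> 2 ^ k * fact k" for k
  proof (induction k)
    case (Suc k)
    have "2 ^ Suc k * fact (Suc k) = (2 * real (Suc k)) * (2 ^ k * fact k)" by (simp add: algebra_simps)
    also have "\<dots> \<le> (2 * real (Suc k)) * real (fact (2 * k))" using Suc by (intro mult_left_mono) auto
    also have "\<dots> \<le> (2 * real (Suc k)) * (real (Suc (2 * k)) * real (fact (2 * k)))"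
      by (intro mult_left_mono) (auto simp: mult_le_cancel_right1)
    also have "\<dots> = real (fact (2 * Suc k))" by (simp add: algebra_simps)
    finally show ?case by simp
  qed simp
  have c: "(\<lambda>n. if even n then inverse (fact n) *\<^sub>R x ^ n else 0) sums cosh x"
    using cosh_converges[of x] by (simp add: divide_inverse_commute)
  have c': "(\<lambda>k. x ^ (2 * k) / fact (2 * k)) sums cosh x"
  proof -
    have sm: "strict_mono (\<lambda>k::nat. 2 * k)" by (intro strict_monoI) auto
    have z: "(if even n then inverse (fact n) *\<^sub>R x ^ n else 0) = 0" if "n \<notin> range (\<lambda>k::nat. 2 * k)" for n
      using that by (auto elim!: evenE)
    have "(\<lambda>k. (if even (2*k) then inverse (fact (2*k)) *\<^sub>R x ^ (2*k) else 0)) sums cosh x"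
      by (rule iffD2[OF sums_mono_reindex[OF sm z] c])
    moreover have "(\<lambda>k. (if even (2*k) then inverse (fact (2*k)) *\<^sub>R x ^ (2*k) else 0)) = (\<lambda>k. x ^ (2 * k) / fact (2 * k))"
      by (rule ext) (simp only: dvd_triv_left if_True real_scaleR_def divide_inverse_commute)
    ultimately show ?thesis by (simp only:)
  qed
  have e: "(\<lambda>k. (x\<^sup>2 / 2) ^ k / fact k) sums exp (x\<^sup>2 / 2)"
    using exp_converges[of "x\<^sup>2 / 2"] by (simp only: real_scaleR_def divide_inverse_commute)
  have "cosh x \<le> exp (x\<^sup>2 / 2)"
  proof (rule sums_le[OF _ c' e])
    fix k
    have "x ^ (2 * k) / fact (2 * k) \<le> x ^ (2 * k) / (2 ^ k * fact k)"
      using fact_ge[of k] by (intro divide_left_mono mult_pos_pos) auto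
    then show "x ^ (2 * k) / fact (2 * k) \<le> (x\<^sup>2 / 2) ^ k / fact k"
      by (simp add: power_divide power_mult)
  qed
  then show ?thesis by (simp add: cosh_def)
qed

section \<open>Norms of random sign matrices through a net of integer vectors\<close>

definition net :: "nat \<Rightarrow> nat \<Rightarrow> (nat \<Rightarrow> int) set" where
  "net n s = {k \<in> {..<n} \<rightarrow>\<^sub>E {- int (4 * n)..int (4 * n)}. (\<Sum>i<n. (k i)\<^sup>2) \<le> int (16 * s)}"

lemma finite_net: "finite (net n s)"
proof -
  have "finite ({..<n} \<rightarrow>\<^sub>E {- int (4 * n)..int (4 * n)})" by (intro finite_PiE) auto
  then show ?thesis unfolding net_def by simp
qed

lemma sum_geom_sym:
  fixes t :: real
  assumes "0 \<le> t" "t \<le> 1/2"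
  shows "(\<Sum>k\<in>{- int B..int B}. t ^ (nat \<bar>k\<bar>)\<^sup>2) \<le> 1 + 4 * t"
proof -
  have "(\<Sum>k\<in>{- int B..int B}. t ^ (nat \<bar>k\<bar>)\<^sup>2) \<le> 1 + 4 * t - 4 * t ^ Suc B"
  proof (induction B)
    case (Suc B)
    have eq: "{- int (Suc B)..int (Suc B)} = insert (- int (Suc B)) (insert (int (Suc B)) {- int B..int B})" by auto
    have "t ^ (Suc B)\<^sup>2 \<le> t ^ Suc B"
      using assms by (intro power_decreasing) (auto simp: power2_eq_square)
    moreover have "2 * t ^ Suc (Suc B) \<le> t ^ Suc B"
      using assms mult_right_mono[of "2 * t" 1 "t ^ Suc B"] by (simp add: mult.assoc)
    ultimately show ?case unfolding eq using Suc by (simp del: of_nat_Suc power_Suc)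
  qed simp
  moreover have "0 \<le> t ^ Suc B" using assms by simp
  ultimately show ?thesis by linarith
qed

text \<open>Counting by weights: \<open>b ^ (16 * s)\<close> times \<open>1 / b\<close> to the
  squared length is at least 1 on the net, and its sum over the whole box factors into coordinates.
  Taking \<open>b\<close> constant suits \<open>s = n\<close>, taking \<open>b = n\<close> suits
  small \<open>s\<close>.\<close>

lemma card_net:
  fixes b :: real
  assumes b: "b \<ge> 2"
  shows "real (card (net n s)) \<le> b ^ (16 * s) * (1 + 4 / b) ^ n"
proof -
  let ?P = "{..<n} \<rightarrow>\<^sub>E {- int (4 * n)..int (4 * n)}"
  have finP: "finite ?P" by (intro finite_PiE) auto
  have "real (card (net n s)) = (\<Sum>k\<in>net n s. 1)" by simp
  also have "\<dots> \<le> (\<Sum>k\<in>net n s. b ^ (16 * s) * (\<Prod>i<n. (1/b) ^ (nat \<bar>k i\<bar>)\<^sup>2))"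
  proof (rule sum_mono)
    fix k assume "k \<in> net n s"
    then have "(\<Sum>i<n. (k i)\<^sup>2) \<le> int (16 * s)" by (simp add: net_def)
    moreover have "int (\<Sum>i<n. (nat \<bar>k i\<bar>)\<^sup>2) = (\<Sum>i<n. (k i)\<^sup>2)" by simp
    ultimately have le: "(\<Sum>i<n. (nat \<bar>k i\<bar>)\<^sup>2) \<le> 16 * s" by linarith
    have "(\<Prod>i<n. (1/b) ^ (nat \<bar>k i\<bar>)\<^sup>2) = (1/b) ^ (\<Sum>i<n. (nat \<bar>k i\<bar>)\<^sup>2)"
      by (simp add: power_sum)
    also have "\<dots> \<ge> (1/b) ^ (16 * s)" using le b by (intro power_decreasing) auto
    finally have "b ^ (16 * s) * (1/b) ^ (16 * s) \<le> b ^ (16 * s) * (\<Prod>i<n. (1/b) ^ (nat \<bar>k i\<bar>)\<^sup>2)"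
      using b by (intro mult_left_mono) auto
    then show "1 \<le> b ^ (16 * s) * (\<Prod>i<n. (1/b) ^ (nat \<bar>k i\<bar>)\<^sup>2)"
      using b by (simp add: power_mult_distrib[symmetric])
  qed
  also have "\<dots> \<le> (\<Sum>k\<in>?P. b ^ (16 * s) * (\<Prod>i<n. (1/b) ^ (nat \<bar>k i\<bar>)\<^sup>2))"
  proof (rule sum_mono2[OF finP])
    show "net n s \<subseteq> ?P" unfolding net_def by blast
    show "0 \<le> b ^ (16 * s) * (\<Prod>i<n. (1/b) ^ (nat \<bar>k i\<bar>)\<^sup>2)" for k
      using b by (intro mult_nonneg_nonneg prod_nonneg zero_le_power) auto
  qed
  also have "\<dots> = b ^ (16 * s) * (\<Prod>i<n. \<Sum>k\<in>{- int (4 * n)..int (4 * n)}. (1/b) ^ (nat \<bar>k\<bar>)\<^sup>2)"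
    by (subst prod_sum_PiE) (auto simp: sum_distrib_left)
  also have "\<dots> \<le> b ^ (16 * s) * (\<Prod>i<n. 1 + 4 / b)"
    using b sum_geom_sym[of "1/b" "4*n"]
    by (intro mult_left_mono prod_mono) (auto intro!: sum_nonneg)
  finally show ?thesis by simp
qed

definition bil :: "nat \<Rightarrow> (nat \<times> nat \<Rightarrow> real) \<Rightarrow> (nat \<Rightarrow> real) \<Rightarrow> (nat \<Rightarrow> real) \<Rightarrow> real" where
  "bil n G x y = (\<Sum>i<n. \<Sum>j<n. x i * G (i, j) * y j)"

text \<open>The form is a signed sum whose coefficients have total square at most
  \<open>(16 * s)\<^sup>2\<close>, hence subgaussian. The bound is stated as an exponential mean, so
  that a union bound over the net becomes linearity of the mean.\<close>

lemma bil_tail: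
  fixes s :: nat and \<tau> :: real
  assumes k: "k \<in> net n s" "k' \<in> net n s" and s: "s > 0" and \<tau>: "\<tau> \<ge> 0"
  shows "E ({..<n} \<times> {..<n}) (\<lambda>G. exp ((\<tau> / (16 * s)) * (bil n G (\<lambda>i. of_int (k i)) (\<lambda>i. of_int (k' i)) - 16 * s * \<tau>))) \<le> exp (- \<tau>\<^sup>2 / 2)"
proof -
  let ?I = "{..<n} \<times> {..<n}"
  define \<mu> where "\<mu> = \<tau> / (16 * real s)"
  define c where "c p = real_of_int (k (fst p)) * of_int (k' (snd p))" for p
  have fin: "finite ?I" by simp
  have sq: "(\<Sum>i<n. (real_of_int (k i))\<^sup>2) \<le> 16 * s" if "k \<in> net n s" for k
  proof -
    have "real_of_int (\<Sum>i<n. (k i)\<^sup>2) \<le> real_of_int (int (16 * s))"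
      using that unfolding net_def of_int_le_iff by simp
    then show ?thesis by simp
  qed
  have "(\<Sum>p\<in>?I. (c p)\<^sup>2) = (\<Sum>i<n. (real_of_int (k i))\<^sup>2) * (\<Sum>i<n. (real_of_int (k' i))\<^sup>2)"
    by (simp add: c_def sum_product sum.cartesian_product power_mult_distrib case_prod_unfold)
  also have "\<dots> \<le> (16 * real s) * (16 * real s)"
    using sq[OF k(1)] sq[OF k(2)] by (intro mult_mono) (auto intro!: sum_nonneg)
  finally have c2: "(\<Sum>p\<in>?I. (c p)\<^sup>2) \<le> (16 * real s)\<^sup>2" by (simp add: power2_eq_square)
  have bl: "bil n G (\<lambda>i. of_int (k i)) (\<lambda>i. of_int (k' i)) = (\<Sum>p\<in>?I. G p * c p)" for G
    by (simp add: bil_def sum.cartesian_product c_def case_prod_unfold mult_ac)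
  have "E ?I (\<lambda>G. exp (\<mu> * (\<Sum>p\<in>?I. G p * c p))) = E ?I (\<lambda>G. \<Prod>p\<in>?I. exp (\<mu> * G p * c p))"
    by (simp add: sum_distrib_left exp_sum mult.assoc)
  also have "\<dots> = (\<Prod>p\<in>?I. (exp (\<mu> * c p) + exp (- (\<mu> * c p))) / 2)"
    using sum_sgns_prod[OF fin, of "\<lambda>p t. exp (\<mu> * t * c p)"] by simp
  also have "\<dots> \<le> (\<Prod>p\<in>?I. exp ((\<mu> * c p)\<^sup>2 / 2))"
    by (intro prod_mono conjI cosh_le_exp) (simp add: add_nonneg_nonneg)
  also have "\<dots> = exp (\<mu>\<^sup>2 / 2 * (\<Sum>p\<in>?I. (c p)\<^sup>2))"
    by (simp add: exp_sum[symmetric] sum_distrib_left power_mult_distrib)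
  also have "\<dots> \<le> exp (\<mu>\<^sup>2 / 2 * (16 * real s)\<^sup>2)"
    by (intro iffD2[OF exp_le_cancel_iff] mult_left_mono c2) simp
  also have "\<mu>\<^sup>2 / 2 * (16 * real s)\<^sup>2 = \<tau>\<^sup>2 / 2"
    using s by (simp add: \<mu>_def power_divide)
  finally have A: "E ?I (\<lambda>G. exp (\<mu> * (\<Sum>p\<in>?I. G p * c p))) \<le> exp (\<tau>\<^sup>2 / 2)" .
  have "\<mu> * (16 * real s * \<tau>) = \<tau>\<^sup>2" using s by (simp add: \<mu>_def power2_eq_square)
  then have "E ?I (\<lambda>G. exp (\<mu> * (bil n G (\<lambda>i. of_int (k i)) (\<lambda>i. of_int (k' i)) - 16 * real s * \<tau>)))
     = exp (- \<tau>\<^sup>2) * E ?I (\<lambda>G. exp (\<mu> * (\<Sum>p\<in>?I. G p * c p)))"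
    unfolding bl E_cmult[symmetric] by (simp add: right_diff_distrib exp_diff exp_minus divide_inverse mult.commute)
  also have "\<dots> \<le> exp (- \<tau>\<^sup>2) * exp (\<tau>\<^sup>2 / 2)" using A by (intro mult_left_mono) auto
  also have "\<dots> = exp (- \<tau>\<^sup>2 / 2)" by (simp add: exp_add[symmetric])
  finally show ?thesis by (simp add: \<mu>_def)
qed

lemma bil_add: "bil n G (\<lambda>i. x i + x' i) y = bil n G x y + bil n G x' y"
  "bil n G x (\<lambda>i. y i + y' i) = bil n G x y + bil n G x y'"
  by (simp_all add: bil_def sum.distrib algebra_simps)

lemma bil_cmult: "bil n G (\<lambda>i. c * x i) y = c * bil n G x y" "bil n G x (\<lambda>i. c * y i) = c * bil n G x y"
  by (simp_all add: bil_def sum_distrib_left mult_ac)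

text \<open>Rounding towards zero: it enlarges no coordinate and keeps zeros, so a rounded vector
  stays in the ball and on the same support.\<close>

definition trunc_int :: "real \<Rightarrow> int" where
  "trunc_int u = (if u \<ge> 0 then \<lfloor>u\<rfloor> else \<lceil>u\<rceil>)"

lemma trunc_int: "\<bar>real_of_int (trunc_int u)\<bar> \<le> \<bar>u\<bar>" "\<bar>u - real_of_int (trunc_int u)\<bar> \<le> 1" "trunc_int 0 = 0"
  unfolding trunc_int_def by (auto; linarith)+

text \<open>After scaling by \<open>r = 4 * sqrt s\<close> a unit vector on \<open>s\<close>
  coordinates is rounded to the net. The error has norm at most 1/4 on the same support, so it is
  itself bounded by a quarter of the supremum \<open>N\<close>. Rounding both arguments gives
  \<open>N \<le> \<tau> + N / 2\<close>.\<close>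

lemma net_bound:
  fixes s :: nat and \<tau> :: real
  assumes net: "\<And>k k'. k \<in> net n s \<Longrightarrow> k' \<in> net n s \<Longrightarrow> bil n G (\<lambda>i. of_int (k i)) (\<lambda>i. of_int (k' i)) \<le> 16 * s * \<tau>"
    and s: "s > 0" "s \<le> n" and G: "\<And>p. p \<in> {..<n} \<times> {..<n} \<Longrightarrow> \<bar>G p\<bar> \<le> 1"
    and T: "T \<subseteq> {..<n}" "T' \<subseteq> {..<n}" "card T \<le> s" "card T' \<le> s"
    and x: "\<And>i. i \<notin> T \<Longrightarrow> x i = 0" "(\<Sum>i<n. (x i)\<^sup>2) \<le> 1" and y: "\<And>i. i \<notin> T' \<Longrightarrow> y i = 0" "(\<Sum>i<n. (y i)\<^sup>2) \<le> 1"
  shows "bil n G x y \<le> 2 * \<tau>"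
proof -
  define U where "U T = {x. (\<forall>i. i \<notin> T \<longrightarrow> x i = (0::real)) \<and> (\<Sum>i<n. (x i)\<^sup>2) \<le> 1}" for T :: "nat set"
  define A where "A = {bil n G x y | x y. x \<in> U T \<and> y \<in> U T'}"
  have one: "\<bar>x i\<bar> \<le> 1" if "x \<in> U T" "i < n" for x i T
  proof -
    have "(x i)\<^sup>2 \<le> (\<Sum>i<n. (x i)\<^sup>2)" using that by (intro member_le_sum) auto
    then have "(x i)\<^sup>2 \<le> 1" using that by (simp add: U_def)
    then show ?thesis by (simp add: abs_square_le_1)
  qed
  have bdd: "bdd_above A"
  proof (rule bdd_aboveI)
    fix a assume "a \<in> A"
    then obtain x y where a: "a = bil n G x y" and xy: "x \<in> U T" "y \<in> U T'" by (auto simp: A_def)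
    have "a \<le> (\<Sum>i<n. \<Sum>j<n. (1::real))"
      unfolding a bil_def
    proof (intro sum_mono)
      fix i j assume "i \<in> {..<n}" "j \<in> {..<n}"
      then have "\<bar>x i * G (i, j) * y j\<bar> \<le> 1"
        unfolding abs_mult using one[OF xy(1)] one[OF xy(2)] G by (intro mult_le_one) auto
      then show "x i * G (i, j) * y j \<le> 1" by linarith
    qed
    then show "a \<le> real n * real n" by simp
  qed
  define N where "N = Sup A"
  have up: "bil n G x y \<le> N" if "x \<in> U T" "y \<in> U T'" for x y
    unfolding N_def using that bdd by (intro cSup_upper) (auto simp: A_def)
  define r where "r = 4 * sqrt (real s)"
  have r: "r > 0" "r\<^sup>2 = 16 * real s" "r \<le> 4 * real n"
  proof -
    have "sqrt (real s) \<le> real s" using s by (intro real_le_lsqrt) (auto simp: power2_eq_square)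
    then show "r \<le> 4 * real n" using s by (simp add: r_def)
  qed (use s in \<open>auto simp: r_def power_mult_distrib\<close>)
  define rd where "rd x = (\<lambda>i\<in>{..<n}. trunc_int (r * x i))" for x
  define hat where "hat x i = real_of_int (trunc_int (r * x i)) / r" for x :: "nat \<Rightarrow> real" and i
  have rdnet: "rd x \<in> net n s" if x: "x \<in> U T" for x T
  proof -
    have "trunc_int (r * x i) \<in> {- int (4 * n)..int (4 * n)}" if "i < n" for i
    proof -
      have "\<bar>real_of_int (trunc_int (r * x i))\<bar> \<le> \<bar>r * x i\<bar>" by (rule trunc_int)
      also have "\<dots> \<le> r * 1" using one[OF x that] r by (simp add: abs_mult)
      finally have "\<bar>real_of_int (trunc_int (r * x i))\<bar> \<le> 4 * real n" using r by simp
      then have "\<bar>trunc_int (r * x i)\<bar> \<le> int (4 * n)" by linarith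
      then show ?thesis by (auto simp: abs_le_iff)
    qed
    moreover have "(\<Sum>i<n. (rd x i)\<^sup>2) \<le> int (16 * s)"
    proof -
      have "(\<Sum>i<n. (real_of_int (trunc_int (r * x i)))\<^sup>2) \<le> (\<Sum>i<n. (r * x i)\<^sup>2)"
        using trunc_int(1) by (intro sum_mono) (simp add: abs_le_square_iff)
      also have "\<dots> = r\<^sup>2 * (\<Sum>i<n. (x i)\<^sup>2)" by (simp add: sum_distrib_left power_mult_distrib)
      also have "\<dots> \<le> 16 * real s" using x r by (simp add: U_def mult_left_le)
      finally have "real_of_int (\<Sum>i<n. (rd x i)\<^sup>2) \<le> real_of_int (int (16 * s))" by (simp add: rd_def)
      then show ?thesis unfolding of_int_le_iff .
    qed
    ultimately show ?thesis unfolding net_def rd_def by (auto simp del: atLeastAtMost_iff)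
  qed
  have hatU: "hat x \<in> U T" if x: "x \<in> U T" for x T
  proof -
    have "(hat x i)\<^sup>2 \<le> (x i)\<^sup>2" for i
    proof -
      have "\<bar>hat x i\<bar> \<le> \<bar>r * x i\<bar> / r" unfolding hat_def abs_divide using r trunc_int(1)[of "r * x i"] by (simp add: divide_right_mono)
      also have "\<dots> = \<bar>x i\<bar>" using r by (simp add: abs_mult)
      finally show ?thesis by (simp add: abs_le_square_iff)
    qed
    then have "(\<Sum>i<n. (hat x i)\<^sup>2) \<le> (\<Sum>i<n. (x i)\<^sup>2)" by (intro sum_mono)
    then show ?thesis using x by (auto simp: U_def hat_def trunc_int)
  qed
  have errU: "(\<lambda>i. 4 * (x i - hat x i)) \<in> U T" if x: "x \<in> U T" and T: "T \<subseteq> {..<n}" "card T \<le> s" for x T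
  proof -
    have z: "x i - hat x i = 0" if "i \<notin> T" for i using x that by (simp add: U_def hat_def trunc_int)
    have "(4 * (x i - hat x i))\<^sup>2 \<le> 1 / real s" for i
    proof -
      have "x i - hat x i = (r * x i - real_of_int (trunc_int (r * x i))) / r" using r by (simp add: hat_def field_simps)
      then have "\<bar>x i - hat x i\<bar> \<le> 1 / r" using trunc_int(2)[of "r * x i"] r by (simp add: abs_divide divide_right_mono)
      then have "\<bar>x i - hat x i\<bar> \<le> \<bar>1 / r\<bar>" using r by simp
      then have "(x i - hat x i)\<^sup>2 \<le> (1 / r)\<^sup>2" by (simp only: abs_le_square_iff)
      also have "(1 / r)\<^sup>2 = 1 / (16 * real s)" using r by (simp add: power_divide)
      finally have "16 * (x i - hat x i)\<^sup>2 \<le> 16 * (1 / (16 * real s))" by (intro mult_left_mono) auto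
      moreover have "(4 * (x i - hat x i))\<^sup>2 = 16 * (x i - hat x i)\<^sup>2" by (simp only: power_mult_distrib) simp
      ultimately show ?thesis by simp
    qed
    then have "(\<Sum>i\<in>T. (4 * (x i - hat x i))\<^sup>2) \<le> (\<Sum>i\<in>T. 1 / real s)" by (intro sum_mono)
    also have "\<dots> \<le> 1" using T s by (simp add: divide_le_eq)
    also have "(\<Sum>i\<in>T. (4 * (x i - hat x i))\<^sup>2) = (\<Sum>i<n. (4 * (x i - hat x i))\<^sup>2)"
      using T z by (intro sum.mono_neutral_left) auto
    finally show ?thesis using z by (auto simp: U_def)
  qed
  have "bil n G x y \<le> \<tau> + N / 2" if xy: "x \<in> U T" "y \<in> U T'" for x y
  proof -
    have q: "(\<lambda>i. (1/4) * (4 * (v i - hat v i))) = (\<lambda>i. v i - hat v i)" for v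
      by (simp add: fun_eq_iff)
    have "bil n G x y = bil n G (\<lambda>i. hat x i + (x i - hat x i)) y" by simp
    also have "\<dots> = bil n G (hat x) y + bil n G (\<lambda>i. (1/4) * (4 * (x i - hat x i))) y"
      by (simp only: bil_add(1) q)
    also have "bil n G (hat x) y = bil n G (hat x) (\<lambda>i. hat y i + (y i - hat y i))" by simp
    also have "\<dots> = bil n G (hat x) (hat y) + bil n G (hat x) (\<lambda>i. (1/4) * (4 * (y i - hat y i)))"
      by (simp only: bil_add(2) q)
    also have "bil n G (hat x) (hat y) + bil n G (hat x) (\<lambda>i. (1/4) * (4 * (y i - hat y i))) + bil n G (\<lambda>i. (1/4) * (4 * (x i - hat x i))) y
      = bil n G (hat x) (hat y) + (1/4) * bil n G (hat x) (\<lambda>i. 4 * (y i - hat y i)) + (1/4) * bil n G (\<lambda>i. 4 * (x i - hat x i)) y"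
      by (simp only: bil_cmult)
    also have "\<dots> \<le> \<tau> + (1/4) * N + (1/4) * N"
    proof (intro add_mono mult_left_mono up hatU errU xy T)
      have "bil n G (hat x) (hat y) = bil n G (\<lambda>i. of_int (rd x i)) (\<lambda>i. of_int (rd y i)) / r\<^sup>2"
        unfolding bil_def sum_divide_distrib by (intro sum.cong refl) (simp add: hat_def rd_def power2_eq_square)
      also have "\<dots> \<le> (16 * s * \<tau>) / r\<^sup>2"
        using net[OF rdnet[OF xy(1)] rdnet[OF xy(2)]] by (intro divide_right_mono) auto
      also have "\<dots> = \<tau>" using r s by simp
      finally show "bil n G (hat x) (hat y) \<le> \<tau>" .
    qed auto
    finally show ?thesis by simp
  qed
  moreover have "x \<in> U T" "y \<in> U T'" using x y by (auto simp: U_def)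
  moreover have "A \<noteq> {}" using calculation(2,3) by (auto simp: A_def)
  ultimately have "N \<le> \<tau> + N / 2"
    unfolding N_def by (intro cSup_least) (auto simp: A_def)
  then show ?thesis using up[OF \<open>x \<in> U T\<close> \<open>y \<in> U T'\<close>] by simp
qed

text \<open>Duality: the bilinear form is tested on a vector and its own image, both
  normalized.\<close>

lemma net_nrm_le:
  fixes s :: nat and \<tau> :: real
  assumes net: "\<And>k k'. k \<in> net n s \<Longrightarrow> k' \<in> net n s \<Longrightarrow> bil n G (\<lambda>i. of_int (k i)) (\<lambda>i. of_int (k' i)) \<le> 16 * s * \<tau>"
    and s: "s > 0" "s \<le> n" and G: "\<And>p. p \<in> {..<n} \<times> {..<n} \<Longrightarrow> \<bar>G p\<bar> \<le> 1"
    and T: "T \<subseteq> {..<n}" "T' \<subseteq> {..<n}" "card T \<le> s" "card T' \<le> s" and c: "c > 0"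
  shows "nrm_le T T' (\<lambda>i j. G (i, j) / c) (2 * \<tau> / c)"
  unfolding nrm_le_def
proof
  fix x :: "nat \<Rightarrow> real"
  define y where "y i = (if i \<in> T then \<Sum>j\<in>T'. G (i, j) / c * x j else 0)" for i
  define x' where "x' j = (if j \<in> T' then x j else 0)" for j
  define X where "X = sqrt (\<Sum>j<n. (x' j)\<^sup>2)"
  define Y where "Y = sqrt (\<Sum>i<n. (y i)\<^sup>2)"
  have X2: "X\<^sup>2 = (\<Sum>j\<in>T'. (x j)\<^sup>2)"
  proof -
    have "X\<^sup>2 = (\<Sum>j<n. (x' j)\<^sup>2)" by (simp add: X_def sum_nonneg)
    also have "\<dots> = (\<Sum>j\<in>T'. (x j)\<^sup>2)" using T by (intro sum.mono_neutral_cong_right) (auto simp: x'_def)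
    finally show ?thesis .
  qed
  have Y2: "Y\<^sup>2 = (\<Sum>i\<in>T. (\<Sum>j\<in>T'. G (i, j) / c * x j)\<^sup>2)"
  proof -
    have "Y\<^sup>2 = (\<Sum>i<n. (y i)\<^sup>2)" by (simp add: Y_def sum_nonneg)
    also have "\<dots> = (\<Sum>i\<in>T. (\<Sum>j\<in>T'. G (i, j) / c * x j)\<^sup>2)" using T by (intro sum.mono_neutral_cong_right) (auto simp: y_def)
    finally show ?thesis .
  qed
  have "Y\<^sup>2 \<le> (2 * \<tau> / c)\<^sup>2 * X\<^sup>2"
  proof (cases "X = 0 \<or> Y = 0")
    case True
    have "Y = 0"
    proof (rule ccontr)
      assume "Y \<noteq> 0"
      then have "X = 0" using True by simp
      then have "(\<Sum>j\<in>T'. (x j)\<^sup>2) = 0" using X2 by simp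
      then have "x j = 0" if "j \<in> T'" for j
        using that T finite_subset[OF T(2)] by (simp add: sum_nonneg_eq_0_iff)
      then have "Y\<^sup>2 = 0" unfolding Y2 by (intro sum.neutral) simp
      with \<open>Y \<noteq> 0\<close> show False by simp
    qed
    then show ?thesis by simp
  next
    case False
    then have pos: "X > 0" "Y > 0" by (auto simp: X_def Y_def sum_nonneg less_le)
    have b: "bil n G y x' = c * Y\<^sup>2"
    proof -
      have "bil n G y x' = (\<Sum>i<n. y i * (\<Sum>j<n. G (i, j) * x' j))"
        by (simp add: bil_def sum_distrib_left mult.assoc)
      also have "\<dots> = (\<Sum>i<n. c * (y i)\<^sup>2)"
      proof (rule sum.cong[OF refl])
        fix i
        have "(\<Sum>j<n. G (i, j) * x' j) = (\<Sum>j\<in>T'. G (i, j) * x j)"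
          using T by (intro sum.mono_neutral_cong_right) (auto simp: x'_def)
        also have "\<dots> = c * (\<Sum>j\<in>T'. G (i, j) / c * x j)"
          unfolding sum_distrib_left using c by (intro sum.cong) auto
        finally show "y i * (\<Sum>j<n. G (i, j) * x' j) = c * (y i)\<^sup>2"
          by (simp add: y_def power2_eq_square)
      qed
      finally show ?thesis by (simp add: sum_distrib_left[symmetric] Y_def sum_nonneg)
    qed
    have "bil n G (\<lambda>i. (1 / Y) * y i) (\<lambda>j. (1 / X) * x' j) \<le> 2 * \<tau>"
    proof (rule net_bound[OF net s G T])
      show "(\<Sum>i<n. (1 / Y * y i)\<^sup>2) \<le> 1"
      proof -
        have "(\<Sum>i<n. (1 / Y * y i)\<^sup>2) = (1 / Y)\<^sup>2 * (\<Sum>i<n. (y i)\<^sup>2)"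
          by (simp only: power_mult_distrib sum_distrib_left)
        also have "(\<Sum>i<n. (y i)\<^sup>2) = Y\<^sup>2" by (simp add: Y_def sum_nonneg)
        finally show ?thesis using pos by (simp add: power_divide)
      qed
      show "(\<Sum>i<n. (1 / X * x' i)\<^sup>2) \<le> 1"
      proof -
        have "(\<Sum>i<n. (1 / X * x' i)\<^sup>2) = (1 / X)\<^sup>2 * (\<Sum>i<n. (x' i)\<^sup>2)"
          by (simp only: power_mult_distrib sum_distrib_left)
        also have "(\<Sum>i<n. (x' i)\<^sup>2) = X\<^sup>2" by (simp add: X_def sum_nonneg)
        finally show ?thesis using pos by (simp add: power_divide)
      qed
    qed (auto simp: y_def x'_def)
    then have "(1 / Y) * ((1 / X) * (c * Y\<^sup>2)) \<le> 2 * \<tau>"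
      unfolding bil_cmult b .
    then have "Y \<le> (2 * \<tau> / c) * X"
      using pos c by (simp add: power2_eq_square field_simps)
    then have "Y\<^sup>2 \<le> ((2 * \<tau> / c) * X)\<^sup>2" using pos by (intro power_mono) auto
    then show ?thesis by (simp only: power_mult_distrib)
  qed
  then show "(\<Sum>i\<in>T. (\<Sum>j\<in>T'. G (i, j) / c * x j)\<^sup>2) \<le> (2 * \<tau> / c)\<^sup>2 * (\<Sum>j\<in>T'. (x j)\<^sup>2)"
    unfolding X2 Y2 .
qed

text \<open>First moment method for a uniform sign matrix. A weight of the form in
  \<open>bil_tail\<close> that exceeds 1 marks a violation at a net point; the mean of the sum of
  all weights, for both scales \<open>n\<close> and \<open>d\<close>, is below 1, so some matrix has
  no violation at all.\<close>

theorem exists_spread_matrix: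
  fixes n d :: nat and \<eta> :: real
  assumes n: "n \<ge> 2" and d: "d > 0" "d \<le> n" and \<eta>: "\<eta> > 0" "\<eta>\<^sup>2 * real n \<ge> real d * ln (real n) + 1"
  shows "\<exists>M. nrm_le {..<n} {..<n} M 1 \<and>
     (\<forall>T T'. T \<subseteq> {..<n} \<longrightarrow> T' \<subseteq> {..<n} \<longrightarrow> card T \<le> d \<longrightarrow> card T' \<le> d \<longrightarrow> nrm_le T T' M \<eta>) \<and>
     (\<forall>i<n. \<forall>j<n. (M i j)\<^sup>2 = (1/400) / real n)"
proof -
  let ?I = "{..<n} \<times> {..<n}"
  define \<tau>1 where "\<tau>1 = 10 * sqrt (real n)"
  define \<tau>2 where "\<tau>2 = 10 * \<eta> * sqrt (real n)"
  define w where "w s \<tau> k k' G = exp ((\<tau> / (16 * real s)) * (bil n G (\<lambda>i. of_int (k i)) (\<lambda>i. of_int (k' i)) - 16 * real s * \<tau>))"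
    for s :: nat and \<tau> and k k' :: "nat \<Rightarrow> int" and G
  define W where "W s \<tau> G = (\<Sum>k\<in>net n s. \<Sum>k'\<in>net n s. w s \<tau> k k' G)" for s \<tau> G
  have EW: "E ?I (W s \<tau>) \<le> (real (card (net n s)))\<^sup>2 * exp (- \<tau>\<^sup>2 / 2)" if "s > 0" "\<tau> \<ge> 0" for s \<tau>
  proof -
    have "E ?I (W s \<tau>) \<le> (\<Sum>k\<in>net n s. \<Sum>k'\<in>net n s. exp (- \<tau>\<^sup>2 / 2))"
      unfolding W_def E_sum w_def using bil_tail that by (intro sum_mono) auto
    then show ?thesis by (simp add: power2_eq_square)
  qed
  have expsq: "(exp a)\<^sup>2 * exp c = exp (2 * a + c)" for a c :: real
    by (simp only: power2_eq_square exp_add mult_2)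
  have ln2: "exp (1::real) \<ge> 2" using exp_ge_add_one_self[of 1] by simp
  \<comment> \<open>The squared size of the net is at most \<open>exp (36 * n)\<close>, against a
    tail of \<open>exp (- 50 * n)\<close>.\<close>
  have W1: "E ?I (W n \<tau>1) < 1/2"
  proof -
    have "real (card (net n n)) \<le> 2 ^ (16 * n) * (1 + 4 / 2) ^ n" by (rule card_net) simp
    also have "\<dots> = (2 ^ 16 * 3) ^ n" by (simp add: power_mult) (simp flip: power_mult_distrib)
    also have "\<dots> \<le> (2 ^ 18) ^ n" by (intro power_mono) auto
    also have "\<dots> \<le> ((exp 1) ^ 18) ^ n" using ln2 by (intro power_mono) auto
    also have "\<dots> = exp (18 * real n)" by (simp add: exp_of_nat_mult[symmetric] power_mult[symmetric])
    finally have c: "(real (card (net n n)))\<^sup>2 \<le> (exp (18 * real n))\<^sup>2" by (intro power_mono) auto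
    have "E ?I (W n \<tau>1) \<le> (real (card (net n n)))\<^sup>2 * exp (- \<tau>1\<^sup>2 / 2)"
      using n by (intro EW) (auto simp: \<tau>1_def)
    also have "\<dots> \<le> (exp (18 * real n))\<^sup>2 * exp (- \<tau>1\<^sup>2 / 2)" using c by (intro mult_right_mono) auto
    also have "\<dots> = exp (36 * real n - 50 * real n)"
      unfolding expsq using n by (simp add: \<tau>1_def power_mult_distrib)
    also have "\<dots> \<le> exp (- 2)" using n by simp
    also have "\<dots> < 1/2" using exp_ge_add_one_self[of 2] by (simp add: exp_minus inverse_eq_divide divide_simps)
    finally show ?thesis .
  qed
  \<comment> \<open>With \<open>b = n\<close> the second factor of \<open>card_net\<close> is at
    most \<open>exp 4\<close>. The hypothesis on \<eta> makes \<open>50 * \<eta>\<^sup>2 * n\<close>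
    exceed \<open>32 * d * ln n + 8\<close> by more than 2.\<close>
  have W2: "E ?I (W d \<tau>2) < 1/2"
  proof -
    have "real (card (net n d)) \<le> real n ^ (16 * d) * (1 + 4 / real n) ^ n" using n by (intro card_net) simp
    also have "(1 + 4 / real n) ^ n \<le> exp (4 / real n) ^ n" using n by (intro power_mono) auto
    also have "\<dots> = exp 4" using n by (simp add: exp_of_nat_mult[symmetric])
    also have "real n ^ (16 * d) * exp 4 = exp (16 * real d * ln (real n) + 4)"
    proof -
      have "real n ^ (16 * d) = exp (ln (real n)) ^ (16 * d)" using n by simp
      also have "\<dots> = exp (16 * real d * ln (real n))" by (simp add: exp_of_nat_mult[symmetric] del: exp_ln)
      finally show ?thesis by (simp add: exp_add)
    qed
    finally have c: "(real (card (net n d)))\<^sup>2 \<le> (exp (16 * real d * ln (real n) + 4))\<^sup>2"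
      using n by (intro power_mono) (auto simp: mult_left_mono)
    have "E ?I (W d \<tau>2) \<le> (real (card (net n d)))\<^sup>2 * exp (- \<tau>2\<^sup>2 / 2)"
      using d \<eta> by (intro EW) (auto simp: \<tau>2_def)
    also have "\<dots> \<le> (exp (16 * real d * ln (real n) + 4))\<^sup>2 * exp (- \<tau>2\<^sup>2 / 2)" using c by (intro mult_right_mono) auto
    also have "\<dots> = exp (32 * (real d * ln (real n)) + 8 - 50 * (\<eta>\<^sup>2 * real n))"
      unfolding expsq using n by (simp add: \<tau>2_def power_mult_distrib)
    also have "\<dots> \<le> exp (- 2)"
    proof -
      have "real d * ln (real n) \<ge> 0" using n by simp
      then show ?thesis using \<eta>(2) by simp
    qed
    also have "\<dots> < 1/2" using exp_ge_add_one_self[of 2] by (simp add: exp_minus inverse_eq_divide divide_simps)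
    finally show ?thesis .
  qed
  have "\<exists>G\<in>sgns ?I. W n \<tau>1 G + W d \<tau>2 G < 1"
  proof (rule ccontr)
    assume "\<not> ?thesis"
    then have "E ?I (\<lambda>_. 1) \<le> E ?I (\<lambda>G. W n \<tau>1 G + W d \<tau>2 G)" by (intro E_mono) (auto simp: not_less)
    then show False using W1 W2 by (simp add: E_const E_add)
  qed
  then obtain G where G: "G \<in> sgns ?I" "W n \<tau>1 G + W d \<tau>2 G < 1" by blast
  have Wpos: "W s \<tau> G \<ge> 0" for s \<tau> unfolding W_def w_def by (intro sum_nonneg) auto
  have nb: "bil n G (\<lambda>i. of_int (k i)) (\<lambda>i. of_int (k' i)) \<le> 16 * real s * \<tau>"
    if "W s \<tau> G < 1" "s > 0" "\<tau> > 0" "k \<in> net n s" "k' \<in> net n s" for s \<tau> k k'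
  proof -
    have "w s \<tau> k k' G \<le> (\<Sum>k'\<in>net n s. w s \<tau> k k' G)"
      using that finite_net by (intro member_le_sum) (auto simp: w_def)
    also have "\<dots> \<le> W s \<tau> G"
      unfolding W_def using that finite_net by (intro member_le_sum) (auto simp: w_def intro!: sum_nonneg)
    finally have "w s \<tau> k k' G < 1" using that by simp
    then show ?thesis using that by (simp add: w_def mult_less_0_iff divide_less_0_iff)
  qed
  have Gabs: "\<bar>G p\<bar> \<le> 1" if "p \<in> ?I" for p using sgns_val[OF G(1) that] by auto
  have lt: "W n \<tau>1 G < 1" "W d \<tau>2 G < 1" using G(2) Wpos[of n \<tau>1] Wpos[of d \<tau>2] by linarith+
  have pos: "\<tau>1 > 0" "\<tau>2 > 0" using n \<eta> by (auto simp: \<tau>1_def \<tau>2_def)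
  \<comment> \<open>Normalizes the bound \<open>2 * \<tau>1\<close> on the full norm to 1, which
    turns \<open>2 * \<tau>2\<close> into \<eta> and the squared entries into
    \<open>1 / (400 * n)\<close>.\<close>
  define c where "c = 20 * sqrt (real n)"
  have c: "c > 0" "2 * \<tau>1 / c = 1" "2 * \<tau>2 / c = \<eta>" using n by (auto simp: c_def \<tau>1_def \<tau>2_def)
  define M where "M i j = G (i, j) / c" for i j
  have 1: "nrm_le {..<n} {..<n} M 1"
    using net_nrm_le[of n n G \<tau>1 "{..<n}" "{..<n}" c] nb[OF lt(1) _ pos(1)] n Gabs c by (simp add: M_def[abs_def])
  have 2: "nrm_le T T' M \<eta>" if "T \<subseteq> {..<n}" "T' \<subseteq> {..<n}" "card T \<le> d" "card T' \<le> d" for T T'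
    using net_nrm_le[of n d G \<tau>2 T T' c] nb[OF lt(2) _ pos(2)] that d Gabs c by (simp add: M_def[abs_def])
  have 3: "(M i j)\<^sup>2 = (1/400) / real n" if "i < n" "j < n" for i j
  proof -
    have "(G (i, j))\<^sup>2 = 1" using sgns_val[OF G(1), of "(i, j)"] that by auto
    then show ?thesis by (simp add: M_def power_divide c_def power_mult_distrib)
  qed
  from 1 2 3 show ?thesis by blast
qed

section \<open>Quantum protocols from input-dependent phases\<close>

fun bitrev :: "nat \<Rightarrow> nat \<Rightarrow> nat" where
  "bitrev 0 j = 0"
| "bitrev (Suc s) j = 2 ^ s * (j mod 2) + bitrev s (j div 2)"

lemma bitrev_less: "j < 2 ^ s \<Longrightarrow> bitrev s j < 2 ^ s"
proof (induction s arbitrary: j)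
  case (Suc s)
  then have "bitrev s (j div 2) < 2 ^ s" by auto
  moreover have "2 ^ s * (j mod 2) \<le> 2 ^ s * 1" by (intro mult_left_mono) auto
  ultimately show ?case unfolding bitrev.simps power_Suc by linarith
qed simp

lemma bitrev_high: "r < 2 ^ s \<Longrightarrow> e < 2 \<Longrightarrow> bitrev (Suc s) (2 ^ s * e + r) = 2 * bitrev s r + e"
proof (induction s arbitrary: r)
  case (Suc s)
  have d: "(2 ^ Suc s * e + r) div 2 = 2 ^ s * e + r div 2" "(2 ^ Suc s * e + r) mod 2 = r mod 2"
    by (simp_all add: mult.assoc)
  have "bitrev (Suc (Suc s)) (2 ^ Suc s * e + r) = 2 ^ Suc s * (r mod 2) + bitrev (Suc s) (2 ^ s * e + r div 2)"
    by (simp only: bitrev.simps(2)[of "Suc s"] d)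
  also have "bitrev (Suc s) (2 ^ s * e + r div 2) = 2 * bitrev s (r div 2) + e"
    using Suc by auto
  finally show ?case by simp
qed (auto simp: less_2_cases_iff)

lemma bitrev_bitrev: "j < 2 ^ s \<Longrightarrow> bitrev s (bitrev s j) = j"
proof (induction s arbitrary: j)
  case (Suc s)
  then have j: "j div 2 < 2 ^ s" by auto
  have "bitrev (Suc s) (bitrev (Suc s) j) = bitrev (Suc s) (2 ^ s * (j mod 2) + bitrev s (j div 2))" by simp
  also have "\<dots> = 2 * bitrev s (bitrev s (j div 2)) + j mod 2"
    using bitrev_less[OF j] by (intro bitrev_high) auto
  also have "\<dots> = j" using Suc.IH[OF j] by simp
  finally show ?case .
qed simp

text \<open>The register during its transfer, with \<open>p\<close> qubits left at Alice. Qubits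
  leave and arrive at the least significant end, so Bob's part is in reversed order:
  \<open>2 ^ q * i + bitrev q j\<close> is the original basis state.\<close>

definition stA :: "(nat \<Rightarrow> real) \<Rightarrow> nat \<Rightarrow> nat \<Rightarrow> complex mat" where
  "stA \<phi> p q = mat (2 ^ p) (2 ^ q) (\<lambda>(i, j). complex_of_real (\<phi> (2 ^ q * i + bitrev q j)))"

definition stB :: "(nat \<Rightarrow> real) \<Rightarrow> nat \<Rightarrow> nat \<Rightarrow> complex mat" where
  "stB \<omega> p q = mat (2 ^ p) (2 ^ q) (\<lambda>(i, j). complex_of_real (\<omega> (2 ^ p * j + bitrev p i)))"

lemma stA_step: "qubit_to_bob (stA \<phi> (Suc p) q) = stA \<phi> p (Suc q)"
proof (rule eq_matI)
  fix i j assume ij: "i < dim_row (stA \<phi> p (Suc q))" "j < dim_col (stA \<phi> p (Suc q))"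
  then have b: "i < 2 ^ p" "j < 2 * 2 ^ q" by (simp_all add: stA_def)
  then have "2 * i + j mod 2 < 2 * 2 ^ p" "j div 2 < 2 ^ q" by auto
  then show "qubit_to_bob (stA \<phi> (Suc p) q) $$ (i, j) = stA \<phi> p (Suc q) $$ (i, j)"
    using b by (simp add: qubit_to_bob_def stA_def algebra_simps)
qed (simp_all add: qubit_to_bob_def stA_def)

lemma stB_step: "qubit_to_alice (stB \<omega> p (Suc q)) = stB \<omega> (Suc p) q"
proof (rule eq_matI)
  fix i j assume ij: "i < dim_row (stB \<omega> (Suc p) q)" "j < dim_col (stB \<omega> (Suc p) q)"
  then have b: "j < 2 ^ q" "i < 2 * 2 ^ p" by (simp_all add: stB_def)
  then have "2 * j + i mod 2 < 2 * 2 ^ q" "i div 2 < 2 ^ p" by auto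
  then show "qubit_to_alice (stB \<omega> p (Suc q)) $$ (i, j) = stB \<omega> (Suc p) q $$ (i, j)"
    using b by (simp add: qubit_to_alice_def stB_def algebra_simps)
qed (simp_all add: qubit_to_alice_def stB_def)

primrec sendsA :: "nat \<Rightarrow> qprotocol \<Rightarrow> qprotocol" where
  "sendsA 0 P = P"
| "sendsA (Suc s) P = ASend (\<lambda>_. 1\<^sub>m (2 ^ Suc s)) (sendsA s P)"

primrec sendsB :: "nat \<Rightarrow> qprotocol \<Rightarrow> qprotocol" where
  "sendsB 0 P = P"
| "sendsB (Suc s) P = BSend (\<lambda>_. 1\<^sub>m (2 ^ Suc s)) (sendsB s P)"

lemma qprob_sendsA: "qprob (sendsA s P) x y (stA \<phi> s t) v = qprob P x y (stA \<phi> 0 (s + t)) v"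
proof (induction s arbitrary: t)
  case (Suc s)
  have "1\<^sub>m (2 ^ Suc s) * stA \<phi> (Suc s) t = stA \<phi> (Suc s) t"
    by (rule left_mult_one_mat[where nc="2 ^ t"]) (simp add: stA_def)
  then show ?case using Suc[of "Suc t"] by (simp add: stA_step del: power_Suc)
qed simp

lemma qprob_sendsB: "qprob (sendsB s P) x y (stB \<omega> t s) v = qprob P x y (stB \<omega> (s + t) 0) v"
proof (induction s arbitrary: t)
  case (Suc s)
  have "stB \<omega> t (Suc s) * (1\<^sub>m (2 ^ Suc s))\<^sup>T = stB \<omega> t (Suc s)"
    unfolding transpose_one by (rule right_mult_one_mat[where nr="2 ^ t"]) (simp add: stB_def)
  then show ?case using Suc[of "Suc t"] by (simp add: stB_step del: power_Suc)
qed simp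

lemma one_unitary: "1\<^sub>m d \<in> unitary_mats d"
  by (simp add: unitary_mats_def mat_adjoint_def) (auto intro!: eq_matI simp: mat_of_rows_def)

lemma qvalid_sendsA: "qvalid N 0 (s + t) P \<Longrightarrow> qvalid N s t (sendsA s P)"
  by (induction s arbitrary: t) (simp_all add: one_unitary del: power_Suc)

lemma qvalid_sendsB: "qvalid N (s + t) 0 P \<Longrightarrow> qvalid N t s (sendsB s P)"
  by (induction s arbitrary: t) (simp_all add: one_unitary del: power_Suc)

lemma qcost_sends: "qcost (sendsA s P) = s + qcost P" "qcost (sendsB s P) = s + qcost P"
  by (induction s) simp_all

section \<open>Round trips of a register with real orthogonal matrices\<close>

definition cmat :: "nat \<Rightarrow> (nat \<Rightarrow> nat \<Rightarrow> real) \<Rightarrow> complex mat" where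
  "cmat d u = mat d d (\<lambda>(i, j). complex_of_real (u i j))"

definition orth :: "'i set \<Rightarrow> ('i \<Rightarrow> 'i \<Rightarrow> real) \<Rightarrow> bool" where
  "orth I u \<longleftrightarrow> (\<forall>i\<in>I. \<forall>j\<in>I. (\<Sum>k\<in>I. u i k * u j k) = (if i = j then 1 else 0) \<and>
                              (\<Sum>k\<in>I. u k i * u k j) = (if i = j then 1 else 0))"

lemma mat_adjoint_index:
  fixes A :: "complex mat"
  assumes "i < dim_col A" "j < dim_row A"
  shows "mat_adjoint A $$ (i, j) = cnj (A $$ (j, i))"
  using assms by (simp add: mat_adjoint_def mat_of_rows_def)

lemma cmat_unitary:
  assumes "orth {..<d} u"
  shows "cmat d u \<in> unitary_mats d"
proof -
  have dims: "dim_row (mat_adjoint (cmat d u)) = d" "dim_col (mat_adjoint (cmat d u)) = d"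
    by (simp_all add: mat_adjoint_def cmat_def)
  have idx: "mat_adjoint (cmat d u) $$ (i, j) = complex_of_real (u j i)" if "i < d" "j < d" for i j
    using that by (subst mat_adjoint_index) (simp_all add: cmat_def)
  have "mat_adjoint (cmat d u) * cmat d u = 1\<^sub>m d"
  proof (rule eq_matI)
    fix i j assume ij: "i < dim_row (1\<^sub>m d)" "j < dim_col (1\<^sub>m d)"
    then have "(mat_adjoint (cmat d u) * cmat d u) $$ (i, j) = complex_of_real (\<Sum>k<d. u k i * u k j)"
      using dims idx by (simp add: scalar_prod_def cmat_def lessThan_atLeast0)
    then show "(mat_adjoint (cmat d u) * cmat d u) $$ (i, j) = 1\<^sub>m d $$ (i, j)"
      using assms ij by (simp add: orth_def del: of_real_sum of_real_mult)
  qed (simp_all add: dims, simp add: cmat_def)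
  moreover have "cmat d u * mat_adjoint (cmat d u) = 1\<^sub>m d"
  proof (rule eq_matI)
    fix i j assume ij: "i < dim_row (1\<^sub>m d)" "j < dim_col (1\<^sub>m d)"
    then have "(cmat d u * mat_adjoint (cmat d u)) $$ (i, j) = complex_of_real (\<Sum>k<d. u i k * u j k)"
      using dims idx by (simp add: scalar_prod_def cmat_def lessThan_atLeast0)
    then show "(cmat d u * mat_adjoint (cmat d u)) $$ (i, j) = 1\<^sub>m d $$ (i, j)"
      using assms ij by (simp add: orth_def del: of_real_sum of_real_mult)
  qed (simp_all add: dims, simp add: cmat_def)
  ultimately show ?thesis by (simp add: unitary_mats_def cmat_def)
qed

lemma cmat_mult_stA:
  "cmat (2 ^ a) u * stA \<psi> a 0 = stA (\<lambda>i. \<Sum>j<2 ^ a. u i j * \<psi> j) a 0"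
  by (rule eq_matI) (simp_all add: cmat_def stA_def scalar_prod_def lessThan_atLeast0)

lemma diag_orth:
  fixes d :: nat
  assumes "\<And>i. i < d \<Longrightarrow> \<theta> i = 1 \<or> \<theta> i = (-1 :: real)"
  shows "orth {..<d} (\<lambda>i j. if i = j then \<theta> i else 0)"
proof -
  have "\<theta> i * \<theta> i = 1" if "i < d" for i using assms[OF that] by auto
  moreover have "(\<Sum>k<d. (if i = k then \<theta> i else 0) * (if j = k then \<theta> j else 0)) = (if i = j then \<theta> i * \<theta> i else 0)"
      "(\<Sum>k<d. (if k = i then \<theta> k else 0) * (if k = j then \<theta> k else 0)) = (if i = j then \<theta> i * \<theta> i else 0)"
    if "i < d" "j < d" for i j
  proof -
    have "(if i = k then \<theta> i else 0) * (if j = k then \<theta> j else 0) = (if k = i then if i = j then \<theta> i * \<theta> i else 0 else 0)"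
      "(if k = i then \<theta> k else 0) * (if k = j then \<theta> k else 0) = (if k = i then if i = j then \<theta> i * \<theta> i else 0 else 0)" for k
      by auto
    then show "(\<Sum>k<d. (if i = k then \<theta> i else 0) * (if j = k then \<theta> j else 0)) = (if i = j then \<theta> i * \<theta> i else 0)"
      "(\<Sum>k<d. (if k = i then \<theta> k else 0) * (if k = j then \<theta> k else 0)) = (if i = j then \<theta> i * \<theta> i else 0)"
      using that by simp_all
  qed
  ultimately show ?thesis by (simp add: orth_def)
qed

text \<open>Bob receives the qubits in reversed order, so the phase of the original basis state \<open>i\<close> sits
  at position \<open>bitrev a i\<close> of his register.\<close>

definition phase_mat :: "nat \<Rightarrow> (nat \<Rightarrow> real) \<Rightarrow> complex mat" where
  "phase_mat a \<theta> = cmat (2 ^ a) (\<lambda>i j. if i = j then \<theta> (bitrev a i) else 0)"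

lemma stA_mult_phase:
  "stA \<psi> 0 a * (phase_mat a \<theta>)\<^sup>T = stB (\<lambda>j. \<theta> (bitrev a j) * \<psi> (bitrev a j)) 0 a"
  by (rule eq_matI)
    (auto simp: phase_mat_def cmat_def stA_def stB_def scalar_prod_def if_distrib[of "\<lambda>t. _ * t"] if_distrib[of complex_of_real] cong: if_cong)

lemma stB_to_stA: "stB (\<lambda>j. \<psi> (bitrev a j)) a 0 = stA \<psi> a 0"
  by (rule eq_matI) (simp_all add: stB_def stA_def bitrev_bitrev)

text \<open>The sender's unitary is merged with the transfer of the first qubit of the register; the
  other \<open>a - 1\<close> qubits follow under identities.\<close>

fun proto :: "nat \<Rightarrow> (nat \<Rightarrow> sign_vec \<Rightarrow> nat \<Rightarrow> nat \<Rightarrow> real) \<Rightarrow> (nat \<Rightarrow> sign_vec \<Rightarrow> nat \<Rightarrow> real) \<Rightarrow> nat \<Rightarrow> nat \<Rightarrow> qprotocol" where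
  "proto a u \<theta> r 0 = ALast (\<lambda>x. cmat (2 ^ a) (u r x))"
| "proto a u \<theta> r (Suc t) = ASend (\<lambda>x. cmat (2 ^ a) (u r x)) (sendsA (a - 1)
     (BSend (\<lambda>y. phase_mat a (\<theta> r y)) (sendsB (a - 1) (proto a u \<theta> (Suc r) t))))"

fun evol :: "'i set \<Rightarrow> (nat \<Rightarrow> 'i \<Rightarrow> 'i \<Rightarrow> real) \<Rightarrow> (nat \<Rightarrow> 'i \<Rightarrow> real) \<Rightarrow> ('i \<Rightarrow> real) \<Rightarrow> nat \<Rightarrow> 'i \<Rightarrow> real" where
  "evol I u \<theta> \<psi> 0 = (\<lambda>i. \<Sum>j\<in>I. u 0 i j * \<psi> j)"
| "evol I u \<theta> \<psi> (Suc t) = (\<lambda>i. \<Sum>j\<in>I. u (Suc t) i j * (\<theta> t j * evol I u \<theta> \<psi> t j))"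

lemma evol_shift:
  "evol I u \<theta> \<psi> (Suc t) = evol I (\<lambda>r. u (Suc r)) (\<lambda>r. \<theta> (Suc r)) (\<lambda>i. \<theta> 0 i * (\<Sum>j\<in>I. u 0 i j * \<psi> j)) t"
  by (induction t) simp_all

lemma qcost_proto: "a \<ge> 1 \<Longrightarrow> qcost (proto a u \<theta> r t) = 2 * a * t + 1"
  by (induction t arbitrary: r) (simp_all add: qcost_sends)

lemma qvalid_proto:
  assumes "a \<ge> 1" "\<And>r x. x \<in> cube N \<Longrightarrow> orth {..<2 ^ a} (u r x)"
    "\<And>r y i. y \<in> cube N \<Longrightarrow> i < 2 ^ a \<Longrightarrow> \<theta> r y i = 1 \<or> \<theta> r y i = -1"
  shows "qvalid N a 0 (proto a u \<theta> r t)"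
proof (induction t arbitrary: r)
  case 0
  then show ?case using assms by (simp add: cmat_unitary)
next
  case (Suc t)
  have ph: "phase_mat a (\<theta> r y) \<in> unitary_mats (2 ^ a)" if "y \<in> cube N" for y
    unfolding phase_mat_def by (intro cmat_unitary diag_orth assms(3)[OF that] bitrev_less)
  have "qvalid N 1 (a - 1) (sendsB (a - 1) (proto a u \<theta> (Suc r) t))"
    by (rule qvalid_sendsB) (use assms(1) Suc in simp)
  then have "qvalid N 0 a (BSend (\<lambda>y. phase_mat a (\<theta> r y)) (sendsB (a - 1) (proto a u \<theta> (Suc r) t)))"
    using assms(1) ph by simp
  then have "qvalid N (a - 1) 1 (sendsA (a - 1) (BSend (\<lambda>y. phase_mat a (\<theta> r y)) (sendsB (a - 1) (proto a u \<theta> (Suc r) t))))"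
    using assms(1) by (intro qvalid_sendsA) simp
  then show ?case using assms(1,2) by (simp add: cmat_unitary)
qed

text \<open>The two reversals of a round trip cancel, so after each round Alice holds the register
  in the original order and the induction can start again from \<open>stA\<close>.\<close>

lemma qprob_proto:
  assumes a: "a \<ge> 1"
  shows "qprob (proto a u \<theta> r t) x y (stA \<psi> a 0) v
    = (\<Sum>i | i < 2 ^ a \<and> odd i = v. (evol {..<2 ^ a} (\<lambda>s. u (r + s) x) (\<lambda>s. \<theta> (r + s) y) \<psi> t i)\<^sup>2)"
proof (induction t arbitrary: r \<psi>)
  case 0
  obtain p where p: "a = Suc p" using a by (cases a) auto
  define \<phi> where "\<phi> i = (\<Sum>j<2 ^ a. u r x i j * \<psi> j)" for i
  have "qprob (proto a u \<theta> r 0) x y (stA \<psi> a 0) v = bob_qubit_prob (stA \<phi> p 1) v"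
    unfolding proto.simps qprob.simps cmat_mult_stA \<phi>_def[symmetric] unfolding p stA_step by simp
  also have "\<dots> = (\<Sum>i<2 ^ p. \<Sum>j | j < 2 \<and> odd j = v. (\<phi> (2 * i + j))\<^sup>2)"
    unfolding bob_qubit_prob_def
    by (intro sum.cong) (auto simp: stA_def norm_of_real less_2_cases_iff)
  also have "\<dots> = (\<Sum>(i, j)\<in>{..<2 ^ p} \<times> {j. j < 2 \<and> odd j = v}. (\<phi> (2 * i + j))\<^sup>2)"
    by (simp add: sum.cartesian_product)
  also have "\<dots> = (\<Sum>k | k < 2 ^ a \<and> odd k = v. (\<phi> k)\<^sup>2)"
    by (rule sum.reindex_bij_witness[of _ "\<lambda>k. (k div 2, k mod 2)" "\<lambda>(i, j). 2 * i + j"])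
       (auto simp: p)
  finally show ?case by (simp add: \<phi>_def)
next
  case (Suc t)
  obtain p where p: "a = Suc p" using a by (cases a) auto
  define \<phi> where "\<phi> i = (\<Sum>j<2 ^ a. u r x i j * \<psi> j)" for i
  have "qprob (proto a u \<theta> r (Suc t)) x y (stA \<psi> a 0) v
     = qprob (BSend (\<lambda>y. phase_mat a (\<theta> r y)) (sendsB (a - 1) (proto a u \<theta> (Suc r) t))) x y (stA \<phi> 0 a) v"
    unfolding proto.simps qprob.simps(3) cmat_mult_stA \<phi>_def[symmetric]
    using qprob_sendsA[of p _ x y \<phi> 1 v] by (simp add: p stA_step)
  also have "\<dots> = qprob (sendsB (a - 1) (proto a u \<theta> (Suc r) t)) x y (qubit_to_alice (stB (\<lambda>j. \<theta> r y (bitrev a j) * \<phi> (bitrev a j)) 0 a)) v"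
    unfolding qprob.simps(4) stA_mult_phase ..
  also have "\<dots> = qprob (proto a u \<theta> (Suc r) t) x y (stB (\<lambda>j. \<theta> r y (bitrev a j) * \<phi> (bitrev a j)) a 0) v"
    using qprob_sendsB[of p "proto a u \<theta> (Suc r) t" x y "\<lambda>j. \<theta> r y (bitrev a j) * \<phi> (bitrev a j)" 1 v]
    by (simp add: p stB_step del: bitrev.simps)
  also have "stB (\<lambda>j. \<theta> r y (bitrev a j) * \<phi> (bitrev a j)) a 0 = stA (\<lambda>i. \<theta> r y i * \<phi> i) a 0"
    by (rule stB_to_stA)
  finally show ?case
    unfolding Suc.IH evol_shift \<phi>_def by simp
qed

lemma init_state_stA: "init_state a 0 = stA (\<lambda>i. if i = 0 then 1 else 0) a 0"
  by (rule eq_matI) (auto simp: init_state_def stA_def)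

lemma evol_cong:
  assumes "\<And>r i j. i \<in> I \<Longrightarrow> j \<in> I \<Longrightarrow> u r i j = u' r i j" "\<And>r i. i \<in> I \<Longrightarrow> \<theta> r i = \<theta>' r i" "\<And>i. i \<in> I \<Longrightarrow> \<psi> i = \<psi>' i"
  shows "i \<in> I \<Longrightarrow> evol I u \<theta> \<psi> t i = evol I u' \<theta>' \<psi>' t i"
proof (induction t arbitrary: i)
  case 0
  then show ?case using assms by simp
next
  case (Suc t)
  then show ?case using assms(1,2) by (auto intro!: sum.cong)
qed

text \<open>Alice sends her whole register, Bob adds phases and sends it back. The lowest qubit stores \<open>acc\<close>.\<close>

theorem phase_protocol:
  fixes I :: "'i set" and u :: "nat \<Rightarrow> sign_vec \<Rightarrow> 'i \<Rightarrow> 'i \<Rightarrow> real" and acc :: "'i \<Rightarrow> bool"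
  assumes I: "finite I" "card I \<le> 2 ^ b" and i0: "i0 \<in> I" "\<not> acc i0"
    and u: "\<And>r x. x \<in> cube N \<Longrightarrow> orth I (u r x)"
    and \<theta>: "\<And>r y i. y \<in> cube N \<Longrightarrow> i \<in> I \<Longrightarrow> \<theta> r y i = 1 \<or> \<theta> r y i = (-1 :: real)"
  shows "\<exists>P. qvalid N (Suc b) 0 P \<and> qcost P = 2 * Suc b * t + 1 \<and>
     (\<forall>x y v. qprob P x y (init_state (Suc b) 0) v =
        (\<Sum>i | i \<in> I \<and> acc i = v. (evol I (\<lambda>r. u r x) (\<lambda>r. \<theta> r y) (\<lambda>i. if i = i0 then 1 else 0) t i)\<^sup>2))"
proof -
  have "\<exists>e. inj_on (e :: 'i \<Rightarrow> nat) I \<and> e ` I \<subseteq> {..<2 ^ b} \<and> e i0 = 0"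
  proof -
    obtain f where f: "bij_betw f I {0..<card I}" using ex_bij_betw_finite_nat[OF I(1)] by blast
    \<comment> \<open>A numbering of \<open>I\<close> modified by a transposition so that
      \<open>i0\<close> gets the number 0.\<close>
    define e where "e i = (if i = i0 then 0 else if f i = 0 then f i0 else f i)" for i
    have inj: "inj_on f I" and im: "f ` I = {0..<card I}" using f by (auto simp: bij_betw_def)
    have "inj_on e I"
    proof (rule inj_onI)
      fix i j assume "i \<in> I" "j \<in> I" "e i = e j"
      then show "i = j" using inj_onD[OF inj, of i j] inj_onD[OF inj, of i i0] inj_onD[OF inj, of j i0] i0(1)
        by (auto simp: e_def split: if_splits)
    qed
    moreover have "e ` I \<subseteq> {..<2 ^ b}"
    proof -
      have "f i < 2 ^ b" if "i \<in> I" for i using im that I(2) by (metis atLeastLessThan_iff imageI less_le_trans)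
      then show ?thesis using i0(1) by (auto simp: e_def)
    qed
    ultimately show ?thesis by (intro exI[of _ e]) (simp add: e_def)
  qed
  then obtain e :: "'i \<Rightarrow> nat" where e: "inj_on e I" "\<And>i. i \<in> I \<Longrightarrow> e i < 2 ^ b" "e i0 = 0" by blast
  define a where "a = Suc b"
  \<comment> \<open>As \<open>i0\<close> is not accepting, its code is 0, the initial basis
    state.\<close>
  define enc where "enc i = 2 * e i + (if acc i then 1 else 0)" for i
  have enc_inj: "inj_on enc I"
  proof (rule inj_onI)
    fix i j assume "i \<in> I" "j \<in> I" "enc i = enc j"
    moreover from this have "e i = e j" by (auto simp: enc_def split: if_splits dest: arg_cong[where f=odd])
    ultimately show "i = j" using inj_onD[OF e(1)] by blast
  qed
  have enc_less: "enc i < 2 ^ a" if "i \<in> I" for i using e(2)[OF that] by (auto simp: enc_def a_def)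
  have enc_odd: "odd (enc i) = acc i" for i by (simp add: enc_def)
  have enc0: "enc i0 = 0" using e i0 by (simp add: enc_def)
  define dec where "dec = the_inv_into I enc"
  have dec: "dec (enc i) = i" if "i \<in> I" for i unfolding dec_def using enc_inj that by (rule the_inv_into_f_f)
  \<comment> \<open>The codes need not exhaust the register; the identity on the other basis states
    keeps the matrix orthogonal and never mixes them with the codes.\<close>
  define ext where "ext (w :: 'i \<Rightarrow> 'i \<Rightarrow> real) m m' = (if m \<in> enc ` I \<and> m' \<in> enc ` I then w (dec m) (dec m') else if m = m' then 1 else 0)" for w m m'
  have sub: "enc ` I \<subseteq> {..<2 ^ a}" using enc_less by auto
  have sum_ext: "(\<Sum>k<2 ^ a. h k) = (\<Sum>k\<in>I. h (enc k)) + (\<Sum>k\<in>{..<2 ^ a} - enc ` I. h k)" for h :: "nat \<Rightarrow> real"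
    using sum.subset_diff[OF sub, of h] by (simp add: sum.reindex[OF enc_inj] add.commute)
  have ext_orth: "orth {..<2 ^ a} (ext w)" if w: "orth I w" for w
    unfolding orth_def
  proof (intro ballI)
    fix m m' :: nat assume m: "m \<in> {..<2 ^ a}" "m' \<in> {..<2 ^ a}"
    consider (in_in) i j where "i \<in> I" "j \<in> I" "m = enc i" "m' = enc j" | (out) "m \<notin> enc ` I \<or> m' \<notin> enc ` I"
      by blast
    then show "(\<Sum>k<2 ^ a. ext w m k * ext w m' k) = (if m = m' then 1 else 0) \<and> (\<Sum>k<2 ^ a. ext w k m * ext w k m') = (if m = m' then 1 else 0)"
    proof cases
      case in_in
      have 1: "(\<Sum>k\<in>{..<2 ^ a} - enc ` I. ext w m k * ext w m' k) = 0" "(\<Sum>k\<in>{..<2 ^ a} - enc ` I. ext w k m * ext w k m') = 0"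
        using in_in by (auto simp: ext_def intro!: sum.neutral)
      have 2: "(\<Sum>k\<in>I. ext w m (enc k) * ext w m' (enc k)) = (\<Sum>k\<in>I. w i k * w j k)"
        "(\<Sum>k\<in>I. ext w (enc k) m * ext w (enc k) m') = (\<Sum>k\<in>I. w k i * w k j)"
        using in_in by (auto simp: ext_def dec intro!: sum.cong)
      have "(m = m') = (i = j)" using in_in inj_onD[OF enc_inj] by auto
      then show ?thesis using w in_in unfolding sum_ext 1 2 by (simp add: orth_def)
    next
      case out
      have 1: "ext w m k * ext w m' k = (if k = m then if m = m' then 1 else 0 else 0)"
        "ext w k m * ext w k m' = (if k = m then if m = m' then 1 else 0 else 0)" if "m \<notin> enc ` I" for k
        using that by (auto simp: ext_def)
      have 2: "ext w m k * ext w m' k = (if k = m' then if m = m' then 1 else 0 else 0)"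
        "ext w k m * ext w k m' = (if k = m' then if m = m' then 1 else 0 else 0)" if "m' \<notin> enc ` I" for k
        using that by (auto simp: ext_def)
      from out show ?thesis
      proof
        assume *: "m \<notin> enc ` I"
        show ?thesis unfolding 1[OF *] using m by simp
      next
        assume *: "m' \<notin> enc ` I"
        show ?thesis unfolding 2[OF *] using m by simp
      qed
    qed
  qed
  define uu where "uu r x = ext (u r x)" for r x
  define tt where "tt r y m = (if m \<in> enc ` I then \<theta> r y (dec m) else 1)" for r y m
  have uu_at: "uu r x (enc i) (enc j) = u r x i j" if "i \<in> I" "j \<in> I" for r x i j
    using that by (simp add: uu_def ext_def dec)
  have uu_out: "m \<noteq> k \<Longrightarrow> uu r x m k = 0" if "m \<notin> enc ` I" for r x m k
    using that by (simp add: uu_def ext_def)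
  have tt_at: "tt r y (enc i) = \<theta> r y i" if "i \<in> I" for r y i using that by (simp add: tt_def dec)
  define e0 :: "nat \<Rightarrow> real" where "e0 m = (if m = 0 then 1 else 0)" for m
  define d0 :: "'i \<Rightarrow> real" where "d0 i = (if i = i0 then 1 else 0)" for i
  have ev: "(\<forall>i\<in>I. evol {..<2 ^ a} (\<lambda>r. uu r x) (\<lambda>r. tt r y) e0 s (enc i) = evol I (\<lambda>r. u r x) (\<lambda>r. \<theta> r y) d0 s i)
     \<and> (\<forall>m. m \<notin> enc ` I \<longrightarrow> m < 2 ^ a \<longrightarrow> evol {..<2 ^ a} (\<lambda>r. uu r x) (\<lambda>r. tt r y) e0 s m = 0)" for x y s
  proof (induction s)
    case 0
    have z: "e0 k = 0" if "k \<notin> enc ` I" for k using that i0 enc0 by (auto simp: e0_def)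
    have z': "e0 (enc k) = d0 k" if "k \<in> I" for k
    proof (cases "k = i0")
      case False
      then have "enc k \<noteq> 0" using that i0(1) inj_onD[OF enc_inj, of k i0] unfolding enc0[symmetric] by metis
      then show ?thesis using False by (simp add: e0_def d0_def)
    qed (simp add: e0_def d0_def enc0)
    have "(\<Sum>k<2 ^ a. uu 0 x (enc i) k * e0 k) = (\<Sum>j\<in>I. u 0 x i j * d0 j)" if "i \<in> I" for i
    proof -
      have "(\<Sum>k\<in>{..<2 ^ a} - enc ` I. uu 0 x (enc i) k * e0 k) = 0" using z by (intro sum.neutral) simp
      moreover have "(\<Sum>k\<in>I. uu 0 x (enc i) (enc k) * e0 (enc k)) = (\<Sum>j\<in>I. u 0 x i j * d0 j)"
        using that z' by (intro sum.cong) (simp_all add: uu_at)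
      ultimately show ?thesis unfolding sum_ext by simp
    qed
    moreover have "(\<Sum>k<2 ^ a. uu 0 x m k * e0 k) = 0" if "m \<notin> enc ` I" for m
    proof (rule sum.neutral, rule ballI)
      fix k show "uu 0 x m k * e0 k = 0"
        using that z[of k] uu_out[OF that, of k] by (cases "m = k") simp_all
    qed
    ultimately show ?case by simp
  next
    case (Suc s)
    let ?e = "evol {..<2 ^ a} (\<lambda>r. uu r x) (\<lambda>r. tt r y) e0 s"
    have "(\<Sum>k<2 ^ a. uu (Suc s) x (enc i) k * (tt s y k * ?e k)) = (\<Sum>j\<in>I. u (Suc s) x i j * (\<theta> s y j * evol I (\<lambda>r. u r x) (\<lambda>r. \<theta> r y) d0 s j))" if "i \<in> I" for i
    proof -
      have "(\<Sum>k\<in>{..<2 ^ a} - enc ` I. uu (Suc s) x (enc i) k * (tt s y k * ?e k)) = 0" using Suc.IH by (intro sum.neutral) simp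
      moreover have "(\<Sum>k\<in>I. uu (Suc s) x (enc i) (enc k) * (tt s y (enc k) * ?e (enc k)))
         = (\<Sum>j\<in>I. u (Suc s) x i j * (\<theta> s y j * evol I (\<lambda>r. u r x) (\<lambda>r. \<theta> r y) d0 s j))"
        using that Suc.IH by (intro sum.cong) (simp_all add: dec uu_at tt_at)
      ultimately show ?thesis unfolding sum_ext by simp
    qed
    moreover have "(\<Sum>k<2 ^ a. uu (Suc s) x m k * (tt s y k * ?e k)) = 0" if "m \<notin> enc ` I" "m < 2 ^ a" for m
    proof (rule sum.neutral, rule ballI)
      fix k assume "k \<in> {..<(2::nat) ^ a}"
      show "uu (Suc s) x m k * (tt s y k * ?e k) = 0"
        using that Suc.IH uu_out[OF that(1), of k] by (cases "m = k") simp_all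
    qed
    ultimately show ?case by simp
  qed
  have val: "qvalid N a 0 (proto a uu tt 0 t)"
  proof (rule qvalid_proto)
    show "orth {..<2 ^ a} (uu r x)" if "x \<in> cube N" for r x unfolding uu_def by (intro ext_orth u that)
    show "tt r y i = 1 \<or> tt r y i = - 1" if "y \<in> cube N" for r y i
      using \<theta>[OF that, of "dec i" r] dec by (cases "i \<in> enc ` I") (auto simp: tt_def)
  qed (simp add: a_def)
  have prob: "qprob (proto a uu tt 0 t) x y (init_state a 0) v =
        (\<Sum>i | i \<in> I \<and> acc i = v. (evol I (\<lambda>r. u r x) (\<lambda>r. \<theta> r y) d0 t i)\<^sup>2)" for x y v
  proof -
    have "qprob (proto a uu tt 0 t) x y (init_state a 0) v
       = (\<Sum>m | m < 2 ^ a \<and> odd m = v. (evol {..<2 ^ a} (\<lambda>r. uu r x) (\<lambda>r. tt r y) e0 t m)\<^sup>2)"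
      unfolding init_state_stA e0_def[symmetric] by (subst qprob_proto) (simp_all add: a_def)
    also have "\<dots> = (\<Sum>m\<in>enc ` {i. i \<in> I \<and> acc i = v}. (evol {..<2 ^ a} (\<lambda>r. uu r x) (\<lambda>r. tt r y) e0 t m)\<^sup>2)"
    proof (intro sum.mono_neutral_right ballI)
      show "enc ` {i. i \<in> I \<and> acc i = v} \<subseteq> {m. m < 2 ^ a \<and> odd m = v}" using enc_less enc_odd by auto
      fix m assume m: "m \<in> {m. m < 2 ^ a \<and> odd m = v} - enc ` {i. i \<in> I \<and> acc i = v}"
      then have "m \<notin> enc ` I" "m < 2 ^ a" using enc_odd by auto
      then show "(evol {..<2 ^ a} (\<lambda>r. uu r x) (\<lambda>r. tt r y) e0 t m)\<^sup>2 = 0" using ev[of x y t] by simp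
    qed simp
    also have "\<dots> = (\<Sum>i | i \<in> I \<and> acc i = v. (evol {..<2 ^ a} (\<lambda>r. uu r x) (\<lambda>r. tt r y) e0 t (enc i))\<^sup>2)"
      by (subst sum.reindex) (auto intro: inj_on_subset[OF enc_inj])
    also have "\<dots> = (\<Sum>i | i \<in> I \<and> acc i = v. (evol I (\<lambda>r. u r x) (\<lambda>r. \<theta> r y) d0 t i)\<^sup>2)"
      using ev[of x y t] by (intro sum.cong) auto
    finally show ?thesis .
  qed
  show ?thesis
    using val prob qcost_proto[of a uu tt 0 t] unfolding a_def d0_def[abs_def]
    by (intro exI[of _ "proto (Suc b) uu tt 0 t"]) simp
qed

section \<open>The walk along the chain as a quantum protocol\<close>

text \<open>The sum \<open>S\<close> of the rank-one matrices satisfies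
  \<open>S * S = 2 * S\<close>, hence subtracting it from the identity gives an involution that is
  also symmetric.\<close>

lemma reflection_orth:
  fixes W :: "'p \<Rightarrow> 'a \<Rightarrow> real"
  assumes A: "finite A" and P: "finite P"
    and W: "\<And>p p'. p \<in> P \<Longrightarrow> p' \<in> P \<Longrightarrow> (\<Sum>a\<in>A. W p a * W p' a) = (if p = p' then 2 else 0)"
  shows "orth A (\<lambda>a b. (if a = b then 1 else 0) - (\<Sum>p\<in>P. W p a * W p b))"
proof -
  define S where "S a b = (\<Sum>p\<in>P. W p a * W p b)" for a b
  have S_sym: "S a b = S b a" for a b by (simp add: S_def mult.commute)
  have SS: "(\<Sum>k\<in>A. S a k * S b k) = 2 * S a b" for a b
  proof -
    have "(\<Sum>k\<in>A. S a k * S b k) = (\<Sum>k\<in>A. \<Sum>p\<in>P. \<Sum>p'\<in>P. W p a * W p' b * (W p k * W p' k))"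
      by (simp add: S_def sum_product mult_ac)
    also have "\<dots> = (\<Sum>p\<in>P. \<Sum>p'\<in>P. W p a * W p' b * (\<Sum>k\<in>A. W p k * W p' k))"
      unfolding sum_distrib_left by (subst sum.swap, rule sum.cong[OF refl], rule sum.swap)
    also have "\<dots> = (\<Sum>p\<in>P. \<Sum>p'\<in>P. if p = p' then W p a * W p b * 2 else 0)"
      by (intro sum.cong refl) (simp add: W)
    also have "\<dots> = 2 * S a b" using P by (simp add: S_def sum_distrib_left mult_ac)
    finally show ?thesis .
  qed
  have main: "(\<Sum>k\<in>A. ((if a = k then 1 else 0) - S a k) * ((if b = k then 1 else 0) - S b k)) = (if a = b then 1 else 0)"
    if ab: "a \<in> A" "b \<in> A" for a b
  proof -
    have "(\<Sum>k\<in>A. ((if a = k then 1 else 0) - S a k) * ((if b = k then 1 else 0) - S b k))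
       = (\<Sum>k\<in>A. (if k = a then if a = b then 1 else 0 else 0) - (if k = a then S b a else 0) - (if k = b then S a b else 0) + S a k * S b k)"
      by (intro sum.cong refl) (auto simp: algebra_simps)
    also have "\<dots> = (if a = b then 1 else 0) - S b a - S a b + 2 * S a b"
      using ab A by (simp add: sum.distrib sum_subtractf SS)
    finally show ?thesis by (simp add: S_sym[of b a])
  qed
  have sym: "((if k = a then 1 else 0) - S k a) = ((if a = k then 1 else 0) - S a k)" for a k
    by (simp add: S_sym[of k a])
  show ?thesis
    unfolding orth_def S_def[symmetric] using main by (simp add: sym)
qed

lemma orth_prod:
  fixes R :: nat
  assumes I: "finite I" and u: "\<And>r. r < R \<Longrightarrow> orth I (u r)"
  shows "orth ({..<R} \<rightarrow>\<^sub>E I) (\<lambda>f h. \<Prod>r<R. u r (f r) (h r))"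
  unfolding orth_def
proof (intro ballI conjI)
  fix f h assume fh: "f \<in> {..<R} \<rightarrow>\<^sub>E I" "h \<in> {..<R} \<rightarrow>\<^sub>E I"
  then have mem: "f r \<in> I" "h r \<in> I" if "r < R" for r using that by auto
  have eq: "(\<Prod>r<R. if f r = h r then 1 else 0 :: real) = (if f = h then 1 else 0)"
  proof (cases "f = h")
    case False
    then obtain r where "r < R" "f r \<noteq> h r" using PiE_ext[OF fh] by blast
    then show ?thesis using False by (auto intro!: prod_zero)
  qed simp
  have "(\<Sum>k\<in>{..<R} \<rightarrow>\<^sub>E I. (\<Prod>r<R. u r (f r) (k r)) * (\<Prod>r<R. u r (h r) (k r)))
     = (\<Prod>r<R. \<Sum>k\<in>I. u r (f r) k * u r (h r) k)"
    using I by (subst prod_sum_PiE) (auto simp: prod.distrib)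
  also have "\<dots> = (\<Prod>r<R. if f r = h r then 1 else 0)"
    using u mem by (intro prod.cong refl) (auto simp: orth_def)
  finally show "(\<Sum>k\<in>{..<R} \<rightarrow>\<^sub>E I. (\<Prod>r<R. u r (f r) (k r)) * (\<Prod>r<R. u r (h r) (k r))) = (if f = h then 1 else 0)"
    unfolding eq .
  have "(\<Sum>k\<in>{..<R} \<rightarrow>\<^sub>E I. (\<Prod>r<R. u r (k r) (f r)) * (\<Prod>r<R. u r (k r) (h r)))
     = (\<Prod>r<R. \<Sum>k\<in>I. u r k (f r) * u r k (h r))"
    using I by (subst prod_sum_PiE) (auto simp: prod.distrib)
  also have "\<dots> = (\<Prod>r<R. if f r = h r then 1 else 0)"
    using u mem by (intro prod.cong refl) (auto simp: orth_def)
  finally show "(\<Sum>k\<in>{..<R} \<rightarrow>\<^sub>E I. (\<Prod>r<R. u r (k r) (f r)) * (\<Prod>r<R. u r (k r) (h r))) = (if f = h then 1 else 0)"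
    unfolding eq .
qed

lemma evol_prod:
  fixes R :: nat
  assumes I: "finite I"
  shows "f \<in> {..<R} \<rightarrow>\<^sub>E I \<Longrightarrow> evol ({..<R} \<rightarrow>\<^sub>E I) (\<lambda>s f h. \<Prod>r<R. u r s (f r) (h r)) (\<lambda>s f. \<Prod>r<R. \<theta> r s (f r)) (\<lambda>f. \<Prod>r<R. \<psi> r (f r)) t f
    = (\<Prod>r<R. evol I (u r) (\<theta> r) (\<psi> r) t (f r))"
proof (induction t arbitrary: f)
  case 0
  then show ?case using I by (subst (2) evol.simps, subst prod_sum_PiE) (auto simp: prod.distrib)
next
  case (Suc t)
  have "evol ({..<R} \<rightarrow>\<^sub>E I) (\<lambda>s f h. \<Prod>r<R. u r s (f r) (h r)) (\<lambda>s f. \<Prod>r<R. \<theta> r s (f r)) (\<lambda>f. \<Prod>r<R. \<psi> r (f r)) (Suc t) f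
     = (\<Sum>j\<in>{..<R} \<rightarrow>\<^sub>E I. \<Prod>r<R. u r (Suc t) (f r) (j r) * (\<theta> r t (j r) * evol I (u r) (\<theta> r) (\<psi> r) t (j r)))"
    unfolding evol.simps(2) using Suc.IH by (intro sum.cong refl) (simp add: prod.distrib)
  also have "\<dots> = (\<Prod>r<R. \<Sum>j\<in>I. u r (Suc t) (f r) j * (\<theta> r t j * evol I (u r) (\<theta> r) (\<psi> r) t j))"
    using I by (subst prod_sum_PiE) auto
  finally show ?case by simp
qed

lemma orth_norm:
  assumes I: "finite I" and u: "orth I u"
  shows "(\<Sum>i\<in>I. (\<Sum>j\<in>I. u i j * c j)\<^sup>2) = (\<Sum>j\<in>I. (c j)\<^sup>2)"
proof -
  have "(\<Sum>i\<in>I. (\<Sum>j\<in>I. u i j * c j)\<^sup>2) = (\<Sum>i\<in>I. \<Sum>j\<in>I. \<Sum>j'\<in>I. c j * c j' * (u i j * u i j'))"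
    by (simp add: power2_eq_square sum_product mult_ac)
  also have "\<dots> = (\<Sum>j\<in>I. \<Sum>j'\<in>I. c j * c j' * (\<Sum>i\<in>I. u i j * u i j'))"
    unfolding sum_distrib_left by (subst sum.swap, rule sum.cong[OF refl], rule sum.swap)
  also have "\<dots> = (\<Sum>j\<in>I. \<Sum>j'\<in>I. if j = j' then c j * c j else 0)"
    using u by (intro sum.cong refl) (auto simp: orth_def)
  also have "\<dots> = (\<Sum>j\<in>I. (c j)\<^sup>2)" using I by (simp add: power2_eq_square)
  finally show ?thesis .
qed

lemma evol_norm:
  assumes I: "finite I" and u: "\<And>s. orth I (u s)" and \<theta>: "\<And>s i. i \<in> I \<Longrightarrow> \<theta> s i = 1 \<or> \<theta> s i = -1"
  shows "(\<Sum>i\<in>I. (evol I u \<theta> \<psi> t i)\<^sup>2) = (\<Sum>i\<in>I. (\<psi> i)\<^sup>2)"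
proof (induction t)
  case 0
  show ?case using orth_norm[OF I u] by simp
next
  case (Suc t)
  have "(\<Sum>i\<in>I. (evol I u \<theta> \<psi> (Suc t) i)\<^sup>2) = (\<Sum>j\<in>I. (\<theta> t j * evol I u \<theta> \<psi> t j)\<^sup>2)"
    unfolding evol.simps(2) by (rule orth_norm[OF I u])
  also have "\<dots> = (\<Sum>j\<in>I. (evol I u \<theta> \<psi> t j)\<^sup>2)"
  proof (intro sum.cong refl)
    fix i assume "i \<in> I"
    then show "(\<theta> t i * evol I u \<theta> \<psi> t i)\<^sup>2 = (evol I u \<theta> \<psi> t i)\<^sup>2" using \<theta>[of i t] by auto
  qed
  finally show ?case using Suc by simp
qed

section \<open>A register for Alice's blocks\<close>

definition cmul :: "nat \<Rightarrow> sign_vec \<Rightarrow> sign_vec \<Rightarrow> sign_vec" where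
  "cmul b w v = (\<lambda>j\<in>{..<b}. w j * v j)"

lemma cmul_in: "w \<in> cube b \<Longrightarrow> v \<in> cube b \<Longrightarrow> cmul b w v \<in> cube b"
  unfolding cube_def cmul_def restrict_PiE_iff by (force simp: PiE_iff)

lemma cmul_cancel: "w \<in> cube b \<Longrightarrow> v \<in> cube b \<Longrightarrow> cmul b (cmul b w v) v = w"
proof (rule ext)
  fix j assume w: "w \<in> cube b" and v: "v \<in> cube b"
  show "cmul b (cmul b w v) v j = w j"
  proof (cases "j < b")
    case True
    then have "v j = -1 \<or> v j = 1" using v by (auto simp: cube_def)
    then show ?thesis using True by (auto simp: cmul_def)
  next
    case False
    then show ?thesis using w by (auto simp: cmul_def cube_def PiE_iff extensional_def)
  qed
qed

lemma finite_cube: "finite (cube b)" by (auto simp: cube_def intro!: finite_PiE)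

lemma card_cube: "card (cube b) = 2 ^ b"
  unfolding cube_def by (subst card_PiE) (auto simp: numeral_2_eq_2)

lemma cmul_eq_iff: "w \<in> cube b \<Longrightarrow> v \<in> cube b \<Longrightarrow> w' \<in> cube b \<Longrightarrow> cmul b w v = w' \<longleftrightarrow> w = cmul b w' v"
  using cmul_cancel by metis

lemma cmul_same_iff: "w \<in> cube b \<Longrightarrow> w' \<in> cube b \<Longrightarrow> v \<in> cube b \<Longrightarrow> cmul b w v = cmul b w' v \<longleftrightarrow> w = w'"
  using cmul_cancel by metis

text \<open>Alongside the walk on \<open>A\<close>, the register is switched from \<open>s\<close> of the old position to \<open>s'\<close> of
  the new one.\<close>

definition regmat :: "nat \<Rightarrow> ('a \<Rightarrow> sign_vec) \<Rightarrow> ('a \<Rightarrow> sign_vec) \<Rightarrow> ('a \<Rightarrow> 'a \<Rightarrow> real) \<Rightarrow> 'a \<times> sign_vec \<Rightarrow> 'a \<times> sign_vec \<Rightarrow> real" where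
  "regmat b s' s u = (\<lambda>(a, w) (a', w'). u a a' * (if cmul b w (s' a) = cmul b w' (s a') then 1 else 0))"

text \<open>For fixed positions the register part is a permutation. In the product of two rows, the
  condition that both hit the same register content does not depend on the intermediate position, so
  the sum over positions reduces to orthogonality of \<open>u\<close>.\<close>

lemma regmat_orth:
  assumes A: "finite A" and u: "orth A u" and s: "\<And>a. a \<in> A \<Longrightarrow> s a \<in> cube b" "\<And>a. a \<in> A \<Longrightarrow> s' a \<in> cube b"
  shows "orth (A \<times> cube b) (regmat b s' s u)"
proof -
  have row: "(\<Sum>(c, v)\<in>A \<times> cube b. (u a c * (if cmul b w (s' a) = cmul b v (s c) then 1 else 0)) * (u a' c * (if cmul b w' (s' a') = cmul b v (s c) then 1 else 0)))
      = (if (a, w) = (a', w') then 1 else 0)"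
    if u: "\<And>a a'. a \<in> A \<Longrightarrow> a' \<in> A \<Longrightarrow> (\<Sum>c\<in>A. u a c * u a' c) = (if a = a' then 1 else 0)"
      and s: "\<And>a. a \<in> A \<Longrightarrow> s a \<in> cube b" "\<And>a. a \<in> A \<Longrightarrow> s' a \<in> cube b"
      and m: "a \<in> A" "a' \<in> A" "w \<in> cube b" "w' \<in> cube b" for u :: "'a \<Rightarrow> 'a \<Rightarrow> real" and s s' a a' w w'
  proof -
    have inner: "(\<Sum>v\<in>cube b. (u a c * (if cmul b w (s' a) = cmul b v (s c) then 1 else 0)) * (u a' c * (if cmul b w' (s' a') = cmul b v (s c) then 1 else 0)))
       = u a c * u a' c * (if cmul b w (s' a) = cmul b w' (s' a') then 1 else 0)" if c: "c \<in> A" for c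
    proof -
      have "(\<Sum>v\<in>cube b. (u a c * (if cmul b w (s' a) = cmul b v (s c) then 1 else 0)) * (u a' c * (if cmul b w' (s' a') = cmul b v (s c) then 1 else 0)))
        = (\<Sum>v\<in>cube b. if v = cmul b (cmul b w (s' a)) (s c) then u a c * u a' c * (if cmul b w (s' a) = cmul b w' (s' a') then 1 else 0) else 0)"
      proof (intro sum.cong refl)
        fix v assume v: "v \<in> cube b"
        have "cmul b w (s' a) = cmul b v (s c) \<longleftrightarrow> v = cmul b (cmul b w (s' a)) (s c)"
          "cmul b w' (s' a') = cmul b v (s c) \<longleftrightarrow> v = cmul b (cmul b w' (s' a')) (s c)"
          unfolding cmul_eq_iff[OF v s(1)[OF c] cmul_in[OF m(3) s(2)[OF m(1)]], symmetric]
            cmul_eq_iff[OF v s(1)[OF c] cmul_in[OF m(4) s(2)[OF m(2)]], symmetric] by (rule eq_commute)+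
        moreover have "cmul b (cmul b w (s' a)) (s c) = cmul b (cmul b w' (s' a')) (s c) \<longleftrightarrow> cmul b w (s' a) = cmul b w' (s' a')"
          using m s c by (intro cmul_same_iff cmul_in) auto
        ultimately show "(u a c * (if cmul b w (s' a) = cmul b v (s c) then 1 else 0)) * (u a' c * (if cmul b w' (s' a') = cmul b v (s c) then 1 else 0))
           = (if v = cmul b (cmul b w (s' a)) (s c) then u a c * u a' c * (if cmul b w (s' a) = cmul b w' (s' a') then 1 else 0) else 0)"
          by auto
      qed
      also have "\<dots> = u a c * u a' c * (if cmul b w (s' a) = cmul b w' (s' a') then 1 else 0)"
        using m s c by (subst sum.delta[OF finite_cube]) (simp add: cmul_in)
      finally show ?thesis .
    qed
    have "(\<Sum>(c, v)\<in>A \<times> cube b. (u a c * (if cmul b w (s' a) = cmul b v (s c) then 1 else 0)) * (u a' c * (if cmul b w' (s' a') = cmul b v (s c) then 1 else 0)))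
       = (\<Sum>c\<in>A. u a c * u a' c * (if cmul b w (s' a) = cmul b w' (s' a') then 1 else 0))"
      unfolding sum.cartesian_product[symmetric] using inner by (intro sum.cong refl) simp
    also have "\<dots> = (if a = a' then 1 else 0) * (if cmul b w (s' a) = cmul b w' (s' a') then 1 else 0)"
      unfolding sum_distrib_right[symmetric] using u m by simp
    also have "\<dots> = (if (a, w) = (a', w') then 1 else 0)"
      using m s cmul_same_iff[of w b w' "s' a"] by auto
    finally show ?thesis .
  qed
  show ?thesis
    unfolding orth_def
  proof (intro ballI conjI)
    fix p q assume "p \<in> A \<times> cube b" "q \<in> A \<times> cube b"
    then obtain a w a' w' where pq: "p = (a, w)" "q = (a', w')" and m: "a \<in> A" "a' \<in> A" "w \<in> cube b" "w' \<in> cube b" by auto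
    show "(\<Sum>k\<in>A \<times> cube b. regmat b s' s u p k * regmat b s' s u q k) = (if p = q then 1 else 0)"
      using row[of u s s' a a' w w', OF _ s m] u by (simp add: regmat_def pq orth_def case_prod_unfold)
    show "(\<Sum>k\<in>A \<times> cube b. regmat b s' s u k p * regmat b s' s u k q) = (if p = q then 1 else 0)"
      using row[of "\<lambda>a c. u c a" s' s a a' w w', OF _ s(2) s(1) m] u
      by (simp only: regmat_def pq orth_def case_prod_unfold fst_conv snd_conv eq_commute[of _ "cmul b _ (s _)"])
  qed
qed

text \<open>The register is determined by the position throughout, so the joint evolution is the
  plain walk. This lets Bob apply phases that depend on both inputs: he finds Alice's block in the
  register that he receives.\<close>

lemma evol_regmat:
  assumes A: "finite A" and s: "\<And>r a. a \<in> A \<Longrightarrow> s r a \<in> cube b"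
    and \<theta>: "\<And>r a. a \<in> A \<Longrightarrow> \<theta>' r (a, s (Suc r) a) = \<theta> r a"
  shows "a \<in> A \<Longrightarrow> w \<in> cube b \<Longrightarrow>
     evol (A \<times> cube b) (\<lambda>r. regmat b (s (Suc r)) (s r) (u r)) \<theta>' (\<lambda>(a, w). if w = s 0 a then \<psi> a else 0) t (a, w)
       = (if w = s (Suc t) a then evol A u \<theta> \<psi> t a else 0)"
proof -
  have step: "(\<Sum>k\<in>A \<times> cube b. regmat b (s (Suc r)) (s r) (u r) (a, w) k * h k) = (if w = s (Suc r) a then \<Sum>c\<in>A. u r a c * c' c else 0)"
    if aw: "a \<in> A" "w \<in> cube b" and h: "\<And>c v. c \<in> A \<Longrightarrow> v \<in> cube b \<Longrightarrow> h (c, v) = (if v = s r c then c' c else 0)" for r a w h c'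
  proof -
    have one: "cmul b v v = cmul b w w" if "v \<in> cube b" "w \<in> cube b" for v w
    proof -
      have "v j * v j = 1" if v: "v \<in> cube b" and j: "j < b" for v j
      proof -
        have "v j = -1 \<or> v j = 1" using v j by (auto simp: cube_def)
        then show ?thesis by auto
      qed
      from this[OF that(1)] this[OF that(2)] show ?thesis by (simp add: cmul_def fun_eq_iff restrict_def)
    qed
    have eq: "cmul b w (s (Suc r) a) = cmul b (s r c) (s r c) \<longleftrightarrow> w = s (Suc r) a" if "c \<in> A" for c
      unfolding one[OF s[OF that] s[OF aw(1), of "Suc r"]] by (rule cmul_same_iff[OF aw(2) s[OF aw(1)] s[OF aw(1)]])
    have "(\<Sum>k\<in>A \<times> cube b. regmat b (s (Suc r)) (s r) (u r) (a, w) k * h k)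
       = (\<Sum>c\<in>A. \<Sum>v\<in>cube b. regmat b (s (Suc r)) (s r) (u r) (a, w) (c, v) * h (c, v))"
      by (simp add: sum.cartesian_product)
    also have "\<dots> = (\<Sum>c\<in>A. \<Sum>v\<in>cube b. if v = s r c then u r a c * (if w = s (Suc r) a then 1 else 0) * c' c else 0)"
      using eq by (intro sum.cong refl) (simp add: h regmat_def)
    also have "\<dots> = (\<Sum>c\<in>A. u r a c * (if w = s (Suc r) a then 1 else 0) * c' c)"
      using s by (intro sum.cong refl) (simp add: finite_cube)
    finally show ?thesis by simp
  qed
  show "a \<in> A \<Longrightarrow> w \<in> cube b \<Longrightarrow>
     evol (A \<times> cube b) (\<lambda>r. regmat b (s (Suc r)) (s r) (u r)) \<theta>' (\<lambda>(a, w). if w = s 0 a then \<psi> a else 0) t (a, w)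
       = (if w = s (Suc t) a then evol A u \<theta> \<psi> t a else 0)"
  proof (induction t arbitrary: a w)
    case 0
    show ?case unfolding evol.simps(1) using 0 by (intro step) auto
  next
    case (Suc t)
    show ?case unfolding evol.simps(2) using Suc.prems
    proof (intro step)
      fix c v assume cv: "c \<in> A" "v \<in> cube b"
      show "\<theta>' t (c, v) * evol (A \<times> cube b) (\<lambda>r. regmat b (s (Suc r)) (s r) (u r)) \<theta>' (\<lambda>(a, w). if w = s 0 a then \<psi> a else 0) t (c, v)
        = (if v = s (Suc t) c then \<theta> t c * evol A u \<theta> \<psi> t c else 0)"
        unfolding Suc.IH[OF cv] using \<theta>[OF cv(1), of t] by auto
    qed
  qed
qed

fun amp :: "'i set \<Rightarrow> (nat \<Rightarrow> 'i \<Rightarrow> 'i \<Rightarrow> real) \<Rightarrow> (nat \<Rightarrow> 'i \<Rightarrow> real) \<Rightarrow> 'i \<Rightarrow> nat \<Rightarrow> 'i \<Rightarrow> real" where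
  "amp I B z i0 0 p = B 0 i0 p"
| "amp I B z i0 (Suc r) p = (\<Sum>i\<in>I. B (Suc r) i p * (z r i * amp I B z i0 r i))"

text \<open>Level \<open>r\<close> of the walk lives on the tag \<open>2 * r\<close>; the tags \<open>2 * r + 1\<close> are fresh coordinates
  which dilate the contraction \<open>B r\<close> to an isometry.\<close>

lemma walk_exists:
  fixes B :: "nat \<Rightarrow> 'i \<Rightarrow> 'i \<Rightarrow> real" and T :: nat
  assumes I: "finite I" "i0 \<in> I" and B: "\<And>r. nrm_le I I (B r) 1"
  defines "A \<equiv> {..2 * T} \<times> I"
  shows "\<exists>u. (\<forall>r. orth A (u r)) \<and>
     (\<forall>z t p. t < T \<longrightarrow> p \<in> I \<longrightarrow> evol A u (\<lambda>r a. if fst a = 2 * r + 2 then z r (snd a) else 1) (\<lambda>a. if a = (0, i0) then 1 else 0) t (2 * t + 2, p) = amp I B z i0 t p)"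
proof -
  have "\<exists>v. \<forall>j\<in>I. \<forall>j'\<in>I. (\<Sum>i\<in>I. B r i j * B r i j') + (\<Sum>k\<in>I. v j k * v j' k) = (if j = j' then 1 else 0 :: real)" for r
    using B[of r] by (intro dilation I(1)) (simp add: nrm_le_def)
  then obtain v where v: "\<And>r j j'. j \<in> I \<Longrightarrow> j' \<in> I \<Longrightarrow> (\<Sum>i\<in>I. B r i j * B r i j') + (\<Sum>k\<in>I. v r j k * v r j' k) = (if j = j' then 1 else 0 :: real)"
    by metis
  \<comment> \<open>\<open>W r p\<close> is the unit vector at \<open>(2 * r + 2, p)\<close> minus
    the dilated column \<open>p\<close> of \<open>B r\<close>, so it has squared norm 2. Its
    reflection swaps the two, and on a state that vanishes at the later tags the amplitude at
    \<open>(2 * r + 2, p)\<close> becomes the entry \<open>p\<close> of the transposed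
    \<open>B r\<close> applied to level \<open>r\<close>.\<close>
  define W :: "nat \<Rightarrow> 'i \<Rightarrow> nat \<times> 'i \<Rightarrow> real" where
    "W r p = (\<lambda>(c, i). if c = 2 * r + 2 then if i = p then 1 else 0 else if c = 2 * r then - B r i p else if c = 2 * r + 1 then - v r p i else 0)" for r p
  define u :: "nat \<Rightarrow> nat \<times> 'i \<Rightarrow> nat \<times> 'i \<Rightarrow> real" where
    "u r = (if r < T then (\<lambda>a b. (if a = b then 1 else 0) - (\<Sum>p\<in>I. W r p a * W r p b)) else (\<lambda>a b. (if a = b then 1 else 0)))" for r
  have finA: "finite A" using I by (simp add: A_def)
  have sumA: "(\<Sum>a\<in>A. W r p a * h a) = h (2 * r + 2, p) - (\<Sum>i\<in>I. B r i p * h (2 * r, i)) - (\<Sum>i\<in>I. v r p i * h (2 * r + 1, i))"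
    if r: "r < T" and p: "p \<in> I" for r p and h :: "nat \<times> 'i \<Rightarrow> real"
  proof -
    have "(\<Sum>a\<in>A. W r p a * h a) = (\<Sum>c\<le>2 * T. \<Sum>i\<in>I. W r p (c, i) * h (c, i))"
      by (simp add: A_def sum.cartesian_product)
    also have "\<dots> = (\<Sum>c\<in>{2 * r, 2 * r + 1, 2 * r + 2}. \<Sum>i\<in>I. W r p (c, i) * h (c, i))"
      using r by (intro sum.mono_neutral_right) (auto simp: W_def)
    also have "\<dots> = (\<Sum>i\<in>I. W r p (2 * r, i) * h (2 * r, i)) + (\<Sum>i\<in>I. W r p (2 * r + 1, i) * h (2 * r + 1, i)) + (\<Sum>i\<in>I. W r p (2 * r + 2, i) * h (2 * r + 2, i))"
      by simp
    also have "(\<Sum>i\<in>I. W r p (2 * r + 2, i) * h (2 * r + 2, i)) = (\<Sum>i\<in>I. if i = p then h (2 * r + 2, p) else 0)"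
      by (intro sum.cong) (auto simp: W_def)
    finally show ?thesis using I p by (simp add: W_def sum_negf)
  qed
  have orth: "orth A (u r)" for r
  proof (cases "r < T")
    case True
    have "(\<Sum>a\<in>A. W r p a * W r p' a) = (if p = p' then 2 else 0)" if "p \<in> I" "p' \<in> I" for p p'
      unfolding sumA[OF True that(1)] using v[OF that, of r] by (auto simp: W_def sum_negf)
    then have "orth A (\<lambda>a b. (if a = b then 1 else 0) - (\<Sum>p\<in>I. W r p a * W r p b))"
      by (rule reflection_orth[OF finA I(1)])
    then show ?thesis using True by (simp add: u_def)
  next
    case False
    have "orth A (\<lambda>a b. (if a = b then 1 else 0) - (\<Sum>p\<in>{}. (0::real) * 0))"
      by (rule reflection_orth[OF finA, where W="\<lambda>_ _. 0"]) auto
    then show ?thesis using False by (simp add: u_def)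
  qed
  have app: "(\<Sum>b\<in>A. u r a b * h b) = h a - (\<Sum>p\<in>I. W r p a * (h (2 * r + 2, p) - (\<Sum>i\<in>I. B r i p * h (2 * r, i)) - (\<Sum>i\<in>I. v r p i * h (2 * r + 1, i))))"
    if r: "r < T" and a: "a \<in> A" for r a and h :: "nat \<times> 'i \<Rightarrow> real"
  proof -
    have "(\<Sum>b\<in>A. u r a b * h b) = (\<Sum>b\<in>A. (if b = a then h a else 0) - (\<Sum>p\<in>I. W r p a * (W r p b * h b)))"
      using r by (intro sum.cong refl) (auto simp: u_def left_diff_distrib sum_distrib_right mult.assoc)
    also have "\<dots> = h a - (\<Sum>p\<in>I. W r p a * (\<Sum>b\<in>A. W r p b * h b))"
      unfolding sum_subtractf sum_distrib_left using finA a by (subst (2) sum.swap) simp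
    also have "(\<Sum>p\<in>I. W r p a * (\<Sum>b\<in>A. W r p b * h b)) = (\<Sum>p\<in>I. W r p a * (h (2 * r + 2, p) - (\<Sum>i\<in>I. B r i p * h (2 * r, i)) - (\<Sum>i\<in>I. v r p i * h (2 * r + 1, i))))"
      by (intro sum.cong refl) (simp only: sumA[OF r])
    finally show ?thesis .
  qed
  have step: "(\<Sum>b\<in>A. u r (2 * r + 2, p) b * h b) = (\<Sum>i\<in>I. B r i p * h (2 * r, i)) \<and>
      (\<forall>c i. c > 2 * r + 2 \<longrightarrow> (c, i) \<in> A \<longrightarrow> (\<Sum>b\<in>A. u r (c, i) b * h b) = 0)"
    if r: "r < T" and h: "\<And>c i. c > 2 * r \<Longrightarrow> (c, i) \<in> A \<Longrightarrow> h (c, i) = 0" and p: "p \<in> I" for r p and h :: "nat \<times> 'i \<Rightarrow> real"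
  proof -
    have mem: "(2 * r + 2, p) \<in> A" "(2 * r + 1, p) \<in> A" if "p \<in> I" for p using that r by (auto simp: A_def)
    have h0: "h (2 * r + 2, p) = 0" "h (2 * r + 1, p) = 0" if "p \<in> I" for p using mem[OF that] h by auto
    have "(\<Sum>b\<in>A. u r (2 * r + 2, p) b * h b) = - (\<Sum>p'\<in>I. (if p' = p then 1 else 0) * - (\<Sum>i\<in>I. B r i p' * h (2 * r, i)))"
      unfolding app[OF r mem(1)[OF p]] using h0 p by (simp add: W_def cong: if_cong) (intro sum.cong refl, auto)
    also have "\<dots> = (\<Sum>i\<in>I. B r i p * h (2 * r, i))"
      using I p by (simp add: sum_negf if_distrib[of "\<lambda>t. t * _"] cong: if_cong)
    finally show ?thesis using app[OF r] h by (auto simp: W_def)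
  qed
  have ev: "(\<forall>p\<in>I. evol A u (\<lambda>r a. if fst a = 2 * r + 2 then z r (snd a) else 1) (\<lambda>a. if a = (0, i0) then 1 else 0) t (2 * t + 2, p) = amp I B z i0 t p)
     \<and> (\<forall>c i. c > 2 * t + 2 \<longrightarrow> (c, i) \<in> A \<longrightarrow> evol A u (\<lambda>r a. if fst a = 2 * r + 2 then z r (snd a) else 1) (\<lambda>a. if a = (0, i0) then 1 else 0) t (c, i) = 0)"
    if "t < T" for z t
    using that
  proof (induction t)
    case 0
    have "(\<Sum>i\<in>I. B 0 i p * (if (0::nat, i) = (0, i0) then 1 else 0)) = B 0 i0 p" for p
      using I by (simp add: if_distrib[of "\<lambda>t. _ * t"] cong: if_cong)
    then show ?case
      using step[OF 0, of "\<lambda>a. if a = (0, i0) then 1 else 0"] I by auto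
  next
    case (Suc t)
    let ?e = "evol A u (\<lambda>r a. if fst a = 2 * r + 2 then z r (snd a) else 1) (\<lambda>a. if a = (0, i0) then 1 else 0) t"
    let ?h = "\<lambda>a. (if fst a = 2 * t + 2 then z t (snd a) else 1) * ?e a"
    have IH: "\<And>p. p \<in> I \<Longrightarrow> ?e (2 * t + 2, p) = amp I B z i0 t p" "\<And>c i. c > 2 * t + 2 \<Longrightarrow> (c, i) \<in> A \<Longrightarrow> ?e (c, i) = 0"
      using Suc by auto
    have "(\<Sum>i\<in>I. B (Suc t) i p * ?h (2 * Suc t, i)) = amp I B z i0 (Suc t) p" for p
      using IH(1) by simp
    then show ?case
      using step[OF Suc.prems, of ?h] IH(2) I unfolding evol.simps(2) by auto
  qed
  show ?thesis using orth ev by (intro exI[of _ u]) auto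
qed

lemma amp_paths:
  assumes I: "finite I" and B0: "\<And>p. B 0 i0 p = c" and B: "\<And>r. 1 \<le> r \<Longrightarrow> r \<le> L \<Longrightarrow> B r = M"
  shows "l \<le> L \<Longrightarrow> (\<Sum>p\<in>I. amp I B z i0 l p * h p)
    = c * (\<Sum>i\<in>{..l} \<rightarrow>\<^sub>E I. (\<Prod>j<l. M (i j) (i (Suc j))) * (\<Prod>j<l. z j (i j)) * h (i l))"
proof (induction l arbitrary: h)
  case 0
  have "(\<Sum>i\<in>{0::nat} \<rightarrow>\<^sub>E I. h (i 0)) = (\<Sum>p\<in>I. h p)"
    by (rule sum.reindex_bij_witness[of _ "\<lambda>p. (\<lambda>_\<in>{0}. p)" "\<lambda>i. i (0::nat)"]) (auto simp: PiE_iff fun_eq_iff restrict_def extensional_def)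
  then show ?case by (simp add: B0 atMost_0 sum_distrib_left[symmetric])
next
  case (Suc l)
  then have Bl: "B (Suc l) = M" using B by simp
  have "(\<Sum>p\<in>I. amp I B z i0 (Suc l) p * h p) = (\<Sum>p\<in>I. \<Sum>i\<in>I. amp I B z i0 l i * (z l i * (M i p * h p)))"
    by (intro sum.cong refl) (simp add: Bl sum_distrib_left sum_distrib_right mult_ac)
  also have "\<dots> = (\<Sum>i\<in>I. amp I B z i0 l i * (z l i * (\<Sum>p\<in>I. M i p * h p)))"
    unfolding sum_distrib_left by (rule sum.swap)
  also have "\<dots> = c * (\<Sum>i\<in>{..l} \<rightarrow>\<^sub>E I. (\<Prod>j<l. M (i j) (i (Suc j))) * (\<Prod>j<l. z j (i j)) * (z l (i l) * (\<Sum>p\<in>I. M (i l) p * h p)))"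
    by (rule Suc.IH) (use Suc.prems in simp)
  also have "(\<Sum>i\<in>{..l} \<rightarrow>\<^sub>E I. (\<Prod>j<l. M (i j) (i (Suc j))) * (\<Prod>j<l. z j (i j)) * (z l (i l) * (\<Sum>p\<in>I. M (i l) p * h p)))
     = (\<Sum>i\<in>{..l} \<rightarrow>\<^sub>E I. \<Sum>p\<in>I. (\<Prod>j<l. M (i j) (i (Suc j))) * M (i l) p * (\<Prod>j<Suc l. z j (i j)) * h p)"
    by (simp add: sum_distrib_left mult_ac)
  also have "\<dots> = (\<Sum>p\<in>I. \<Sum>i\<in>{..l} \<rightarrow>\<^sub>E I. (\<Prod>j<l. M (i j) (i (Suc j))) * M (i l) p * (\<Prod>j<Suc l. z j (i j)) * h p)"
    by (rule sum.swap)
  also have "\<dots> = (\<Sum>i\<in>{..Suc l} \<rightarrow>\<^sub>E I. (\<Prod>j<Suc l. M (i j) (i (Suc j))) * (\<Prod>j<Suc l. z j (i j)) * h (i (Suc l)))"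
  proof -
    have eq: "{..Suc l} \<rightarrow>\<^sub>E I = (\<lambda>(y, g). g(Suc l := y)) ` (I \<times> ({..l} \<rightarrow>\<^sub>E I))"
      unfolding atMost_Suc by (rule PiE_insert_eq)
    have inj: "inj_on (\<lambda>(y, g). g(Suc l := y)) (I \<times> ({..l} \<rightarrow>\<^sub>E I))" by (intro inj_combinator) auto
    show ?thesis
      unfolding eq sum.reindex[OF inj] sum.cartesian_product
      by (intro sum.cong refl) (auto simp: prod.lessThan_Suc)
  qed
  finally show ?case .
qed

text \<open>The amplitude at the last level is \<open>phi\<close>, and \<open>R\<close> walks run as
  a tensor product. A basis state accepts if any of the walks has reached the target, so rejection
  probabilities multiply. One walk needs \<open>2 * k + 5\<close> tags, the indices of
  \<open>I\<close> and a register of \<open>b\<close> bits, which explains the dimension.\<close>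

theorem phase_query_protocol:
  fixes I :: "'i set" and M :: "'i \<Rightarrow> 'i \<Rightarrow> real" and X Y :: "nat \<Rightarrow> nat \<Rightarrow> 'i \<Rightarrow> sign_vec \<Rightarrow> sign_vec"
  assumes I: "finite I" "I \<noteq> {}" and M: "nrm_le I I M 1"
    and X: "\<And>\<rho> l i x. x \<in> cube N \<Longrightarrow> X \<rho> l i x \<in> cube b" and Y: "\<And>\<rho> l i y. y \<in> cube N \<Longrightarrow> Y \<rho> l i y \<in> cube b"
    and g: "\<And>v w. v \<in> cube b \<Longrightarrow> w \<in> cube b \<Longrightarrow> g v w = 1 \<or> g v w = (-1 :: real)"
    and b': "((2 * k + 5) * card I * 2 ^ b) ^ R \<le> 2 ^ b'"
  shows "\<exists>P. qvalid N (Suc b') 0 P \<and> qcost P = 2 * Suc b' * (k + 1) + 1 \<and>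
     (\<forall>x\<in>cube N. \<forall>y\<in>cube N.
        qprob P x y (init_state (Suc b') 0) False = (\<Prod>\<rho><R. 1 - (phi I M k (\<lambda>l i. g (X \<rho> l i x) (Y \<rho> l i y)))\<^sup>2) \<and>
        qprob P x y (init_state (Suc b') 0) True = 1 - (\<Prod>\<rho><R. 1 - (phi I M k (\<lambda>l i. g (X \<rho> l i x) (Y \<rho> l i y)))\<^sup>2))"
proof -
  obtain i0 where i0: "i0 \<in> I" using I by blast
  define n where "n = real (card I)"
  have n: "n > 0" using I by (simp add: n_def card_gt_0_iff)
  define c where "c = 1 / sqrt n"
  have c2: "c * c = 1 / n" "c\<^sup>2 = 1 / n" using n by (simp_all add: c_def power2_eq_square)
  \<comment> \<open>The first contraction sends \<open>i0\<close> to the uniform superposition, the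
    last one returns the overlap with it at \<open>i0\<close>; in between stands
    \<open>M\<close>.\<close>
  define B :: "nat \<Rightarrow> 'i \<Rightarrow> 'i \<Rightarrow> real" where
    "B r = (if r = 0 then (\<lambda>i p. if i = i0 then c else 0) else if r \<le> k then M else (\<lambda>i p. if p = i0 then c else 0))" for r
  have nrm0: "nrm_le I I (\<lambda>i p. if i = i0 then c else 0) 1"
    unfolding nrm_le_def
  proof
    fix h :: "'i \<Rightarrow> real"
    have "(\<Sum>i\<in>I. (\<Sum>j\<in>I. (if i = i0 then c else 0) * h j)\<^sup>2) = (\<Sum>i\<in>I. if i = i0 then (\<Sum>j\<in>I. c * h j)\<^sup>2 else 0)"
      by (intro sum.cong) auto
    also have "\<dots> = (\<Sum>j\<in>I. c * h j)\<^sup>2" using I i0 by simp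
    also have "\<dots> \<le> (\<Sum>j\<in>I. c\<^sup>2) * (\<Sum>j\<in>I. (h j)\<^sup>2)" by (rule Cauchy_Schwarz_ineq_sum)
    also have "(\<Sum>j\<in>I. c\<^sup>2) = 1\<^sup>2" using n by (simp add: c2 n_def)
    finally show "(\<Sum>i\<in>I. (\<Sum>j\<in>I. (if i = i0 then c else 0) * h j)\<^sup>2) \<le> 1\<^sup>2 * (\<Sum>j\<in>I. (h j)\<^sup>2)" .
  qed
  have nrm1: "nrm_le I I (\<lambda>i p. if p = i0 then c else 0) 1"
    unfolding nrm_le_def
  proof
    fix h :: "'i \<Rightarrow> real"
    have "(\<Sum>j\<in>I. (if j = i0 then c else 0) * h j) = c * h i0" using I i0
      by (simp add: if_distrib[of "\<lambda>t. t * _"] cong: if_cong)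
    then have "(\<Sum>i\<in>I. (\<Sum>j\<in>I. (if j = i0 then c else 0) * h j)\<^sup>2) = (h i0)\<^sup>2" using n by (simp add: power_mult_distrib c2 n_def)
    also have "\<dots> \<le> (\<Sum>j\<in>I. (h j)\<^sup>2)" using I i0 by (intro member_le_sum) auto
    finally show "(\<Sum>i\<in>I. (\<Sum>j\<in>I. (if j = i0 then c else 0) * h j)\<^sup>2) \<le> 1\<^sup>2 * (\<Sum>j\<in>I. (h j)\<^sup>2)" by simp
  qed
  have nrmB: "nrm_le I I (B r) 1" for r using nrm0 nrm1 M by (simp add: B_def)
  define A where "A = {..2 * (k + 2)} \<times> I"
  have finA: "finite A" using I by (simp add: A_def)
  obtain u where u: "\<And>r. orth A (u r)" and
    ev: "\<And>z t p. t < k + 2 \<Longrightarrow> p \<in> I \<Longrightarrow> evol A u (\<lambda>r a. if fst a = 2 * r + 2 then z r (snd a) else 1) (\<lambda>a. if a = (0, i0) then 1 else 0) t (2 * t + 2, p) = amp I B z i0 t p"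
    using walk_exists[where T="k + 2" and B=B, OF I(1) i0 nrmB] unfolding A_def by blast
  have amp_phi: "amp I B z i0 (Suc k) i0 = phi I M k z" for z
  proof -
    have "amp I B z i0 (Suc k) i0 = (\<Sum>i\<in>I. amp I B z i0 k i * (c * z k i))"
      by (simp add: B_def mult_ac)
    also have "\<dots> = c * (\<Sum>i\<in>{..k} \<rightarrow>\<^sub>E I. (\<Prod>j<k. M (i j) (i (Suc j))) * (\<Prod>j<k. z j (i j)) * (c * z k (i k)))"
      by (rule amp_paths[where L=k]) (auto simp: I B_def)
    also have "\<dots> = (c * c) * (\<Sum>i\<in>{..k} \<rightarrow>\<^sub>E I. (\<Prod>j<k. M (i j) (i (Suc j))) * (\<Prod>l<Suc k. z l (i l)))"
      by (simp add: sum_distrib_left mult_ac)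
    finally show ?thesis by (simp add: phi_def c2 n_def)
  qed
  define ones :: sign_vec where "ones = (\<lambda>j\<in>{..<b}. 1)"
  have ones: "ones \<in> cube b" by (simp add: ones_def cube_def)
  \<comment> \<open>The block for layer \<open>r\<close> is loaded by the unitary with index
    \<open>r\<close>, which moves the walk to tag \<open>2 * r + 2\<close>; hence the shift by one.
    Everywhere else the register holds the neutral vector.\<close>
  define s where "s \<rho> x r a = (if r > 0 \<and> fst a = 2 * r then X \<rho> (r - 1) (snd a) x else ones)" for \<rho> x r and a :: "nat \<times> 'i"
  have s_in: "s \<rho> x r a \<in> cube b" if "x \<in> cube N" for \<rho> x r a using X[OF that] ones by (simp add: s_def)
  define \<theta> where "\<theta> \<rho> y r = (\<lambda>(a :: nat \<times> 'i, w). if fst a = 2 * r + 2 then g w (Y \<rho> r (snd a) y) else 1)" for \<rho> y r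
  have \<theta>1: "\<theta> \<rho> y r p = 1 \<or> \<theta> \<rho> y r p = -1" if "y \<in> cube N" "p \<in> A \<times> cube b" for \<rho> y r p
    using g[OF _ Y[OF that(1)], of "snd p" \<rho> r "snd (fst p)"] that(2) by (cases p) (auto simp: \<theta>_def)
  define I1 where "I1 = A \<times> cube b"
  have finI1: "finite I1" by (simp add: I1_def finA finite_cube)
  define v where "v \<rho> x r = regmat b (s \<rho> x (Suc r)) (s \<rho> x r) (u r)" for \<rho> x r
  have v: "orth I1 (v \<rho> x r)" if "x \<in> cube N" for \<rho> x r
    unfolding v_def I1_def by (intro regmat_orth finA u s_in that)
  define acc where "acc f \<longleftrightarrow> (\<exists>\<rho><R. fst (f \<rho>) = (2 * k + 4, i0))" for f :: "nat \<Rightarrow> (nat \<times> 'i) \<times> sign_vec"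
  define st where "st = (\<lambda>\<rho>\<in>{..<R}. ((0 :: nat, i0), ones))"
  have st: "st \<in> {..<R} \<rightarrow>\<^sub>E I1" using i0 ones by (simp add: st_def I1_def A_def)
  have nacc: "\<not> acc st" by (simp add: acc_def st_def)
  have fin: "finite ({..<R} \<rightarrow>\<^sub>E I1)" using finI1 by (intro finite_PiE) auto
  have "card I1 = (2 * k + 5) * card I * 2 ^ b" by (simp add: I1_def A_def card_cartesian_product card_cube algebra_simps)
  then have card: "card ({..<R} \<rightarrow>\<^sub>E I1) \<le> 2 ^ b'" using b' by (subst card_PiE) auto
  have prodsign: "(\<Prod>\<rho>\<in>S. h \<rho>) = 1 \<or> (\<Prod>\<rho>\<in>S. h \<rho>) = -1" if "finite S" "\<And>\<rho>. \<rho> \<in> S \<Longrightarrow> h \<rho> = 1 \<or> h \<rho> = -1" for S :: "nat set" and h :: "nat \<Rightarrow> real"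
    using that
  proof (induction S)
    case (insert a S)
    then have "h a = 1 \<or> h a = -1" "prod h S = 1 \<or> prod h S = -1" by auto
    then show ?case using insert.hyps by auto
  qed simp
  define U where "U r x f h = (\<Prod>\<rho><R. v \<rho> x r (f \<rho>) (h \<rho>))" for r x f h
  define \<Theta> where "\<Theta> r y f = (\<Prod>\<rho><R. \<theta> \<rho> y r (f \<rho>))" for r y f
  obtain P where P: "qvalid N (Suc b') 0 P" "qcost P = 2 * Suc b' * (k + 1) + 1"
    and prob: "\<And>x y w. qprob P x y (init_state (Suc b') 0) w =
        (\<Sum>f | f \<in> {..<R} \<rightarrow>\<^sub>E I1 \<and> acc f = w. (evol ({..<R} \<rightarrow>\<^sub>E I1) (\<lambda>r f h. \<Prod>\<rho><R. v \<rho> x r (f \<rho>) (h \<rho>)) (\<lambda>r f. \<Prod>\<rho><R. \<theta> \<rho> y r (f \<rho>)) (\<lambda>i. if i = st then 1 else 0) (k + 1) f)\<^sup>2)"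
  proof -
    have "\<exists>P. qvalid N (Suc b') 0 P \<and> qcost P = 2 * Suc b' * (k + 1) + 1 \<and>
      (\<forall>x y w. qprob P x y (init_state (Suc b') 0) w =
        (\<Sum>f | f \<in> {..<R} \<rightarrow>\<^sub>E I1 \<and> acc f = w. (evol ({..<R} \<rightarrow>\<^sub>E I1) (\<lambda>r. U r x) (\<lambda>r. \<Theta> r y) (\<lambda>i. if i = st then 1 else 0) (k + 1) f)\<^sup>2))"
    proof (rule phase_protocol[where u=U and \<theta>=\<Theta> and acc=acc and t="k + 1", OF fin card st nacc], unfold U_def \<Theta>_def)
      show "orth ({..<R} \<rightarrow>\<^sub>E I1) (\<lambda>f h. \<Prod>\<rho><R. v \<rho> x r (f \<rho>) (h \<rho>))" if "x \<in> cube N" for r x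
        by (intro orth_prod finI1 v that)
      show "(\<Prod>\<rho><R. \<theta> \<rho> y r (f \<rho>)) = 1 \<or> (\<Prod>\<rho><R. \<theta> \<rho> y r (f \<rho>)) = - 1" if "y \<in> cube N" "f \<in> {..<R} \<rightarrow>\<^sub>E I1" for r y f
      proof (rule prodsign)
        fix \<rho> assume "\<rho> \<in> {..<R}"
        then show "\<theta> \<rho> y r (f \<rho>) = 1 \<or> \<theta> \<rho> y r (f \<rho>) = - 1"
          using \<theta>1[OF that(1)] that(2) unfolding I1_def by (metis PiE_mem)
      qed simp
    qed
    then show ?thesis using that unfolding U_def \<Theta>_def by blast
  qed
  have main: "qprob P x y (init_state (Suc b') 0) False = (\<Prod>\<rho><R. 1 - (phi I M k (\<lambda>l i. g (X \<rho> l i x) (Y \<rho> l i y)))\<^sup>2) \<and>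
        qprob P x y (init_state (Suc b') 0) True = 1 - (\<Prod>\<rho><R. 1 - (phi I M k (\<lambda>l i. g (X \<rho> l i x) (Y \<rho> l i y)))\<^sup>2)"
    if xy: "x \<in> cube N" "y \<in> cube N" for x y
  proof -
    define z where "z \<rho> l i = g (X \<rho> l i x) (Y \<rho> l i y)" for \<rho> l i
    define \<psi> where "\<psi> = (\<lambda>(a :: nat \<times> 'i, w). if w = ones then (if a = (0, i0) then 1 else 0 :: real) else 0)"
    define e where "e \<rho> = evol I1 (v \<rho> x) (\<theta> \<rho> y) \<psi> (k + 1)" for \<rho>
    define wk where "wk \<rho> = evol A u (\<lambda>r a. if fst a = 2 * r + 2 then z \<rho> r (snd a) else 1) (\<lambda>a. if a = (0, i0) then 1 else 0) (k + 1)" for \<rho>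
    have e_acc: "e \<rho> ((2 * k + 4, i0), w) = (if w = s \<rho> x (k + 2) (2 * k + 4, i0) then phi I M k (z \<rho>) else 0)"
      if "w \<in> cube b" for \<rho> w
    proof -
      have mem: "(2 * k + 4, i0) \<in> A" using i0 by (simp add: A_def)
      have "evol (A \<times> cube b) (\<lambda>r. regmat b (s \<rho> x (Suc r)) (s \<rho> x r) (u r)) (\<theta> \<rho> y) (\<lambda>(a, w). if w = s \<rho> x 0 a then if a = (0, i0) then 1 else 0 else 0) (k + 1) ((2 * k + 4, i0), w)
         = (if w = s \<rho> x (Suc (k + 1)) (2 * k + 4, i0) then wk \<rho> (2 * k + 4, i0) else 0)"
        unfolding wk_def
      proof (rule evol_regmat[OF finA _ _ mem that])
        show "s \<rho> x r a \<in> cube b" for r a by (rule s_in[OF xy(1)])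
        show "\<theta> \<rho> y r (a, s \<rho> x (Suc r) a) = (if fst a = 2 * r + 2 then z \<rho> r (snd a) else 1)" for r a
          by (simp add: \<theta>_def s_def z_def)
      qed
      moreover have "wk \<rho> (2 * k + 4, i0) = phi I M k (z \<rho>)"
      proof -
        have eq: "2 * (k + 1) + 2 = 2 * k + 4" by simp
        show ?thesis
          using ev[of "k + 1" i0 "z \<rho>"] i0 amp_phi[of "z \<rho>"]
          unfolding wk_def eq by (simp del: evol.simps amp.simps)
      qed
      moreover have "(\<lambda>(a, w). if w = s \<rho> x 0 a then if a = (0, i0) then 1 else 0 else 0) = \<psi>"
        by (simp add: \<psi>_def s_def)
      ultimately show ?thesis by (simp add: e_def I1_def v_def[abs_def])
    qed
    have e_norm: "(\<Sum>p\<in>I1. (e \<rho> p)\<^sup>2) = 1" for \<rho>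
    proof -
      have "(\<Sum>p\<in>I1. (e \<rho> p)\<^sup>2) = (\<Sum>p\<in>I1. (\<psi> p)\<^sup>2)"
        unfolding e_def using \<theta>1[OF xy(2)] by (intro evol_norm finI1 v xy) (simp add: I1_def)
      also have "\<dots> = (\<Sum>p\<in>I1. if p = ((0, i0), ones) then 1 else 0)" by (intro sum.cong) (auto simp: \<psi>_def split: if_splits)
      also have "\<dots> = 1" using finI1 i0 ones by (simp add: I1_def A_def)
      finally show ?thesis .
    qed
    have e_rej: "(\<Sum>p | p \<in> I1 \<and> fst p \<noteq> (2 * k + 4, i0). (e \<rho> p)\<^sup>2) = 1 - (phi I M k (z \<rho>))\<^sup>2" for \<rho>
    proof -
      have sub: "{(2 * k + 4, i0)} \<times> cube b \<subseteq> I1" using i0 by (auto simp: I1_def A_def)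
      have "(\<Sum>p\<in>{(2 * k + 4, i0)} \<times> cube b. (e \<rho> p)\<^sup>2) = (\<Sum>w\<in>cube b. (e \<rho> ((2 * k + 4, i0), w))\<^sup>2)"
        by (rule sum.reindex_bij_witness[of _ "\<lambda>w. ((2 * k + 4, i0), w)" snd]) auto
      also have "\<dots> = (\<Sum>w\<in>cube b. if w = s \<rho> x (k + 2) (2 * k + 4, i0) then (phi I M k (z \<rho>))\<^sup>2 else 0)"
        by (intro sum.cong) (simp_all add: e_acc)
      also have "\<dots> = (phi I M k (z \<rho>))\<^sup>2" using s_in[OF xy(1)] by (simp add: finite_cube)
      finally have 1: "(\<Sum>p\<in>{(2 * k + 4, i0)} \<times> cube b. (e \<rho> p)\<^sup>2) = (phi I M k (z \<rho>))\<^sup>2" .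
      have 2: "{p. p \<in> I1 \<and> fst p \<noteq> (2 * k + 4, i0)} = I1 - {(2 * k + 4, i0)} \<times> cube b" by (auto simp: I1_def)
      show ?thesis unfolding 2 using sum.subset_diff[OF sub finI1, of "\<lambda>p. (e \<rho> p)\<^sup>2"] 1 e_norm[of \<rho>] by simp
    qed
    have full: "evol ({..<R} \<rightarrow>\<^sub>E I1) (\<lambda>r f h. \<Prod>\<rho><R. v \<rho> x r (f \<rho>) (h \<rho>)) (\<lambda>r f. \<Prod>\<rho><R. \<theta> \<rho> y r (f \<rho>)) (\<lambda>i. if i = st then 1 else 0) (k + 1) f
        = (\<Prod>\<rho><R. e \<rho> (f \<rho>))" if f: "f \<in> {..<R} \<rightarrow>\<^sub>E I1" for f
    proof -
      have init: "(if f = st then 1 else 0) = (\<Prod>\<rho><R. \<psi> (f \<rho>))" if f: "f \<in> {..<R} \<rightarrow>\<^sub>E I1" for f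
      proof (cases "f = st")
        case True
        then show ?thesis by (simp add: st_def \<psi>_def)
      next
        case False
        then obtain \<rho> where \<rho>: "\<rho> < R" "f \<rho> \<noteq> st \<rho>" using PiE_ext[OF f st] by blast
        then have "\<psi> (f \<rho>) = 0" by (cases "f \<rho>") (auto simp: st_def \<psi>_def)
        then have "(\<Prod>\<rho><R. \<psi> (f \<rho>)) = 0" using \<rho>(1) by (intro prod_zero) auto
        then show ?thesis using False by simp
      qed
      have "evol ({..<R} \<rightarrow>\<^sub>E I1) (\<lambda>r f h. \<Prod>\<rho><R. v \<rho> x r (f \<rho>) (h \<rho>)) (\<lambda>r f. \<Prod>\<rho><R. \<theta> \<rho> y r (f \<rho>)) (\<lambda>i. if i = st then 1 else 0) (k + 1) f
        = evol ({..<R} \<rightarrow>\<^sub>E I1) (\<lambda>r f h. \<Prod>\<rho><R. v \<rho> x r (f \<rho>) (h \<rho>)) (\<lambda>r f. \<Prod>\<rho><R. \<theta> \<rho> y r (f \<rho>)) (\<lambda>f. \<Prod>\<rho><R. \<psi> (f \<rho>)) (k + 1) f"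
        by (rule evol_cong) (simp_all add: init f)
      also have "\<dots> = (\<Prod>\<rho><R. evol I1 (v \<rho> x) (\<theta> \<rho> y) \<psi> (k + 1) (f \<rho>))"
        by (rule evol_prod[OF finI1 f])
      finally show ?thesis by (simp only: e_def)
    qed
    have tot: "(\<Sum>f\<in>{..<R} \<rightarrow>\<^sub>E I1. (\<Prod>\<rho><R. e \<rho> (f \<rho>))\<^sup>2) = 1"
    proof -
      have "(\<Sum>f\<in>{..<R} \<rightarrow>\<^sub>E I1. (\<Prod>\<rho><R. e \<rho> (f \<rho>))\<^sup>2) = (\<Prod>\<rho><R. \<Sum>p\<in>I1. (e \<rho> p)\<^sup>2)"
        unfolding prod_power_distrib using finI1 by (subst prod_sum_PiE) auto
      then show ?thesis by (simp add: e_norm)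
    qed
    have rej_set: "{f. f \<in> {..<R} \<rightarrow>\<^sub>E I1 \<and> acc f = False} = {..<R} \<rightarrow>\<^sub>E {p. p \<in> I1 \<and> fst p \<noteq> (2 * k + 4, i0)}"
    proof -
      have "f \<in> {..<R} \<rightarrow>\<^sub>E I1 \<and> \<not> acc f \<longleftrightarrow> f \<in> {..<R} \<rightarrow>\<^sub>E {p. p \<in> I1 \<and> fst p \<noteq> (2 * k + 4, i0)}" for f
        unfolding acc_def PiE_iff by (simp, blast)
      then show ?thesis by simp
    qed
    have rej: "(\<Sum>f | f \<in> {..<R} \<rightarrow>\<^sub>E I1 \<and> acc f = False. (\<Prod>\<rho><R. e \<rho> (f \<rho>))\<^sup>2) = (\<Prod>\<rho><R. 1 - (phi I M k (z \<rho>))\<^sup>2)"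
    proof -
      have "(\<Sum>f\<in>{..<R} \<rightarrow>\<^sub>E {p. p \<in> I1 \<and> fst p \<noteq> (2 * k + 4, i0)}. (\<Prod>\<rho><R. e \<rho> (f \<rho>))\<^sup>2) = (\<Prod>\<rho><R. \<Sum>p | p \<in> I1 \<and> fst p \<noteq> (2 * k + 4, i0). (e \<rho> p)\<^sup>2)"
        unfolding prod_power_distrib using finI1 by (subst prod_sum_PiE) auto
      then show ?thesis unfolding rej_set e_rej .
    qed
    have acc: "(\<Sum>f | f \<in> {..<R} \<rightarrow>\<^sub>E I1 \<and> acc f = True. (\<Prod>\<rho><R. e \<rho> (f \<rho>))\<^sup>2) = 1 - (\<Prod>\<rho><R. 1 - (phi I M k (z \<rho>))\<^sup>2)"
    proof -
      have "{f. f \<in> {..<R} \<rightarrow>\<^sub>E I1 \<and> acc f = True} = ({..<R} \<rightarrow>\<^sub>E I1) - {f. f \<in> {..<R} \<rightarrow>\<^sub>E I1 \<and> acc f = False}" by auto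
      then show ?thesis
        using sum.subset_diff[of "{f. f \<in> {..<R} \<rightarrow>\<^sub>E I1 \<and> acc f = False}" "{..<R} \<rightarrow>\<^sub>E I1" "\<lambda>f. (\<Prod>\<rho><R. e \<rho> (f \<rho>))\<^sup>2"] fin tot rej
        by simp
    qed
    have "qprob P x y (init_state (Suc b') 0) w = (\<Sum>f | f \<in> {..<R} \<rightarrow>\<^sub>E I1 \<and> acc f = w. (\<Prod>\<rho><R. e \<rho> (f \<rho>))\<^sup>2)" for w
      unfolding prob
    proof (intro sum.cong refl)
      fix f assume "f \<in> {f \<in> {..<R} \<rightarrow>\<^sub>E I1. acc f = w}"
      then have "f \<in> {..<R} \<rightarrow>\<^sub>E I1" by blast
      from full[OF this] show "(evol ({..<R} \<rightarrow>\<^sub>E I1) (\<lambda>r f h. \<Prod>\<rho><R. v \<rho> x r (f \<rho>) (h \<rho>)) (\<lambda>r f. \<Prod>\<rho><R. \<theta> \<rho> y r (f \<rho>)) (\<lambda>i. if i = st then 1 else 0) (k + 1) f)\<^sup>2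
        = (\<Prod>\<rho><R. e \<rho> (f \<rho>))\<^sup>2" by (simp only:)
    qed
    then show ?thesis using rej acc by (simp only: z_def[abs_def])
  qed
  show ?thesis using P main by blast
qed

section \<open>Independent copies\<close>

definition slice :: "'i set \<Rightarrow> nat \<Rightarrow> (nat \<times> nat \<times> 'i \<Rightarrow> real) \<Rightarrow> nat \<Rightarrow> nat \<Rightarrow> 'i \<Rightarrow> real" where
  "slice I k z r = (\<lambda>l\<in>{..<Suc k}. \<lambda>i\<in>I. z (r, l, i))"

definition idx :: "nat \<Rightarrow> nat \<Rightarrow> 'i set \<Rightarrow> (nat \<times> nat \<times> 'i) set" where
  "idx R k I = {..<R} \<times> {..<Suc k} \<times> I"

lemma finite_idx [simp]: "finite I \<Longrightarrow> finite (idx R k I)"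
  by (simp add: idx_def)

lemma slice_in: "z \<in> sgns (idx R k I) \<Longrightarrow> r < R \<Longrightarrow> slice I k z r \<in> {..<Suc k} \<rightarrow>\<^sub>E sgns I"
  by (auto simp: slice_def sgns_def idx_def PiE_iff)

text \<open>Slicing is a bijection onto families of \<open>R\<close> chains: it is injective and the
  cardinalities agree.\<close>

lemma sum_slices:
  assumes I: "finite I"
  shows "(\<Sum>z\<in>sgns (idx R k I). \<Prod>r<R. u r (slice I k z r)) = 2 ^ card (idx R k I) * (\<Prod>r<R. EF I (Suc k) (u r))"
proof -
  let ?B = "{..<R} \<rightarrow>\<^sub>E ({..<Suc k} \<rightarrow>\<^sub>E sgns I)"
  let ?h = "\<lambda>z. \<lambda>r\<in>{..<R}. slice I k z r"
  have finB: "finite ?B" using I by (intro finite_PiE) auto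
  have inj: "inj_on ?h (sgns (idx R k I))"
  proof (rule inj_onI)
    fix z z' assume z: "z \<in> sgns (idx R k I)" "z' \<in> sgns (idx R k I)" and eq: "?h z = ?h z'"
    show "z = z'"
    proof (rule PiE_ext[OF z[unfolded sgns_def]])
      fix p assume "p \<in> idx R k I"
      then obtain r l i where p: "p = (r, l, i)" "r < R" "l < Suc k" "i \<in> I" by (auto simp: idx_def)
      have "?h z r l i = ?h z' r l i" unfolding eq ..
      then show "z p = z' p" using p by (simp add: slice_def)
    qed
  qed
  have into: "?h ` sgns (idx R k I) \<subseteq> ?B"
  proof
    fix f assume "f \<in> ?h ` sgns (idx R k I)"
    then obtain z where "z \<in> sgns (idx R k I)" "f = ?h z" by blast
    then show "f \<in> ?B" using slice_in[of z R k I] by (simp only: restrict_PiE_iff) simp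
  qed
  have "card ?B = card (sgns (idx R k I))"
    using I by (simp add: card_PiE card_sgns idx_def card_cartesian_product power_mult[symmetric] power_add[symmetric] mult_ac)
  then have im: "?h ` sgns (idx R k I) = ?B"
    using card_image[OF inj] by (intro card_subset_eq finB into) simp
  have "(\<Sum>z\<in>sgns (idx R k I). \<Prod>r<R. u r (slice I k z r)) = (\<Sum>z\<in>sgns (idx R k I). \<Prod>r<R. u r (?h z r))"
    by (intro sum.cong refl prod.cong) simp
  also have "\<dots> = (\<Sum>h\<in>?B. \<Prod>r<R. u r (h r))"
    unfolding im[symmetric] by (simp add: sum.reindex[OF inj])
  also have "\<dots> = (\<Prod>r<R. \<Sum>h\<in>{..<Suc k} \<rightarrow>\<^sub>E sgns I. u r h)"
    using I by (subst prod_sum_PiE) (auto intro!: finite_PiE)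
  also have "\<dots> = (\<Prod>r<R. (2 ^ card I) ^ Suc k * EF I (Suc k) (u r))"
    by (simp add: EF_def)
  also have "\<dots> = 2 ^ card (idx R k I) * (\<Prod>r<R. EF I (Suc k) (u r))"
    using I by (simp add: prod.distrib idx_def card_cartesian_product power_mult[symmetric] power_add[symmetric] mult_ac del: power_Suc)
  finally show ?thesis .
qed

lemma EF_one: "finite I \<Longrightarrow> EF I L (\<lambda>_. 1) = 1"
  using EF_prod[of I L "\<lambda>_ _. 1"] by (simp add: E_def card_sgns)

lemma phi_cong:
  assumes "\<And>l i. l \<le> k \<Longrightarrow> i \<in> I \<Longrightarrow> z l i = z' l i"
  shows "phi I M k z = phi I M k z'"
proof -
  have "z l (i l) = z' l (i l)" if "i \<in> {..k} \<rightarrow>\<^sub>E I" "l < Suc k" for i l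
    using that by (intro assms) (auto intro: PiE_mem[OF that(1)])
  then show ?thesis
    unfolding phi_def by (intro arg_cong2[where f=divide] sum.cong refl arg_cong2[where f=times] prod.cong) auto
qed

lemma qprob_nonneg: "qprob P x y S v \<ge> 0"
  by (induction P arbitrary: S) (auto simp: alice_qubit_prob_def bob_qubit_prob_def intro!: sum_nonneg)

text \<open>\<open>phi\<close> is an amplitude of the query protocol on a one-bit gadget.\<close>

lemma phi_sq_le_1:
  assumes I: "finite I" "I \<noteq> {}" and M: "nrm_le I I M 1" and z: "\<And>l i. l \<le> k \<Longrightarrow> i \<in> I \<Longrightarrow> z l i = 1 \<or> z l i = -1"
  shows "(phi I M k z)\<^sup>2 \<le> 1"
proof -
  define X :: "nat \<Rightarrow> nat \<Rightarrow> 'a \<Rightarrow> sign_vec \<Rightarrow> sign_vec" where "X \<rho> l i x = (\<lambda>_\<in>{..<1}. if z l i = 1 then 1 else -1)" for \<rho> l i x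
  define g :: "sign_vec \<Rightarrow> sign_vec \<Rightarrow> real" where "g v w = v 0" for v w
  have b: "((2 * k + 5) * card I * 2 ^ 1) ^ 1 \<le> (2::nat) ^ ((2 * k + 5) * card I * 2)"
    by (simp add: less_imp_le)
  have X: "X \<rho> l i x \<in> cube 1" for \<rho> l i x by (auto simp: X_def cube_def)
  have g: "g v w = 1 \<or> g v w = -1" if "v \<in> cube 1" for v w
  proof -
    have "v 0 = 1 \<or> v 0 = -1" using that by (auto simp: cube_def)
    then show ?thesis by (auto simp: g_def)
  qed
  have "(\<lambda>_. undefined) \<in> cube 0" by (simp add: cube_def)
  then obtain P x y where "qprob P x y (init_state (Suc ((2 * k + 5) * card I * 2)) 0) False = (\<Prod>\<rho><(1::nat). 1 - (phi I M k (\<lambda>l i. g (X \<rho> l i x) (X \<rho> l i y)))\<^sup>2)"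
    using phase_query_protocol[OF I M, of 0 X 1 X g k 1 "(2 * k + 5) * card I * 2", OF X X g b] by blast
  moreover have "phi I M k (\<lambda>l i. g (X 0 l i x) (X 0 l i y)) = phi I M k z"
  proof (rule phi_cong)
    fix l i assume "l \<le> k" "i \<in> I"
    from z[OF this] show "g (X 0 l i x) (X 0 l i y) = z l i" by (auto simp: g_def X_def)
  qed
  ultimately show ?thesis using qprob_nonneg[of P x y "init_state (Suc ((2 * k + 5) * card I * 2)) 0" False] by simp
qed

lemma sum_agree:
  assumes J: "finite J" and T: "T \<subseteq> J" and a: "a \<in> sgns J"
  shows "(\<Sum>z\<in>{z\<in>sgns J. \<forall>i\<in>T. z i = a i}. f z) = (\<Sum>z\<in>sgns J. (\<Prod>i\<in>T. 1 + a i * z i) * f z) / 2 ^ card T"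
proof -
  have finT: "finite T" using T J by (rule finite_subset)
  have ind: "(\<Prod>i\<in>T. 1 + a i * z i) = (if \<forall>i\<in>T. z i = a i then 2 ^ card T else 0)" if z: "z \<in> sgns J" for z
  proof (cases "\<forall>i\<in>T. z i = a i")
    case True
    have "1 + a i * z i = 2" if "i \<in> T" for i
    proof -
      have "a i = 1 \<or> a i = -1" using a T that by (auto simp: sgns_def)
      then show ?thesis using True that by auto
    qed
    then show ?thesis using True by simp
  next
    case False
    then obtain i where i: "i \<in> T" "z i \<noteq> a i" by blast
    have "a i = 1 \<or> a i = -1" "z i = 1 \<or> z i = -1" using a z T i by (auto simp: sgns_def)
    then have "1 + a i * z i = 0" using i by auto
    then have "(\<Prod>i\<in>T. 1 + a i * z i) = 0" using i finT by (intro prod_zero) auto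
    then show ?thesis using False by simp
  qed
  have "(\<Sum>z\<in>{z\<in>sgns J. \<forall>i\<in>T. z i = a i}. f z) = (\<Sum>z\<in>sgns J. if \<forall>i\<in>T. z i = a i then f z else 0)"
    using J by (simp add: sum.inter_filter)
  also have "\<dots> = (\<Sum>z\<in>sgns J. (\<Prod>i\<in>T. 1 + a i * z i) * f z / 2 ^ card T)"
    by (intro sum.cong refl) (simp add: ind)
  finally show ?thesis by (simp add: sum_divide_distrib)
qed

text \<open>The probability that all \<open>R\<close> copies of the quantum walk reject.\<close>

definition rej :: "'i set \<Rightarrow> ('i \<Rightarrow> 'i \<Rightarrow> real) \<Rightarrow> nat \<Rightarrow> nat \<Rightarrow> (nat \<times> nat \<times> 'i \<Rightarrow> real) \<Rightarrow> real" where
  "rej I M k R z = (\<Prod>r<R. 1 - (phi I M k (slice I k z r))\<^sup>2)"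

locale copies =
  fixes I :: "'i set" and q M d \<eta> and R :: nat and h m t c
  assumes good: "good I q (sin_kernel M) d \<eta>" and I: "I \<noteq> {}" and M: "nrm_le I I M 1"
    and m: "m > 0" "2 * real m * \<eta> \<le> 1" and t: "t > 0" "d * t < m ^ h" and h: "h > 0"
    and flat: "\<And>i j. i \<in> I \<Longrightarrow> j \<in> I \<Longrightarrow> (M i j)\<^sup>2 \<le> 1 / real (card I)"
    and c: "c > 0" "EF I (Suc (2 * h)) (\<lambda>z. phi I M (2 * h) z * dens q I (2 * h) z) \<ge> c"
begin

lemma finI: "finite I" by (rule good_fin[OF good])

abbreviation "J \<equiv> idx R (2 * h) I"
abbreviation "\<Phi> z r \<equiv> phi I M (2 * h) (slice I (2 * h) z r)"

definition nu :: "(nat \<times> nat \<times> 'i \<Rightarrow> real) \<Rightarrow> real" where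
  "nu z = (\<Prod>r<R. dens q I (2 * h) (slice I (2 * h) z r))"

lemma fam_sq: "z \<in> {..<Suc (2 * h)} \<rightarrow>\<^sub>E sgns I \<Longrightarrow> (phi I M (2 * h) z)\<^sup>2 \<le> 1"
  by (rule phi_sq_le_1[OF finI I M]) (fastforce simp: sgns_def PiE_iff)

lemma fam_dens: "z \<in> {..<Suc (2 * h)} \<rightarrow>\<^sub>E sgns I \<Longrightarrow> dens q I (2 * h) z \<ge> 0"
  by (rule dens_nonneg[OF good]) (erule PiE_mem, simp)

lemma nu_nonneg: "z \<in> sgns J \<Longrightarrow> nu z \<ge> 0"
  unfolding nu_def by (intro prod_nonneg fam_dens slice_in[of z R]) auto

lemma nu_total: "(\<Sum>z\<in>sgns J. nu z) = 2 ^ card J"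
  unfolding nu_def sum_slices[OF finI, of "\<lambda>_. dens q I (2 * h)"]
  using dens_total[OF good, of "2 * h"] h by simp

text \<open>At most \<open>d\<close> coordinates of \<open>J\<close> leave at most \<open>d\<close>
  on each layer of each copy, and the copies are independent, so \<open>dens_subcube\<close> applies
  to every factor.\<close>

lemma nu_subcube:
  assumes T: "T \<subseteq> J" "card T \<le> d" and a: "a \<in> sgns J"
  shows "(\<Sum>z\<in>{z\<in>sgns J. \<forall>i\<in>T. z i = a i}. nu z) \<ge> (1 - 1 / real t) ^ R * 2 ^ (card J - card T)"
proof -
  define S where "S r l = {i. (r, l, i) \<in> T}" for r l
  have finT: "finite T" by (rule finite_subset[OF T(1) finite_idx[OF finI]])
  have SI: "S r l \<subseteq> I" for r l using T by (auto simp: S_def idx_def)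
  have Sd: "card (S r l) \<le> d" for r l
  proof -
    have "card (S r l) = card ((\<lambda>i. (r, l, i)) ` S r l)" by (intro card_image[symmetric]) (auto simp: inj_on_def)
    also have "\<dots> \<le> card T" by (intro card_mono finT) (auto simp: S_def)
    finally show ?thesis using T(2) by simp
  qed
  have prod_eq: "(\<Prod>p\<in>T. 1 + a p * z p) = (\<Prod>r<R. \<Prod>l<Suc (2 * h). \<Prod>i\<in>S r l. 1 + slice I (2 * h) a r l i * slice I (2 * h) z r l i)" for z
  proof -
    have T_eq: "T = Sigma {..<R} (\<lambda>r. Sigma {..<Suc (2 * h)} (S r))" using T(1) by (auto simp: S_def idx_def)
    have "(\<Prod>p\<in>T. 1 + a p * z p) = (\<Prod>r<R. \<Prod>p\<in>Sigma {..<Suc (2 * h)} (S r). 1 + a (r, p) * z (r, p))"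
      by (subst T_eq, subst prod.Sigma) (auto intro!: finite_subset[OF SI] finI finite_SigmaI simp: case_prod_unfold)
    also have "\<dots> = (\<Prod>r<R. \<Prod>l<Suc (2 * h). \<Prod>i\<in>S r l. 1 + a (r, l, i) * z (r, l, i))"
      by (intro prod.cong refl, subst prod.Sigma) (auto intro!: finite_subset[OF SI] finI simp: case_prod_unfold)
    also have "\<dots> = (\<Prod>r<R. \<Prod>l<Suc (2 * h). \<Prod>i\<in>S r l. 1 + slice I (2 * h) a r l i * slice I (2 * h) z r l i)"
      using SI by (intro prod.cong refl) (auto simp: slice_def)
    finally show ?thesis .
  qed
  have cardT: "card T \<le> card J" using T(1) finI by (intro card_mono) auto
  have sl: "slice I (2 * h) a r j \<in> sgns I" if "r < R" "j \<le> 2 * h" for r j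
    by (rule PiE_mem[OF slice_in[OF a that(1)]]) (use that in simp)
  have t1: "0 \<le> 1 - 1 / real t" using t by simp
  have "(\<Sum>z\<in>{z\<in>sgns J. \<forall>i\<in>T. z i = a i}. nu z)
     = (\<Sum>z\<in>sgns J. \<Prod>r<R. (\<lambda>r z. (\<Prod>l<Suc (2 * h). \<Prod>i\<in>S r l. 1 + slice I (2 * h) a r l i * z l i) * dens q I (2 * h) z) r (slice I (2 * h) z r)) / 2 ^ card T"
    unfolding sum_agree[OF finite_idx[OF finI] T(1) a] prod_eq nu_def prod.distrib ..
  also have "\<dots> = 2 ^ card J / 2 ^ card T * (\<Prod>r<R. EF I (Suc (2 * h)) (\<lambda>z. (\<Prod>l<Suc (2 * h). \<Prod>i\<in>S r l. 1 + slice I (2 * h) a r l i * z l i) * dens q I (2 * h) z))"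
    unfolding sum_slices[OF finI, of "\<lambda>r z. (\<Prod>l<Suc (2 * h). \<Prod>i\<in>S r l. 1 + slice I (2 * h) a r l i * z l i) * dens q I (2 * h) z"]
    by (simp only: times_divide_eq_left)
  also have "\<dots> \<ge> 2 ^ card J / 2 ^ card T * (\<Prod>r<R. 1 - 1 / real t)"
    using t1 by (intro mult_left_mono prod_mono conjI dens_subcube[OF good SI Sd sl m t h]) auto
  finally show ?thesis using cardT by (simp add: power_diff mult.commute)
qed

lemma rej_nonneg: "z \<in> sgns J \<Longrightarrow> rej I M (2 * h) R z \<ge> 0"
  unfolding rej_def using fam_sq slice_in[of z R "2 * h" I] by (intro prod_nonneg) auto

text \<open>The squared amplitude has mean at least \<open>c\<^sup>2\<close> under the density,
  because the weighted mean of the square of \<open>phi - c\<close> is nonnegative.\<close>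

lemma second_moment: "EF I (Suc (2 * h)) (\<lambda>z. (1 - (phi I M (2 * h) z)\<^sup>2) * dens q I (2 * h) z) \<le> 1 - c\<^sup>2"
proof -
  let ?p = "phi I M (2 * h)" and ?D = "dens q I (2 * h)"
  have "0 \<le> EF I (Suc (2 * h)) (\<lambda>z. (?p z - c)\<^sup>2 * ?D z)"
    unfolding EF_def using fam_dens by (intro divide_nonneg_nonneg sum_nonneg mult_nonneg_nonneg) auto
  also have "(\<lambda>z. (?p z - c)\<^sup>2 * ?D z) = (\<lambda>z. (?D z - (1 - (?p z)\<^sup>2) * ?D z) + ((- 2 * c) * (?p z * ?D z) + c\<^sup>2 * ?D z))"
    by (rule ext) (simp add: power2_eq_square algebra_simps)
  also have "EF I (Suc (2 * h)) \<dots> = 1 - EF I (Suc (2 * h)) (\<lambda>z. (1 - (?p z)\<^sup>2) * ?D z) + (-2 * c * EF I (Suc (2 * h)) (\<lambda>z. ?p z * ?D z) + c\<^sup>2)"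
    unfolding EF_add EF_diff EF_cmult using dens_total[OF good, of "2 * h"] h by simp
  finally have "EF I (Suc (2 * h)) (\<lambda>z. (1 - (?p z)\<^sup>2) * ?D z) \<le> 1 - 2 * (c * EF I (Suc (2 * h)) (\<lambda>z. ?p z * ?D z)) + c\<^sup>2" by simp
  moreover have "c * c \<le> c * EF I (Suc (2 * h)) (\<lambda>z. ?p z * ?D z)" using c by (intro mult_left_mono) auto
  ultimately show ?thesis by (simp add: power2_eq_square)
qed

lemma nu_reject: "(\<Sum>z | z \<in> sgns J \<and> \<not> rej I M (2 * h) R z \<le> 1 / 3. nu z) \<le> 3 * (1 - c\<^sup>2) ^ R * 2 ^ card J"
proof -
  have "(\<Sum>z | z \<in> sgns J \<and> \<not> rej I M (2 * h) R z \<le> 1 / 3. nu z) \<le> (\<Sum>z | z \<in> sgns J \<and> \<not> rej I M (2 * h) R z \<le> 1 / 3. 3 * (rej I M (2 * h) R z * nu z))"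
  proof (rule sum_mono)
    fix z assume z: "z \<in> {z. z \<in> sgns J \<and> \<not> rej I M (2 * h) R z \<le> 1 / 3}"
    then have "1 * nu z \<le> (3 * rej I M (2 * h) R z) * nu z" using nu_nonneg by (intro mult_right_mono) auto
    then show "nu z \<le> 3 * (rej I M (2 * h) R z * nu z)" by simp
  qed
  also have "\<dots> \<le> (\<Sum>z\<in>sgns J. 3 * (rej I M (2 * h) R z * nu z))"
    using nu_nonneg rej_nonneg finI by (intro sum_mono2) auto
  also have "\<dots> = 3 * (\<Sum>z\<in>sgns J. \<Prod>r<R. (\<lambda>_ z. (1 - (phi I M (2 * h) z)\<^sup>2) * dens q I (2 * h) z) r (slice I (2 * h) z r))"
    by (simp add: sum_distrib_left rej_def nu_def prod.distrib)
  also have "\<dots> = 3 * (2 ^ card J * (\<Prod>r<R. EF I (Suc (2 * h)) (\<lambda>z. (1 - (phi I M (2 * h) z)\<^sup>2) * dens q I (2 * h) z)))"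
    unfolding sum_slices[OF finI, of "\<lambda>_ z. (1 - (phi I M (2 * h) z)\<^sup>2) * dens q I (2 * h) z"] ..
  also have "\<dots> \<le> 3 * (2 ^ card J * (\<Prod>r<R. 1 - c\<^sup>2))"
  proof (intro mult_left_mono prod_mono conjI second_moment)
    show "0 \<le> EF I (Suc (2 * h)) (\<lambda>z. (1 - (phi I M (2 * h) z)\<^sup>2) * dens q I (2 * h) z)"
      unfolding EF_def using fam_dens fam_sq by (intro divide_nonneg_nonneg sum_nonneg mult_nonneg_nonneg) auto
  qed auto
  finally show ?thesis by (simp only: prod_constant card_lessThan mult_ac)
qed

lemma prod_ge: "(\<And>r. r \<in> S \<Longrightarrow> 0 \<le> p r \<and> p r \<le> (1::real)) \<Longrightarrow> finite S \<Longrightarrow> 1 - (\<Sum>r\<in>S. p r) \<le> (\<Prod>r\<in>S. 1 - p r)"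
proof (induction S rule: infinite_finite_induct)
  case (insert x S)
  have "1 - (\<Sum>r\<in>S. p r) - p x \<le> (\<Prod>r\<in>S. 1 - p r) - p x * 1" using insert by simp
  also have "\<dots> \<le> (\<Prod>r\<in>S. 1 - p r) - p x * (\<Prod>r\<in>S. 1 - p r)"
    using insert.prems by (intro diff_mono mult_left_mono prod_le_1 order_refl) auto
  finally show ?case using insert by (simp add: algebra_simps)
qed auto

text \<open>A rejection probability below 2/3 forces the squared amplitudes to sum to more than 1/3;
  Markov's inequality with \<open>phi_unif_sq\<close> bounds how often this happens.\<close>

lemma unif_accept: "real (card {z \<in> sgns J. \<not> rej I M (2 * h) R z \<ge> 2 / 3}) \<le> 3 * real R / real (card I) * 2 ^ card J"
proof -
  let ?S = "{z \<in> sgns J. \<not> rej I M (2 * h) R z \<ge> 2 / 3}"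
  have "real (card ?S) = (\<Sum>z\<in>?S. 1)" by simp
  also have "\<dots> \<le> (\<Sum>z\<in>?S. 3 * (\<Sum>r<R. (\<Phi> z r)\<^sup>2))"
  proof (rule sum_mono)
    fix z assume z: "z \<in> ?S"
    then have "1 - (\<Sum>r<R. (\<Phi> z r)\<^sup>2) \<le> rej I M (2 * h) R z"
      unfolding rej_def using fam_sq slice_in[of z R "2 * h" I] by (intro prod_ge) auto
    then show "1 \<le> 3 * (\<Sum>r<R. (\<Phi> z r)\<^sup>2)" using z by simp
  qed
  also have "\<dots> \<le> (\<Sum>z\<in>sgns J. 3 * (\<Sum>r<R. (\<Phi> z r)\<^sup>2))"
    using finI by (intro sum_mono2) (auto intro!: sum_nonneg)
  also have "\<dots> = 3 * (\<Sum>r<R. \<Sum>z\<in>sgns J. (\<Phi> z r)\<^sup>2)"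
    unfolding sum_distrib_left by (rule sum.swap)
  also have "\<dots> \<le> 3 * (\<Sum>r<R. 2 ^ card J * (1 / real (card I)))"
  proof (intro mult_left_mono sum_mono)
    fix r assume r: "r \<in> {..<R}"
    have "(\<Sum>z\<in>sgns J. (\<Phi> z r)\<^sup>2) = (\<Sum>z\<in>sgns J. \<Prod>r'<R. (\<lambda>r' z. if r' = r then (phi I M (2 * h) z)\<^sup>2 else 1) r' (slice I (2 * h) z r'))"
      using r by (intro sum.cong refl) (simp add: prod.delta)
    also have "\<dots> = 2 ^ card J * (\<Prod>r'<R. EF I (Suc (2 * h)) (\<lambda>z. if r' = r then (phi I M (2 * h) z)\<^sup>2 else 1))"
      by (rule sum_slices[OF finI])
    also have "(\<Prod>r'<R. EF I (Suc (2 * h)) (\<lambda>z. if r' = r then (phi I M (2 * h) z)\<^sup>2 else 1)) = (\<Prod>r'<R. if r' = r then EF I (Suc (2 * h)) (\<lambda>z. (phi I M (2 * h) z)\<^sup>2) else 1)"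
      using finI by (intro prod.cong refl) (auto simp: EF_one)
    also have "\<dots> = EF I (Suc (2 * h)) (\<lambda>z. (phi I M (2 * h) z)\<^sup>2)" using r by (simp add: prod.delta)
    also have "\<dots> \<le> 1 / real (card I)" by (rule phi_unif_sq[OF finI I flat])
    finally show "(\<Sum>z\<in>sgns J. (\<Phi> z r)\<^sup>2) \<le> 2 ^ card J * (1 / real (card I))" by simp
  qed auto
  finally show ?thesis by (simp add: mult_ac)
qed

end

section \<open>The classical lower bound\<close>

text \<open>The inputs answered by 0 form at most \<open>2 ^ cost t\<close> rectangles, one for each
  such leaf, and each of them loses at most \<open>err\<close>. The induction splits the rectangle
  along the tree instead of collecting leaves.\<close>

lemma tree_bound:
  fixes \<phi> :: "sign_vec \<Rightarrow> sign_vec \<Rightarrow> real"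
  assumes fin: "finite \<Omega>" and err: "err \<ge> 0"
    and rect: "\<And>A B. A \<subseteq> \<Omega> \<Longrightarrow> B \<subseteq> \<Omega> \<Longrightarrow> (\<Sum>x\<in>A. \<Sum>y\<in>B. \<phi> x y - c) \<ge> - err"
  shows "A \<subseteq> \<Omega> \<Longrightarrow> B \<subseteq> \<Omega> \<Longrightarrow> (\<Sum>x\<in>A. \<Sum>y\<in>B. if run t x y then 0 else \<phi> x y - c) \<ge> - (2 ^ cost t * err)"
proof (induction t arbitrary: A B)
  case (Leaf v)
  then show ?case using rect[OF Leaf] err by (cases v) auto
next
  case (Alice f P0 P1)
  let ?A1 = "{x\<in>A. f x}" and ?A0 = "{x\<in>A. \<not> f x}"
  have finA: "finite A" using Alice.prems(1) fin by (rule finite_subset)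
  have "(\<Sum>x\<in>A. \<Sum>y\<in>B. if run (Alice f P0 P1) x y then 0 else \<phi> x y - c)
     = (\<Sum>x\<in>?A0. \<Sum>y\<in>B. if run (Alice f P0 P1) x y then 0 else \<phi> x y - c) + (\<Sum>x\<in>?A1. \<Sum>y\<in>B. if run (Alice f P0 P1) x y then 0 else \<phi> x y - c)"
    using finA by (subst sum.union_disjoint[symmetric]) (auto intro!: sum.cong)
  also have "\<dots> = (\<Sum>x\<in>?A0. \<Sum>y\<in>B. if run P0 x y then 0 else \<phi> x y - c) + (\<Sum>x\<in>?A1. \<Sum>y\<in>B. if run P1 x y then 0 else \<phi> x y - c)"
    by (intro arg_cong2[where f=plus] sum.cong refl) auto
  also have "\<dots> \<ge> - (2 ^ cost P0 * err) + - (2 ^ cost P1 * err)"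
    using Alice.prems by (intro add_mono Alice.IH) auto
  also have "- (2 ^ cost P0 * err) + - (2 ^ cost P1 * err) \<ge> - (2 ^ max (cost P0) (cost P1) * err) + - (2 ^ max (cost P0) (cost P1) * err)"
    using err by (intro add_mono le_imp_neg_le mult_right_mono power_increasing) auto
  finally show ?case by (simp add: mult_ac)
next
  case (Bob f P0 P1)
  let ?B1 = "{x\<in>B. f x}" and ?B0 = "{x\<in>B. \<not> f x}"
  have finB: "finite B" using Bob.prems(2) fin by (rule finite_subset)
  have "(\<Sum>x\<in>A. \<Sum>y\<in>B. if run (Bob f P0 P1) x y then 0 else \<phi> x y - c)
     = (\<Sum>x\<in>A. (\<Sum>y\<in>?B0. if run (Bob f P0 P1) x y then 0 else \<phi> x y - c) + (\<Sum>y\<in>?B1. if run (Bob f P0 P1) x y then 0 else \<phi> x y - c))"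
    using finB by (intro sum.cong refl, subst sum.union_disjoint[symmetric]) (auto intro!: sum.cong)
  also have "\<dots> = (\<Sum>x\<in>A. \<Sum>y\<in>?B0. if run P0 x y then 0 else \<phi> x y - c) + (\<Sum>x\<in>A. \<Sum>y\<in>?B1. if run P1 x y then 0 else \<phi> x y - c)"
    unfolding sum.distrib by (intro arg_cong2[where f=plus] sum.cong refl) auto
  also have "\<dots> \<ge> - (2 ^ cost P0 * err) + - (2 ^ cost P1 * err)"
    using Bob.prems by (intro add_mono Bob.IH) auto
  also have "- (2 ^ cost P0 * err) + - (2 ^ cost P1 * err) \<ge> - (2 ^ max (cost P0) (cost P1) * err) + - (2 ^ max (cost P0) (cost P1) * err)"
    using err by (intro add_mono le_imp_neg_le mult_right_mono power_increasing) auto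
  finally show ?case by (simp add: mult_ac)
qed

text \<open>Averaging \<open>tree_bound\<close> over the coins bounds the sum of
  \<open>\<phi> x y - c\<close> weighted by the probability \<open>p\<close> of answering 0.
  Correctness makes \<open>p\<close> at least 2/3 on 0-inputs and at most 1/3 on 1-inputs; elsewhere
  the trivial bounds \<open>0 \<le> p \<le> 1\<close> are used.\<close>

lemma randomized_bound:
  fixes \<phi> :: "sign_vec \<Rightarrow> sign_vec \<Rightarrow> real" and N :: nat
  defines "\<Omega> \<equiv> cube N"
  assumes err: "err \<ge> 0" and c: "c \<ge> 0"
    and rect: "\<And>A B. A \<subseteq> \<Omega> \<Longrightarrow> B \<subseteq> \<Omega> \<Longrightarrow> (\<Sum>x\<in>A. \<Sum>y\<in>B. \<phi> x y - c) \<ge> - err"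
    and \<phi>: "\<And>x y. x \<in> \<Omega> \<Longrightarrow> y \<in> \<Omega> \<Longrightarrow> \<phi> x y \<ge> 0"
    and P: "rand_computes N (1/3) F P" "\<And>t. t \<in> set_pmf P \<Longrightarrow> cost t \<le> C"
  shows "2 / 3 * c * (\<Sum>x\<in>\<Omega>. \<Sum>y\<in>\<Omega>. if F x y = Some False then 1 else 0)
     \<le> 1 / 3 * (\<Sum>x\<in>\<Omega>. \<Sum>y\<in>\<Omega>. \<phi> x y) + (\<Sum>x\<in>\<Omega>. \<Sum>y\<in>\<Omega>. if F x y = Some True then 0 else \<phi> x y) + 2 ^ C * err"
proof -
  have fin: "finite \<Omega>" by (simp add: \<Omega>_def finite_cube)
  define p where "p x y = measure_pmf.prob P {t. \<not> run t x y}" for x y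
  define W where "W t = (\<Sum>x\<in>\<Omega>. \<Sum>y\<in>\<Omega>. (\<phi> x y - c) * indicator {t. \<not> run t x y} t)" for t
  have Wge: "W t \<ge> - (2 ^ C * err)" if t: "t \<in> set_pmf P" for t
  proof -
    have "W t = (\<Sum>x\<in>\<Omega>. \<Sum>y\<in>\<Omega>. if run t x y then 0 else \<phi> x y - c)"
      unfolding W_def by (intro sum.cong refl) (simp add: indicator_def)
    also have "\<dots> \<ge> - (2 ^ cost t * err)"
      by (rule tree_bound[OF fin err rect]) auto
    also have "- (2 ^ cost t * err) \<ge> - (2 ^ C * err)"
      using P(2)[OF t] err by (intro le_imp_neg_le mult_right_mono power_increasing) auto
    finally show ?thesis .
  qed
  have intW: "measure_pmf.expectation P W = (\<Sum>x\<in>\<Omega>. \<Sum>y\<in>\<Omega>. (\<phi> x y - c) * p x y)"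
    and int: "integrable (measure_pmf P) W"
  proof -
    have ind: "integrable (measure_pmf P) (\<lambda>t. (\<phi> x y - c) * indicator {t. \<not> run t x y} t)" for x y
      by (intro integrable_mult_right integrable_real_indicator) (auto simp: measure_pmf.emeasure_eq_measure)
    show "measure_pmf.expectation P W = (\<Sum>x\<in>\<Omega>. \<Sum>y\<in>\<Omega>. (\<phi> x y - c) * p x y)"
      unfolding W_def p_def using ind by (simp add: Bochner_Integration.integral_sum)
    show "integrable (measure_pmf P) W" unfolding W_def using ind by auto
  qed
  have lower: "- (2 ^ C * err) \<le> (\<Sum>x\<in>\<Omega>. \<Sum>y\<in>\<Omega>. (\<phi> x y - c) * p x y)"
  proof -
    have "measure_pmf.expectation P (\<lambda>_. - (2 ^ C * err)) \<le> measure_pmf.expectation P W"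
      using Wge int by (intro integral_mono_AE) (auto simp: AE_measure_pmf_iff)
    then show ?thesis by (simp add: intW)
  qed
  have p01: "0 \<le> p x y" "p x y \<le> 1" for x y by (simp_all add: p_def)
  have pT: "p x y \<le> 1 / 3" if "x \<in> \<Omega>" "y \<in> \<Omega>" "F x y = Some True" for x y
  proof -
    have "measure_pmf.prob P {t. run t x y} \<ge> 2 / 3"
    proof -
      have "measure_pmf.prob P {t. run t x y = True} \<ge> 1 - 1 / 3"
        using P(1) that unfolding rand_computes_def \<Omega>_def by blast
      then show ?thesis by simp
    qed
    moreover have "p x y = 1 - measure_pmf.prob P {t. run t x y}"
      unfolding p_def using measure_pmf.prob_compl[of "{t. run t x y}" P] by (simp add: Compl_eq_Diff_UNIV[symmetric] Collect_neg_eq[symmetric])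
    ultimately show ?thesis by simp
  qed
  have pF: "p x y \<ge> 2 / 3" if "x \<in> \<Omega>" "y \<in> \<Omega>" "F x y = Some False" for x y
  proof -
    have "measure_pmf.prob P {t. run t x y = False} \<ge> 1 - 1 / 3"
      using P(1) that unfolding rand_computes_def \<Omega>_def by blast
    then show ?thesis by (simp add: p_def)
  qed
  have "(\<Sum>x\<in>\<Omega>. \<Sum>y\<in>\<Omega>. (\<phi> x y - c) * p x y)
     \<le> (\<Sum>x\<in>\<Omega>. \<Sum>y\<in>\<Omega>. (1 / 3 * \<phi> x y + (if F x y = Some True then 0 else \<phi> x y)) - 2 / 3 * c * (if F x y = Some False then 1 else 0))"
  proof (intro sum_mono)
    fix x y assume xy: "x \<in> \<Omega>" "y \<in> \<Omega>"
    have "\<phi> x y * p x y \<le> 1 / 3 * \<phi> x y + (if F x y = Some True then 0 else \<phi> x y)"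
    proof (cases "F x y = Some True")
      case True
      then show ?thesis using mult_left_mono[OF pT[OF xy True] \<phi>[OF xy]] by simp
    next
      case False
      then show ?thesis using mult_left_le[OF p01(2)[of x y] \<phi>[OF xy]] \<phi>[OF xy] by simp
    qed
    moreover have "c * p x y \<ge> 2 / 3 * c * (if F x y = Some False then 1 else 0)"
      using mult_left_mono[OF pF[OF xy] c] mult_nonneg_nonneg[OF c p01(1)[of x y]] by auto
    ultimately show "(\<phi> x y - c) * p x y \<le> (1 / 3 * \<phi> x y + (if F x y = Some True then 0 else \<phi> x y)) - 2 / 3 * c * (if F x y = Some False then 1 else 0)"
      by (simp add: left_diff_distrib)
  qed
  also have "\<dots> = 1 / 3 * (\<Sum>x\<in>\<Omega>. \<Sum>y\<in>\<Omega>. \<phi> x y) + (\<Sum>x\<in>\<Omega>. \<Sum>y\<in>\<Omega>. if F x y = Some True then 0 else \<phi> x y)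
      - 2 / 3 * c * (\<Sum>x\<in>\<Omega>. \<Sum>y\<in>\<Omega>. if F x y = Some False then 1 else 0)"
    by (simp only: sum_subtractf sum.distrib sum_distrib_left[symmetric])
  finally show ?thesis using lower by linarith
qed

text \<open>For every fixed \<open>y\<close>, balancedness makes each sign pattern \<open>z\<close>
  arise from equally many \<open>x\<close>, so the gadget maps uniform inputs to uniform
  signs.\<close>

lemma (in gadget) uniform_lift:
  fixes J :: "'j set"
  assumes J: "finite J"
  shows "(\<Sum>x\<in>J \<rightarrow>\<^sub>E \<Sigma>. \<Sum>y\<in>J \<rightarrow>\<^sub>E \<Sigma>. f (G J x y)) = s ^ (2 * card J) / 2 ^ card J * (\<Sum>z\<in>sgns J. f z :: real)"
proof -
  let ?\<Omega> = "J \<rightarrow>\<^sub>E \<Sigma>"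
  have fin\<Omega>: "finite ?\<Omega>" using J fin by (intro finite_PiE) auto
  have count: "real (card {x\<in>?\<Omega>. G J x y = z}) = (s / 2) ^ card J" if y: "y \<in> ?\<Omega>" and z: "z \<in> sgns J" for y z
  proof -
    have "real (card {x\<in>?\<Omega>. G J x y = z}) = (\<Sum>x\<in>?\<Omega>. if G J x y = z then 1 else 0)"
      using fin\<Omega> by (simp add: sum.If_cases Int_def)
    also have "\<dots> = (\<Sum>x\<in>?\<Omega>. \<Prod>i\<in>J. (1 + z i * g (x i) (y i)) / 2)"
    proof (intro sum.cong refl)
      fix x assume x: "x \<in> ?\<Omega>"
      have v: "g (x i) (y i) = 1 \<or> g (x i) (y i) = -1" "z i = 1 \<or> z i = -1" if "i \<in> J" for i
        using sign[of "x i" "y i"] x y z that by (auto simp: sgns_def PiE_iff)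
      show "(if G J x y = z then 1 else 0) = (\<Prod>i\<in>J. (1 + z i * g (x i) (y i)) / 2)"
      proof (cases "G J x y = z")
        case True
        have "(1 + z i * g (x i) (y i)) / 2 = 1" if "i \<in> J" for i
          using v[OF that] that True by (auto simp: G_def)
        then show ?thesis using True by simp
      next
        case False
        then obtain i where i: "i \<in> J" "G J x y i \<noteq> z i"
          using PiE_ext[OF G_sgns[OF x y, unfolded sgns_def] z[unfolded sgns_def]] by blast
        then have "(1 + z i * g (x i) (y i)) / 2 = 0" using v[OF i(1)] by (auto simp: G_def)
        then have "(\<Prod>i\<in>J. (1 + z i * g (x i) (y i)) / 2) = 0" using i(1) J by (intro prod_zero) auto
        then show ?thesis using False by simp
      qed
    qed
    also have "\<dots> = (\<Prod>i\<in>J. \<Sum>a\<in>\<Sigma>. (1 + z i * g a (y i)) / 2)"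
      using J fin by (subst prod_sum_PiE) auto
    also have "\<dots> = (\<Prod>i\<in>J. s / 2)"
    proof (intro prod.cong refl)
      fix i assume "i \<in> J"
      then have "(\<Sum>a\<in>\<Sigma>. g a (y i)) = 0" using y balanced by auto
      then show "(\<Sum>a\<in>\<Sigma>. (1 + z i * g a (y i)) / 2) = s / 2"
        by (simp add: sum_divide_distrib[symmetric] sum.distrib sum_distrib_left[symmetric] s_def)
    qed
    finally show ?thesis by simp
  qed
  have card\<Omega>: "real (card ?\<Omega>) = s ^ card J" using J by (simp add: card_PiE s_def)
  have "(\<Sum>x\<in>?\<Omega>. \<Sum>y\<in>?\<Omega>. f (G J x y)) = (\<Sum>y\<in>?\<Omega>. \<Sum>x\<in>?\<Omega>. f (G J x y))" by (rule sum.swap)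
  also have "\<dots> = (\<Sum>y\<in>?\<Omega>. \<Sum>z\<in>sgns J. real (card {x\<in>?\<Omega>. G J x y = z}) * f z)"
    using G_sgns J fin\<Omega> by (intro sum.cong refl sum_fiber_card) auto
  also have "\<dots> = (\<Sum>y\<in>?\<Omega>. (s / 2) ^ card J * (\<Sum>z\<in>sgns J. f z))"
    by (intro sum.cong refl) (simp add: count sum_distrib_left)
  also have "\<dots> = s ^ (2 * card J) / 2 ^ card J * (\<Sum>z\<in>sgns J. f z)"
    by (simp add: card\<Omega> power_divide mult_2 power_add)
  finally show ?thesis .
qed

section \<open>The inner product gadget on bits of the input\<close>

text \<open>One sign of \<open>x\<close> balances the gadget; the remaining positions carry an inner product.\<close>

definition bitg :: "nat \<Rightarrow> int \<Rightarrow> int \<Rightarrow> real" where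
  "bitg j u v = (if j = 0 then u else if u = -1 \<and> v = -1 then -1 else 1)"

definition ipg :: "nat \<Rightarrow> sign_vec \<Rightarrow> sign_vec \<Rightarrow> real" where
  "ipg b x y = (\<Prod>j<b. bitg j (x j) (y j))"

lemma ipg_sign: "x \<in> cube b \<Longrightarrow> ipg b x y = 1 \<or> ipg b x y = -1"
proof -
  assume x: "x \<in> cube b"
  have sg: "bitg j (x j) (y j) = 1 \<or> bitg j (x j) (y j) = -1" if "j < b" for j
  proof -
    have "x j = 1 \<or> x j = -1" using x that by (auto simp: cube_def)
    then show ?thesis by (auto simp: bitg_def)
  qed
  have "m \<le> b \<Longrightarrow> (\<Prod>j<m. bitg j (x j) (y j)) = 1 \<or> (\<Prod>j<m. bitg j (x j) (y j)) = -1" for m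
  proof (induction m)
    case (Suc m)
    then have "m < b" "(\<Prod>j<m. bitg j (x j) (y j)) = 1 \<or> (\<Prod>j<m. bitg j (x j) (y j)) = -1" by auto
    moreover have "bitg m (x m) (y m) = 1 \<or> bitg m (x m) (y m) = -1" by (rule sg[OF \<open>m < b\<close>])
    ultimately show ?case unfolding prod.lessThan_Suc by (elim disjE) simp_all
  qed simp
  then show ?thesis by (simp add: ipg_def)
qed

lemma gadget_ipg:
  assumes b: "b > 0"
  shows "gadget (cube b) (ipg b)"
proof
  show "finite (cube b)" by (rule finite_cube)
  show "cube b \<noteq> {}" by (simp add: cube_def PiE_eq_empty_iff)
  show "ipg b x y \<in> {-1, 1}" if "x \<in> cube b" for x y using ipg_sign[OF that] by auto
  show "(\<Sum>x\<in>cube b. ipg b x y) = 0" for y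
  proof -
    have "(\<Sum>x\<in>cube b. ipg b x y) = (\<Prod>j<b. \<Sum>u\<in>{-1,1}. bitg j u (y j))"
      unfolding ipg_def cube_def by (subst prod_sum_PiE) auto
    also have "\<dots> = 0" using b by (intro prod_zero bexI[of _ 0]) (auto simp: bitg_def)
    finally show ?thesis .
  qed
  show "(\<Sum>x'\<in>cube b. \<bar>\<Sum>y\<in>cube b. ipg b x y * ipg b x' y\<bar>) \<le> 2 * real (card (cube b))" if x: "x \<in> cube b" for x
  proof -
    have "(\<Sum>x'\<in>cube b. \<bar>\<Sum>y\<in>cube b. ipg b x y * ipg b x' y\<bar>)
       = (\<Sum>x'\<in>cube b. \<Prod>j<b. \<bar>\<Sum>v\<in>{-1,1}. bitg j (x j) v * bitg j (x' j) v\<bar>)"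
    proof (intro sum.cong refl)
      fix x'
      have "(\<Sum>y\<in>cube b. ipg b x y * ipg b x' y) = (\<Prod>j<b. \<Sum>v\<in>{-1,1}. bitg j (x j) v * bitg j (x' j) v)"
        unfolding ipg_def cube_def prod.distrib[symmetric] by (subst prod_sum_PiE) auto
      then show "\<bar>\<Sum>y\<in>cube b. ipg b x y * ipg b x' y\<bar> = (\<Prod>j<b. \<bar>\<Sum>v\<in>{-1,1}. bitg j (x j) v * bitg j (x' j) v\<bar>)"
        by (simp only: abs_prod)
    qed
    also have "\<dots> = (\<Prod>j<b. \<Sum>u\<in>{-1,1}. \<bar>\<Sum>v\<in>{-1,1}. bitg j (x j) v * bitg j u v\<bar>)"
      unfolding cube_def by (subst prod_sum_PiE) auto
    \<comment> \<open>At position 0 no choice of \<open>u\<close> leads to cancellation, which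
      doubles the factor 2 of a true inner product position. This is the source of the 2 in
      \<open>gram\<close>.\<close>
    also have "\<dots> = (\<Prod>j<b. if j = 0 then 4 else 2)"
    proof (intro prod.cong refl)
      fix j assume "j \<in> {..<b}"
      then have "x j = 1 \<or> x j = -1" using x by (auto simp: cube_def)
      then show "(\<Sum>u\<in>{-1,1}. \<bar>\<Sum>v\<in>{-1,1}. bitg j (x j) v * bitg j u v\<bar>) = (if j = 0 then 4 else 2)"
        by (auto simp: bitg_def)
    qed
    also have "\<dots> = 2 * real (card (cube b))"
    proof -
      obtain b' where b': "b = Suc b'" using b by (cases b) auto
      show ?thesis unfolding b' by (subst prod.lessThan_Suc_shift) (simp add: card_cube)
    qed
    finally show ?thesis by simp
  qed
qed

definition blk :: "('j \<Rightarrow> nat) \<Rightarrow> nat \<Rightarrow> 'j \<Rightarrow> sign_vec \<Rightarrow> sign_vec" where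
  "blk e b j x = (\<lambda>t\<in>{..<b}. x (e j * b + t))"

lemma blk_in:
  assumes "e j < m" "x \<in> cube (m * b)"
  shows "blk e b j x \<in> cube b"
proof -
  have "e j * b + t < m * b" if "t < b" for t
  proof -
    have "e j * b + t < Suc (e j) * b" using that by simp
    also have "\<dots> \<le> m * b" using assms(1) by (intro mult_right_mono) auto
    finally show ?thesis .
  qed
  then show ?thesis using assms(2) unfolding cube_def blk_def restrict_PiE_iff by (auto simp: PiE_iff)
qed

definition blks :: "('j \<Rightarrow> nat) \<Rightarrow> nat \<Rightarrow> 'j set \<Rightarrow> sign_vec \<Rightarrow> 'j \<Rightarrow> sign_vec" where
  "blks e b J x = (\<lambda>j\<in>J. blk e b j x)"

lemma blks_bij:
  assumes J: "finite J" and e: "bij_betw e J {..<card J}" and b: "b > 0"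
  shows "bij_betw (blks e b J) (cube (card J * b)) (J \<rightarrow>\<^sub>E cube b)"
proof -
  have into: "blks e b J ` cube (card J * b) \<subseteq> J \<rightarrow>\<^sub>E cube b"
  proof
    fix X assume "X \<in> blks e b J ` cube (card J * b)"
    then obtain x where "x \<in> cube (card J * b)" "X = blks e b J x" by blast
    then show "X \<in> J \<rightarrow>\<^sub>E cube b"
      unfolding blks_def using blk_in[of e _ "card J" x b] bij_betwE[OF e] by (auto simp only: restrict_PiE_iff lessThan_iff)
  qed
  have inj: "inj_on (blks e b J) (cube (card J * b))"
  proof (rule inj_onI)
    fix x x' assume x: "x \<in> cube (card J * b)" "x' \<in> cube (card J * b)" and eq: "blks e b J x = blks e b J x'"
    show "x = x'"
    proof (rule PiE_ext[OF x[unfolded cube_def]])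
      fix m assume m: "m \<in> {..<card J * b}"
      then have "m div b < card J" by (simp add: less_mult_imp_div_less)
      then obtain j where j: "j \<in> J" "e j = m div b" using e unfolding bij_betw_def by (metis imageE lessThan_iff)
      have "blks e b J x j (m mod b) = blks e b J x' j (m mod b)" unfolding eq ..
      then show "x m = x' m" using j b by (simp add: blks_def blk_def)
    qed
  qed
  have "finite (J \<rightarrow>\<^sub>E cube b)" using J finite_cube by (intro finite_PiE) auto
  moreover have "card (J \<rightarrow>\<^sub>E cube b) = card (cube (card J * b))"
    using J by (simp add: card_PiE card_cube power_mult[symmetric] mult.commute)
  ultimately have "blks e b J ` cube (card J * b) = J \<rightarrow>\<^sub>E cube b"
    using card_image[OF inj] into by (intro card_subset_eq) auto
  then show ?thesis using inj by (simp add: bij_betw_def)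
qed

context copies
begin

definition hard_fun :: "(nat \<times> nat \<times> 'i \<Rightarrow> nat) \<Rightarrow> nat \<Rightarrow> partial_fun" where
  "hard_fun e b x y = (let \<rho> = rej I M (2 * h) R (gadget.G (ipg b) J (blks e b J x) (blks e b J y)) in
     if \<rho> \<le> 1 / 3 then Some True else if \<rho> \<ge> 2 / 3 then Some False else None)"

text \<open>\<open>randomized_bound\<close> for the lifted density \<open>nu\<close>, divided by the
  number \<open>Q\<close> of input pairs. The 0-inputs have nearly full uniform measure by
  \<open>unif_accept\<close>, the density is nearly concentrated on 1-inputs by
  \<open>nu_reject\<close>, and the rectangle error is \<open>(W * \<tau> / 2 ^ b) ^ d\<close> times
  \<open>Q\<close>.\<close>

theorem classical_lower:
  assumes e: "bij_betw e J {..<card J}" and b: "b > 0"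
    and \<tau>: "\<tau> > 0" and \<omega>: "(1 + sqrt (2 * 2 ^ b) / \<tau>) ^ card J \<le> 1 + \<epsilon>" "\<epsilon> \<le> 1" "0 \<le> \<epsilon>"
    and W: "W \<ge> 1" "W \<ge> 2 * harm (card (cube b) ^ card J)" and \<theta>: "W * \<tau> / 2 ^ b \<le> 1"
    and P: "rand_computes (card J * b) (1/3) (hard_fun e b) P" "\<And>t. t \<in> set_pmf P \<Longrightarrow> cost t \<le> C"
  shows "2 / 3 * ((1 - 1 / real t) ^ R * (1 - \<epsilon>)) * (1 - 3 * real R / real (card I))
     \<le> 1 / 3 + 3 * (1 - c\<^sup>2) ^ R + 2 ^ C * (W * \<tau> / 2 ^ b) ^ d"
proof -
  interpret g: gadget "cube b" "ipg b" by (rule gadget_ipg[OF b])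
  have gs: "g.s = 2 ^ b" by (simp add: g.s_def card_cube)
  have finJ: "finite J" using finI by simp
  let ?N = "card J * b" and ?D = "blks e b J" and ?lam = "(1 - 1 / real t) ^ R"
  let ?X = "J \<rightarrow>\<^sub>E cube b"
  define \<phi> where "\<phi> x y = nu (g.G J (?D x) (?D y))" for x y
  have bij: "bij_betw ?D (cube ?N) ?X" by (rule blks_bij[OF finJ e b])
  have inj: "inj_on ?D (cube ?N)" and im: "?D ` cube ?N = ?X" using bij by (auto simp: bij_betw_def)
  have lift: "(\<Sum>x\<in>A. \<Sum>y\<in>B. u (?D x) (?D y)) = (\<Sum>x\<in>?D ` A. \<Sum>y\<in>?D ` B. u x y)" if "A \<subseteq> cube ?N" "B \<subseteq> cube ?N" for A B and u :: "_ \<Rightarrow> _ \<Rightarrow> real"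
    using that by (simp add: sum.reindex inj_on_subset[OF inj])
  have lam: "0 \<le> ?lam" "?lam \<le> 1" using t by (auto intro!: zero_le_power power_le_one)
  define c1 where "c1 = ?lam * (1 - \<epsilon>)"
  define err where "err = (W * \<tau> / 2 ^ b) ^ d * (2 ^ b) ^ (2 * card J)"
  have err0: "err \<ge> 0" using W \<tau> by (simp add: err_def)
  have c10: "c1 \<ge> 0" using lam \<omega> by (simp add: c1_def)
  have Din: "?D x \<in> ?X" if "x \<in> cube ?N" for x using im that by blast
  have rect: "(\<Sum>x\<in>A. \<Sum>y\<in>B. \<phi> x y - c1) \<ge> - err" if AB: "A \<subseteq> cube ?N" "B \<subseteq> cube ?N" for A B
  proof -
    have "(\<Sum>x\<in>?D ` A. \<Sum>y\<in>?D ` B. nu (g.G J x y)) \<ge> ?lam * (1 - \<epsilon>) * real (card (?D ` A)) * real (card (?D ` B)) - (W * \<tau> / 2 ^ b) ^ d * g.s ^ (2 * card J)"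
    proof (rule g.rectangle_bound[OF finJ nu_nonneg nu_subcube lam \<tau> refl _ \<omega>(2,3) W _ \<theta>])
      show "(1 + sqrt (2 * g.s) / \<tau>) ^ card J \<le> 1 + \<epsilon>" using \<omega>(1) by (simp add: gs)
      show "W * \<tau> / 2 ^ b = W * \<tau> / g.s" by (simp add: gs)
      show "?D ` A \<subseteq> ?X" "?D ` B \<subseteq> ?X" unfolding im[symmetric] by (intro image_mono AB)+
    qed
    moreover have "card (?D ` A) = card A" "card (?D ` B) = card B"
      using AB by (auto intro!: card_image inj_on_subset[OF inj])
    ultimately have "(\<Sum>x\<in>A. \<Sum>y\<in>B. \<phi> x y) \<ge> c1 * real (card A) * real (card B) - err"
      unfolding \<phi>_def lift[OF AB, of "\<lambda>x y. nu (g.G J x y)"] by (simp add: gs c1_def err_def)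
    then show ?thesis by (simp add: sum_subtractf mult_ac)
  qed
  have G_in: "g.G J (?D x) (?D y) \<in> sgns J" if "x \<in> cube ?N" "y \<in> cube ?N" for x y
    using Din that by (intro g.G_sgns) auto
  have \<phi>0: "\<phi> x y \<ge> 0" if "x \<in> cube ?N" "y \<in> cube ?N" for x y
    unfolding \<phi>_def by (intro nu_nonneg G_in that)
  define Q :: real where "Q = (2 ^ b) ^ (2 * card J)"
  have Q: "Q > 0" by (simp add: Q_def)
  have U: "(\<Sum>x\<in>cube ?N. \<Sum>y\<in>cube ?N. f (g.G J (?D x) (?D y))) = Q / 2 ^ card J * (\<Sum>z\<in>sgns J. f z)" for f :: "_ \<Rightarrow> real"
    unfolding lift[OF subset_refl subset_refl, of "\<lambda>x y. f (g.G J x y)"] im g.uniform_lift[OF finJ] gs Q_def ..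
  have total: "(\<Sum>x\<in>cube ?N. \<Sum>y\<in>cube ?N. \<phi> x y) = Q"
    unfolding \<phi>_def U nu_total by simp
  have T: "(\<Sum>x\<in>cube ?N. \<Sum>y\<in>cube ?N. if hard_fun e b x y = Some True then 0 else \<phi> x y) \<le> 3 * (1 - c\<^sup>2) ^ R * Q"
  proof -
    have "(\<Sum>x\<in>cube ?N. \<Sum>y\<in>cube ?N. if hard_fun e b x y = Some True then 0 else \<phi> x y)
      = (\<Sum>x\<in>cube ?N. \<Sum>y\<in>cube ?N. (\<lambda>z. if \<not> rej I M (2 * h) R z \<le> 1 / 3 then nu z else 0) (g.G J (?D x) (?D y)))"
      by (intro sum.cong refl) (simp add: hard_fun_def \<phi>_def Let_def)
    also have "\<dots> = Q / 2 ^ card J * (\<Sum>z\<in>sgns J. if \<not> rej I M (2 * h) R z \<le> 1 / 3 then nu z else 0)" by (rule U)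
    also have "(\<Sum>z\<in>sgns J. if \<not> rej I M (2 * h) R z \<le> 1 / 3 then nu z else 0) = (\<Sum>z | z \<in> sgns J \<and> \<not> rej I M (2 * h) R z \<le> 1 / 3. nu z)"
      using finJ by (subst sum.inter_filter[symmetric]) simp_all
    also have "Q / 2 ^ card J * \<dots> \<le> Q / 2 ^ card J * (3 * (1 - c\<^sup>2) ^ R * 2 ^ card J)"
      using Q by (intro mult_left_mono nu_reject) auto
    finally show ?thesis by (simp add: mult_ac)
  qed
  have Fa: "(\<Sum>x\<in>cube ?N. \<Sum>y\<in>cube ?N. if hard_fun e b x y = Some False then 1 else 0) \<ge> (1 - 3 * real R / real (card I)) * Q"
  proof -
    have "(\<Sum>x\<in>cube ?N. \<Sum>y\<in>cube ?N. if hard_fun e b x y = Some False then 1 else 0)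
      = (\<Sum>x\<in>cube ?N. \<Sum>y\<in>cube ?N. (\<lambda>z. 1 - (if \<not> rej I M (2 * h) R z \<ge> 2 / 3 then 1 else 0 :: real)) (g.G J (?D x) (?D y)))"
      by (intro sum.cong refl) (simp add: hard_fun_def Let_def)
    also have "\<dots> = Q / 2 ^ card J * (\<Sum>z\<in>sgns J. 1 - (if \<not> rej I M (2 * h) R z \<ge> 2 / 3 then 1 else 0))" by (rule U)
    also have "(\<Sum>z\<in>sgns J. 1 - (if \<not> rej I M (2 * h) R z \<ge> 2 / 3 then 1 else 0 :: real)) = 2 ^ card J - real (card {z \<in> sgns J. \<not> rej I M (2 * h) R z \<ge> 2 / 3})"
      using finJ by (simp add: sum_subtractf card_sgns sum.If_cases Int_def)
    also have "Q / 2 ^ card J * \<dots> \<ge> Q / 2 ^ card J * (2 ^ card J - 3 * real R / real (card I) * 2 ^ card J)"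
      using Q unif_accept by (intro mult_left_mono) auto
    also have "Q / 2 ^ card J * (2 ^ card J - 3 * real R / real (card I) * 2 ^ card J) = (1 - 3 * real R / real (card I)) * Q"
      by (simp add: field_simps)
    finally show ?thesis .
  qed
  have "2 / 3 * c1 * ((1 - 3 * real R / real (card I)) * Q) \<le> 2 / 3 * c1 * (\<Sum>x\<in>cube ?N. \<Sum>y\<in>cube ?N. if hard_fun e b x y = Some False then 1 else 0)"
    using c10 by (intro mult_left_mono Fa) auto
  also have "\<dots> \<le> 1 / 3 * Q + (\<Sum>x\<in>cube ?N. \<Sum>y\<in>cube ?N. if hard_fun e b x y = Some True then 0 else \<phi> x y) + 2 ^ C * err"
    using randomized_bound[OF err0 c10 rect \<phi>0 P] unfolding total .
  also have "\<dots> \<le> 1 / 3 * Q + 3 * (1 - c\<^sup>2) ^ R * Q + 2 ^ C * ((W * \<tau> / 2 ^ b) ^ d * Q)"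
    using T by (simp add: err_def Q_def)
  finally have "(2 / 3 * c1 * (1 - 3 * real R / real (card I))) * Q \<le> (1 / 3 + 3 * (1 - c\<^sup>2) ^ R + 2 ^ C * (W * \<tau> / 2 ^ b) ^ d) * Q"
    by (simp add: algebra_simps)
  then show ?thesis using Q by (simp add: c1_def)
qed

end

section \<open>Choice of parameters\<close>

lemma harm_add_le: "m > 0 \<Longrightarrow> harm (m + j) \<le> (harm m + real j / real m :: real)"
proof (induction j)
  case (Suc j)
  have "inverse (real (Suc (m + j))) \<le> 1 / real m" using Suc.prems by (simp add: field_simps)
  then show ?case using Suc by (simp add: harm_Suc add_divide_distrib)
qed simp

text \<open>The harmonic number of the count of all inputs of a player is thus only linear in the
  input length, so the factor \<open>W\<close> of the lifting error can be polynomial.\<close>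

lemma harm_pow2_le: "harm (2 ^ k) \<le> (1 + real k :: real)"
proof (induction k)
  case (Suc k)
  have "harm (2 ^ Suc k) = (harm (2 ^ k + 2 ^ k) :: real)" by (simp add: mult_2)
  also have "\<dots> \<le> harm (2 ^ k) + 1" using harm_add_le[of "2 ^ k" "2 ^ k"] by simp
  finally show ?case using Suc by simp
qed (simp add: harm_def)

context copies
begin

lemma quantum_upper:
  assumes e: "bij_betw e J {..<card J}" and b: "b > 0" and b': "((4 * h + 5) * card I * 2 ^ b) ^ R \<le> 2 ^ b'"
  shows "Qcc (card J * b) (1/3) (hard_fun e b) \<le> enat (2 * Suc b' * (2 * h + 1) + 1)"
proof -
  let ?N = "card J * b"
  \<comment> \<open>Outside \<open>J\<close> the block is a default value that still lies in
    \<open>cube b\<close>, as the protocol asks for a block at every index.\<close>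
  define X where "X \<rho> l i x = (if (\<rho>, l, i) \<in> J then blk e b (\<rho>, l, i) x else (\<lambda>_\<in>{..<b}. 1))" for \<rho> l i x
  have X: "X \<rho> l i x \<in> cube b" if "x \<in> cube ?N" for \<rho> l i x
  proof (cases "(\<rho>, l, i) \<in> J")
    case True
    then have "e (\<rho>, l, i) < card J" using bij_betwE[OF e] by blast
    then show ?thesis using True blk_in[of e "(\<rho>, l, i)" "card J" x b] that by (simp add: X_def)
  next
    case False
    have "(\<lambda>_\<in>{..<b}. 1 :: int) \<in> cube b" by (simp add: cube_def)
    then show ?thesis using False by (simp add: X_def)
  qed
  have b'': "((2 * (2 * h) + 5) * card I * 2 ^ b) ^ R \<le> 2 ^ b'" using b' by simp
  have ip: "ipg b v w = 1 \<or> ipg b v w = -1" if "v \<in> cube b" "w \<in> cube b" for v w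
    by (rule ipg_sign[OF that(1)])
  obtain P where P: "qvalid ?N (Suc b') 0 P" "qcost P = 2 * Suc b' * (2 * h + 1) + 1"
    and pr: "\<And>x y. x \<in> cube ?N \<Longrightarrow> y \<in> cube ?N \<Longrightarrow>
        qprob P x y (init_state (Suc b') 0) False = (\<Prod>\<rho><R. 1 - (phi I M (2 * h) (\<lambda>l i. ipg b (X \<rho> l i x) (X \<rho> l i y)))\<^sup>2) \<and>
        qprob P x y (init_state (Suc b') 0) True = 1 - (\<Prod>\<rho><R. 1 - (phi I M (2 * h) (\<lambda>l i. ipg b (X \<rho> l i x) (X \<rho> l i y)))\<^sup>2)"
    using phase_query_protocol[where N="card J * b" and X=X and Y=X and g="ipg b" and b=b, OF finI I M X X ip b''] by blast
  have eq: "(\<Prod>\<rho><R. 1 - (phi I M (2 * h) (\<lambda>l i. ipg b (X \<rho> l i x) (X \<rho> l i y)))\<^sup>2)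
      = rej I M (2 * h) R (gadget.G (ipg b) J (blks e b J x) (blks e b J y))" for x y
    unfolding rej_def
  proof (intro prod.cong refl arg_cong[where f="\<lambda>t. 1 - t\<^sup>2"] phi_cong)
    fix \<rho> l i assume "\<rho> \<in> {..<R}" "l \<le> 2 * h" "i \<in> I"
    then have mem: "(\<rho>, l, i) \<in> J" by (simp add: idx_def)
    then show "ipg b (X \<rho> l i x) (X \<rho> l i y) = slice I (2 * h) (gadget.G (ipg b) J (blks e b J x) (blks e b J y)) \<rho> l i"
      using \<open>l \<le> 2 * h\<close> \<open>i \<in> I\<close> by (simp add: slice_def blks_def X_def gadget.G_def[OF gadget_ipg[OF b]])
  qed
  have "quantum_computes ?N (1/3) (hard_fun e b) (Suc b') 0 P"
    unfolding quantum_computes_def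
  proof (intro conjI ballI allI impI P(1))
    fix x y v assume xy: "x \<in> cube ?N" "y \<in> cube ?N" and v: "hard_fun e b x y = Some v"
    show "1 - 1 / 3 \<le> qprob P x y (init_state (Suc b') 0) v"
      using v pr[OF xy] unfolding eq hard_fun_def Let_def by (cases v) (auto split: if_splits)
  qed
  then have "Qcc ?N (1/3) (hard_fun e b) \<le> enat (qcost P)"
    unfolding Qcc_def by (intro Inf_lower) blast
  then show ?thesis by (simp only: P(2))
qed

end

text \<open>\<open>c\<close> is the bound of \<open>phi_dens\<close> for \<open>k = 2 * A\<close>
  and entries with \<open>\<kappa> = 1/400\<close>; \<open>R\<close> copies make the rejection
  probability under the density negligible, and \<open>t \<ge> 20 * R\<close> keeps their joint
  subcube loss below 5 percent. \<open>D\<close> counts the layers of all copies, so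
  \<open>card J = D * n\<close>, and each sign takes a gadget of \<open>40 * A * u\<close>
  bits.\<close>

lemma hard_instance_exists:
  fixes A R t u :: nat
  defines "c \<equiv> (exp (-1) * (1 / 400)) ^ (2 * A) :: real" and "D \<equiv> R * (2 * A + 1)"
  assumes A: "A \<ge> 6" and R: "R > 0" "3 * (1 - c\<^sup>2) ^ R \<le> 1 / 100" and tR: "t \<ge> 20 * R" and u: "u > 0"
    and big: "1000 * A * D * t * (u + 1) \<le> 2 ^ u"
  shows "\<exists>F. Qcc (D * 2 ^ (A * u) * (40 * A * u)) (1/3) F \<le> enat (2 * Suc (R * ((4 * A + 5) + 41 * A * u)) * (2 * A + 1) + 1) \<and>
     Rcc (D * 2 ^ (A * u) * (40 * A * u)) (1/3) F \<ge> enat (2 ^ ((A - 4) * u))"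
proof -
  define U :: nat where "U = 2 ^ u"
  define n where "n = U ^ A"
  define d where "d = U ^ (A - 4)"
  \<comment> \<open>The largest noise for which one layer may multiply exponents by
    \<open>m = U\<close>, as \<open>2 * m * \<eta> = 1\<close>.\<close>
  define \<eta> where "\<eta> = 1 / (2 * real U)"
  define I where "I = {..<n}"
  have D: "D \<ge> 1" using R by (simp add: D_def)
  have t1: "t \<ge> 1" using tR R by simp
  have big': "x \<le> U" if "x \<le> 1000 * A * D * t * (u + 1)" for x using that big by (simp add: U_def)
  have AD: "A * D * t * (u + 1) \<ge> A * u + 1" 
  proof -
    have "A * u + 1 \<le> A * 1 * 1 * (u + 1)" using A by simp
    also have "\<dots> \<le> A * D * t * (u + 1)" using D t1 by (intro mult_mono order_refl) auto
    finally show ?thesis .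
  qed
  have U_Au: "1000 * (A * u + 1) \<le> U"
    using AD by (intro big') simp
  have U_t: "1000 * t \<le> U"
  proof (rule big')
    have "1000 * (1 * 1 * t * 1) \<le> 1000 * (A * D * t * (u + 1))" using A D by (intro mult_mono order_refl) auto
    then show "1000 * t \<le> 1000 * A * D * t * (u + 1)" by (simp only: mult.assoc mult_1)
  qed
  have U_D: "1000 * (A * D * (u + 1)) \<le> U"
  proof (rule big')
    have "1000 * (A * D * 1 * (u + 1)) \<le> 1000 * (A * D * t * (u + 1))" using t1 by (intro mult_mono order_refl) auto
    then show "1000 * (A * D * (u + 1)) \<le> 1000 * A * D * t * (u + 1)" by (simp only: mult.assoc mult_1)
  qed
  have RD: "R \<le> D" by (simp add: D_def)
  have D_U: "1000 * D \<le> U"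
  proof -
    have "1000 * (1 * D * 1) \<le> 1000 * (A * D * (u + 1))" using A by (intro mult_mono order_refl) auto
    then show ?thesis using U_D by simp
  qed
  have U1: "U \<ge> 1000" using U_Au by simp
  have n_dU: "n = d * U ^ 4"
    unfolding n_def d_def using A by (simp add: power_add[symmetric])
  have d1: "d \<ge> 1" using U1 by (simp add: d_def)
  have n_U: "n \<ge> U"
    unfolding n_def using A U1 by (intro self_le_power) auto
  have n_pow: "n = 2 ^ (A * u)" by (simp add: n_def U_def power_mult[symmetric] mult.commute)
  have n2: "n \<ge> 2" using n_U U1 by simp
  have d_n: "d \<le> n" using U1 by (simp add: n_dU)
  have \<eta>0: "\<eta> > 0" "\<eta> \<le> 1" using U1 by (simp_all add: \<eta>_def)
  have \<eta>n: "\<eta>\<^sup>2 * real n \<ge> real d * ln (real n) + 1"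
  proof -
    have "ln (real n) = real (A * u) * ln 2" by (simp add: n_pow ln_realpow)
    also have "\<dots> \<le> real (A * u) * 1" using ln_2_less_1 by (intro mult_left_mono) auto
    finally have "real d * ln (real n) + 1 \<le> real d * real (A * u) + real d * 1"
      using d1 by (intro add_mono mult_left_mono) auto
    also have "\<dots> = real d * real (A * u + 1)" by (simp add: algebra_simps)
    also have "\<dots> \<le> real d * (real U * (real U / 4))"
    proof (intro mult_left_mono)
      have "real (A * u + 1) * 1 \<le> real U * (real U / 4)"
        using U_Au U1 by (intro mult_mono) (simp_all add: of_nat_mult[symmetric] del: of_nat_mult)
      then show "real (A * u + 1) \<le> real U * (real U / 4)" by simp
    qed simp
    also have "\<dots> = \<eta>\<^sup>2 * real n" using U1 by (simp add: \<eta>_def n_dU power2_eq_square field_simps power4_eq_xxxx)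
    finally show ?thesis .
  qed
  have d0: "0 < d" using d1 by simp
  obtain M where M: "nrm_le I I M 1" and sub: "\<And>T T'. T \<subseteq> I \<Longrightarrow> T' \<subseteq> I \<Longrightarrow> card T \<le> d \<Longrightarrow> card T' \<le> d \<Longrightarrow> nrm_le T T' M \<eta>"
    and ent: "\<And>i j. i \<in> I \<Longrightarrow> j \<in> I \<Longrightarrow> (M i j)\<^sup>2 = (1/400) / real n"
    using exists_spread_matrix[OF n2 d0 d_n \<eta>0(1) \<eta>n] unfolding I_def by (metis lessThan_iff)
  have finI: "finite I" and cardI: "card I = n" and Ine: "I \<noteq> {}" using n2 by (auto simp: I_def lessThan_empty_iff)
  obtain q where q: "good I q (sin_kernel M) d \<eta>"
    using exists_good_kernel[OF finI M \<eta>0 sub] by blast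
  have c0: "c > 0" by (simp add: c_def)
  have tU: "d * t < U ^ A"
  proof -
    have "t < U ^ 4" using U_t U1 self_le_power[of U 4] by linarith
    then have "d * t < d * U ^ 4" using d0 by simp
    then show ?thesis by (simp add: n_dU[symmetric] n_def[symmetric])
  qed
  interpret copies I q M d \<eta> R A U t c
  proof
    show "good I q (sin_kernel M) d \<eta>" "I \<noteq> {}" "nrm_le I I M 1" by fact+
    show "0 < U" "0 < t" "0 < A" using U1 t1 A by auto
    show "2 * real U * \<eta> \<le> 1" using U1 by (simp add: \<eta>_def)
    show "d * t < U ^ A" by fact
    show "(M i j)\<^sup>2 \<le> 1 / real (card I)" if "i \<in> I" "j \<in> I" for i j
      using n2 by (simp add: ent[OF that] cardI field_simps)
    show "0 < c" by fact
    show "c \<le> EF I (Suc (2 * A)) (\<lambda>z. phi I M (2 * A) z * dens q I (2 * A) z)"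
      unfolding c_def by (rule phi_dens[OF q Ine]) (use A ent cardI in auto)
  qed
  \<comment> \<open>\<open>2 ^ v = n * n\<close> serves as the unit of scale: it dominates
    \<open>card J\<close> and the harmonic factor, and a gadget of size \<open>2 ^ (20 * v)\<close>
    leaves room between the two requirements on \<tau>.\<close>
  define v where "v = 2 * A * u"
  define b where "b = 20 * v"
  have cardJ: "card J = D * n" by (simp add: idx_def card_cartesian_product cardI D_def algebra_simps)
  have N: "D * 2 ^ (A * u) * (40 * A * u) = card J * b" by (simp add: cardJ n_pow b_def v_def)
  obtain e where e: "bij_betw e J {..<card J}"
    using ex_bij_betw_finite_nat[of J] finI by (auto simp: lessThan_atLeast0)
  have b: "b > 0" using A u by (simp add: b_def v_def)
  have n2v: "(2::nat) ^ v = n * n" by (simp add: n_pow v_def power_add[symmetric])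
  have upper: "Qcc (card J * b) (1/3) (hard_fun e b) \<le> enat (2 * Suc (R * ((4 * A + 5) + 41 * A * u)) * (2 * A + 1) + 1)"
  proof (rule quantum_upper[OF e b])
    have "(4 * A + 5) * card I * 2 ^ b \<le> 2 ^ (4 * A + 5) * 2 ^ (A * u) * 2 ^ (40 * A * u)"
      unfolding cardI n_pow b_def v_def by (intro mult_mono) (auto intro: less_imp_le[OF less_exp])
    also have "\<dots> = 2 ^ ((4 * A + 5) + 41 * A * u)" by (simp add: power_add[symmetric])
    finally have "((4 * A + 5) * card I * 2 ^ b) ^ R \<le> (2 ^ ((4 * A + 5) + 41 * A * u)) ^ R" by (rule power_mono) simp
    then show "((4 * A + 5) * card I * 2 ^ b) ^ R \<le> 2 ^ (R * ((4 * A + 5) + 41 * A * u))"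
      by (simp only: power_mult[symmetric] mult.commute)
  qed
  have lower: "d \<le> C" if P: "rand_computes (card J * b) (1/3) (hard_fun e b) P" "\<And>t. t \<in> set_pmf P \<Longrightarrow> cost t \<le> C" for P C
  proof -
    \<comment> \<open>With \<open>s = 2 ^ (20 * v)\<close> the characters decay like
      \<open>2 ^ (10 * v) / 2 ^ (18 * v)\<close> up to a factor 2, far below
      \<open>1 / card J\<close>, while \<open>W * \<tau> / s\<close> is exactly
      \<open>1 / 2 ^ v\<close>.\<close>
    let ?\<tau> = "2 ^ (18 * v) :: real" and ?W = "2 ^ v :: real" and ?\<epsilon> = "1 / 20 :: real"
    have Jn: "real (card J) / 2 ^ (8 * v) \<le> 1 / 1000"
    proof -
      have "1000 * card J \<le> n * n" using D_U n_U 
      proof -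
        have "1000 * D * n \<le> n * n" using D_U n_U by (intro mult_right_mono) auto
        then show ?thesis by (simp add: cardJ mult.assoc)
      qed
      then have "1000 * real (card J) \<le> 2 ^ v" unfolding n2v[symmetric] by (metis of_nat_le_iff of_nat_mult of_nat_numeral of_nat_power)
      also have "\<dots> \<le> 2 ^ (8 * v)" by (intro power_increasing) auto
      finally show ?thesis by (simp add: field_simps)
    qed
    have om: "sqrt (2 * 2 ^ b) / ?\<tau> \<le> 2 / 2 ^ (8 * v)"
    proof -
      have "2 * 2 ^ b \<le> (2 * 2 ^ (10 * v) :: real)\<^sup>2"
        by (simp add: b_def power_mult_distrib power_mult[symmetric])
      then have "sqrt (2 * 2 ^ b) \<le> 2 * 2 ^ (10 * v)" by (intro real_le_lsqrt) auto
      then have "sqrt (2 * 2 ^ b) / ?\<tau> \<le> 2 * 2 ^ (10 * v) / ?\<tau>" by (rule divide_right_mono) simp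
      also have "\<dots> = 2 / 2 ^ (8 * v)"
      proof -
        have "?\<tau> = 2 ^ (10 * v) * 2 ^ (8 * v)" by (simp add: power_add[symmetric])
        then show ?thesis by simp
      qed
      finally show ?thesis .
    qed
    have om0: "0 \<le> sqrt (2 * 2 ^ b) / ?\<tau>" by simp
    have w1: "(1 + sqrt (2 * 2 ^ b) / ?\<tau>) ^ card J \<le> 1 + ?\<epsilon>"
    proof -
      let ?o = "sqrt (2 * 2 ^ b) / ?\<tau>"
      have "(1 + ?o) ^ card J \<le> exp ?o ^ card J" using om0 by (intro power_mono) (auto simp: exp_ge_add_one_self)
      also have "\<dots> = exp (real (card J) * ?o)" by (rule exp_of_nat_mult[symmetric])
      also have "\<dots> \<le> exp (1 / 500)"
      proof -
        have "real (card J) * ?o \<le> real (card J) * (2 / 2 ^ (8 * v))" using om by (intro mult_left_mono) auto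
        also have "\<dots> \<le> 1 / 500" using Jn by simp
        finally show ?thesis by simp
      qed
      also have "\<dots> \<le> 1 + 1 / 500 + (1 / 500)\<^sup>2" by (rule exp_bound) auto
      also have "\<dots> \<le> 1 + ?\<epsilon>" by (simp add: power2_eq_square)
      finally show ?thesis .
    qed
    have W2: "?W \<ge> 2 * harm (card (cube b) ^ card J)"
    proof -
      have "2 * harm (card (cube b) ^ card J) \<le> 2 * (1 + real (b * card J))"
        unfolding card_cube power_mult[symmetric] by (intro mult_left_mono harm_pow2_le) auto
      also have "\<dots> = real (2 + 80 * (A * u) * (D * n))" by (simp add: b_def v_def cardJ)
      also have "\<dots> \<le> real (n * n)"
      proof -
        have "2 + 80 * (A * u) * (D * n) \<le> 1000 * (A * D * (u + 1)) * n"
        proof -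
          have "1000 * (A * D * (u + 1)) * n = 920 * (A * D * u * n) + 1000 * (A * D * n) + 80 * (A * u) * (D * n)" by (simp add: algebra_simps)
          moreover have "A * D * n \<ge> 1" using A D n2 by simp
          ultimately show ?thesis by linarith
        qed
        also have "\<dots> \<le> U * n" using U_D by (rule mult_right_mono) simp
        also have "\<dots> \<le> n * n" using n_U by simp
        finally show ?thesis by (rule of_nat_mono)
      qed
      also have "\<dots> = ?W" unfolding n2v[symmetric] by simp
      finally show ?thesis .
    qed
    have th: "?W * ?\<tau> / 2 ^ b = 1 / 2 ^ v"
    proof -
      have "(2::real) ^ b = ?W * ?\<tau> * 2 ^ v" by (simp add: b_def power_add[symmetric])
      then show ?thesis by simp
    qed
    have main: "2 / 3 * ((1 - 1 / real t) ^ R * (1 - ?\<epsilon>)) * (1 - 3 * real R / real (card I)) \<le> 1 / 3 + 3 * (1 - c\<^sup>2) ^ R + 2 ^ C * (1 / 2 ^ v) ^ d"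
      unfolding th[symmetric]
    proof (rule classical_lower[OF e b _ w1 _ _ _ W2 _ P])
      show "?W * ?\<tau> / 2 ^ b \<le> 1" unfolding th by simp
    qed auto
    have lam: "(1 - 1 / real t) ^ R \<ge> 95 / 100"
    proof -
      have "1 + real R * (- (1 / real t)) \<le> (1 + - (1 / real t)) ^ R"
        using t1 by (intro Bernoulli_inequality) simp
      moreover have "real R * (1 / real t) \<le> 1 / 20" using t1 of_nat_mono[OF tR, where 'a=real] by (simp add: field_simps)
      ultimately show ?thesis by simp
    qed
    have Rn: "1 - 3 * real R / real (card I) \<ge> 95 / 100"
    proof -
      have "60 * R \<le> n" using RD D_U n_U by linarith
      then have "3 * real R / real n \<le> 5 / 100" using n2 by (simp add: field_simps)
      then show ?thesis by (simp add: cardI)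
    qed
    \<comment> \<open>Three losses of 5 percent leave more than 0.57 of the initial 2/3. Subtracting
      1/3 and 1/100 leaves more than 1/8 for the error term.\<close>
    have "2 / 3 * ((95 / 100) * (1 - ?\<epsilon>)) * (95 / 100) \<le> 2 / 3 * ((1 - 1 / real t) ^ R * (1 - ?\<epsilon>)) * (1 - 3 * real R / real (card I))"
      using lam Rn by (intro mult_mono mult_left_mono mult_right_mono) auto
    moreover have "2 / 3 * ((95 / 100) * (1 - ?\<epsilon>)) * (95 / 100) \<ge> (57 / 100 :: real)" by simp
    ultimately have "57 / 100 \<le> 1 / 3 + 3 * (1 - c\<^sup>2) ^ R + 2 ^ C * (1 / 2 ^ v) ^ d"
      using main by (meson order_trans)
    moreover have "y \<le> 1 / 100 \<Longrightarrow> 57 / 100 \<le> 1 / 3 + y + z \<Longrightarrow> 1 / 8 \<le> z" for y z :: real by linarith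
    ultimately have "1 / 8 \<le> 2 ^ C * (1 / 2 ^ v :: real) ^ d" using R(2) by blast
    then have "1 / 8 \<le> 2 ^ C / (2 ^ (v * d) :: real)"
      by (simp add: power_divide power_mult)
    then have "2 ^ (v * d) \<le> (2 ^ (C + 3) :: real)"
      by (simp add: field_simps power_add)
    then have "v * d \<le> C + 3" by simp
    \<comment> \<open>\<open>4 * d \<le> C + 3\<close> implies \<open>d \<le> C\<close> because
      \<open>d\<close> is at least 1.\<close>
    moreover have "4 * d \<le> v * d"
    proof (rule mult_right_mono)
      have "2 * 6 * 1 \<le> 2 * A * u" using A u by (intro mult_mono) auto
      then show "4 \<le> v" by (simp add: v_def)
    qed simp
    ultimately show ?thesis using d1 by linarith
  qed
  have "enat d \<le> Rcc (card J * b) (1/3) (hard_fun e b)"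
    unfolding Rcc_def using lower by (intro Inf_greatest) auto
  moreover have "d = 2 ^ ((A - 4) * u)" by (simp add: d_def U_def power_mult[symmetric] mult.commute)
  ultimately show ?thesis using upper unfolding N by metis
qed

section \<open>From fixed exponents to the family\<close>

lemma exists_large_exponent: "\<exists>u\<ge>N0. u > 0 \<and> C * (u + 1) \<le> (2::nat) ^ u"
proof -
  define j where "j = max 3 (max C N0)"
  have "2 * j + 1 \<le> 2 ^ j" if "j \<ge> 3" for j :: nat
    using that by (induction j rule: dec_induct) auto
  then have 1: "2 * j + 1 \<le> 2 ^ j" by (simp add: j_def)
  have 2: "C \<le> 2 ^ j"
  proof -
    have "C \<le> j" by (simp add: j_def)
    also have "j \<le> 2 ^ j" using less_exp[of j] by simp
    finally show ?thesis .
  qed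
  have "C * (2 * j + 1) \<le> 2 ^ j * 2 ^ j" by (intro mult_mono 1 2) auto
  moreover have "N0 \<le> 2 * j" "0 < 2 * j" by (simp_all add: j_def max_def)
  ultimately show ?thesis by (intro exI[of _ "2 * j"]) (simp add: mult_2 power_add)
qed

text \<open>For fixed \<open>A\<close> the numbers \<open>R\<close>, \<open>D\<close>,
  \<open>t\<close> are constants and only \<open>u\<close> grows. Then \<open>N\<close> lies between
  \<open>2 ^ (A * u)\<close> and \<open>2 ^ ((A + 1) * u)\<close>, so the lower bound
  \<open>2 ^ ((A - 4) * u)\<close> is at least \<open>N\<close> to the power
  \<open>(A - 4) / (A + 1) = 1 - 5 / (A + 1)\<close>.\<close>

lemma hard_functions:
  fixes A :: nat
  assumes A: "A \<ge> 6"
  shows "\<exists>C :: nat. \<forall>N0. \<exists>N\<ge>N0. \<exists>F. N \<ge> 2 \<and> ereal_of_enat (Qcc N (1/3) F) \<le> ereal (real C * log 2 (real N)) \<and>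
     ereal_of_enat (Rcc N (1/3) F) \<ge> ereal (real N powr (1 - 5 / (real A + 1)))"
proof -
  define c where "c = (exp (-1) * (1 / 400) :: real) ^ (2 * A)"
  have "exp (-1) * (1 / 400) \<le> (1 :: real)" by (intro mult_le_one) auto
  then have c: "0 < c" "c \<le> 1" unfolding c_def by (auto intro!: power_le_one)
  have "0 \<le> 1 - c\<^sup>2" "1 - c\<^sup>2 < 1" using c by (auto simp: power_le_one)
  then obtain R0 where R0: "(1 - c\<^sup>2) ^ R0 < 1 / 300" using real_arch_pow_inv[of "1/300" "1 - c\<^sup>2"] by auto
  define R where "R = Suc R0"
  have R: "R > 0" "3 * (1 - c\<^sup>2) ^ R \<le> 1 / 100"
  proof -
    have "(1 - c\<^sup>2) ^ R \<le> (1 - c\<^sup>2) ^ R0"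
      unfolding R_def using \<open>0 \<le> 1 - c\<^sup>2\<close> \<open>1 - c\<^sup>2 < 1\<close> by (intro power_decreasing) auto
    then show "3 * (1 - c\<^sup>2) ^ R \<le> 1 / 100" using R0 by simp
  qed (simp add: R_def)
  define D where "D = R * (2 * A + 1)"
  define t where "t = 20 * R"
  define C where "C = 2 * (2 * A + 1) * (R * ((4 * A + 5) + 41) + 1) + 1"
  show ?thesis
  proof (rule exI[of _ C], rule allI)
    fix N0
    obtain u where u: "u \<ge> N0" "u > 0" "1000 * A * D * t * (u + 1) \<le> 2 ^ u" using exists_large_exponent by blast
    define N where "N = D * 2 ^ (A * u) * (40 * A * u)"
    obtain F where F: "Qcc N (1/3) F \<le> enat (2 * Suc (R * ((4 * A + 5) + 41 * A * u)) * (2 * A + 1) + 1)"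
      "Rcc N (1/3) F \<ge> enat (2 ^ ((A - 4) * u))"
      using hard_instance_exists[of A R t u] A R u(2,3) unfolding N_def D_def t_def c_def by auto
    have D1: "D \<ge> 1" using R by (simp add: D_def)
    have N_ge: "2 ^ (A * u) \<le> N"
    proof -
      have "1 * 2 ^ (A * u) * 1 \<le> N" unfolding N_def using D1 A u by (intro mult_mono order_refl) auto
      then show ?thesis by simp
    qed
    have N_le: "N \<le> 2 ^ ((A + 1) * u)"
    proof -
      have "40 * (A * D * u * 1) \<le> 1000 * (A * D * (u + 1) * t)" using R by (intro mult_mono order_refl) (auto simp: t_def)
      also have "\<dots> = 1000 * A * D * t * (u + 1)" by (simp only: mult_ac)
      finally have "40 * (A * D * u * 1) \<le> 2 ^ u" using u(3) by (rule le_trans)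
      then have "40 * A * D * u \<le> 2 ^ u" by (simp only: mult_1_right mult.assoc)
      then have "40 * A * D * u * 2 ^ (A * u) \<le> 2 ^ u * 2 ^ (A * u)" by (rule mult_right_mono) simp
      then show ?thesis by (simp add: N_def power_add[symmetric] algebra_simps)
    qed
    have Au: "A * u \<ge> 1" using A u by simp
    have "u \<le> A * u" using A by simp
    also have "\<dots> < 2 ^ (A * u)" by (rule less_exp)
    finally have "N \<ge> N0" using u N_ge by simp
    moreover have "N \<ge> 2"
    proof -
      have "(2::nat) ^ 1 \<le> 2 ^ (A * u)" using Au by (intro power_increasing) auto
      then show ?thesis using N_ge by simp
    qed
    moreover have "ereal_of_enat (Qcc N (1/3) F) \<le> ereal (real C * log 2 (real N))"
    proof -
      let ?q = "2 * Suc (R * ((4 * A + 5) + 41 * A * u)) * (2 * A + 1) + 1"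
      have "ereal_of_enat (Qcc N (1/3) F) \<le> ereal_of_enat (enat ?q)" using F(1) by (simp only: ereal_of_enat_le_iff)
      also have "\<dots> = ereal (real ?q)" by simp
      also have "\<dots> \<le> ereal (real C * log 2 (real N))"
      proof -
        have "?q \<le> C * (A * u)"
        proof -
          have "4 * A + 5 \<le> (4 * A + 5) * (A * u)" using mult_le_mono2[OF Au, of "4 * A + 5"] by simp
          then have "(4 * A + 5) + 41 * A * u \<le> ((4 * A + 5) + 41) * (A * u)" by (simp add: algebra_simps)
          then have "R * ((4 * A + 5) + 41 * A * u) \<le> R * (((4 * A + 5) + 41) * (A * u))" by (rule mult_le_mono2)
          then have "Suc (R * ((4 * A + 5) + 41 * A * u)) \<le> (R * ((4 * A + 5) + 41) + 1) * (A * u)"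
            using Au unfolding add_mult_distrib[of _ 1] mult_1 by (simp only: mult.assoc)
          then have "2 * (2 * A + 1) * Suc (R * ((4 * A + 5) + 41 * A * u)) \<le> 2 * (2 * A + 1) * ((R * ((4 * A + 5) + 41) + 1) * (A * u))" by (rule mult_le_mono2)
          then have "2 * (2 * A + 1) * Suc (R * ((4 * A + 5) + 41 * A * u)) + 1 \<le> 2 * (2 * A + 1) * ((R * ((4 * A + 5) + 41) + 1) * (A * u)) + A * u"
            using Au by (rule add_mono)
          also have "\<dots> = C * (A * u)" by (simp only: C_def add_mult_distrib mult_1 mult.assoc)
          finally have "2 * (2 * A + 1) * Suc (R * ((4 * A + 5) + 41 * A * u)) + 1 \<le> C * (A * u)" .
          then show ?thesis by (simp only: mult_ac)
        qed
        then have "real ?q \<le> real C * real (A * u)" by (metis of_nat_le_iff of_nat_mult)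
        also have "real (A * u) = log 2 (2 ^ (A * u))" by (simp add: log_nat_power)
        also have "real C * \<dots> \<le> real C * log 2 (real N)"
        proof (intro mult_left_mono)
          have "(2::real) ^ (A * u) \<le> real N" using N_ge by (metis of_nat_le_iff of_nat_numeral of_nat_power)
          then show "log 2 (2 ^ (A * u)) \<le> log 2 (real N)" by (rule log_mono[rotated -1]) auto
        qed simp
        finally show ?thesis by simp
      qed
      finally show ?thesis .
    qed
    moreover have "ereal_of_enat (Rcc N (1/3) F) \<ge> ereal (real N powr (1 - 5 / (real A + 1)))"
    proof -
      have eq: "1 - 5 / (real A + 1) = real (A - 4) / (real A + 1)" using A by (simp add: field_simps of_nat_diff)
      have "real N \<le> 2 ^ ((A + 1) * u)" using N_le by (metis of_nat_le_iff of_nat_numeral of_nat_power)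
      then have "real N powr (1 - 5 / (real A + 1)) \<le> (2 ^ ((A + 1) * u)) powr (1 - 5 / (real A + 1))"
        unfolding eq by (intro powr_mono2) auto
      also have "\<dots> = 2 powr (real ((A + 1) * u) * (real (A - 4) / (real A + 1)))"
        unfolding eq by (simp add: powr_realpow[symmetric] powr_powr)
      also have "real ((A + 1) * u) * (real (A - 4) / (real A + 1)) = real ((A - 4) * u)"
        by (simp add: field_simps)
      also have "2 powr real ((A - 4) * u) = 2 ^ ((A - 4) * u)" by (rule powr_realpow) simp
      finally have "ereal (real N powr (1 - 5 / (real A + 1))) \<le> ereal (real (2 ^ ((A - 4) * u)))" by simp
      also have "\<dots> = ereal_of_enat (enat (2 ^ ((A - 4) * u)))" by simp
      also have "\<dots> \<le> ereal_of_enat (Rcc N (1/3) F)" using F(2) by (simp only: ereal_of_enat_le_iff)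
      finally show ?thesis .
    qed
    ultimately show "\<exists>N\<ge>N0. \<exists>F. N \<ge> 2 \<and> ereal_of_enat (Qcc N (1/3) F) \<le> ereal (real C * log 2 (real N)) \<and>
     ereal_of_enat (Rcc N (1/3) F) \<ge> ereal (real N powr (1 - 5 / (real A + 1)))" by blast
  qed
qed

theorem theorem1p6:
  fixes \<alpha> :: "nat \<Rightarrow> nat"
  assumes "mono \<alpha>"
    and "(\<lambda>n. real (\<alpha> n)) \<in> \<omega>(\<lambda>_. 1)"
  shows "\<exists>(S :: nat set) (F :: nat \<Rightarrow> partial_fun) (\<delta> :: nat \<Rightarrow> real).
           infinite S \<and> \<delta> \<in> o(\<lambda>_. 1) \<and>
           (\<forall>N \<in> S.
              ereal_of_enat (Qcc N (1/3) (F N)) \<le> ereal (real (\<alpha> N) * log 2 (real N)) \<and>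
              ereal_of_enat (Rcc N (1/3) (F N)) \<ge> ereal (real N powr (1 - \<delta> N)))"
proof -
  \<comment> \<open>The exponent loss is that of \<open>hard_functions\<close> with
    \<open>A = j + 6\<close>. Since \<alpha> tends to infinity, it exceeds the constant
    \<open>C\<close> belonging to \<open>j\<close> at all large \<open>N\<close>.\<close>
  define P where "P j N \<longleftrightarrow> (\<exists>F. ereal_of_enat (Qcc N (1/3) F) \<le> ereal (real (\<alpha> N) * log 2 (real N)) \<and>
     ereal_of_enat (Rcc N (1/3) F) \<ge> ereal (real N powr (1 - 5 / (real j + 7))))" for j N
  have large: "\<exists>N\<ge>N0. P j N" for j N0
  proof -
    obtain C :: nat where C: "\<And>N0. \<exists>N\<ge>N0. \<exists>F. N \<ge> 2 \<and> ereal_of_enat (Qcc N (1/3) F) \<le> ereal (real C * log 2 (real N)) \<and>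
     ereal_of_enat (Rcc N (1/3) F) \<ge> ereal (real N powr (1 - 5 / (real (j + 6) + 1)))"
      using hard_functions[of "j + 6"] by auto
    have "eventually (\<lambda>n. real C * norm (1::real) \<le> norm (real (\<alpha> n))) at_top"
      using landau_omega.smallD[OF assms(2), of "real C + 1"] by (auto elim!: eventually_mono)
    then obtain N1 where N1: "\<And>n. n \<ge> N1 \<Longrightarrow> C \<le> \<alpha> n" by (auto simp: eventually_at_top_linorder)
    obtain N F where N: "N \<ge> max N0 N1" "N \<ge> 2" and F: "ereal_of_enat (Qcc N (1/3) F) \<le> ereal (real C * log 2 (real N))"
      "ereal_of_enat (Rcc N (1/3) F) \<ge> ereal (real N powr (1 - 5 / (real (j + 6) + 1)))"
      using C[of "max N0 N1"] by blast
    have "real C * log 2 (real N) \<le> real (\<alpha> N) * log 2 (real N)"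
      using N N1[of N] by (intro mult_right_mono) auto
    then have "ereal_of_enat (Qcc N (1/3) F) \<le> ereal (real (\<alpha> N) * log 2 (real N))"
      using F(1) by (meson ereal_less_eq(3) order_trans)
    moreover have "real (j + 6) + 1 = real j + 7" by simp
    ultimately have "P j N" using F(2) unfolding P_def by metis
    then show ?thesis using N by auto
  qed
  \<comment> \<open>Strictly increasing sizes make \<open>j\<close> recoverable from
    \<open>N\<close>, so that \<open>F\<close> and \<delta> can be indexed by
    \<open>N\<close>.\<close>
  have "\<exists>f. \<forall>j. P j (f j) \<and> f j < f (Suc j)"
  proof (rule dependent_nat_choice)
    show "\<exists>N. P 0 N" using large by blast
    show "\<exists>N'. P (Suc j) N' \<and> N < N'" for N j using large[of "Suc N" "Suc j"] by auto
  qed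
  then obtain f where f: "\<And>j. P j (f j)" "\<And>j. f j < f (Suc j)" by blast
  have mono: "strict_mono f" using f(2) by (rule strict_mono_Suc_iff[THEN iffD2, rule_format])
  have inj: "inj f" using mono by (rule strict_mono_imp_inj_on)
  obtain F where F: "\<And>j. ereal_of_enat (Qcc (f j) (1/3) (F j)) \<le> ereal (real (\<alpha> (f j)) * log 2 (real (f j))) \<and>
     ereal_of_enat (Rcc (f j) (1/3) (F j)) \<ge> ereal (real (f j) powr (1 - 5 / (real j + 7)))"
    using f(1) unfolding P_def by metis
  \<comment> \<open>Off the range the value is 0, which keeps \<delta> convergent to 0 along all
    \<open>N\<close> and not merely along the family.\<close>
  define \<delta> where "\<delta> N = (if N \<in> range f then 5 / (real (the_inv f N) + 7) else 0)" for N
  have "\<delta> \<longlonglongrightarrow> 0"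
  proof (rule LIMSEQ_I)
    fix r :: real assume r: "0 < r"
    obtain j0 :: nat where j0: "5 / r < real j0" using reals_Archimedean2 by blast
    have "norm (\<delta> N - 0) < r" if "N \<ge> f j0" for N
    proof (cases "N \<in> range f")
      case True
      then obtain j where j: "N = f j" by blast
      have "j0 \<le> j" using that mono by (simp add: j strict_mono_less_eq)
      then have "5 < r * (real j + 7)" using j0 r by (simp add: field_simps) (smt (verit) mult_left_mono of_nat_mono)
      then show ?thesis using the_inv_f_f[OF inj] by (simp add: \<delta>_def j field_simps)
    qed (simp add: \<delta>_def r)
    then show "\<exists>no. \<forall>n\<ge>no. norm (\<delta> n - 0) < r" by blast
  qed
  then have "\<delta> \<in> o(\<lambda>_. 1)" by (intro smalloI_tendsto) simp_all
  moreover have "infinite (range f)" using inj by (simp add: range_inj_infinite)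
  moreover have "ereal_of_enat (Qcc N (1/3) (F (the_inv f N))) \<le> ereal (real (\<alpha> N) * log 2 (real N)) \<and>
      ereal_of_enat (Rcc N (1/3) (F (the_inv f N))) \<ge> ereal (real N powr (1 - \<delta> N))" if "N \<in> range f" for N
    using that F the_inv_f_f[OF inj] by (auto simp: \<delta>_def)
  ultimately show ?thesis by (intro exI[of _ "range f"] exI[of _ "\<lambda>N. F (the_inv f N)"] exI[of _ \<delta>]) blast
qed

end
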